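(* Let $\mathcal V$ be a lextensive category with terminal object $\mathbf 1$, and let $T=(T,m,e)$ be a cartesian monad on $\mathcal V$. If the vertical transformation $\hat\epsilon_{T(-\ast\mathbf 1)}\colon\overline T(-)\ast\mathbf 1\to T(-\ast\mathbf 1)$ of functors $\mathcal V\text{-}\mathsf{Mat}\to\mathsf{Span}(\mathcal V)$ has a strong conjoint, then there is an adjunction $-\ast\mathbf 1\dashv\mathcal V(\mathbf 1,-)$ with left adjoint $-\ast\mathbf 1\colon(\overline T,\mathcal V)\text{-}\mathsf{Cat}\to\mathsf{Cat}(T,\mathcal V)$ and right adjoint $\mathcal V(\mathbf 1,-)\colon\mathsf{Cat}(T,\mathcal V)\to(\overline T,\mathcal V)\text{-}\mathsf{Cat}$.
   Context: **Base category.** Coproducts are small. $\mathcal V$ (with coproducts) is extensive if $\sum\colon\prod_{i\in I}\mathcal V\downarrow X_i\to\mathcal V\downarrow\sum_{i\in I}X_i$ is an equivalence for every family $(X_i)_{i\in I}$; lextensive means extensive with finite limits. For a set $X$, $X\ast\mathbf 1=\sum_{x\in X}\mathbf 1$; $-\ast\mathbf 1\colon\mathsf{Set}\to\mathcal V$ is left adjoint to $\mathcal V(\mathbf 1,-)$, with unit $\hat\eta$ and counit $\hat\epsilon_A\colon\mathcal V(\mathbf 1,A)\ast\mathbf 1\to A$. A monad $T=(T,m,e)$ is cartesian if $T$ preserves pullbacks and all naturality squares of $m$ and $e$ are pullbacks. **Internal $T$-categories.** An object of $\mathsf{Cat}(T,\mathcal V)$ consists of objects $X_0,X_1$, morphisms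 $l\colon X_1\to TX_0$, $r\colon X_1\to X_0$, a unit $\upsilon\colon X_0\to X_1$ with $l\upsilon=e$, $r\upsilon=\mathrm{id}$, and a multiplication $\mu\colon X_2\to X_1$, where $X_2$ is the pullback of $l\colon X_1\to TX_0$ and $Tr\colon TX_1\to TX_0$ (with projections $\mathrm{pr}_1,\mathrm{pr}_2$ to $X_1,TX_1$), with $l\mu=m\circ Tl\circ\mathrm{pr}_2$, $r\mu=r\circ\mathrm{pr}_1$, subject to the evident unit and associativity laws. Morphisms are pairs $(f_0,f_1)$ compatible with $l,r,\upsilon,\mu$. **Spans and matrices.** $\mathsf{Span}(\mathcal V)$ is the pseudodouble category of spans ($p\colon X\nrightarrow Y$ is $X\xleftarrow{l_p}M_p\xrightarrow{r_p}Y$, composed by pullback); $T$ acts on it, levelwise, as a strong monad. $\mathcal V\text{-}\mathsf{Mat}$ is the pseudodouble category with 0-cells sets, vertical 1-cells functions, horizontal 1-cells $p\colon X\nrightarrow Y$ families $p(x,y)\in\mathcal V$, 2-cells over $(f,g)$ families $p(x,y)\to q(fx,gy)$, composition $(q\cdot p)(x,z)=\sum_yq(y,z)\times p(x,y)$ and units $1_X(x,x')=[x=x']\ast\mathbf 1$. For a matrix $p$, $p\ast\mathbf 1$ is the span $X\ast\mathbf 1\leftarrow\sum_{x,y}p(x,y)\to Y\ast\mathbf 1$; for a span $s\colon V\nrightarrow W$, $\mathcal V(\mathbf 1,s)$ is the matrix $\mathcal V(\mathbf 1,V)\nrightarrow\mathcal V(\mathbf 1,W)$ whose $(v,w)$ entry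 is the pullback of $\langle l_s,r_s\rangle\colon M_s\to V\times W$ along $\langle v,w\rangle\colon\mathbf 1\to V\times W$. For $\mathcal V$ lextensive, $-\ast\mathbf 1$ is a strong functor, $\mathcal V(\mathbf 1,-)$ is canonically a lax functor, and $-\ast\mathbf 1\dashv\mathcal V(\mathbf 1,-)$ is an adjunction in the 2-category of pseudodouble categories, lax functors and vertical transformations, with unit $\hat\eta$ (on $p$: $p(x,y)\to\mathcal V(\mathbf 1,p\ast\mathbf 1)(\hat\eta x,\hat\eta y)$ induced by coproduct inclusion) and counit $\hat\epsilon$ (on $s$: $\sum_{v,w}\mathcal V(\mathbf 1,s)(v,w)\to M_s$ induced by pullback projections). **The monad $\overline T$.** $\overline T=\mathcal V(\mathbf 1,T(-\ast\mathbf 1))$, as a lax functor on $\mathcal V\text{-}\mathsf{Mat}$, with multiplication $\overline m=\mathcal V(\mathbf 1,(m\circ T\hat\epsilon T)(-\ast\mathbf 1))$ and unit $\overline e=\mathcal V(\mathbf 1,e(-\ast\mathbf 1))\circ\hat\eta$. So $\overline TX=\mathcal V(\mathbf 1,T(X\ast\mathbf 1))$ for a set $X$, and $(\overline Tp)(\mathfrak x,\mathfrak y)$ is the pullback of $TM_{p\ast\mathbf 1}\to T(X\ast\mathbf 1)\times T(Y\ast\mathbf 1)$ along $\langle\mathfrak x,\mathfrak y\rangle$. Write $\mathsf e^{\overline T},\mathsf m^{\overline T}$ for its lax unit and composition comparisons. **Strong conjoint.** In $\mathsf{Span}(\mathcal V)$ the conjoint of $f\colon A\to B$ is the span $f^*=(B\xleftarrow{f}A\xrightarrow{\mathrm{id}}A)$.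 That $\hat\epsilon_{T(-\ast\mathbf 1)}$ has a strong conjoint means: for every $\mathcal V$-matrix $a\colon s\nrightarrow t$ the canonical globular 2-cell $(\overline Ta\ast\mathbf 1)\cdot\hat\epsilon_{T(s\ast\mathbf 1)}^*\to\hat\epsilon_{T(t\ast\mathbf 1)}^*\cdot T(a\ast\mathbf 1)$ is invertible, where on apexes this is the morphism $M_{\overline Ta\ast\mathbf 1}\to TM_{a\ast\mathbf 1}\times_{T(t\ast\mathbf 1)}(\overline Tt\ast\mathbf 1)$ induced by $\hat\epsilon_{T(a\ast\mathbf 1)}$ and $r_{\overline Ta\ast\mathbf 1}$. **Enriched $\overline T$-categories.** An object of $(\overline T,\mathcal V)\text{-}\mathsf{Cat}$ is a set $X$, a $\mathcal V$-matrix $a\colon\overline TX\nrightarrow X$, and 2-cells $\upsilon\colon1_X\to a$ over $(\overline e_X,\mathrm{id})$ and $\mu\colon a\cdot\overline Ta\to a$ over $(\overline m_X,\mathrm{id})$, with $\mu\circ(\upsilon\cdot\overline e_a)=\lambda$, $\mu\circ(\mathrm{id}\cdot(\overline T\upsilon\circ\mathsf e^{\overline T}))=\rho$, $\mu\circ(\mathrm{id}\cdot(\overline T\mu\circ\mathsf m^{\overline T}))=\mu\circ(\mu\cdot\overline m_a)\circ\alpha^{-1}$, where $\lambda,\rho,\alpha$ are the unitors and associator. A morphism $(X,a)\to(Y,b)$ is a function $f$ with a 2-cell $\zeta\colon a\to b$ over $(\overline Tf,f)$ such that $\zeta\circ\upsilon=\upsilon\circ1_f$, $\zeta\circ\mu=\mu\circ(\zeta\cdot\overline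 T\zeta)$. **The two functors.** $-\ast\mathbf 1$ sends $(X,a,\upsilon,\mu)$ to the internal $T$-category with $X_0=X\ast\mathbf 1$, $X_1=M_{a\ast\mathbf 1}$, $r=r_{a\ast\mathbf 1}$, $l=\hat\epsilon_{T(X\ast\mathbf 1)}\circ l_{a\ast\mathbf 1}$, unit induced by $\upsilon$, and multiplication $X_2\cong M_{a\ast\mathbf 1}\times_{\overline TX\ast\mathbf 1}M_{\overline Ta\ast\mathbf 1}\cong M_{(a\cdot\overline Ta)\ast\mathbf 1}\to M_{a\ast\mathbf 1}$, the first isomorphism coming from the strong conjoint hypothesis and the last map induced by $\mu$; on morphisms $(f,\zeta)\mapsto(f\ast\mathbf 1,\zeta\ast\mathbf 1)$. $\mathcal V(\mathbf 1,-)$ sends an internal $T$-category with span $b=(TY\xleftarrow{l_b}M_b\xrightarrow{r_b}Y)$ to the set $\mathcal V(\mathbf 1,Y)$ with the matrix $\overline T\mathcal V(\mathbf 1,Y)\nrightarrow\mathcal V(\mathbf 1,Y)$ whose value at $(\mathfrak x,y)$ is $\mathcal V(\mathbf 1,b)(T\hat\epsilon_Y\circ\mathfrak x,\,y)$, with unit and multiplication induced from those of $b$, and acts on morphisms in the induced way. *)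

theory Defs
  imports "HOL-Library.FuncSet"
begin

section \<open>Categories, functors, adjunctions\<close>

record ('o, 'a) cat =
  Obj :: "'o set"
  Arr :: "'a set"
  Dom :: "'a \<Rightarrow> 'o"
  Cod :: "'a \<Rightarrow> 'o"
  Ident :: "'o \<Rightarrow> 'a"
  Cmp :: "'a \<Rightarrow> 'a \<Rightarrow> 'a"  (infixr \<open>\<cdot>\<index>\<close> 70)

definition Hom :: "('o, 'a) cat \<Rightarrow> 'o \<Rightarrow> 'o \<Rightarrow> 'a set" where
  "Hom C A B = {f \<in> Arr C. Dom C f = A \<and> Cod C f = B}"

locale category =
  fixes C :: "('o, 'a) cat" (structure)
  assumes Dom_Obj: "f \<in> Arr C \<Longrightarrow> Dom C f \<in> Obj C"
    and Cod_Obj: "f \<in> Arr C \<Longrightarrow> Cod C f \<in> Obj C"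
    and Ident_Hom: "A \<in> Obj C \<Longrightarrow> Ident C A \<in> Hom C A A"
    and Cmp_Hom: "f \<in> Hom C A B \<Longrightarrow> g \<in> Hom C B D \<Longrightarrow> g \<cdot> f \<in> Hom C A D"
    and Cmp_Ident: "f \<in> Hom C A B \<Longrightarrow> f \<cdot> Ident C A = f"
    and Ident_Cmp: "f \<in> Hom C A B \<Longrightarrow> Ident C B \<cdot> f = f"
    and Cmp_assoc: "f \<in> Hom C A B \<Longrightarrow> g \<in> Hom C B D \<Longrightarrow> h \<in> Hom C D E \<Longrightarrow>
      h \<cdot> (g \<cdot> f) = (h \<cdot> g) \<cdot> f"

definition is_iso :: "('o, 'a) cat \<Rightarrow> 'a \<Rightarrow> bool" where
  "is_iso C f \<longleftrightarrow> f \<in> Arr C \<and>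
     (\<exists>g \<in> Hom C (Cod C f) (Dom C f).
        g \<cdot>\<^bsub>C\<^esub> f = Ident C (Dom C f) \<and> f \<cdot>\<^bsub>C\<^esub> g = Ident C (Cod C f))"

definition inv_arr :: "('o, 'a) cat \<Rightarrow> 'a \<Rightarrow> 'a" where
  "inv_arr C f = (THE g. g \<in> Hom C (Cod C f) (Dom C f) \<and>
     g \<cdot>\<^bsub>C\<^esub> f = Ident C (Dom C f) \<and> f \<cdot>\<^bsub>C\<^esub> g = Ident C (Cod C f))"

record ('o, 'a, 'p, 'b) fun_data =
  omap :: "'o \<Rightarrow> 'p"
  amap :: "'a \<Rightarrow> 'b"

definition is_functor :: "('o, 'a) cat \<Rightarrow> ('p, 'b) cat \<Rightarrow> ('o, 'a, 'p, 'b) fun_data \<Rightarrow> bool" where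
  "is_functor A B F \<longleftrightarrow> category A \<and> category B \<and>
     (\<forall>X \<in> Obj A. omap F X \<in> Obj B) \<and>
     (\<forall>f \<in> Arr A. amap F f \<in> Hom B (omap F (Dom A f)) (omap F (Cod A f))) \<and>
     (\<forall>X \<in> Obj A. amap F (Ident A X) = Ident B (omap F X)) \<and>
     (\<forall>f \<in> Arr A. \<forall>g \<in> Arr A. Dom A g = Cod A f \<longrightarrow>
        amap F (g \<cdot>\<^bsub>A\<^esub> f) = amap F g \<cdot>\<^bsub>B\<^esub> amap F f)"

definition id_functor :: "('o, 'a, 'o, 'a) fun_data" where
  "id_functor = \<lparr>omap = \<lambda>X. X, amap = \<lambda>f. f\<rparr>"

definition comp_functor ::
  "('p, 'b, 'q, 'c) fun_data \<Rightarrow> ('o, 'a, 'p, 'b) fun_data \<Rightarrow> ('o, 'a, 'q, 'c) fun_data" where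
  "comp_functor G F = \<lparr>omap = \<lambda>X. omap G (omap F X), amap = \<lambda>f. amap G (amap F f)\<rparr>"

definition is_nat_trans :: "('o, 'a) cat \<Rightarrow> ('p, 'b) cat \<Rightarrow>
  ('o, 'a, 'p, 'b) fun_data \<Rightarrow> ('o, 'a, 'p, 'b) fun_data \<Rightarrow> ('o \<Rightarrow> 'b) \<Rightarrow> bool" where
  "is_nat_trans A B F G \<tau> \<longleftrightarrow> is_functor A B F \<and> is_functor A B G \<and>
     (\<forall>X \<in> Obj A. \<tau> X \<in> Hom B (omap F X) (omap G X)) \<and>
     (\<forall>f \<in> Arr A. \<tau> (Cod A f) \<cdot>\<^bsub>B\<^esub> amap F f = amap G f \<cdot>\<^bsub>B\<^esub> \<tau> (Dom A f))"

definition is_nat_iso :: "('o, 'a) cat \<Rightarrow> ('p, 'b) cat \<Rightarrow>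
  ('o, 'a, 'p, 'b) fun_data \<Rightarrow> ('o, 'a, 'p, 'b) fun_data \<Rightarrow> ('o \<Rightarrow> 'b) \<Rightarrow> bool" where
  "is_nat_iso A B F G \<tau> \<longleftrightarrow> is_nat_trans A B F G \<tau> \<and> (\<forall>X \<in> Obj A. is_iso B (\<tau> X))"

definition is_equivalence :: "('o, 'a) cat \<Rightarrow> ('p, 'b) cat \<Rightarrow> ('o, 'a, 'p, 'b) fun_data \<Rightarrow> bool" where
  "is_equivalence A B F \<longleftrightarrow> is_functor A B F \<and>
     (\<exists>G \<eta> \<epsilon>. is_functor B A G \<and>
        is_nat_iso A A id_functor (comp_functor G F) \<eta> \<and>
        is_nat_iso B B (comp_functor F G) id_functor \<epsilon>)"

definition is_adjunction :: "('o, 'a) cat \<Rightarrow> ('p, 'b) cat \<Rightarrow>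
  ('o, 'a, 'p, 'b) fun_data \<Rightarrow> ('p, 'b, 'o, 'a) fun_data \<Rightarrow>
  ('o \<Rightarrow> 'a) \<Rightarrow> ('p \<Rightarrow> 'b) \<Rightarrow> bool" where
  "is_adjunction A B F G \<eta> \<epsilon> \<longleftrightarrow> is_functor A B F \<and> is_functor B A G \<and>
     is_nat_trans A A id_functor (comp_functor G F) \<eta> \<and>
     is_nat_trans B B (comp_functor F G) id_functor \<epsilon> \<and>
     (\<forall>X \<in> Obj A. \<epsilon> (omap F X) \<cdot>\<^bsub>B\<^esub> amap F (\<eta> X) = Ident B (omap F X)) \<and>
     (\<forall>Y \<in> Obj B. amap G (\<epsilon> Y) \<cdot>\<^bsub>A\<^esub> \<eta> (omap G Y) = Ident A (omap G Y))"


section \<open>Limits and coproducts\<close>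

definition is_limit :: "('j, 'k) cat \<Rightarrow> ('o, 'a) cat \<Rightarrow> ('j, 'k, 'o, 'a) fun_data \<Rightarrow>
  'o \<Rightarrow> ('j \<Rightarrow> 'a) \<Rightarrow> bool" where
  "is_limit J C D L \<pi> \<longleftrightarrow>
     (let cone = (\<lambda>B \<kappa>. B \<in> Obj C \<and> (\<forall>j \<in> Obj J. \<kappa> j \<in> Hom C B (omap D j)) \<and>
                   (\<forall>k \<in> Arr J. amap D k \<cdot>\<^bsub>C\<^esub> \<kappa> (Dom J k) = \<kappa> (Cod J k)))
      in cone L \<pi> \<and>
         (\<forall>B \<kappa>. cone B \<kappa> \<longrightarrow> (\<exists>!u. u \<in> Hom C B L \<and> (\<forall>j \<in> Obj J. \<pi> j \<cdot>\<^bsub>C\<^esub> u = \<kappa> j))))"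

text \<open>Every finite category is isomorphic to one whose objects and arrows are natural numbers.\<close>

definition has_finite_limits :: "('o, 'a) cat \<Rightarrow> bool" where
  "has_finite_limits C \<longleftrightarrow>
     (\<forall>(J :: (nat, nat) cat) D. finite (Obj J) \<and> finite (Arr J) \<and> is_functor J C D \<longrightarrow>
        (\<exists>L \<pi>. is_limit J C D L \<pi>))"

definition is_terminal :: "('o, 'a) cat \<Rightarrow> 'o \<Rightarrow> bool" where
  "is_terminal C t \<longleftrightarrow> t \<in> Obj C \<and> (\<forall>A \<in> Obj C. \<exists>!f. f \<in> Hom C A t)"

definition is_product :: "('o, 'a) cat \<Rightarrow> 'o \<Rightarrow> 'o \<Rightarrow> 'a \<Rightarrow> 'a \<Rightarrow> bool" where
  "is_product C A B p q \<longleftrightarrow> p \<in> Hom C (Dom C p) A \<and> q \<in> Hom C (Dom C p) B \<and>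
     (\<forall>D \<in> Obj C. \<forall>h \<in> Hom C D A. \<forall>k \<in> Hom C D B.
        \<exists>!u. u \<in> Hom C D (Dom C p) \<and> p \<cdot>\<^bsub>C\<^esub> u = h \<and> q \<cdot>\<^bsub>C\<^esub> u = k)"

definition is_pullback :: "('o, 'a) cat \<Rightarrow> 'a \<Rightarrow> 'a \<Rightarrow> 'a \<Rightarrow> 'a \<Rightarrow> bool" where
  "is_pullback C f g p q \<longleftrightarrow> f \<in> Arr C \<and> g \<in> Arr C \<and> Cod C f = Cod C g \<and>
     p \<in> Hom C (Dom C p) (Dom C f) \<and> q \<in> Hom C (Dom C p) (Dom C g) \<and>
     f \<cdot>\<^bsub>C\<^esub> p = g \<cdot>\<^bsub>C\<^esub> q \<and>
     (\<forall>D \<in> Obj C. \<forall>h \<in> Hom C D (Dom C f). \<forall>k \<in> Hom C D (Dom C g). f \<cdot>\<^bsub>C\<^esub> h = g \<cdot>\<^bsub>C\<^esub> k \<longrightarrow>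
        (\<exists>!u. u \<in> Hom C D (Dom C p) \<and> p \<cdot>\<^bsub>C\<^esub> u = h \<and> q \<cdot>\<^bsub>C\<^esub> u = k))"

definition is_coproduct :: "('o, 'a) cat \<Rightarrow> 'i set \<Rightarrow> ('i \<Rightarrow> 'o) \<Rightarrow> 'o \<Rightarrow> ('i \<Rightarrow> 'a) \<Rightarrow> bool" where
  "is_coproduct C I F S \<iota> \<longleftrightarrow> S \<in> Obj C \<and> (\<forall>i \<in> I. \<iota> i \<in> Hom C (F i) S) \<and>
     (\<forall>B \<in> Obj C. \<forall>g. (\<forall>i \<in> I. g i \<in> Hom C (F i) B) \<longrightarrow>
        (\<exists>!u. u \<in> Hom C S B \<and> (\<forall>i \<in> I. u \<cdot>\<^bsub>C\<^esub> \<iota> i = g i)))"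

text \<open>
  Chosen limits and colimits. The universal properties depend on a family \<^term>\<open>F\<close> only through its
  values on the index set, hence so do the choices.
\<close>

definition pb_cone :: "('o, 'a) cat \<Rightarrow> 'a \<Rightarrow> 'a \<Rightarrow> 'a \<times> 'a" where
  "pb_cone C f g = (SOME (p, q). is_pullback C f g p q)"

definition pb1 :: "('o, 'a) cat \<Rightarrow> 'a \<Rightarrow> 'a \<Rightarrow> 'a" where "pb1 C f g = fst (pb_cone C f g)"
definition pb2 :: "('o, 'a) cat \<Rightarrow> 'a \<Rightarrow> 'a \<Rightarrow> 'a" where "pb2 C f g = snd (pb_cone C f g)"
definition pb :: "('o, 'a) cat \<Rightarrow> 'a \<Rightarrow> 'a \<Rightarrow> 'o" where "pb C f g = Dom C (pb1 C f g)"

definition pb_pair :: "('o, 'a) cat \<Rightarrow> 'a \<Rightarrow> 'a \<Rightarrow> 'a \<Rightarrow> 'a \<Rightarrow> 'a" where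
  "pb_pair C f g h k = (THE u. u \<in> Hom C (Dom C h) (pb C f g) \<and>
     pb1 C f g \<cdot>\<^bsub>C\<^esub> u = h \<and> pb2 C f g \<cdot>\<^bsub>C\<^esub> u = k)"

definition prod_cone :: "('o, 'a) cat \<Rightarrow> 'o \<Rightarrow> 'o \<Rightarrow> 'a \<times> 'a" where
  "prod_cone C A B = (SOME (p, q). is_product C A B p q)"

definition pr1 :: "('o, 'a) cat \<Rightarrow> 'o \<Rightarrow> 'o \<Rightarrow> 'a" where "pr1 C A B = fst (prod_cone C A B)"
definition pr2 :: "('o, 'a) cat \<Rightarrow> 'o \<Rightarrow> 'o \<Rightarrow> 'a" where "pr2 C A B = snd (prod_cone C A B)"
definition prd :: "('o, 'a) cat \<Rightarrow> 'o \<Rightarrow> 'o \<Rightarrow> 'o" where "prd C A B = Dom C (pr1 C A B)"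

definition pair :: "('o, 'a) cat \<Rightarrow> 'a \<Rightarrow> 'a \<Rightarrow> 'a" where
  "pair C h k = (THE u. u \<in> Hom C (Dom C h) (prd C (Cod C h) (Cod C k)) \<and>
     pr1 C (Cod C h) (Cod C k) \<cdot>\<^bsub>C\<^esub> u = h \<and> pr2 C (Cod C h) (Cod C k) \<cdot>\<^bsub>C\<^esub> u = k)"

definition prd_map :: "('o, 'a) cat \<Rightarrow> 'a \<Rightarrow> 'a \<Rightarrow> 'a" where
  "prd_map C f g = pair C (f \<cdot>\<^bsub>C\<^esub> pr1 C (Dom C f) (Dom C g)) (g \<cdot>\<^bsub>C\<^esub> pr2 C (Dom C f) (Dom C g))"

definition prd_assoc :: "('o, 'a) cat \<Rightarrow> 'o \<Rightarrow> 'o \<Rightarrow> 'o \<Rightarrow> 'a" where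
  \<comment> \<open>\<open>(A \<times> B) \<times> D \<rightarrow> A \<times> (B \<times> D)\<close>\<close>
  "prd_assoc C A B D =
     pair C (pr1 C A B \<cdot>\<^bsub>C\<^esub> pr1 C (prd C A B) D)
            (pair C (pr2 C A B \<cdot>\<^bsub>C\<^esub> pr1 C (prd C A B) D) (pr2 C (prd C A B) D))"

definition coprod_cocone :: "('o, 'a) cat \<Rightarrow> 'i set \<Rightarrow> ('i \<Rightarrow> 'o) \<Rightarrow> 'o \<times> ('i \<Rightarrow> 'a)" where
  "coprod_cocone C I F = (SOME (S, \<iota>). is_coproduct C I F S \<iota>)"

definition coprod :: "('o, 'a) cat \<Rightarrow> 'i set \<Rightarrow> ('i \<Rightarrow> 'o) \<Rightarrow> 'o" where
  "coprod C I F = fst (coprod_cocone C I F)"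

definition incl :: "('o, 'a) cat \<Rightarrow> 'i set \<Rightarrow> ('i \<Rightarrow> 'o) \<Rightarrow> 'i \<Rightarrow> 'a" where
  "incl C I F = snd (coprod_cocone C I F)"

definition cotuple :: "('o, 'a) cat \<Rightarrow> 'i set \<Rightarrow> ('i \<Rightarrow> 'o) \<Rightarrow> 'o \<Rightarrow> ('i \<Rightarrow> 'a) \<Rightarrow> 'a" where
  "cotuple C I F B g = (THE u. u \<in> Hom C (coprod C I F) B \<and> (\<forall>i \<in> I. u \<cdot>\<^bsub>C\<^esub> incl C I F i = g i))"


section \<open>Lextensive categories\<close>

text \<open>
  \<^term>\<open>small\<close> singles out the small sets among the subsets of the type \<^typ>\<open>'a\<close>, which will also be
  the type of arrows of the base category. The axioms say that the small sets are those of
  cardinality below some infinite regular cardinal; the small sets of set theory, or the elements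
  of a Grothendieck universe, are an instance.
\<close>

definition smallness :: "('a set \<Rightarrow> bool) \<Rightarrow> bool" where
  "smallness small \<longleftrightarrow> infinite (UNIV :: 'a set) \<and>
     (\<forall>X. finite X \<longrightarrow> small X) \<and>
     (\<forall>X Y. small X \<and> Y \<subseteq> X \<longrightarrow> small Y) \<and>
     (\<forall>X (f :: 'a \<Rightarrow> 'a). small X \<longrightarrow> small (f ` X)) \<and>
     (\<forall>I (F :: 'a \<Rightarrow> 'a set). small I \<and> (\<forall>i \<in> I. small (F i)) \<longrightarrow> small (\<Union>i \<in> I. F i))"

definition locally_small :: "('a set \<Rightarrow> bool) \<Rightarrow> ('o, 'a) cat \<Rightarrow> bool" where
  "locally_small small C \<longleftrightarrow> (\<forall>A \<in> Obj C. \<forall>B \<in> Obj C. small (Hom C A B))"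

definition has_small_coproducts :: "('a set \<Rightarrow> bool) \<Rightarrow> ('o, 'a) cat \<Rightarrow> bool" where
  "has_small_coproducts small C \<longleftrightarrow>
     (\<forall>(I :: 'a set) F. small I \<and> F \<in> I \<rightarrow> Obj C \<longrightarrow> (\<exists>S \<iota>. is_coproduct C I F S \<iota>))"

text \<open>An arrow \<open>h\<close> from \<open>f\<close> to \<open>g\<close> in the slice is the triple \<open>(f, g, h)\<close>.\<close>

definition slice :: "('o, 'a) cat \<Rightarrow> 'o \<Rightarrow> ('a, 'a \<times> 'a \<times> 'a) cat" where
  "slice C X =
    \<lparr>Obj = {f \<in> Arr C. Cod C f = X},
     Arr = {(f, g, h). f \<in> Arr C \<and> Cod C f = X \<and> g \<in> Arr C \<and> Cod C g = X \<and>
                       h \<in> Hom C (Dom C f) (Dom C g) \<and> g \<cdot>\<^bsub>C\<^esub> h = f},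
     Dom = (\<lambda>(f, g, h). f),
     Cod = (\<lambda>(f, g, h). g),
     Ident = (\<lambda>f. (f, f, Ident C (Dom C f))),
     Cmp = (\<lambda>(f', g', h') (f, g, h). (f, g', h' \<cdot>\<^bsub>C\<^esub> h))\<rparr>"

definition prod_cat :: "'i set \<Rightarrow> ('i \<Rightarrow> ('o, 'a) cat) \<Rightarrow> ('i \<Rightarrow> 'o, 'i \<Rightarrow> 'a) cat" where
  "prod_cat I D =
    \<lparr>Obj = (\<Pi>\<^sub>E i \<in> I. Obj (D i)),
     Arr = (\<Pi>\<^sub>E i \<in> I. Arr (D i)),
     Dom = (\<lambda>f. \<lambda>i \<in> I. Dom (D i) (f i)),
     Cod = (\<lambda>f. \<lambda>i \<in> I. Cod (D i) (f i)),
     Ident = (\<lambda>X. \<lambda>i \<in> I. Ident (D i) (X i)),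
     Cmp = (\<lambda>g f. \<lambda>i \<in> I. Cmp (D i) (g i) (f i))\<rparr>"

definition coprod_map :: "('o, 'a) cat \<Rightarrow> 'i set \<Rightarrow> ('i \<Rightarrow> 'a) \<Rightarrow> 'a" where
  "coprod_map C I f =
     cotuple C I (\<lambda>i. Dom C (f i)) (coprod C I (\<lambda>i. Cod C (f i)))
       (\<lambda>i. incl C I (\<lambda>i. Cod C (f i)) i \<cdot>\<^bsub>C\<^esub> f i)"

definition sum_functor :: "('o, 'a) cat \<Rightarrow> 'i set \<Rightarrow>
  ('i \<Rightarrow> 'a, 'i \<Rightarrow> 'a \<times> 'a \<times> 'a, 'a, 'a \<times> 'a \<times> 'a) fun_data" where
  "sum_functor C I =
    \<lparr>omap = coprod_map C I,
     amap = (\<lambda>t. (coprod_map C I (\<lambda>i. fst (t i)),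
                  coprod_map C I (\<lambda>i. fst (snd (t i))),
                  coprod_map C I (\<lambda>i. snd (snd (t i)))))\<rparr>"

definition extensive :: "('a set \<Rightarrow> bool) \<Rightarrow> ('o, 'a) cat \<Rightarrow> bool" where
  "extensive small C \<longleftrightarrow> has_small_coproducts small C \<and>
     (\<forall>(I :: 'a set) X. small I \<and> X \<in> I \<rightarrow> Obj C \<longrightarrow>
        is_equivalence (prod_cat I (\<lambda>i. slice C (X i))) (slice C (coprod C I X)) (sum_functor C I))"

definition lextensive :: "('a set \<Rightarrow> bool) \<Rightarrow> ('o, 'a) cat \<Rightarrow> bool" where
  "lextensive small C \<longleftrightarrow> category C \<and> extensive small C \<and> has_finite_limits C"


section \<open>Cartesian monads\<close>

record ('o, 'a) monad_data =
  endo :: "('o, 'a, 'o, 'a) fun_data"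
  mult :: "'o \<Rightarrow> 'a"
  unit :: "'o \<Rightarrow> 'a"

definition is_monad :: "('o, 'a) cat \<Rightarrow> ('o, 'a) monad_data \<Rightarrow> bool" where
  "is_monad C T \<longleftrightarrow> is_functor C C (endo T) \<and>
     is_nat_trans C C (comp_functor (endo T) (endo T)) (endo T) (mult T) \<and>
     is_nat_trans C C id_functor (endo T) (unit T) \<and>
     (\<forall>A \<in> Obj C.
        mult T A \<cdot>\<^bsub>C\<^esub> unit T (omap (endo T) A) = Ident C (omap (endo T) A) \<and>
        mult T A \<cdot>\<^bsub>C\<^esub> amap (endo T) (unit T A) = Ident C (omap (endo T) A) \<and>
        mult T A \<cdot>\<^bsub>C\<^esub> mult T (omap (endo T) A) = mult T A \<cdot>\<^bsub>C\<^esub> amap (endo T) (mult T A))"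

definition cartesian_monad :: "('o, 'a) cat \<Rightarrow> ('o, 'a) monad_data \<Rightarrow> bool" where
  "cartesian_monad C T \<longleftrightarrow> is_monad C T \<and>
     (\<forall>f g p q. is_pullback C f g p q \<longrightarrow>
        is_pullback C (amap (endo T) f) (amap (endo T) g) (amap (endo T) p) (amap (endo T) q)) \<and>
     (\<forall>f \<in> Arr C.
        is_pullback C (mult T (Cod C f)) (amap (endo T) f)
          (amap (endo T) (amap (endo T) f)) (mult T (Dom C f)) \<and>
        is_pullback C (unit T (Cod C f)) (amap (endo T) f) f (unit T (Dom C f)))"


section \<open>Matrices and spans\<close>

text \<open>
  A matrix \<open>p\<close> has a source set, a target set, and entries \<open>p (x, y)\<close>; all functions on sets are
  extensional, so that equality of the records below is equality of the mathematical objects.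
  A 2-cell records its horizontal source and target (\<open>cdom\<close>, \<open>ccod\<close>), its vertical boundary
  functions (\<open>cleft\<close>, \<open>cright\<close>), and its components.
\<close>

record ('o, 'a) mat =
  msrc :: "'a set"
  mtgt :: "'a set"
  ment :: "'a \<times> 'a \<Rightarrow> 'o"

record ('o, 'a) mcell =
  cdom :: "('o, 'a) mat"
  ccod :: "('o, 'a) mat"
  cleft :: "'a \<Rightarrow> 'a"
  cright :: "'a \<Rightarrow> 'a"
  cmap :: "'a \<times> 'a \<Rightarrow> 'a"

text \<open>The span with legs \<open>l\<close> and \<open>r\<close> has apex \<open>Dom l\<close> and feet \<open>Cod l\<close> and \<open>Cod r\<close>.\<close>

record 'a span =
  sl :: 'a
  sr :: 'a

record 'a scell =
  sdom :: "'a span"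
  scod :: "'a span"
  sleft :: 'a
  sright :: 'a
  smap :: 'a

text \<open>An internal \<open>T\<close>-category \<open>(X\<^sub>0, X\<^sub>1, l, r, \<upsilon>, \<mu>)\<close>, and an enriched one \<open>(X, a, \<upsilon>, \<mu>)\<close>.\<close>

record ('o, 'a) icat =
  iX0 :: 'o
  iX1 :: 'o
  il :: 'a
  ir :: 'a
  iun :: 'a
  imu :: 'a

record ('o, 'a) ecat =
  eX :: "'a set"
  ea :: "('o, 'a) mat"
  eun :: "('o, 'a) mcell"
  emu :: "('o, 'a) mcell"

abbreviation idf :: "'a set \<Rightarrow> 'a \<Rightarrow> 'a" where
  "idf X \<equiv> \<lambda>x \<in> X. x"

context
  fixes small :: "'a set \<Rightarrow> bool"
    and C :: "('o, 'a) cat" (structure)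
    and one :: 'o
    and T :: "('o, 'a) monad_data"
begin

abbreviation "T\<^sub>0 \<equiv> omap (endo T)"
abbreviation "T\<^sub>1 \<equiv> amap (endo T)"

subsection \<open>The pseudodouble category of matrices\<close>

definition is_mat :: "('o, 'a) mat \<Rightarrow> bool" where
  "is_mat p \<longleftrightarrow> small (msrc p) \<and> small (mtgt p) \<and> ment p \<in> (msrc p \<times> mtgt p) \<rightarrow>\<^sub>E Obj C"

definition is_mcell :: "('o, 'a) mcell \<Rightarrow> bool" where
  "is_mcell \<Phi> \<longleftrightarrow> is_mat (cdom \<Phi>) \<and> is_mat (ccod \<Phi>) \<and>
     cleft \<Phi> \<in> msrc (cdom \<Phi>) \<rightarrow>\<^sub>E msrc (ccod \<Phi>) \<and>
     cright \<Phi> \<in> mtgt (cdom \<Phi>) \<rightarrow>\<^sub>E mtgt (ccod \<Phi>) \<and>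
     cmap \<Phi> \<in> (\<Pi>\<^sub>E (x, y) \<in> msrc (cdom \<Phi>) \<times> mtgt (cdom \<Phi>).
        Hom C (ment (cdom \<Phi>) (x, y)) (ment (ccod \<Phi>) (cleft \<Phi> x, cright \<Phi> y)))"

definition mcid :: "('o, 'a) mat \<Rightarrow> ('o, 'a) mcell" where
  "mcid p = \<lparr>cdom = p, ccod = p, cleft = idf (msrc p), cright = idf (mtgt p),
     cmap = (\<lambda>z \<in> msrc p \<times> mtgt p. Ident C (ment p z))\<rparr>"

definition vcomp :: "('o, 'a) mcell \<Rightarrow> ('o, 'a) mcell \<Rightarrow> ('o, 'a) mcell" where
  "vcomp \<Psi> \<Phi> = \<lparr>cdom = cdom \<Phi>, ccod = ccod \<Psi>,
     cleft = compose (msrc (cdom \<Phi>)) (cleft \<Psi>) (cleft \<Phi>),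
     cright = compose (mtgt (cdom \<Phi>)) (cright \<Psi>) (cright \<Phi>),
     cmap = (\<lambda>(x, y) \<in> msrc (cdom \<Phi>) \<times> mtgt (cdom \<Phi>).
       cmap \<Psi> (cleft \<Phi> x, cright \<Phi> y) \<cdot> cmap \<Phi> (x, y))\<rparr>"

definition mcomp_fam :: "('o, 'a) mat \<Rightarrow> ('o, 'a) mat \<Rightarrow> 'a \<Rightarrow> 'a \<Rightarrow> 'a \<Rightarrow> 'o" where
  "mcomp_fam q p x z = (\<lambda>y. prd C (ment q (y, z)) (ment p (x, y)))"

definition mcomp :: "('o, 'a) mat \<Rightarrow> ('o, 'a) mat \<Rightarrow> ('o, 'a) mat" (infixr \<open>\<odot>\<close> 70) where
  "q \<odot> p = \<lparr>msrc = msrc p, mtgt = mtgt q,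
     ment = (\<lambda>(x, z) \<in> msrc p \<times> mtgt q. coprod C (mtgt p) (mcomp_fam q p x z))\<rparr>"

definition mincl :: "('o, 'a) mat \<Rightarrow> ('o, 'a) mat \<Rightarrow> 'a \<Rightarrow> 'a \<Rightarrow> 'a \<Rightarrow> 'a" where
  \<comment> \<open>the inclusion \<open>q (y, z) \<times> p (x, y) \<rightarrow> (q \<odot> p) (x, z)\<close>\<close>
  "mincl q p x y z = incl C (mtgt p) (mcomp_fam q p x z) y"

definition hcomp :: "('o, 'a) mcell \<Rightarrow> ('o, 'a) mcell \<Rightarrow> ('o, 'a) mcell" where
  "hcomp \<Psi> \<Phi> = \<lparr>cdom = cdom \<Psi> \<odot> cdom \<Phi>, ccod = ccod \<Psi> \<odot> ccod \<Phi>,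
     cleft = cleft \<Phi>, cright = cright \<Psi>,
     cmap = (\<lambda>(x, z) \<in> msrc (cdom \<Phi>) \<times> mtgt (cdom \<Psi>).
       cotuple C (mtgt (cdom \<Phi>)) (mcomp_fam (cdom \<Psi>) (cdom \<Phi>) x z)
         (ment (ccod \<Psi> \<odot> ccod \<Phi>) (cleft \<Phi> x, cright \<Psi> z))
         (\<lambda>y. mincl (ccod \<Psi>) (ccod \<Phi>) (cleft \<Phi> x) (cright \<Phi> y) (cright \<Psi> z)
                \<cdot> prd_map C (cmap \<Psi> (y, z)) (cmap \<Phi> (x, y))))\<rparr>"

text \<open>The copower \<open>I * 1\<close> and, for a function \<open>f\<close>, the arrow \<open>f * 1\<close>.\<close>

definition copow :: "'i set \<Rightarrow> 'o" where
  "copow I = coprod C I (\<lambda>_. one)"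

definition copow_incl :: "'i set \<Rightarrow> 'i \<Rightarrow> 'a" where
  "copow_incl I = incl C I (\<lambda>_. one)"

definition copow_cotuple :: "'i set \<Rightarrow> 'o \<Rightarrow> ('i \<Rightarrow> 'a) \<Rightarrow> 'a" where
  "copow_cotuple I = cotuple C I (\<lambda>_. one)"

definition copow_map :: "'i set \<Rightarrow> 'i set \<Rightarrow> ('i \<Rightarrow> 'i) \<Rightarrow> 'a" where
  "copow_map I J f = copow_cotuple I (copow J) (\<lambda>i. copow_incl J (f i))"

text \<open>The truth value \<open>[x = x']\<close>, as a set with at most one element.\<close>

definition eqv :: "'a \<Rightarrow> 'a \<Rightarrow> Product_Type.unit set" where
  "eqv x x' = {_. x = x'}"

definition munit :: "'a set \<Rightarrow> ('o, 'a) mat" where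
  "munit X = \<lparr>msrc = X, mtgt = X, ment = (\<lambda>(x, x') \<in> X \<times> X. copow (eqv x x'))\<rparr>"

definition munit_cell :: "'a set \<Rightarrow> 'a set \<Rightarrow> ('a \<Rightarrow> 'a) \<Rightarrow> ('o, 'a) mcell" where
  "munit_cell X Y f = \<lparr>cdom = munit X, ccod = munit Y, cleft = restrict f X, cright = restrict f X,
     cmap = (\<lambda>(x, x') \<in> X \<times> X. copow_map (eqv x x') (eqv (f x) (f x')) id)\<rparr>"

text \<open>
  The unitors \<open>\<lambda> : 1 \<odot> p \<rightarrow> p\<close> and \<open>\<rho> : p \<odot> 1 \<rightarrow> p\<close>: on the diagonal summands they are
  the product projections, and all other summands are initial. The associator
  \<open>(r \<odot> q) \<odot> p \<rightarrow> r \<odot> (q \<odot> p)\<close> is determined by its restrictions to the summands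
  \<open>(r (z, w) \<times> q (y, z)) \<times> p (x, y)\<close>.
\<close>

definition lunitor :: "('o, 'a) mat \<Rightarrow> ('o, 'a) mcell" where
  "lunitor p = \<lparr>cdom = munit (mtgt p) \<odot> p, ccod = p,
     cleft = idf (msrc p), cright = idf (mtgt p),
     cmap = (\<lambda>(x, y) \<in> msrc p \<times> mtgt p.
       THE u. u \<in> Hom C (ment (munit (mtgt p) \<odot> p) (x, y)) (ment p (x, y)) \<and>
         u \<cdot> mincl (munit (mtgt p)) p x y y = pr2 C (ment (munit (mtgt p)) (y, y)) (ment p (x, y)))\<rparr>"

definition runitor :: "('o, 'a) mat \<Rightarrow> ('o, 'a) mcell" where
  "runitor p = \<lparr>cdom = p \<odot> munit (msrc p), ccod = p,
     cleft = idf (msrc p), cright = idf (mtgt p),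
     cmap = (\<lambda>(x, y) \<in> msrc p \<times> mtgt p.
       THE u. u \<in> Hom C (ment (p \<odot> munit (msrc p)) (x, y)) (ment p (x, y)) \<and>
         u \<cdot> mincl p (munit (msrc p)) x x y = pr1 C (ment p (x, y)) (ment (munit (msrc p)) (x, x)))\<rparr>"

definition associator :: "('o, 'a) mat \<Rightarrow> ('o, 'a) mat \<Rightarrow> ('o, 'a) mat \<Rightarrow> ('o, 'a) mcell" where
  "associator r q p = \<lparr>cdom = (r \<odot> q) \<odot> p, ccod = r \<odot> (q \<odot> p),
     cleft = idf (msrc p), cright = idf (mtgt r),
     cmap = (\<lambda>(x, w) \<in> msrc p \<times> mtgt r.
       THE u. u \<in> Hom C (ment ((r \<odot> q) \<odot> p) (x, w)) (ment (r \<odot> (q \<odot> p)) (x, w)) \<and>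
         (\<forall>y \<in> mtgt p. \<forall>z \<in> mtgt q.
            u \<cdot> (mincl (r \<odot> q) p x y w \<cdot> prd_map C (mincl r q y z w) (Ident C (ment p (x, y))))
            = mincl r (q \<odot> p) x z w \<cdot>
                (prd_map C (Ident C (ment r (z, w))) (mincl q p x y z) \<cdot>
                  prd_assoc C (ment r (z, w)) (ment q (y, z)) (ment p (x, y)))))\<rparr>"

definition globular_inv :: "('o, 'a) mcell \<Rightarrow> ('o, 'a) mcell" where
  \<comment> \<open>the inverse of an invertible 2-cell with identity vertical boundary\<close>
  "globular_inv \<Phi> = \<lparr>cdom = ccod \<Phi>, ccod = cdom \<Phi>, cleft = cleft \<Phi>, cright = cright \<Phi>,
     cmap = (\<lambda>z \<in> msrc (cdom \<Phi>) \<times> mtgt (cdom \<Phi>). inv_arr C (cmap \<Phi> z))\<rparr>"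

subsection \<open>The pseudodouble category of spans\<close>

definition apex :: "'a span \<Rightarrow> 'o" where
  "apex s = Dom C (sl s)"

definition svcomp :: "'a scell \<Rightarrow> 'a scell \<Rightarrow> 'a scell" where
  "svcomp \<Psi> \<Phi> = \<lparr>sdom = sdom \<Phi>, scod = scod \<Psi>, sleft = sleft \<Psi> \<cdot> sleft \<Phi>,
     sright = sright \<Psi> \<cdot> sright \<Phi>, smap = smap \<Psi> \<cdot> smap \<Phi>\<rparr>"

definition sunit :: "'o \<Rightarrow> 'a span" where
  "sunit A = \<lparr>sl = Ident C A, sr = Ident C A\<rparr>"

text \<open>The apex of \<open>t \<circ> s\<close> is the pullback of \<open>l\<^sub>t\<close> and \<open>r\<^sub>s\<close>, in this order.\<close>

definition scomp :: "'a span \<Rightarrow> 'a span \<Rightarrow> 'a span" where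
  "scomp t s = \<lparr>sl = sl s \<cdot> pb2 C (sl t) (sr s), sr = sr t \<cdot> pb1 C (sl t) (sr s)\<rparr>"

definition globular_scell :: "'a span \<Rightarrow> 'a span \<Rightarrow> 'a \<Rightarrow> 'a scell" where
  "globular_scell s t h = \<lparr>sdom = s, scod = t, sleft = Ident C (Cod C (sl s)),
     sright = Ident C (Cod C (sr s)), smap = h\<rparr>"

subsection \<open>The strong functor \<open>- * 1\<close> from matrices to spans\<close>

definition bang :: "'o \<Rightarrow> 'a" where
  "bang A = (THE f. f \<in> Hom C A one)"

definition mtot :: "('o, 'a) mat \<Rightarrow> 'o" where
  "mtot p = coprod C (msrc p \<times> mtgt p) (ment p)"

definition mtot_incl :: "('o, 'a) mat \<Rightarrow> 'a \<times> 'a \<Rightarrow> 'a" where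
  "mtot_incl p = incl C (msrc p \<times> mtgt p) (ment p)"

definition mtot_cotuple :: "('o, 'a) mat \<Rightarrow> 'o \<Rightarrow> ('a \<times> 'a \<Rightarrow> 'a) \<Rightarrow> 'a" where
  "mtot_cotuple p = cotuple C (msrc p \<times> mtgt p) (ment p)"

definition star_mat :: "('o, 'a) mat \<Rightarrow> 'a span" where
  "star_mat p =
    \<lparr>sl = mtot_cotuple p (copow (msrc p)) (\<lambda>(x, y). copow_incl (msrc p) x \<cdot> bang (ment p (x, y))),
     sr = mtot_cotuple p (copow (mtgt p)) (\<lambda>(x, y). copow_incl (mtgt p) y \<cdot> bang (ment p (x, y)))\<rparr>"

definition star_cell :: "('o, 'a) mcell \<Rightarrow> 'a scell" where
  "star_cell \<Phi> = \<lparr>sdom = star_mat (cdom \<Phi>), scod = star_mat (ccod \<Phi>),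
     sleft = copow_map (msrc (cdom \<Phi>)) (msrc (ccod \<Phi>)) (cleft \<Phi>),
     sright = copow_map (mtgt (cdom \<Phi>)) (mtgt (ccod \<Phi>)) (cright \<Phi>),
     smap = mtot_cotuple (cdom \<Phi>) (mtot (ccod \<Phi>))
       (\<lambda>(x, y). mtot_incl (ccod \<Phi>) (cleft \<Phi> x, cright \<Phi> y) \<cdot> cmap \<Phi> (x, y))\<rparr>"

definition star_unit :: "'a set \<Rightarrow> 'a scell" where
  \<comment> \<open>the unit comparison \<open>1 \<rightarrow> 1\<^sub>X * 1\<close>\<close>
  "star_unit X = globular_scell (sunit (copow X)) (star_mat (munit X))
     (copow_cotuple X (mtot (munit X)) (\<lambda>x. mtot_incl (munit X) (x, x) \<cdot> copow_incl (eqv x x) ()))"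

definition star_cocomp_map :: "('o, 'a) mat \<Rightarrow> ('o, 'a) mat \<Rightarrow> 'a" where
  \<comment> \<open>the canonical arrow from the apex of \<open>(q \<odot> p) * 1\<close> to the apex of \<open>(q * 1) \<circ> (p * 1)\<close>\<close>
  "star_cocomp_map q p =
     mtot_cotuple (q \<odot> p) (apex (scomp (star_mat q) (star_mat p)))
       (\<lambda>(x, z). cotuple C (mtgt p) (mcomp_fam q p x z) (apex (scomp (star_mat q) (star_mat p)))
          (\<lambda>y. pb_pair C (sl (star_mat q)) (sr (star_mat p))
             (mtot_incl q (y, z) \<cdot> pr1 C (ment q (y, z)) (ment p (x, y)))
             (mtot_incl p (x, y) \<cdot> pr2 C (ment q (y, z)) (ment p (x, y)))))"

definition star_comp :: "('o, 'a) mat \<Rightarrow> ('o, 'a) mat \<Rightarrow> 'a scell" where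
  \<comment> \<open>the composition comparison \<open>(q * 1) \<circ> (p * 1) \<rightarrow> (q \<odot> p) * 1\<close>\<close>
  "star_comp q p = globular_scell (scomp (star_mat q) (star_mat p)) (star_mat (q \<odot> p))
     (inv_arr C (star_cocomp_map q p))"

subsection \<open>The lax functor \<open>V(1, -)\<close> from spans to matrices\<close>

definition pts :: "'o \<Rightarrow> 'a set" where
  "pts A = Hom C one A"

definition pts_map :: "'a \<Rightarrow> 'a \<Rightarrow> 'a" where
  "pts_map f = (\<lambda>v \<in> pts (Dom C f). f \<cdot> v)"

definition fib :: "'a span \<Rightarrow> 'a \<times> 'a \<Rightarrow> 'o" where
  "fib s = (\<lambda>(v, w). pb C (pair C (sl s) (sr s)) (pair C v w))"

definition fib_incl :: "'a span \<Rightarrow> 'a \<times> 'a \<Rightarrow> 'a" where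
  "fib_incl s = (\<lambda>(v, w). pb1 C (pair C (sl s) (sr s)) (pair C v w))"

definition fib_lift :: "'a span \<Rightarrow> 'a \<times> 'a \<Rightarrow> 'a \<Rightarrow> 'a" where
  \<comment> \<open>the arrow into the fibre over \<open>(v, w)\<close> induced by an arrow \<open>h\<close> into the apex\<close>
  "fib_lift s = (\<lambda>(v, w) h. pb_pair C (pair C (sl s) (sr s)) (pair C v w) h (bang (Dom C h)))"

definition pts_span :: "'a span \<Rightarrow> ('o, 'a) mat" where
  "pts_span s = \<lparr>msrc = pts (Cod C (sl s)), mtgt = pts (Cod C (sr s)),
     ment = restrict (fib s) (pts (Cod C (sl s)) \<times> pts (Cod C (sr s)))\<rparr>"

definition pts_cell :: "'a scell \<Rightarrow> ('o, 'a) mcell" where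
  "pts_cell \<Theta> = \<lparr>cdom = pts_span (sdom \<Theta>), ccod = pts_span (scod \<Theta>),
     cleft = pts_map (sleft \<Theta>), cright = pts_map (sright \<Theta>),
     cmap = (\<lambda>(v, w) \<in> pts (Cod C (sl (sdom \<Theta>))) \<times> pts (Cod C (sr (sdom \<Theta>))).
       fib_lift (scod \<Theta>) (sleft \<Theta> \<cdot> v, sright \<Theta> \<cdot> w) (smap \<Theta> \<cdot> fib_incl (sdom \<Theta>) (v, w)))\<rparr>"

definition pts_unit :: "'o \<Rightarrow> ('o, 'a) mcell" where
  \<comment> \<open>the lax unit comparison \<open>1 \<rightarrow> V(1, 1\<^sub>A)\<close>\<close>
  "pts_unit A = \<lparr>cdom = munit (pts A), ccod = pts_span (sunit A),
     cleft = idf (pts A), cright = idf (pts A),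
     cmap = (\<lambda>(v, w) \<in> pts A \<times> pts A.
       copow_cotuple (eqv v w) (fib (sunit A) (v, w)) (\<lambda>_. fib_lift (sunit A) (v, w) v))\<rparr>"

definition pts_comp :: "'a span \<Rightarrow> 'a span \<Rightarrow> ('o, 'a) mcell" where
  \<comment> \<open>the lax composition comparison \<open>V(1, t) \<odot> V(1, s) \<rightarrow> V(1, t \<circ> s)\<close>\<close>
  "pts_comp t s = \<lparr>cdom = pts_span t \<odot> pts_span s, ccod = pts_span (scomp t s),
     cleft = idf (pts (Cod C (sl s))), cright = idf (pts (Cod C (sr t))),
     cmap = (\<lambda>(v, w) \<in> pts (Cod C (sl s)) \<times> pts (Cod C (sr t)).
       cotuple C (pts (Cod C (sr s))) (mcomp_fam (pts_span t) (pts_span s) v w)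
         (fib (scomp t s) (v, w))
         (\<lambda>u. fib_lift (scomp t s) (v, w)
            (pb_pair C (sl t) (sr s)
              (fib_incl t (u, w) \<cdot> pr1 C (fib t (u, w)) (fib s (v, u)))
              (fib_incl s (v, u) \<cdot> pr2 C (fib t (u, w)) (fib s (v, u))))))\<rparr>"

subsection \<open>Unit and counit of \<open>- * 1 \<stileturn> V(1, -)\<close>\<close>

definition eta_set :: "'a set \<Rightarrow> 'a \<Rightarrow> 'a" where
  "eta_set X = (\<lambda>x \<in> X. copow_incl X x)"

definition eta_mat :: "('o, 'a) mat \<Rightarrow> ('o, 'a) mcell" where
  "eta_mat p = \<lparr>cdom = p, ccod = pts_span (star_mat p),
     cleft = eta_set (msrc p), cright = eta_set (mtgt p),
     cmap = (\<lambda>(x, y) \<in> msrc p \<times> mtgt p.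
       fib_lift (star_mat p) (eta_set (msrc p) x, eta_set (mtgt p) y) (mtot_incl p (x, y)))\<rparr>"

definition eps_obj :: "'o \<Rightarrow> 'a" where
  "eps_obj A = copow_cotuple (pts A) A (\<lambda>v. v)"

definition eps_span :: "'a span \<Rightarrow> 'a scell" where
  "eps_span s = \<lparr>sdom = star_mat (pts_span s), scod = s,
     sleft = eps_obj (Cod C (sl s)), sright = eps_obj (Cod C (sr s)),
     smap = mtot_cotuple (pts_span s) (apex s) (fib_incl s)\<rparr>"

subsection \<open>The action of \<open>T\<close> on spans\<close>

definition T_span :: "'a span \<Rightarrow> 'a span" where
  "T_span s = \<lparr>sl = T\<^sub>1 (sl s), sr = T\<^sub>1 (sr s)\<rparr>"

definition T_cell :: "'a scell \<Rightarrow> 'a scell" where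
  "T_cell \<Theta> = \<lparr>sdom = T_span (sdom \<Theta>), scod = T_span (scod \<Theta>),
     sleft = T\<^sub>1 (sleft \<Theta>), sright = T\<^sub>1 (sright \<Theta>), smap = T\<^sub>1 (smap \<Theta>)\<rparr>"

definition T_comp :: "'a span \<Rightarrow> 'a span \<Rightarrow> 'a scell" where
  \<comment> \<open>the comparison \<open>T t \<circ> T s \<rightarrow> T (t \<circ> s)\<close>; since \<open>T 1\<^sub>A = 1\<^sub>T\<^sub>A\<close>, the one for units is an identity\<close>
  "T_comp t s = globular_scell (scomp (T_span t) (T_span s)) (T_span (scomp t s))
     (THE u. u \<in> Hom C (apex (scomp (T_span t) (T_span s))) (T\<^sub>0 (apex (scomp t s))) \<and>
        T\<^sub>1 (pb1 C (sl t) (sr s)) \<cdot> u = pb1 C (T\<^sub>1 (sl t)) (T\<^sub>1 (sr s)) \<and>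
        T\<^sub>1 (pb2 C (sl t) (sr s)) \<cdot> u = pb2 C (T\<^sub>1 (sl t)) (T\<^sub>1 (sr s)))"

definition m_span :: "'a span \<Rightarrow> 'a scell" where
  "m_span s = \<lparr>sdom = T_span (T_span s), scod = T_span s,
     sleft = mult T (Cod C (sl s)), sright = mult T (Cod C (sr s)), smap = mult T (apex s)\<rparr>"

definition e_span :: "'a span \<Rightarrow> 'a scell" where
  "e_span s = \<lparr>sdom = s, scod = T_span s,
     sleft = unit T (Cod C (sl s)), sright = unit T (Cod C (sr s)), smap = unit T (apex s)\<rparr>"

subsection \<open>The monad \<open>Tb = V(1, T(- * 1))\<close>\<close>

definition Tb_set :: "'a set \<Rightarrow> 'a set" where
  "Tb_set X = pts (T\<^sub>0 (copow X))"

definition Tb_fun :: "'a set \<Rightarrow> 'a set \<Rightarrow> ('a \<Rightarrow> 'a) \<Rightarrow> 'a \<Rightarrow> 'a" where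
  "Tb_fun X Y f = pts_map (T\<^sub>1 (copow_map X Y f))"

definition Tb_mat :: "('o, 'a) mat \<Rightarrow> ('o, 'a) mat" where
  "Tb_mat p = pts_span (T_span (star_mat p))"

definition Tb_cell :: "('o, 'a) mcell \<Rightarrow> ('o, 'a) mcell" where
  "Tb_cell \<Phi> = pts_cell (T_cell (star_cell \<Phi>))"

definition Tb_unit :: "'a set \<Rightarrow> ('o, 'a) mcell" where
  "Tb_unit X = vcomp (pts_cell (T_cell (star_unit X))) (pts_unit (T\<^sub>0 (copow X)))"

definition Tb_comp :: "('o, 'a) mat \<Rightarrow> ('o, 'a) mat \<Rightarrow> ('o, 'a) mcell" where
  "Tb_comp q p =
     vcomp (pts_cell (T_cell (star_comp q p)))
       (vcomp (pts_cell (T_comp (star_mat q) (star_mat p)))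
         (pts_comp (T_span (star_mat q)) (T_span (star_mat p))))"

definition mb_set :: "'a set \<Rightarrow> 'a \<Rightarrow> 'a" where
  "mb_set X = pts_map (mult T (copow X) \<cdot> T\<^sub>1 (eps_obj (T\<^sub>0 (copow X))))"

definition mb_mat :: "('o, 'a) mat \<Rightarrow> ('o, 'a) mcell" where
  "mb_mat p = pts_cell (svcomp (m_span (star_mat p)) (T_cell (eps_span (T_span (star_mat p)))))"

definition eb_set :: "'a set \<Rightarrow> 'a \<Rightarrow> 'a" where
  "eb_set X = compose X (pts_map (unit T (copow X))) (eta_set X)"

definition eb_mat :: "('o, 'a) mat \<Rightarrow> ('o, 'a) mcell" where
  "eb_mat p = vcomp (pts_cell (e_span (star_mat p))) (eta_mat p)"

definition strong_conjoint :: bool where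
  \<comment> \<open>for the transformation \<open>Tb(-) * 1 \<rightarrow> T(- * 1)\<close> given by \<open>\<epsilon>\<close>: invertibility of
      the arrow from the apex of \<open>Tb a * 1\<close> to the pullback of \<open>T r : T M \<rightarrow> T (t * 1)\<close> and
      \<open>\<epsilon> : Tb t * 1 \<rightarrow> T (t * 1)\<close>, where \<open>M\<close> is the apex of \<open>a * 1\<close>; this is the apex component
      of the canonical 2-cell \<open>(Tb a * 1) \<circ> \<epsilon>\<^sup>* \<rightarrow> \<epsilon>\<^sup>* \<circ> T (a * 1)\<close>\<close>
  "strong_conjoint \<longleftrightarrow>
     (\<forall>a. is_mat a \<longrightarrow>
        is_iso C (pb_pair C (T\<^sub>1 (sr (star_mat a))) (eps_obj (T\<^sub>0 (copow (mtgt a))))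
          (smap (eps_span (T_span (star_mat a)))) (sr (star_mat (Tb_mat a)))))"

subsection \<open>Internal \<open>T\<close>-categories\<close>

abbreviation i_pr1 :: "('o, 'a) icat \<Rightarrow> 'a" where "i_pr1 S \<equiv> pb1 C (il S) (T\<^sub>1 (ir S))"
abbreviation i_pr2 :: "('o, 'a) icat \<Rightarrow> 'a" where "i_pr2 S \<equiv> pb2 C (il S) (T\<^sub>1 (ir S))"
abbreviation i_X2 :: "('o, 'a) icat \<Rightarrow> 'o" where "i_X2 S \<equiv> pb C (il S) (T\<^sub>1 (ir S))"
abbreviation i_pair :: "('o, 'a) icat \<Rightarrow> 'a \<Rightarrow> 'a \<Rightarrow> 'a" where
  "i_pair S \<equiv> pb_pair C (il S) (T\<^sub>1 (ir S))"

text \<open>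
  For associativity, \<open>X\<^sub>3\<close> is the pullback of \<open>pr\<^sub>2 : X\<^sub>2 \<rightarrow> T X\<^sub>1\<close> and
  \<open>T pr\<^sub>1 : T X\<^sub>2 \<rightarrow> T X\<^sub>1\<close>.
\<close>

definition is_icat :: "('o, 'a) icat \<Rightarrow> bool" where
  "is_icat S \<longleftrightarrow> iX0 S \<in> Obj C \<and> iX1 S \<in> Obj C \<and>
     il S \<in> Hom C (iX1 S) (T\<^sub>0 (iX0 S)) \<and> ir S \<in> Hom C (iX1 S) (iX0 S) \<and>
     iun S \<in> Hom C (iX0 S) (iX1 S) \<and> imu S \<in> Hom C (i_X2 S) (iX1 S) \<and>
     il S \<cdot> iun S = unit T (iX0 S) \<and> ir S \<cdot> iun S = Ident C (iX0 S) \<and>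
     il S \<cdot> imu S = mult T (iX0 S) \<cdot> (T\<^sub>1 (il S) \<cdot> i_pr2 S) \<and>
     ir S \<cdot> imu S = ir S \<cdot> i_pr1 S \<and>
     imu S \<cdot> i_pair S (iun S \<cdot> ir S) (unit T (iX1 S)) = Ident C (iX1 S) \<and>
     imu S \<cdot> i_pair S (Ident C (iX1 S)) (T\<^sub>1 (iun S) \<cdot> il S) = Ident C (iX1 S) \<and>
     (let \<pi>\<^sub>1 = pb1 C (i_pr2 S) (T\<^sub>1 (i_pr1 S)); \<pi>\<^sub>2 = pb2 C (i_pr2 S) (T\<^sub>1 (i_pr1 S)) in
        imu S \<cdot> i_pair S (imu S \<cdot> \<pi>\<^sub>1) (mult T (iX1 S) \<cdot> (T\<^sub>1 (i_pr2 S) \<cdot> \<pi>\<^sub>2))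
        = imu S \<cdot> i_pair S (i_pr1 S \<cdot> \<pi>\<^sub>1) (T\<^sub>1 (imu S) \<cdot> \<pi>\<^sub>2))"

definition is_icat_mor :: "('o, 'a) icat \<Rightarrow> ('o, 'a) icat \<Rightarrow> 'a \<Rightarrow> 'a \<Rightarrow> bool" where
  "is_icat_mor S R f\<^sub>0 f\<^sub>1 \<longleftrightarrow> f\<^sub>0 \<in> Hom C (iX0 S) (iX0 R) \<and> f\<^sub>1 \<in> Hom C (iX1 S) (iX1 R) \<and>
     il R \<cdot> f\<^sub>1 = T\<^sub>1 f\<^sub>0 \<cdot> il S \<and> ir R \<cdot> f\<^sub>1 = f\<^sub>0 \<cdot> ir S \<and>
     f\<^sub>1 \<cdot> iun S = iun R \<cdot> f\<^sub>0 \<and>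
     f\<^sub>1 \<cdot> imu S = imu R \<cdot> i_pair R (f\<^sub>1 \<cdot> i_pr1 S) (T\<^sub>1 f\<^sub>1 \<cdot> i_pr2 S)"

definition Int_Cat ::
  "(('o, 'a) icat, ('o, 'a) icat \<times> ('o, 'a) icat \<times> 'a \<times> 'a) cat" where
  "Int_Cat =
    \<lparr>Obj = {S. is_icat S},
     Arr = {(S, R, f\<^sub>0, f\<^sub>1). is_icat S \<and> is_icat R \<and> is_icat_mor S R f\<^sub>0 f\<^sub>1},
     Dom = (\<lambda>(S, R, f\<^sub>0, f\<^sub>1). S),
     Cod = (\<lambda>(S, R, f\<^sub>0, f\<^sub>1). R),
     Ident = (\<lambda>S. (S, S, Ident C (iX0 S), Ident C (iX1 S))),
     Cmp = (\<lambda>(S', R', g\<^sub>0, g\<^sub>1) (S, R, f\<^sub>0, f\<^sub>1). (S, R', g\<^sub>0 \<cdot> f\<^sub>0, g\<^sub>1 \<cdot> f\<^sub>1))\<rparr>"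

subsection \<open>Enriched \<open>Tb\<close>-categories\<close>

definition is_ecat :: "('o, 'a) ecat \<Rightarrow> bool" where
  "is_ecat A \<longleftrightarrow> small (eX A) \<and>
     is_mat (ea A) \<and> msrc (ea A) = Tb_set (eX A) \<and> mtgt (ea A) = eX A \<and>
     is_mcell (eun A) \<and> cdom (eun A) = munit (eX A) \<and> ccod (eun A) = ea A \<and>
     cleft (eun A) = eb_set (eX A) \<and> cright (eun A) = idf (eX A) \<and>
     is_mcell (emu A) \<and> cdom (emu A) = ea A \<odot> Tb_mat (ea A) \<and> ccod (emu A) = ea A \<and>
     cleft (emu A) = mb_set (eX A) \<and> cright (emu A) = idf (eX A) \<and>
     vcomp (emu A) (hcomp (eun A) (eb_mat (ea A))) = lunitor (ea A) \<and>
     vcomp (emu A) (hcomp (mcid (ea A)) (vcomp (Tb_cell (eun A)) (Tb_unit (eX A)))) = runitor (ea A) \<and>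
     vcomp (emu A) (hcomp (mcid (ea A)) (vcomp (Tb_cell (emu A)) (Tb_comp (ea A) (Tb_mat (ea A)))))
     = vcomp (vcomp (emu A) (hcomp (emu A) (mb_mat (ea A))))
         (globular_inv (associator (ea A) (Tb_mat (ea A)) (Tb_mat (Tb_mat (ea A)))))"

definition is_ecat_mor :: "('o, 'a) ecat \<Rightarrow> ('o, 'a) ecat \<Rightarrow> ('a \<Rightarrow> 'a) \<Rightarrow> ('o, 'a) mcell \<Rightarrow> bool" where
  "is_ecat_mor A B f \<zeta> \<longleftrightarrow> f \<in> eX A \<rightarrow>\<^sub>E eX B \<and>
     is_mcell \<zeta> \<and> cdom \<zeta> = ea A \<and> ccod \<zeta> = ea B \<and>
     cleft \<zeta> = Tb_fun (eX A) (eX B) f \<and> cright \<zeta> = f \<and>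
     vcomp \<zeta> (eun A) = vcomp (eun B) (munit_cell (eX A) (eX B) f) \<and>
     vcomp \<zeta> (emu A) = vcomp (emu B) (hcomp \<zeta> (Tb_cell \<zeta>))"

definition Enr_Cat ::
  "(('o, 'a) ecat, ('o, 'a) ecat \<times> ('o, 'a) ecat \<times> ('a \<Rightarrow> 'a) \<times> ('o, 'a) mcell) cat" where
  "Enr_Cat =
    \<lparr>Obj = {A. is_ecat A},
     Arr = {(A, B, f, \<zeta>). is_ecat A \<and> is_ecat B \<and> is_ecat_mor A B f \<zeta>},
     Dom = (\<lambda>(A, B, f, \<zeta>). A),
     Cod = (\<lambda>(A, B, f, \<zeta>). B),
     Ident = (\<lambda>A. (A, A, idf (eX A), mcid (ea A))),
     Cmp = (\<lambda>(A', B', g, \<xi>) (A, B, f, \<zeta>). (A, B', compose (eX A) g f, vcomp \<xi> \<zeta>))\<rparr>"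

subsection \<open>The functor \<open>- * 1\<close> from enriched to internal categories\<close>

definition star_ecat_l :: "('o, 'a) ecat \<Rightarrow> 'a" where
  "star_ecat_l A = eps_obj (T\<^sub>0 (copow (eX A))) \<cdot> sl (star_mat (ea A))"

definition star_X2_map :: "('o, 'a) ecat \<Rightarrow> 'a" where
  \<comment> \<open>the arrow from the apex of \<open>(a * 1) \<circ> (Tb a * 1)\<close> to \<open>X\<^sub>2\<close>, invertible under the strong
      conjoint hypothesis\<close>
  "star_X2_map A =
     (let a = star_mat (ea A); ta = star_mat (Tb_mat (ea A)) in
        pb_pair C (star_ecat_l A) (T\<^sub>1 (sr a))
          (pb1 C (sl a) (sr ta))
          (smap (eps_span (T_span a)) \<cdot> pb2 C (sl a) (sr ta)))"

definition star_ecat :: "('o, 'a) ecat \<Rightarrow> ('o, 'a) icat" where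
  "star_ecat A = \<lparr>iX0 = copow (eX A), iX1 = apex (star_mat (ea A)),
     il = star_ecat_l A, ir = sr (star_mat (ea A)),
     iun = smap (star_cell (eun A)) \<cdot> smap (star_unit (eX A)),
     imu = smap (star_cell (emu A)) \<cdot>
       (smap (star_comp (ea A) (Tb_mat (ea A))) \<cdot> inv_arr C (star_X2_map A))\<rparr>"

definition star_functor ::
  "(('o, 'a) ecat, ('o, 'a) ecat \<times> ('o, 'a) ecat \<times> ('a \<Rightarrow> 'a) \<times> ('o, 'a) mcell,
    ('o, 'a) icat, ('o, 'a) icat \<times> ('o, 'a) icat \<times> 'a \<times> 'a) fun_data" where
  "star_functor =
    \<lparr>omap = star_ecat,
     amap = (\<lambda>(A, B, f, \<zeta>).
       (star_ecat A, star_ecat B, copow_map (eX A) (eX B) f, smap (star_cell \<zeta>)))\<rparr>"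

subsection \<open>The functor \<open>V(1, -)\<close> from internal to enriched categories\<close>

definition icat_span :: "('o, 'a) icat \<Rightarrow> 'a span" where
  "icat_span S = \<lparr>sl = il S, sr = ir S\<rparr>"

definition pts_icat_left :: "('o, 'a) icat \<Rightarrow> 'a \<Rightarrow> 'a" where
  \<comment> \<open>\<open>x \<mapsto> T \<epsilon>\<^sub>Y \<circ> x\<close>\<close>
  "pts_icat_left S = pts_map (T\<^sub>1 (eps_obj (iX0 S)))"

definition pts_icat_mat :: "('o, 'a) icat \<Rightarrow> ('o, 'a) mat" where
  "pts_icat_mat S = \<lparr>msrc = Tb_set (pts (iX0 S)), mtgt = pts (iX0 S),
     ment = (\<lambda>(x, y) \<in> Tb_set (pts (iX0 S)) \<times> pts (iX0 S).
       ment (pts_span (icat_span S)) (pts_icat_left S x, y))\<rparr>"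

text \<open>
  The matrix of \<open>V(1, b)\<close> is the restriction of the matrix \<open>V(1, b)\<close> along \<open>V(1, T \<epsilon>\<^sub>Y)\<close>; the
  restricting 2-cell has identity components. A 2-cell into \<open>V(1, b)\<close> whose left boundary is
  \<open>V(1, T \<epsilon>\<^sub>Y) \<circ> f\<close> thus corresponds to a 2-cell over \<open>f\<close>, with the same components, into the
  restricted matrix.
\<close>

definition pts_icat_restr :: "('o, 'a) icat \<Rightarrow> ('o, 'a) mcell" where
  "pts_icat_restr S = \<lparr>cdom = pts_icat_mat S, ccod = pts_span (icat_span S),
     cleft = pts_icat_left S, cright = idf (pts (iX0 S)),
     cmap = (\<lambda>z \<in> Tb_set (pts (iX0 S)) \<times> pts (iX0 S). Ident C (ment (pts_icat_mat S) z))\<rparr>"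

definition pts_icat_factor ::
  "('o, 'a) icat \<Rightarrow> ('a \<Rightarrow> 'a) \<Rightarrow> ('o, 'a) mcell \<Rightarrow> ('o, 'a) mcell" where
  "pts_icat_factor S f \<Phi> = \<lparr>cdom = cdom \<Phi>, ccod = pts_icat_mat S,
     cleft = f, cright = cright \<Phi>, cmap = cmap \<Phi>\<rparr>"

definition icat_un_cell :: "('o, 'a) icat \<Rightarrow> 'a scell" where
  "icat_un_cell S = \<lparr>sdom = sunit (iX0 S), scod = icat_span S,
     sleft = unit T (iX0 S), sright = Ident C (iX0 S), smap = iun S\<rparr>"

definition icat_mu_cell :: "('o, 'a) icat \<Rightarrow> 'a scell" where
  "icat_mu_cell S = \<lparr>sdom = scomp (icat_span S) (T_span (icat_span S)), scod = icat_span S,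
     sleft = mult T (iX0 S), sright = Ident C (iX0 S), smap = imu S\<rparr>"

definition icat_mor_cell :: "('o, 'a) icat \<Rightarrow> ('o, 'a) icat \<Rightarrow> 'a \<Rightarrow> 'a \<Rightarrow> 'a scell" where
  "icat_mor_cell S R f\<^sub>0 f\<^sub>1 = \<lparr>sdom = icat_span S, scod = icat_span R,
     sleft = T\<^sub>1 f\<^sub>0, sright = f\<^sub>0, smap = f\<^sub>1\<rparr>"

definition pts_icat_T_restr :: "('o, 'a) icat \<Rightarrow> ('o, 'a) mcell" where
  \<comment> \<open>\<open>Tb a \<rightarrow> V(1, T b)\<close>, induced by \<open>a * 1 \<rightarrow> V(1, b) * 1 \<rightarrow> b\<close>\<close>
  "pts_icat_T_restr S =
     pts_cell (T_cell (svcomp (eps_span (icat_span S)) (star_cell (pts_icat_restr S))))"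

definition pts_icat :: "('o, 'a) icat \<Rightarrow> ('o, 'a) ecat" where
  "pts_icat S = \<lparr>eX = pts (iX0 S), ea = pts_icat_mat S,
     eun = pts_icat_factor S (eb_set (pts (iX0 S)))
       (vcomp (pts_cell (icat_un_cell S)) (pts_unit (iX0 S))),
     emu = pts_icat_factor S (mb_set (pts (iX0 S)))
       (vcomp (pts_cell (icat_mu_cell S))
         (vcomp (pts_comp (icat_span S) (T_span (icat_span S)))
           (hcomp (pts_icat_restr S) (pts_icat_T_restr S))))\<rparr>"

definition pts_functor ::
  "(('o, 'a) icat, ('o, 'a) icat \<times> ('o, 'a) icat \<times> 'a \<times> 'a,
    ('o, 'a) ecat, ('o, 'a) ecat \<times> ('o, 'a) ecat \<times> ('a \<Rightarrow> 'a) \<times> ('o, 'a) mcell) fun_data" where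
  "pts_functor =
    \<lparr>omap = pts_icat,
     amap = (\<lambda>(S, R, f\<^sub>0, f\<^sub>1).
       (pts_icat S, pts_icat R, pts_map f\<^sub>0,
        pts_icat_factor R (Tb_fun (pts (iX0 S)) (pts (iX0 R)) (pts_map f\<^sub>0))
          (vcomp (pts_cell (icat_mor_cell S R f\<^sub>0 f\<^sub>1)) (pts_icat_restr S))))\<rparr>"

end

end

theory Submission
  imports Defs
begin

text \<open>
  Only the counit has to be understood. A 2-cell into an entry of a matrix \<open>V(1, b)\<close> is the same as an
  arrow into the apex of \<open>b\<close> over a pair of points, since the fibre inclusions are monic; hence the
  axioms of an enriched category can be tested on generalized elements of the entries of its matrix.
  Arrows out of a copower or out of the apex of \<open>a * 1\<close> are tested on the summands, and by extensivity so
  are arrows out of the pullbacks occurring in composites of such spans: after splitting its domain,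
  every generalized element of the pullback comes from the summands. Under the strong conjoint
  hypothesis, generalized elements of the pullback \<open>X\<^sub>2\<close> of \<open>A * 1\<close> likewise come from those of \<open>a\<close> and of
  \<open>Tb a\<close>, so that the axioms of \<open>A\<close> and of \<open>A * 1\<close> correspond to each other.

  The counit at \<open>S\<close> sends a summand of \<open>V(1, S) * 1\<close> to \<open>S\<close> by the fibre inclusion. It is universal: a
  morphism \<open>(g\<^sub>0, g\<^sub>1)\<close> from \<open>A * 1\<close> to \<open>S\<close> is determined by its values on the points of \<open>X * 1\<close> and on the
  summands \<open>a (x, y)\<close>, and compatibility with the legs says that the latter land in the fibres of \<open>S\<close>
  which form the matrix of \<open>V(1, S)\<close>. Functoriality of \<open>V(1, -)\<close>, the unit and the triangle identities
  are formal consequences.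
\<close>

text \<open>The obstacle is that \<open>T\<close> need not preserve coproducts. An element of
  \<open>T (a * 1)\<close> does not split over the summands of \<open>a * 1\<close>, and it need not
  lie, even locally, in the fibres that form \<open>Tb a\<close>. The strong conjoint hypothesis
  removes this obstacle in the situation that arises: if the target of the element is constant at a
  point of \<open>T (t * 1)\<close>, then the element does lie locally in such fibres. A composable
  pair is of this kind as soon as its first component has been split, because the source of that
  component is then a point. For composable triples the argument is repeated one level up, with
  \<open>Tb a\<close> in place of \<open>a\<close>. The axioms are therefore restated with the
  values of the inner 2-cells replaced by variables that are constrained through their images under
  fibre inclusions. Initial objects form a separate case throughout, since elements of two different
  summands may agree over an initial domain.\<close>

lemma Hom_iff [simp]: "f \<in> Hom C A B \<longleftrightarrow> f \<in> Arr C \<and> Dom C f = A \<and> Cod C f = B"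
  by (auto simp: Hom_def)

definition is_initial :: "('o, 'a) cat \<Rightarrow> 'o \<Rightarrow> bool" where
  "is_initial C A \<longleftrightarrow> A \<in> Obj C \<and> (\<forall>B \<in> Obj C. \<exists>!f. f \<in> Hom C A B)"

section \<open>Composition, isomorphisms and initial objects in a category\<close>

context category
begin

lemma Dom_in_Obj [simp]: "f \<in> Arr C \<Longrightarrow> Dom C f \<in> Obj C"
  by (rule Dom_Obj)

lemma Cod_in_Obj [simp]: "f \<in> Arr C \<Longrightarrow> Cod C f \<in> Obj C"
  by (rule Cod_Obj)

lemma Ident_simps [simp]:
  assumes "A \<in> Obj C"
  shows "Ident C A \<in> Arr C" "Dom C (Ident C A) = A" "Cod C (Ident C A) = A"
  using Ident_Hom[OF assms] by auto

lemma Cmp_simps [simp]: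
  assumes "f \<in> Arr C" "g \<in> Arr C" "Dom C g = Cod C f"
  shows "g \<cdot> f \<in> Arr C" "Dom C (g \<cdot> f) = Dom C f" "Cod C (g \<cdot> f) = Cod C g"
  using Cmp_Hom[of f "Dom C f" "Cod C f" g "Cod C g"] assms by auto

lemma Cmp_Ident_right [simp]: "f \<in> Arr C \<Longrightarrow> Dom C f = A \<Longrightarrow> f \<cdot> Ident C A = f"
  using Cmp_Ident[of f A "Cod C f"] by simp

lemma Cmp_Ident_left [simp]: "f \<in> Arr C \<Longrightarrow> Cod C f = A \<Longrightarrow> Ident C A \<cdot> f = f"
  using Ident_Cmp[of f "Dom C f" A] by simp

text \<open>Oriented as a rewrite rule, so that simplification nests every composite to the right.
  In this form the left-hand side of an equation \<open>g \<cdot> f = h\<close> no longer occurs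
  once a further arrow is composed on the right; \<open>Cmp_extend\<close> and
  \<open>Cmp_extend1\<close> supply the prolonged equations.\<close>

lemma assoc_right [simp]:
  "\<lbrakk>f \<in> Arr C; g \<in> Arr C; h \<in> Arr C; Dom C g = Cod C f; Dom C h = Cod C g\<rbrakk> \<Longrightarrow>
   (h \<cdot> g) \<cdot> f = h \<cdot> (g \<cdot> f)"
  using Cmp_assoc[of f "Dom C f" "Cod C f" g "Cod C g" h "Cod C h"] by simp

lemma Cmp_extend:
  "\<lbrakk>g \<cdot> f = g' \<cdot> f'; f \<in> Arr C; g \<in> Arr C; f' \<in> Arr C; g' \<in> Arr C; Dom C g = Cod C f; Dom C g' = Cod C f'; k \<in> Arr C; Cod C k = Dom C f; Dom C f' = Dom C f\<rbrakk> \<Longrightarrow>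
   g \<cdot> (f \<cdot> k) = g' \<cdot> (f' \<cdot> k)"
  by (metis assoc_right)

lemma Cmp_extend1:
  "\<lbrakk>g \<cdot> f = h; f \<in> Arr C; g \<in> Arr C; Dom C g = Cod C f; k \<in> Arr C; Cod C k = Dom C f\<rbrakk> \<Longrightarrow>
   g \<cdot> (f \<cdot> k) = h \<cdot> k"
  by (metis assoc_right)

lemma isoI:
  assumes "f \<in> Arr C" "g \<in> Arr C" "Dom C g = Cod C f" "Cod C g = Dom C f"
    and "g \<cdot> f = Ident C (Dom C f)" "f \<cdot> g = Ident C (Cod C f)"
  shows "is_iso C f" "inv_arr C f = g"
proof -
  show "is_iso C f" using assms unfolding is_iso_def by auto
  show "inv_arr C f = g" unfolding inv_arr_def
  proof (rule the_equality)
    fix k assume k: "k \<in> Hom C (Cod C f) (Dom C f) \<and> k \<cdot> f = Ident C (Dom C f) \<and> f \<cdot> k = Ident C (Cod C f)"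
    have "k = k \<cdot> (f \<cdot> g)" using k assms by simp
    also have "\<dots> = (k \<cdot> f) \<cdot> g" by (rule assoc_right[symmetric]) (use k assms in auto)
    also have "\<dots> = g" using k assms by (simp del: assoc_right)
    finally show "k = g" .
  qed (use assms in auto)
qed

lemma inv_arr_simps [simp]:
  assumes "is_iso C f"
  shows "inv_arr C f \<in> Arr C" "Dom C (inv_arr C f) = Cod C f" "Cod C (inv_arr C f) = Dom C f"
    "inv_arr C f \<cdot> f = Ident C (Dom C f)" (is ?A) "f \<cdot> inv_arr C f = Ident C (Cod C f)" (is ?B)
proof -
  obtain g where g: "f \<in> Arr C" "g \<in> Arr C" "Dom C g = Cod C f" "Cod C g = Dom C f"
    "g \<cdot> f = Ident C (Dom C f)" "f \<cdot> g = Ident C (Cod C f)"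
    using assms unfolding is_iso_def by auto
  note isoI(2)[OF g]
  then show "inv_arr C f \<in> Arr C" "Dom C (inv_arr C f) = Cod C f" "Cod C (inv_arr C f) = Dom C f"
    ?A ?B
    using g by simp_all
qed

lemma is_iso_Arr: "is_iso C f \<Longrightarrow> f \<in> Arr C"
  by (simp add: is_iso_def)

lemma inv_arr_cancel [simp]:
  assumes "is_iso C f"
  shows "k \<in> Arr C \<Longrightarrow> Cod C k = Dom C f \<Longrightarrow> inv_arr C f \<cdot> (f \<cdot> k) = k"
    "k \<in> Arr C \<Longrightarrow> Cod C k = Cod C f \<Longrightarrow> f \<cdot> (inv_arr C f \<cdot> k) = k"
  using Cmp_extend1[OF inv_arr_simps(4)[OF assms]] Cmp_extend1[OF inv_arr_simps(5)[OF assms]] assms is_iso_Arr[OF assms]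
  by simp_all

lemma iso_cancel_left:
  assumes "is_iso C f" "u \<in> Arr C" "v \<in> Arr C" "Cod C u = Dom C f" "Cod C v = Dom C f" "f \<cdot> u = f \<cdot> v"
  shows "u = v"
  using inv_arr_cancel(1)[OF assms(1)] assms by metis

lemma iso_cancel_right:
  assumes "is_iso C f" "u \<in> Arr C" "v \<in> Arr C" "Dom C u = Cod C f" "Dom C v = Cod C f" "u \<cdot> f = v \<cdot> f"
  shows "u = v"
proof -
  have "u \<cdot> (f \<cdot> inv_arr C f) = v \<cdot> (f \<cdot> inv_arr C f)"
    by (rule Cmp_extend) (use assms is_iso_Arr[OF assms(1)] in auto)
  then show ?thesis using assms by simp
qed

lemma functor_simps:
  assumes "is_functor C D F"
  shows "X \<in> Obj C \<Longrightarrow> omap F X \<in> Obj D"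
    "f \<in> Arr C \<Longrightarrow> amap F f \<in> Arr D"
    "f \<in> Arr C \<Longrightarrow> Dom D (amap F f) = omap F (Dom C f)"
    "f \<in> Arr C \<Longrightarrow> Cod D (amap F f) = omap F (Cod C f)"
    "X \<in> Obj C \<Longrightarrow> amap F (Ident C X) = Ident D (omap F X)"
    "\<lbrakk>f \<in> Arr C; g \<in> Arr C; Dom C g = Cod C f\<rbrakk> \<Longrightarrow> amap F (g \<cdot> f) = amap F g \<cdot>\<^bsub>D\<^esub> amap F f"
  using assms unfolding is_functor_def by auto

lemma is_initial_unique:
  "\<lbrakk>is_initial C A; f \<in> Arr C; g \<in> Arr C; Dom C f = A; Dom C g = A; Cod C f = Cod C g\<rbrakk> \<Longrightarrow> f = g"
  unfolding is_initial_def by (metis Cod_Obj Hom_iff)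

lemma is_initial_arrow:
  "is_initial C A \<Longrightarrow> B \<in> Obj C \<Longrightarrow> \<exists>f \<in> Arr C. Dom C f = A \<and> Cod C f = B"
  unfolding is_initial_def by (metis Hom_iff)

end

text \<open>The preimage of \<open>h\<close> is \<open>G h\<close> conjugated by the unit.
  Naturality of \<eta> gives \<open>G (F k) = G h\<close>, and naturality of \<epsilon> turns this
  into \<open>F k = h\<close>. An equivalence comes here without triangle identities, so both
  natural isomorphisms enter. Applied to the sum functor, fullness yields disjointness of
  coproducts.\<close>

lemma equivalence_full:
  assumes "is_equivalence A B F" "X \<in> Obj A" "Y \<in> Obj A" "h \<in> Hom B (omap F X) (omap F Y)"
  shows "\<exists>k \<in> Hom A X Y. amap F k = h"
proof -
  obtain G \<eta> \<epsilon> where F: "is_functor A B F" and G: "is_functor B A G"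
    and eta: "is_nat_iso A A id_functor (comp_functor G F) \<eta>"
    and eps: "is_nat_iso B B (comp_functor F G) id_functor \<epsilon>"
    using assms(1) unfolding is_equivalence_def by auto
  interpret A: category A using F by (simp add: is_functor_def)
  interpret B: category B using F by (simp add: is_functor_def)
  note [simp] = A.functor_simps[OF F] B.functor_simps[OF G]
  have eta1: "Z \<in> Obj A \<Longrightarrow> is_iso A (\<eta> Z) \<and> \<eta> Z \<in> Arr A \<and> Dom A (\<eta> Z) = Z \<and> Cod A (\<eta> Z) = omap G (omap F Z)" for Z
    using eta by (simp add: is_nat_iso_def is_nat_trans_def id_functor_def comp_functor_def)
  have eta2: "f \<in> Arr A \<Longrightarrow> \<eta> (Cod A f) \<cdot>\<^bsub>A\<^esub> f = amap G (amap F f) \<cdot>\<^bsub>A\<^esub> \<eta> (Dom A f)" for f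
    using eta by (simp add: is_nat_iso_def is_nat_trans_def id_functor_def comp_functor_def)
  have eps1: "Z \<in> Obj B \<Longrightarrow> is_iso B (\<epsilon> Z) \<and> \<epsilon> Z \<in> Arr B \<and> Cod B (\<epsilon> Z) = Z \<and> Dom B (\<epsilon> Z) = omap F (omap G Z)" for Z
    using eps by (simp add: is_nat_iso_def is_nat_trans_def id_functor_def comp_functor_def)
  have eps2: "f \<in> Arr B \<Longrightarrow> \<epsilon> (Cod B f) \<cdot>\<^bsub>B\<^esub> amap F (amap G f) = f \<cdot>\<^bsub>B\<^esub> \<epsilon> (Dom B f)" for f
    using eps by (simp add: is_nat_iso_def is_nat_trans_def id_functor_def comp_functor_def)
  define k where "k = inv_arr A (\<eta> Y) \<cdot>\<^bsub>A\<^esub> (amap G h \<cdot>\<^bsub>A\<^esub> \<eta> X)"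
  have h: "h \<in> Arr B" "Dom B h = omap F X" "Cod B h = omap F Y" using assms(4) by auto
  have k: "k \<in> Arr A" "Dom A k = X" "Cod A k = Y"
    unfolding k_def using h eta1 assms(2,3) by auto
  have "\<eta> Y \<cdot>\<^bsub>A\<^esub> k = amap G h \<cdot>\<^bsub>A\<^esub> \<eta> X"
    using h eta1 assms(2,3) by (simp add: k_def)
  then have "amap G (amap F k) \<cdot>\<^bsub>A\<^esub> \<eta> X = amap G h \<cdot>\<^bsub>A\<^esub> \<eta> X"
    using eta2[OF k(1)] k by simp
  then have "amap G (amap F k) = amap G h"
    using A.iso_cancel_right[of "\<eta> X"] eta1 assms(2,3) k h by simp
  then have "amap F k \<cdot>\<^bsub>B\<^esub> \<epsilon> (omap F X) = h \<cdot>\<^bsub>B\<^esub> \<epsilon> (omap F X)"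
    using eps2[of "amap F k"] eps2[of h] k h by simp
  then have "amap F k = h"
    using B.iso_cancel_right[of "\<epsilon> (omap F X)"] eps1 assms(2,3) k h by simp
  then show ?thesis using k by auto
qed

subsection \<open>Pullbacks and products\<close>

locale finitely_complete = category +
  assumes finite_limits: "has_finite_limits C"
begin

lemma ex_pullback:
  assumes f: "f \<in> Arr C" and g: "g \<in> Arr C" and fg: "Cod C f = Cod C g"
  shows "\<exists>p q. is_pullback C f g p q"
proof -
  \<comment> \<open>The cospan \<open>0 -> 2 <- 1\<close>: the numbers 0, 1, 2 are the objects and
    their identities, 3 and 4 are the two legs. In a composable pair one factor is an identity, and
    \<open>Cmp\<close> returns the other one.\<close>
  define J :: "(nat, nat) cat" where "J = \<lparr>Obj = {0,1,2}, Arr = {0,1,2,3,4},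
     Dom = (\<lambda>k. if k = 3 then 0 else if k = 4 then 1 else k),
     Cod = (\<lambda>k. if k = 3 \<or> k = 4 then 2 else k), Ident = (\<lambda>k. k),
     Cmp = (\<lambda>g f. if f \<le> 2 then g else f)\<rparr>"
  define D where "D = \<lparr>omap = (\<lambda>k::nat. if k = 0 then Dom C f else if k = 1 then Dom C g else Cod C f),
     amap = (\<lambda>k::nat. if k = 0 then Ident C (Dom C f) else if k = 1 then Ident C (Dom C g)
        else if k = 2 then Ident C (Cod C f) else if k = 3 then f else g)\<rparr>"
  have J: "category J"
    by unfold_locales (auto simp: J_def split: if_splits)
  have D: "is_functor J C D"
    unfolding is_functor_def using f g fg
    by (intro conjI J category_axioms) (auto simp: J_def D_def)
  obtain L \<pi> where lim: "is_limit J C D L \<pi>"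
    using finite_limits D unfolding has_finite_limits_def by (force simp: J_def)
  have objJ: "(\<forall>j \<in> Obj J. P j) \<longleftrightarrow> P 0 \<and> P 1 \<and> P 2" for P by (simp add: J_def)
  have arrJ: "(\<forall>j \<in> Arr J. P j) \<longleftrightarrow> P 0 \<and> P 1 \<and> P 2 \<and> P 3 \<and> P 4" for P by (simp add: J_def)
  have simps: "omap D 0 = Dom C f" "omap D (Suc 0) = Dom C g" "omap D 2 = Cod C f" "amap D 0 = Ident C (Dom C f)"
     "amap D (Suc 0) = Ident C (Dom C g)" "amap D 2 = Ident C (Cod C f)" "amap D 3 = f" "amap D 4 = g"
     "Dom J 0 = 0" "Dom J (Suc 0) = Suc 0" "Dom J 2 = 2" "Dom J 3 = 0" "Dom J 4 = Suc 0" "Cod J 0 = 0" "Cod J (Suc 0) = Suc 0" "Cod J 2 = 2" "Cod J 3 = 2" "Cod J 4 = 2"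
    by (auto simp: J_def D_def)
  note lim' = lim[unfolded is_limit_def Let_def objJ arrJ, simplified simps One_nat_def]
  have "is_pullback C f g (\<pi> 0) (\<pi> (Suc 0))"
    unfolding is_pullback_def
  proof (intro conjI ballI impI)
    fix B h k assume hk: "B \<in> Obj C" "h \<in> Hom C B (Dom C f)" "k \<in> Hom C B (Dom C g)" "f \<cdot> h = g \<cdot> k"
    define \<kappa> where "\<kappa> = (\<lambda>j::nat. if j = 0 then h else if j = 1 then k else f \<cdot> h)"
    have "\<exists>!u. u \<in> Hom C B L \<and> \<pi> 0 \<cdot> u = \<kappa> 0 \<and> \<pi> (Suc 0) \<cdot> u = \<kappa> (Suc 0) \<and> \<pi> 2 \<cdot> u = \<kappa> 2"
      using lim'[THEN conjunct2, rule_format, of B \<kappa>] hk f g fg by (auto simp: \<kappa>_def)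
    moreover have "u \<in> Hom C B L \<and> \<pi> 0 \<cdot> u = \<kappa> 0 \<and> \<pi> (Suc 0) \<cdot> u = \<kappa> (Suc 0) \<and> \<pi> 2 \<cdot> u = \<kappa> 2 \<longleftrightarrow>
      u \<in> Hom C B (Dom C (\<pi> 0)) \<and> \<pi> 0 \<cdot> u = h \<and> \<pi> (Suc 0) \<cdot> u = k" for u
    proof -
      have "\<pi> 2 = f \<cdot> \<pi> 0" "Dom C (\<pi> 0) = L" "\<pi> 0 \<in> Arr C" "Cod C (\<pi> 0) = Dom C f" using lim' by auto
      then show ?thesis using f by (auto simp: \<kappa>_def)
    qed
    ultimately show "\<exists>!u. u \<in> Hom C B (Dom C (\<pi> 0)) \<and> \<pi> 0 \<cdot> u = h \<and> \<pi> (Suc 0) \<cdot> u = k"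
      by simp
  qed (use lim' f g fg in auto)
  then show ?thesis by blast
qed

lemma ex_product:
  assumes A: "A \<in> Obj C" and B: "B \<in> Obj C"
  shows "\<exists>p q. is_product C A B p q"
proof -
  \<comment> \<open>The discrete category on two objects, with each object serving as its own
    identity.\<close>
  define J :: "(nat, nat) cat" where "J = \<lparr>Obj = {0,1}, Arr = {0,1},
     Dom = (\<lambda>k. k), Cod = (\<lambda>k. k), Ident = (\<lambda>k. k), Cmp = (\<lambda>g f. g)\<rparr>"
  define D where "D = \<lparr>omap = (\<lambda>k::nat. if k = 0 then A else B),
     amap = (\<lambda>k::nat. if k = 0 then Ident C A else Ident C B)\<rparr>"
  have J: "category J"
    by unfold_locales (auto simp: J_def split: if_splits)
  have D: "is_functor J C D"
    unfolding is_functor_def using A B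
    by (intro conjI J category_axioms) (auto simp: J_def D_def)
  obtain L \<pi> where lim: "is_limit J C D L \<pi>"
    using finite_limits D unfolding has_finite_limits_def by (force simp: J_def)
  have objJ: "(\<forall>j \<in> Obj J. P j) \<longleftrightarrow> P 0 \<and> P 1" for P by (simp add: J_def)
  have arrJ: "(\<forall>j \<in> Arr J. P j) \<longleftrightarrow> P 0 \<and> P 1" for P by (simp add: J_def)
  have simps: "omap D 0 = A" "omap D (Suc 0) = B" "amap D 0 = Ident C A"
     "amap D (Suc 0) = Ident C B" "Dom J k = k" "Cod J k = k" for k
    by (auto simp: J_def D_def)
  note lim' = lim[unfolded is_limit_def Let_def objJ arrJ, simplified simps One_nat_def]
  have "is_product C A B (\<pi> 0) (\<pi> (Suc 0))"
    unfolding is_product_def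
  proof (intro conjI ballI impI)
    fix E h k assume hk: "E \<in> Obj C" "h \<in> Hom C E A" "k \<in> Hom C E B"
    define \<kappa> where "\<kappa> = (\<lambda>j::nat. if j = 0 then h else k)"
    have "\<exists>!u. u \<in> Hom C E L \<and> \<pi> 0 \<cdot> u = \<kappa> 0 \<and> \<pi> (Suc 0) \<cdot> u = \<kappa> (Suc 0)"
      using lim'[THEN conjunct2, rule_format, of E \<kappa>] hk by (auto simp: \<kappa>_def)
    then show "\<exists>!u. u \<in> Hom C E (Dom C (\<pi> 0)) \<and> \<pi> 0 \<cdot> u = h \<and> \<pi> (Suc 0) \<cdot> u = k"
      using lim' by (auto simp: \<kappa>_def)
  qed (use lim' in auto)
  then show ?thesis by blast
qed

lemma pullback:
  assumes "f \<in> Arr C" "g \<in> Arr C" "Cod C f = Cod C g"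
  shows "is_pullback C f g (pb1 C f g) (pb2 C f g)"
proof -
  have "case pb_cone C f g of (p, q) \<Rightarrow> is_pullback C f g p q"
    unfolding pb_cone_def by (rule someI_ex) (use ex_pullback[OF assms] in auto)
  then show ?thesis by (simp add: pb1_def pb2_def split_beta)
qed

lemma pb_simps [simp]:
  assumes "f \<in> Arr C" "g \<in> Arr C" "Cod C f = Cod C g"
  shows "pb1 C f g \<in> Arr C" "Dom C (pb1 C f g) = pb C f g" "Cod C (pb1 C f g) = Dom C f"
    "pb2 C f g \<in> Arr C" "Dom C (pb2 C f g) = pb C f g" "Cod C (pb2 C f g) = Dom C g"
    "pb C f g \<in> Obj C"
  using pullback[OF assms] by (auto simp: is_pullback_def pb_def)

lemma pb_commute:
  assumes "f \<in> Arr C" "g \<in> Arr C" "Cod C f = Cod C g"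
  shows "f \<cdot> pb1 C f g = g \<cdot> pb2 C f g"
  using pullback[OF assms] by (auto simp: is_pullback_def)

lemma is_pullback_ex1:
  assumes "is_pullback C f g p q" "h \<in> Arr C" "k \<in> Arr C" "Dom C h = Dom C k"
    "Cod C h = Dom C f" "Cod C k = Dom C g" "f \<cdot> h = g \<cdot> k"
  shows "\<exists>!u. u \<in> Hom C (Dom C h) (Dom C p) \<and> p \<cdot> u = h \<and> q \<cdot> u = k"
proof -
  have "\<forall>D\<in>Obj C. \<forall>h\<in>Hom C D (Dom C f). \<forall>k\<in>Hom C D (Dom C g). f \<cdot> h = g \<cdot> k \<longrightarrow> (\<exists>!u. u \<in> Hom C D (Dom C p) \<and> p \<cdot> u = h \<and> q \<cdot> u = k)"
    using assms(1) unfolding is_pullback_def by blast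
  from this[rule_format, of "Dom C h" h k] show ?thesis using assms by simp
qed

lemma pb_pair_simps [simp]:
  assumes "f \<in> Arr C" "g \<in> Arr C" "Cod C f = Cod C g"
    "h \<in> Arr C" "k \<in> Arr C" "Dom C h = Dom C k" "Cod C h = Dom C f" "Cod C k = Dom C g" "f \<cdot> h = g \<cdot> k"
  shows "pb_pair C f g h k \<in> Arr C" "Dom C (pb_pair C f g h k) = Dom C k" "Cod C (pb_pair C f g h k) = pb C f g"
    "pb1 C f g \<cdot> pb_pair C f g h k = h" "pb2 C f g \<cdot> pb_pair C f g h k = k"
  using theI'[OF is_pullback_ex1[OF pullback[OF assms(1-3)] assms(4-9)]] assms
  by (simp_all add: pb_pair_def)

lemma pb_pair_cancel [simp]:
  assumes "f \<in> Arr C" "g \<in> Arr C" "Cod C f = Cod C g"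
    "h \<in> Arr C" "k \<in> Arr C" "Dom C h = Dom C k" "Cod C h = Dom C f" "Cod C k = Dom C g" "f \<cdot> h = g \<cdot> k"
    "e \<in> Arr C" "Cod C e = Dom C k"
  shows "pb1 C f g \<cdot> (pb_pair C f g h k \<cdot> e) = h \<cdot> e" "pb2 C f g \<cdot> (pb_pair C f g h k \<cdot> e) = k \<cdot> e"
  using assms Cmp_extend1[OF pb_pair_simps(4)[OF assms(1-9)]] Cmp_extend1[OF pb_pair_simps(5)[OF assms(1-9)]]
  by simp_all

lemma is_pullback_eqI:
  assumes "is_pullback C f g p q" "u \<in> Arr C" "v \<in> Arr C" "Dom C u = Dom C v"
    "Cod C u = Dom C p" "Cod C v = Dom C p" "p \<cdot> u = p \<cdot> v" "q \<cdot> u = q \<cdot> v"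
  shows "u = v"
proof -
  have *: "f \<in> Arr C" "g \<in> Arr C" "p \<in> Arr C" "q \<in> Arr C" "Dom C f = Cod C p" "Dom C g = Cod C q" "Dom C q = Dom C p" "f \<cdot> p = g \<cdot> q"
    "Cod C f = Cod C g"
    using assms(1) unfolding is_pullback_def by auto
  have "f \<cdot> (p \<cdot> u) = g \<cdot> (q \<cdot> u)"
    by (rule Cmp_extend[OF *(8)]) (use assms * in auto)
  then show ?thesis
    using is_pullback_ex1[OF assms(1), of "p \<cdot> u" "q \<cdot> u"] assms(2-) * by auto
qed

lemma pb_eqI:
  assumes "f \<in> Arr C" "g \<in> Arr C" "Cod C f = Cod C g"
    "u \<in> Arr C" "v \<in> Arr C" "Dom C u = Dom C v" "Cod C u = pb C f g" "Cod C v = pb C f g"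
    "pb1 C f g \<cdot> u = pb1 C f g \<cdot> v" "pb2 C f g \<cdot> u = pb2 C f g \<cdot> v"
  shows "u = v"
  by (rule is_pullback_eqI[OF pullback[OF assms(1-3)]]) (simp_all add: assms)

lemma pb_pair_Cmp:
  assumes "f \<in> Arr C" "g \<in> Arr C" "Cod C f = Cod C g"
    "h \<in> Arr C" "k \<in> Arr C" "Dom C h = Dom C k" "Cod C h = Dom C f" "Cod C k = Dom C g" "f \<cdot> h = g \<cdot> k"
    "e \<in> Arr C" "Cod C e = Dom C k"
  shows "pb_pair C f g h k \<cdot> e = pb_pair C f g (h \<cdot> e) (k \<cdot> e)"
proof (rule pb_eqI[OF assms(1-3)])
  have "f \<cdot> (h \<cdot> e) = g \<cdot> (k \<cdot> e)" by (rule Cmp_extend[OF assms(9)]) (simp_all add: assms)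
  note * = pb_pair_simps[OF assms(1-3) _ _ _ _ _ this]
  show "pb1 C f g \<cdot> (pb_pair C f g h k \<cdot> e) = pb1 C f g \<cdot> pb_pair C f g (h \<cdot> e) (k \<cdot> e)"
    "pb2 C f g \<cdot> (pb_pair C f g h k \<cdot> e) = pb2 C f g \<cdot> pb_pair C f g (h \<cdot> e) (k \<cdot> e)"
    "pb_pair C f g (h \<cdot> e) (k \<cdot> e) \<in> Arr C"
    "Dom C (pb_pair C f g h k \<cdot> e) = Dom C (pb_pair C f g (h \<cdot> e) (k \<cdot> e))"
    "Cod C (pb_pair C f g (h \<cdot> e) (k \<cdot> e)) = pb C f g"
    using assms by (simp_all add: *)
qed (use assms in auto)

lemma product:
  assumes "A \<in> Obj C" "B \<in> Obj C"
  shows "is_product C A B (pr1 C A B) (pr2 C A B)"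
proof -
  have "case prod_cone C A B of (p, q) \<Rightarrow> is_product C A B p q"
    unfolding prod_cone_def by (rule someI_ex) (use ex_product[OF assms] in auto)
  then show ?thesis by (simp add: pr1_def pr2_def split_beta)
qed

lemma prd_simps [simp]:
  assumes "A \<in> Obj C" "B \<in> Obj C"
  shows "pr1 C A B \<in> Arr C" "Dom C (pr1 C A B) = prd C A B" "Cod C (pr1 C A B) = A"
    "pr2 C A B \<in> Arr C" "Dom C (pr2 C A B) = prd C A B" "Cod C (pr2 C A B) = B"
    "prd C A B \<in> Obj C"
  using product[OF assms] by (auto simp: is_product_def prd_def)

lemma prd_ex1:
  assumes "h \<in> Arr C" "k \<in> Arr C" "Dom C h = Dom C k"
  shows "\<exists>!u. u \<in> Hom C (Dom C h) (prd C (Cod C h) (Cod C k)) \<and>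
    pr1 C (Cod C h) (Cod C k) \<cdot> u = h \<and> pr2 C (Cod C h) (Cod C k) \<cdot> u = k"
proof -
  have "\<forall>D \<in> Obj C. \<forall>h' \<in> Hom C D (Cod C h). \<forall>k' \<in> Hom C D (Cod C k).
    \<exists>!u. u \<in> Hom C D (Dom C (pr1 C (Cod C h) (Cod C k))) \<and> pr1 C (Cod C h) (Cod C k) \<cdot> u = h' \<and> pr2 C (Cod C h) (Cod C k) \<cdot> u = k'"
    using product[of "Cod C h" "Cod C k"] assms unfolding is_product_def by simp
  from this[rule_format, of "Dom C h" h k] show ?thesis using assms by simp
qed

lemma pair_simps [simp]:
  assumes "h \<in> Arr C" "k \<in> Arr C" "Dom C h = Dom C k"
  shows "pair C h k \<in> Arr C" "Dom C (pair C h k) = Dom C k" "Cod C (pair C h k) = prd C (Cod C h) (Cod C k)"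
    "Cod C h = A \<Longrightarrow> Cod C k = B \<Longrightarrow> pr1 C A B \<cdot> pair C h k = h"
    "Cod C h = A \<Longrightarrow> Cod C k = B \<Longrightarrow> pr2 C A B \<cdot> pair C h k = k"
  using theI'[OF prd_ex1[OF assms]] assms by (auto simp add: pair_def)

lemma pair_cancel [simp]:
  assumes "h \<in> Arr C" "k \<in> Arr C" "Dom C h = Dom C k" "e \<in> Arr C" "Cod C e = Dom C k" "Cod C h = A" "Cod C k = B"
  shows "pr1 C A B \<cdot> (pair C h k \<cdot> e) = h \<cdot> e" "pr2 C A B \<cdot> (pair C h k \<cdot> e) = k \<cdot> e"
  using assms by (auto intro!: Cmp_extend1 pair_simps(4,5))

lemma prd_eqI:
  assumes "A \<in> Obj C" "B \<in> Obj C"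
    "u \<in> Arr C" "v \<in> Arr C" "Dom C u = Dom C v" "Cod C u = prd C A B" "Cod C v = prd C A B"
    "pr1 C A B \<cdot> u = pr1 C A B \<cdot> v" "pr2 C A B \<cdot> u = pr2 C A B \<cdot> v"
  shows "u = v"
  using prd_ex1[of "pr1 C A B \<cdot> u" "pr2 C A B \<cdot> u"] assms by auto

lemma pair_Cmp [simp]:
  assumes "h \<in> Arr C" "k \<in> Arr C" "Dom C h = Dom C k" "e \<in> Arr C" "Cod C e = Dom C k"
  shows "pair C h k \<cdot> e = pair C (h \<cdot> e) (k \<cdot> e)"
  by (rule prd_eqI[of "Cod C h" "Cod C k"]) (use assms in auto)

lemma pair_pr:
  assumes "A \<in> Obj C" "B \<in> Obj C" "u \<in> Arr C" "Cod C u = prd C A B"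
  shows "pair C (pr1 C A B \<cdot> u) (pr2 C A B \<cdot> u) = u"
  by (rule prd_eqI[of A B]) (use assms in auto)

lemma prd_map_simps [simp]:
  assumes "f \<in> Arr C" "g \<in> Arr C"
  shows "prd_map C f g \<in> Arr C" "Dom C (prd_map C f g) = prd C (Dom C f) (Dom C g)"
    "Cod C (prd_map C f g) = prd C (Cod C f) (Cod C g)"
  using assms by (simp_all add: prd_map_def)

lemma prd_map_pair [simp]:
  assumes "f \<in> Arr C" "g \<in> Arr C" "h \<in> Arr C" "k \<in> Arr C" "Dom C h = Dom C k" "Cod C h = Dom C f" "Cod C k = Dom C g"
  shows "prd_map C f g \<cdot> pair C h k = pair C (f \<cdot> h) (g \<cdot> k)"
  using assms by (simp add: prd_map_def)

end

section \<open>Coproducts in an arbitrary category\<close>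

context category
begin

lemma is_coproduct_ex1:
  assumes "is_coproduct C I X S \<iota>" "B \<in> Obj C" "\<And>i. i \<in> I \<Longrightarrow> g i \<in> Hom C (X i) B"
  shows "\<exists>!u. u \<in> Hom C S B \<and> (\<forall>i \<in> I. u \<cdot> \<iota> i = g i)"
  using assms unfolding is_coproduct_def by blast

lemma is_coproduct_eqI:
  assumes "is_coproduct C I X S \<iota>" "u \<in> Arr C" "v \<in> Arr C" "Dom C u = S" "Dom C v = S" "Cod C u = Cod C v"
    "\<And>i. i \<in> I \<Longrightarrow> u \<cdot> \<iota> i = v \<cdot> \<iota> i"
  shows "u = v"
proof -
  have "\<exists>!w. w \<in> Hom C S (Cod C v) \<and> (\<forall>i \<in> I. w \<cdot> \<iota> i = u \<cdot> \<iota> i)"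
    by (rule is_coproduct_ex1[OF assms(1)]) (use assms in \<open>auto simp: is_coproduct_def\<close>)
  then show ?thesis using assms by (metis Hom_iff)
qed

lemma is_coproduct_simps:
  assumes "is_coproduct C I X S \<iota>"
  shows "S \<in> Obj C" "i \<in> I \<Longrightarrow> \<iota> i \<in> Arr C" "i \<in> I \<Longrightarrow> Dom C (\<iota> i) = X i" "i \<in> I \<Longrightarrow> Cod C (\<iota> i) = S"
    "i \<in> I \<Longrightarrow> X i \<in> Obj C" (is "PROP ?A")
proof -
  show *: "S \<in> Obj C" "i \<in> I \<Longrightarrow> \<iota> i \<in> Arr C" "i \<in> I \<Longrightarrow> Dom C (\<iota> i) = X i" "i \<in> I \<Longrightarrow> Cod C (\<iota> i) = S" for i
    using assms by (auto simp: is_coproduct_def)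
  show "PROP ?A" using *(2,3)[of i] Dom_in_Obj[of "\<iota> i"] by simp
qed

lemma is_coproduct_cong:
  assumes "\<And>i. i \<in> I \<Longrightarrow> X i = Y i" "\<And>i. i \<in> I \<Longrightarrow> \<iota> i = \<kappa> i"
  shows "is_coproduct C I X S \<iota> \<longleftrightarrow> is_coproduct C I Y S \<kappa>"
  using assms by (simp add: is_coproduct_def)

text \<open>Extensivity is formulated for index sets inside the type of arrows. Reindexing carries
  coproducts over to other index types, such as the pairs and triples that index totals and
  composites of matrices.\<close>

lemma is_coproduct_reindex:
  assumes bij: "bij_betw \<phi> I J" and cop: "is_coproduct C J Y S j"
  shows "is_coproduct C I (\<lambda>i. Y (\<phi> i)) S (\<lambda>i. j (\<phi> i))"
  unfolding is_coproduct_def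
proof (intro conjI ballI allI impI)
  fix B g assume B: "B \<in> Obj C" and g: "\<forall>i\<in>I. g i \<in> Hom C (Y (\<phi> i)) B"
  have inv: "k \<in> J \<Longrightarrow> inv_into I \<phi> k \<in> I \<and> \<phi> (inv_into I \<phi> k) = k" for k
    using bij by (metis bij_betw_imp_surj_on f_inv_into_f inv_into_into)
  have "\<exists>!u. u \<in> Hom C S B \<and> (\<forall>k\<in>J. u \<cdot> j k = g (inv_into I \<phi> k))"
    by (rule is_coproduct_ex1[OF cop B]) (use g inv in force)
  moreover have "(\<forall>k\<in>J. u \<cdot> j k = g (inv_into I \<phi> k)) \<longleftrightarrow> (\<forall>i\<in>I. u \<cdot> j (\<phi> i) = g i)" for u
    using inv bij by (metis bij_betw_def bij_betw_inv_into_left imageI)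
  ultimately show "\<exists>!u. u \<in> Hom C S B \<and> (\<forall>i\<in>I. u \<cdot> j (\<phi> i) = g i)" by simp
qed (use cop bij in \<open>auto simp: is_coproduct_def bij_betw_def\<close>)

lemma is_coproduct_iso:
  assumes cop: "is_coproduct C I X S \<iota>" and e: "is_iso C e" "Dom C e = S"
  shows "is_coproduct C I X (Cod C e) (\<lambda>i. e \<cdot> \<iota> i)"
  unfolding is_coproduct_def
proof (intro conjI ballI allI impI)
  note [simp] = is_coproduct_simps[OF cop] is_iso_Arr[OF e(1)] e
  fix B g assume B: "B \<in> Obj C" and g: "\<forall>i\<in>I. g i \<in> Hom C (X i) B"
  obtain u where u: "u \<in> Hom C S B" "\<forall>i\<in>I. u \<cdot> \<iota> i = g i"
    using is_coproduct_ex1[OF cop B, of g] g by blast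
  show "\<exists>!u. u \<in> Hom C (Cod C e) B \<and> (\<forall>i\<in>I. u \<cdot> (e \<cdot> \<iota> i) = g i)"
  proof (rule ex1I)
    show "u \<cdot> inv_arr C e \<in> Hom C (Cod C e) B \<and> (\<forall>i\<in>I. (u \<cdot> inv_arr C e) \<cdot> (e \<cdot> \<iota> i) = g i)"
      using u by simp
    fix v assume v: "v \<in> Hom C (Cod C e) B \<and> (\<forall>i\<in>I. v \<cdot> (e \<cdot> \<iota> i) = g i)"
    have "v \<cdot> e = u"
      by (rule is_coproduct_eqI[OF cop]) (use u v in auto)
    then have "v \<cdot> (e \<cdot> inv_arr C e) = u \<cdot> inv_arr C e"
      by (intro Cmp_extend1) (use v in auto)
    then show "v = u \<cdot> inv_arr C e" using v by simp
  qed
qed (use assms is_iso_Arr[OF e(1)] in \<open>auto simp: is_coproduct_def\<close>)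

lemma is_coproduct_compare:
  assumes "is_coproduct C I X S \<iota>" "is_coproduct C I X R \<kappa>"
  shows "\<exists>e. is_iso C e \<and> Dom C e = S \<and> Cod C e = R \<and> (\<forall>i\<in>I. e \<cdot> \<iota> i = \<kappa> i)"
proof -
  note [simp] = is_coproduct_simps[OF assms(1)] is_coproduct_simps[OF assms(2)]
  obtain e where e: "e \<in> Hom C S R" "\<forall>i\<in>I. e \<cdot> \<iota> i = \<kappa> i"
    using is_coproduct_ex1[OF assms(1), of R \<kappa>] by auto
  obtain k where k: "k \<in> Hom C R S" "\<forall>i\<in>I. k \<cdot> \<kappa> i = \<iota> i"
    using is_coproduct_ex1[OF assms(2), of S \<iota>] by auto
  have "k \<cdot> e = Ident C S" by (rule is_coproduct_eqI[OF assms(1)]) (use e k in auto)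
  moreover have "e \<cdot> k = Ident C R" by (rule is_coproduct_eqI[OF assms(2)]) (use e k in auto)
  ultimately have "is_iso C e" using e k by (intro isoI(1)[of e k]) auto
  then show ?thesis using e by auto
qed

lemma is_coproduct_empty: "is_coproduct C {} X S \<iota> \<longleftrightarrow> is_initial C S"
  unfolding is_coproduct_def is_initial_def by simp

text \<open>A monic arrow with a section is invertible. Isomorphisms are recognized in this form
  because both conditions can be tested locally: equality of two arrows by \<open>local_eqI\<close>,
  existence of the section by \<open>local_lift\<close>.\<close>

lemma is_isoI_mono_lift:
  assumes m: "m \<in> Arr C"
    and mono: "\<And>u v. \<lbrakk>u \<in> Arr C; v \<in> Arr C; Dom C u = Dom C v; Cod C u = Dom C m; Cod C v = Dom C m; m \<cdot> u = m \<cdot> v\<rbrakk> \<Longrightarrow> u = v"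
    and w: "\<exists>w \<in> Arr C. Dom C w = Cod C m \<and> Cod C w = Dom C m \<and> m \<cdot> w = Ident C (Cod C m)"
  shows "is_iso C m"
proof -
  obtain w where w: "w \<in> Arr C" "Dom C w = Cod C m" "Cod C w = Dom C m" "m \<cdot> w = Ident C (Cod C m)"
    using w by auto
  have "m \<cdot> (w \<cdot> m) = Ident C (Cod C m) \<cdot> m" by (rule Cmp_extend1[OF w(4)]) (use m w in auto)
  then have "w \<cdot> m = Ident C (Dom C m)" by - (rule mono, use m w in auto)
  then show ?thesis using m w by (intro isoI(1)[of m w]) auto
qed

text \<open>The two choices are made from the same predicate, because the universal property sees
  the families only on the index set. This matters for families such as
  \<open>\<lambda>i. Cod V (f i)\<close>, whose values outside the index set are arbitrary.\<close>

lemma coprod_cong: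
  assumes "\<And>i. i \<in> I \<Longrightarrow> X i = Y i"
  shows "coprod C I X = coprod C I Y" "incl C I X = incl C I Y"
    "(\<And>i. i \<in> I \<Longrightarrow> f i = g i) \<Longrightarrow> cotuple C I X B f = cotuple C I Y B g" (is "PROP ?A")
proof -
  have "(\<lambda>(S, \<iota>). is_coproduct C I X S \<iota>) = (\<lambda>(S, \<iota>). is_coproduct C I Y S \<iota>)"
    using is_coproduct_cong[of I X Y] assms by auto
  then have *: "coprod_cocone C I X = coprod_cocone C I Y" by (simp add: coprod_cocone_def)
  then show "coprod C I X = coprod C I Y" "incl C I X = incl C I Y"
    by (simp_all add: coprod_def incl_def)
  then show "PROP ?A"
    by (simp add: cotuple_def)
qed

end

subsection \<open>Consequences of extensivity\<close>

text \<open>\<open>small\<close> only speaks of subsets of the type of arrows. Sums are also taken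
  over pairs of arrows and over truth values, so smallness is transferred to other types along an
  injection.\<close>

definition smalli :: "('a set \<Rightarrow> bool) \<Rightarrow> 'i set \<Rightarrow> bool" where
  "smalli small I \<longleftrightarrow> (\<exists>\<phi> :: 'i \<Rightarrow> 'a. inj_on \<phi> I \<and> small (\<phi> ` I))"

locale lextensive_category =
  fixes small :: "'a set \<Rightarrow> bool" and V :: "('o, 'a) cat" (structure) and one :: 'o
  assumes smallness: "smallness small" and loc_small: "locally_small small V"
    and lextensive: "lextensive small V" and terminal: "is_terminal V one"

sublocale lextensive_category \<subseteq> finitely_complete V
  using lextensive by unfold_locales (auto simp: lextensive_def category_def)

context lextensive_category
begin

lemma smalli_self [simp]: "small X \<Longrightarrow> smalli small X"
  unfolding smalli_def by (rule exI[of _ "\<lambda>x. x"]) simp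

lemma small_finite: "finite X \<Longrightarrow> small X"
  using smallness unfolding smallness_def by blast

lemma smalli_finite [simp]:
  assumes "finite I" shows "smalli small I"
proof -
  have "infinite (UNIV :: 'a set)" using smallness by (simp add: smallness_def)
  then obtain B :: "'a set" where "finite B" "card B = card I"
    using infinite_arbitrarily_large by blast
  then obtain \<phi> where "bij_betw \<phi> I B" using assms finite_same_card_bij by metis
  then show ?thesis unfolding smalli_def using \<open>finite B\<close> small_finite by (auto simp: bij_betw_def)
qed

text \<open>The type of arrows is infinite, hence its square injects into it. The image of
  \<open>X \<times> Y\<close> is then a union over \<open>X\<close> of images of \<open>Y\<close>,
  and small sets are closed under such unions.\<close>

lemma smalli_Times [simp]:
  assumes "small X" "small Y" shows "smalli small (X \<times> Y)"
proof -
  have inf: "infinite (UNIV :: 'a set)" using smallness by (simp add: smallness_def)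
  obtain \<psi> :: "'a \<times> 'a \<Rightarrow> 'a" where psi: "inj \<psi>"
    using card_of_ordIso[THEN iffD2, OF card_of_Times_same_infinite[OF inf]]
    by (auto simp: bij_betw_def)
  have im: "\<And>X (f :: 'a \<Rightarrow> 'a). small X \<Longrightarrow> small (f ` X)"
    and un: "\<And>I (F :: 'a \<Rightarrow> 'a set). small I \<Longrightarrow> (\<forall>i \<in> I. small (F i)) \<Longrightarrow> small (\<Union>i \<in> I. F i)"
    using smallness unfolding smallness_def by blast+
  have "\<psi> ` (X \<times> Y) = (\<Union>x\<in>X. (\<lambda>y. \<psi> (x, y)) ` Y)" by auto
  then have "small (\<psi> ` (X \<times> Y))" using im un assms by simp
  then show ?thesis unfolding smalli_def using psi by (meson inj_on_subset subset_UNIV)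
qed

lemma smalli_Times' [simp]:
  fixes I :: "'i set" and J :: "'j set"
  assumes "smalli small I" "smalli small J" shows "smalli small (I \<times> J)"
proof -
  obtain \<phi> :: "'i \<Rightarrow> 'a" where phi: "inj_on \<phi> I" "small (\<phi> ` I)" using assms(1) by (auto simp: smalli_def)
  obtain \<psi> :: "'j \<Rightarrow> 'a" where psi: "inj_on \<psi> J" "small (\<psi> ` J)" using assms(2) by (auto simp: smalli_def)
  obtain \<chi> :: "'a \<times> 'a \<Rightarrow> 'a" where chi: "inj_on \<chi> (\<phi> ` I \<times> \<psi> ` J)" "small (\<chi> ` (\<phi> ` I \<times> \<psi> ` J))"
    using smalli_Times[OF phi(2) psi(2)] by (auto simp: smalli_def)
  have im: "map_prod \<phi> \<psi> ` (I \<times> J) = \<phi> ` I \<times> \<psi> ` J" by auto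
  have "inj_on (\<chi> \<circ> map_prod \<phi> \<psi>) (I \<times> J)"
    by (rule comp_inj_on) (use phi psi chi im in \<open>auto simp: inj_on_def\<close>)
  moreover have "small ((\<chi> \<circ> map_prod \<phi> \<psi>) ` (I \<times> J))" using chi(2) by (simp only: image_comp[symmetric] im)
  ultimately show ?thesis unfolding smalli_def by blast
qed

lemma ex_coproduct:
  assumes "smalli small I" "\<And>i. i \<in> I \<Longrightarrow> X i \<in> Obj V"
  shows "\<exists>S \<iota>. is_coproduct V I X S \<iota>"
proof -
  obtain \<phi> :: "'b \<Rightarrow> 'a" where phi: "inj_on \<phi> I" "small (\<phi> ` I)" using assms(1) by (auto simp: smalli_def)
  have "has_small_coproducts small V" using lextensive by (simp add: lextensive_def extensive_def)
  moreover have "X \<circ> inv_into I \<phi> \<in> \<phi> ` I \<rightarrow> Obj V" using phi assms(2) by auto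
  ultimately obtain S \<iota> where "is_coproduct V (\<phi> ` I) (X \<circ> inv_into I \<phi>) S \<iota>"
    using phi(2) unfolding has_small_coproducts_def by metis
  then have "is_coproduct V I (\<lambda>i. (X \<circ> inv_into I \<phi>) (\<phi> i)) S (\<lambda>i. \<iota> (\<phi> i))"
    using is_coproduct_reindex phi by (metis inj_on_imp_bij_betw)
  then have "is_coproduct V I X S (\<lambda>i. \<iota> (\<phi> i))"
    using phi(1) by (subst (asm) is_coproduct_cong[of I _ X _ "\<lambda>i. \<iota> (\<phi> i)"]) auto
  then show ?thesis by blast
qed

lemma coproduct:
  assumes "smalli small I" "\<And>i. i \<in> I \<Longrightarrow> X i \<in> Obj V"
  shows "is_coproduct V I X (coprod V I X) (incl V I X)"
proof -
  have "case coprod_cocone V I X of (S, \<iota>) \<Rightarrow> is_coproduct V I X S \<iota>"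
    unfolding coprod_cocone_def by (rule someI_ex) (use ex_coproduct[OF assms] in auto)
  then show ?thesis by (simp add: coprod_def incl_def split_beta)
qed

lemma incl_simps [simp]:
  assumes "smalli small I" "\<And>i. i \<in> I \<Longrightarrow> X i \<in> Obj V"
  shows "coprod V I X \<in> Obj V" "i \<in> I \<Longrightarrow> incl V I X i \<in> Arr V"
    "i \<in> I \<Longrightarrow> Dom V (incl V I X i) = X i" "i \<in> I \<Longrightarrow> Cod V (incl V I X i) = coprod V I X"
  using is_coproduct_simps[OF coproduct[of I X]] assms by auto

lemma cotuple_simps:
  assumes "smalli small I" "B \<in> Obj V"
    "\<And>i. i \<in> I \<Longrightarrow> g i \<in> Arr V \<and> Dom V (g i) = X i \<and> Cod V (g i) = B"
  shows "cotuple V I X B g \<in> Arr V" "Dom V (cotuple V I X B g) = coprod V I X"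
    "Cod V (cotuple V I X B g) = B" "i \<in> I \<Longrightarrow> cotuple V I X B g \<cdot> incl V I X i = g i"
    "\<lbrakk>i \<in> I; e \<in> Arr V; Cod V e = X i\<rbrakk> \<Longrightarrow> cotuple V I X B g \<cdot> (incl V I X i \<cdot> e) = g i \<cdot> e" (is "PROP ?A")
proof -
  have X: "i \<in> I \<Longrightarrow> X i \<in> Obj V" for i using assms(3)[of i] Dom_in_Obj[of "g i"] by simp
  have 1: "\<exists>!u. u \<in> Hom V (coprod V I X) B \<and> (\<forall>i \<in> I. u \<cdot> incl V I X i = g i)"
    by (rule is_coproduct_ex1[OF coproduct]) (use assms X in auto)
  from theI'[OF this] show *: "cotuple V I X B g \<in> Arr V" "Dom V (cotuple V I X B g) = coprod V I X"
    "Cod V (cotuple V I X B g) = B" "i \<in> I \<Longrightarrow> cotuple V I X B g \<cdot> incl V I X i = g i" for i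
    by (simp_all add: cotuple_def)
  show "PROP ?A"
    by (rule Cmp_extend1) (use assms X * in auto)
qed

lemma coprod_eqI:
  assumes "smalli small I" "\<And>i. i \<in> I \<Longrightarrow> X i \<in> Obj V"
    "u \<in> Arr V" "v \<in> Arr V" "Dom V u = coprod V I X" "Dom V v = coprod V I X" "Cod V u = Cod V v"
    "\<And>i. i \<in> I \<Longrightarrow> u \<cdot> incl V I X i = v \<cdot> incl V I X i"
  shows "u = v"
  using is_coproduct_eqI[OF coproduct] assms by blast

lemma coprod_map_simps:
  assumes "smalli small I" "\<And>i. i \<in> I \<Longrightarrow> f i \<in> Arr V"
  shows "coprod_map V I f \<in> Arr V" "Dom V (coprod_map V I f) = coprod V I (\<lambda>i. Dom V (f i))"
    "Cod V (coprod_map V I f) = coprod V I (\<lambda>i. Cod V (f i))"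
    "i \<in> I \<Longrightarrow> coprod_map V I f \<cdot> incl V I (\<lambda>i. Dom V (f i)) i = incl V I (\<lambda>i. Cod V (f i)) i \<cdot> f i"
  unfolding coprod_map_def using assms by (simp_all add: cotuple_simps)

text \<open>Essential surjectivity of the sum functor.\<close>

lemma split_chosen:
  assumes I: "small I" "\<And>i. i \<in> I \<Longrightarrow> X i \<in> Obj V" and f: "f \<in> Arr V" "Cod V f = coprod V I X"
  shows "\<exists>D j g. is_coproduct V I D (Dom V f) j \<and>
    (\<forall>i \<in> I. g i \<in> Hom V (D i) (X i) \<and> f \<cdot> j i = incl V I X i \<cdot> g i)"
proof -
  let ?A = "prod_cat I (\<lambda>i. slice V (X i))" and ?B = "slice V (coprod V I X)"
  have "is_equivalence ?A ?B (sum_functor V I)"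
    using lextensive I unfolding lextensive_def extensive_def by blast
  then obtain G \<epsilon> where G: "is_functor ?B ?A G"
    and eps: "is_nat_iso ?B ?B (comp_functor (sum_functor V I) G) id_functor \<epsilon>"
    unfolding is_equivalence_def by auto
  \<comment> \<open>The component at \<open>f\<close> of the natural isomorphism from
    \<open>F G\<close> to the identity is an isomorphism over the coproduct, from the sum of the
    arrows \<open>r i\<close> to \<open>f\<close>. Transporting the coproduct structure along it
    splits the domain of \<open>f\<close>.\<close>
  define r where "r = omap G f"
  have fB: "f \<in> Obj ?B" using f by (simp add: slice_def)
  then have "r \<in> Obj ?A" using G unfolding is_functor_def r_def by blast
  then have r: "i \<in> I \<Longrightarrow> r i \<in> Arr V" "i \<in> I \<Longrightarrow> Cod V (r i) = X i" for i
    by (auto simp: prod_cat_def slice_def)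
  have epsf: "\<epsilon> f \<in> Hom ?B (coprod_map V I r) f" "is_iso ?B (\<epsilon> f)"
    using eps fB unfolding is_nat_iso_def is_nat_trans_def
    by (auto simp: comp_functor_def sum_functor_def id_functor_def r_def)
  obtain p q e where [simp]: "\<epsilon> f = (p, q, e)" by (cases "\<epsilon> f")
  have [simp]: "p = coprod_map V I r" "q = f" and e: "e \<in> Arr V" "Dom V e = Dom V p" "Cod V e = Dom V f" "f \<cdot> e = p"
    using epsf(1) by (auto simp: slice_def)
  obtain k where k: "k \<in> Hom ?B (Cod ?B (\<epsilon> f)) (Dom ?B (\<epsilon> f))"
    "Cmp ?B k (\<epsilon> f) = Ident ?B (Dom ?B (\<epsilon> f))" "Cmp ?B (\<epsilon> f) k = Ident ?B (Cod ?B (\<epsilon> f))"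
    using epsf(2) unfolding is_iso_def by blast
  obtain k1 k2 e' where [simp]: "k = (k1, k2, e')" by (cases k)
  have "e' \<in> Arr V" "Dom V e' = Dom V f" "Cod V e' = Dom V p" "e' \<cdot> e = Ident V (Dom V p)" "e \<cdot> e' = Ident V (Dom V f)"
    using k by (simp_all add: slice_def)
  then have iso: "is_iso V e" using e by (intro isoI(1)[of e e']) auto
  let ?D = "\<lambda>i. Dom V (r i)"
  have Xr: "coprod V I (\<lambda>i. Cod V (r i)) = coprod V I X" "incl V I (\<lambda>i. Cod V (r i)) = incl V I X"
    using r by (auto intro: coprod_cong)
  have cop: "is_coproduct V I ?D (coprod V I ?D) (incl V I ?D)"
    using I r by (intro coproduct) auto
  note cm = coprod_map_simps[of I r, OF smalli_self[OF I(1)] r(1)]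
  have 1: "is_coproduct V I ?D (Dom V f) (\<lambda>i. e \<cdot> incl V I ?D i)"
    using is_coproduct_iso[OF cop iso] e cm by simp
  have 2: "f \<cdot> (e \<cdot> incl V I ?D i) = incl V I X i \<cdot> r i" if "i \<in> I" for i
  proof -
    have "f \<cdot> (e \<cdot> incl V I ?D i) = p \<cdot> incl V I ?D i"
      by (rule Cmp_extend1[OF e(4)]) (use e f cm that I r in auto)
    then show ?thesis using cm(4)[OF _ that] Xr by simp
  qed
  have 3: "\<forall>i\<in>I. r i \<in> Hom V (?D i) (X i)" using r by simp
  show ?thesis using 1 2 3 by blast
qed

text \<open>The coproduct \<open>S\<close> is compared by an isomorphism \<open>c\<close> with the
  chosen coproduct over the image of \<open>I\<close> in the type of arrows. The composite of
  \<open>f\<close> with \<open>c\<close> is split there, and \<open>c\<close> is cancelled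
  afterwards.\<close>

lemma split:
  assumes cop: "is_coproduct V I X S \<iota>" and I: "smalli small I" and f: "f \<in> Arr V" "Cod V f = S"
  obtains D j g where "is_coproduct V I D (Dom V f) j"
    "\<And>i. i \<in> I \<Longrightarrow> g i \<in> Arr V" "\<And>i. i \<in> I \<Longrightarrow> Dom V (g i) = D i" "\<And>i. i \<in> I \<Longrightarrow> Cod V (g i) = X i"
    "\<And>i. i \<in> I \<Longrightarrow> f \<cdot> j i = \<iota> i \<cdot> g i"
proof -
  note [simp] = is_coproduct_simps[OF cop]
  obtain \<phi> :: "'b \<Rightarrow> 'a" where phi: "inj_on \<phi> I" "small (\<phi> ` I)" using I by (auto simp: smalli_def)
  let ?J = "\<phi> ` I" and ?Y = "\<lambda>k. X (inv_into I \<phi> k)"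
  have Y: "k \<in> ?J \<Longrightarrow> ?Y k \<in> Obj V" for k using phi(1) by auto
  have cop': "is_coproduct V ?J ?Y (coprod V ?J ?Y) (incl V ?J ?Y)"
    by (rule coproduct) (use phi in auto)
  have "is_coproduct V I (\<lambda>i. ?Y (\<phi> i)) (coprod V ?J ?Y) (\<lambda>i. incl V ?J ?Y (\<phi> i))"
    by (rule is_coproduct_reindex[OF _ cop']) (use phi inj_on_imp_bij_betw in auto)
  then have "is_coproduct V I X (coprod V ?J ?Y) (\<lambda>i. incl V ?J ?Y (\<phi> i))"
    using phi(1) by (subst (asm) is_coproduct_cong[of I _ X _ "\<lambda>i. incl V ?J ?Y (\<phi> i)"]) auto
  from is_coproduct_compare[OF cop this] obtain c where c: "is_iso V c" "Dom V c = S" "Cod V c = coprod V ?J ?Y"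
    and ci: "\<And>i. i \<in> I \<Longrightarrow> c \<cdot> \<iota> i = incl V ?J ?Y (\<phi> i)" by blast
  note [simp] = is_iso_Arr[OF c(1)] c f
  have "\<exists>D j g. is_coproduct V ?J D (Dom V (c \<cdot> f)) j \<and>
    (\<forall>k \<in> ?J. g k \<in> Hom V (D k) (?Y k) \<and> (c \<cdot> f) \<cdot> j k = incl V ?J ?Y k \<cdot> g k)"
    by (rule split_chosen[OF phi(2) Y]) auto
  then obtain D j g where D: "is_coproduct V ?J D (Dom V (c \<cdot> f)) j"
    and g: "\<And>k. k \<in> ?J \<Longrightarrow> g k \<in> Hom V (D k) (?Y k) \<and> (c \<cdot> f) \<cdot> j k = incl V ?J ?Y k \<cdot> g k"
    by blast
  have D': "is_coproduct V I (\<lambda>i. D (\<phi> i)) (Dom V f) (\<lambda>i. j (\<phi> i))"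
    using is_coproduct_reindex[OF inj_on_imp_bij_betw[OF phi(1)] D] by simp
  note [simp] = is_coproduct_simps[OF D']
  have g': "g (\<phi> i) \<in> Arr V" "Dom V (g (\<phi> i)) = D (\<phi> i)" "Cod V (g (\<phi> i)) = X i"
     "f \<cdot> j (\<phi> i) = \<iota> i \<cdot> g (\<phi> i)" if i: "i \<in> I" for i
  proof -
    show *: "g (\<phi> i) \<in> Arr V" "Dom V (g (\<phi> i)) = D (\<phi> i)" "Cod V (g (\<phi> i)) = X i"
      using g[of "\<phi> i"] i phi(1) by auto
    have "c \<cdot> (f \<cdot> j (\<phi> i)) = incl V ?J ?Y (\<phi> i) \<cdot> g (\<phi> i)"
      using g[of "\<phi> i"] i by simp
    also have "\<dots> = c \<cdot> (\<iota> i \<cdot> g (\<phi> i))"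
      by (rule Cmp_extend1[symmetric, OF ci]) (use i * in auto)
    finally show "f \<cdot> j (\<phi> i) = \<iota> i \<cdot> g (\<phi> i)"
      by (rule iso_cancel_left[OF c(1), rotated -1]) (use i * in auto)
  qed
  show thesis by (rule that[OF D']) (use g' in auto)
qed

text \<open>The pieces into which the domain of \<open>f\<close> splits are jointly epic, and on
  each of them \<open>f\<close> factors through one summand. Hence it suffices to compare
  \<open>u\<close> and \<open>v\<close> on generalized elements \<open>h\<close> that
  \<open>f\<close> carries into a single summand.\<close>

lemma local_eqI:
  assumes cop: "is_coproduct V I X S \<iota>" and I: "smalli small I" and f: "f \<in> Arr V" "Cod V f = S"
    and uv: "u \<in> Arr V" "v \<in> Arr V" "Dom V u = Dom V f" "Dom V v = Dom V f" "Cod V u = Cod V v"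
    and loc: "\<And>i h g. \<lbrakk>i \<in> I; h \<in> Arr V; g \<in> Arr V; Dom V g = Dom V h; Cod V h = Dom V f; Cod V g = X i; f \<cdot> h = \<iota> i \<cdot> g\<rbrakk> \<Longrightarrow> u \<cdot> h = v \<cdot> h"
  shows "u = v"
proof -
  obtain D j g where D: "is_coproduct V I D (Dom V f) j" and g:
    "\<And>i. i \<in> I \<Longrightarrow> g i \<in> Arr V" "\<And>i. i \<in> I \<Longrightarrow> Dom V (g i) = D i" "\<And>i. i \<in> I \<Longrightarrow> Cod V (g i) = X i"
    "\<And>i. i \<in> I \<Longrightarrow> f \<cdot> j i = \<iota> i \<cdot> g i"
    using split[OF cop I f] by metis
  show ?thesis
  proof (rule is_coproduct_eqI[OF D])
    fix i assume i: "i \<in> I"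
    show "u \<cdot> j i = v \<cdot> j i"
      by (rule loc[of i "j i" "g i"]) (use i g is_coproduct_simps[OF D] in auto)
  qed (use uv in auto)
qed

text \<open>The local lifts are glued by the universal property of the coproduct of pieces. Distinct
  pieces of a coproduct impose no compatibility on each other, so any choice of local lifts will
  do.\<close>

lemma local_lift:
  assumes cop: "is_coproduct V I X S \<iota>" and I: "smalli small I" and f: "f \<in> Arr V" "Cod V f = S"
    and uv: "u \<in> Arr V" "m \<in> Arr V" "Dom V u = Dom V f" "Cod V u = Cod V m"
    and loc: "\<And>i h g. \<lbrakk>i \<in> I; h \<in> Arr V; g \<in> Arr V; Dom V g = Dom V h; Cod V h = Dom V f; Cod V g = X i; f \<cdot> h = \<iota> i \<cdot> g\<rbrakk> \<Longrightarrow> \<exists>w \<in> Arr V. Dom V w = Dom V h \<and> Cod V w = Dom V m \<and> m \<cdot> w = u \<cdot> h"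
  shows "\<exists>w \<in> Arr V. Dom V w = Dom V f \<and> Cod V w = Dom V m \<and> m \<cdot> w = u"
proof -
  obtain D j g where D: "is_coproduct V I D (Dom V f) j" and g:
    "\<And>i. i \<in> I \<Longrightarrow> g i \<in> Arr V" "\<And>i. i \<in> I \<Longrightarrow> Dom V (g i) = D i" "\<And>i. i \<in> I \<Longrightarrow> Cod V (g i) = X i"
    "\<And>i. i \<in> I \<Longrightarrow> f \<cdot> j i = \<iota> i \<cdot> g i"
    using split[OF cop I f] by metis
  note [simp] = is_coproduct_simps[OF D]
  have "\<forall>i\<in>I. \<exists>w. w \<in> Arr V \<and> Dom V w = D i \<and> Cod V w = Dom V m \<and> m \<cdot> w = u \<cdot> j i"
  proof
    fix i assume i: "i \<in> I"
    show "\<exists>w. w \<in> Arr V \<and> Dom V w = D i \<and> Cod V w = Dom V m \<and> m \<cdot> w = u \<cdot> j i"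
      using loc[of i "j i" "g i"] i g by auto
  qed
  then obtain w where w: "\<And>i. i \<in> I \<Longrightarrow> w i \<in> Arr V \<and> Dom V (w i) = D i \<and> Cod V (w i) = Dom V m \<and> m \<cdot> w i = u \<cdot> j i"
    by metis
  obtain W where W: "W \<in> Hom V (Dom V f) (Dom V m)" "\<forall>i\<in>I. W \<cdot> j i = w i"
    using is_coproduct_ex1[OF D, of "Dom V m" w] w uv by auto
  have "m \<cdot> W = u"
    by (rule is_coproduct_eqI[OF D]) (use W w uv in auto)
  then show ?thesis using W by auto
qed

section \<open>Strictness of initial objects and disjointness of coproducts\<close>

lemma ex_initial: "is_initial V (coprod V {} X)"
  using coproduct[of "{}" X] by (simp add: is_coproduct_empty)

text \<open>An initial object is a coproduct of the empty family; splitting over it exhibits the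
  domain of \<open>f\<close> as a coproduct of the empty family too.\<close>

lemma strict_initial:
  assumes "is_initial V A" "f \<in> Arr V" "Cod V f = A"
  shows "is_initial V (Dom V f)"
proof -
  have "is_coproduct V ({} :: 'a set) (\<lambda>_. A) A (\<lambda>_. f)" using assms(1) is_coproduct_empty by blast
  then obtain D j where "is_coproduct V ({} :: 'a set) D (Dom V f) j"
    by (rule split[OF _ _ assms(2,3)]) auto
  then show ?thesis by (simp add: is_coproduct_empty)
qed

text \<open>Fullness of the sum functor is used. The families \<open>a\<close> and \<open>b\<close>
  consist of \<open>g\<close> at \<open>i\<close>, respectively \<open>h\<close> at
  \<open>j\<close>, padded with initial objects elsewhere. The equation makes the evident arrow
  \<phi> between their sums an arrow over the coproduct, hence a sum of arrows \<open>s k\<close>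
  over the objects \<open>X k\<close>. If \<open>i\<close> and \<open>j\<close> differ, then
  \<open>s i\<close> ends in an initial object and strictness applies; if they are equal, then
  \<open>s i\<close> is an identity and \<open>g = h\<close>.\<close>

lemma disjoint_chosen:
  assumes I: "small I" "\<And>i. i \<in> I \<Longrightarrow> X i \<in> Obj V" and ij: "i \<in> I" "j \<in> I"
    and g: "g \<in> Arr V" "Cod V g = X i" and h: "h \<in> Arr V" "Cod V h = X j" "Dom V h = Dom V g"
    and eq: "incl V I X i \<cdot> g = incl V I X j \<cdot> h"
  shows "i = j \<and> g = h \<or> is_initial V (Dom V g)"
proof -
  let ?A = "prod_cat I (\<lambda>i. slice V (X i))" and ?B = "slice V (coprod V I X)"
  have equiv: "is_equivalence ?A ?B (sum_functor V I)"
    using lextensive I unfolding lextensive_def extensive_def by blast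
  let ?Z = "coprod V ({} :: 'a set) X"
  have Z: "is_initial V ?Z" by (rule ex_initial)
  have ZO: "?Z \<in> Obj V" using Z by (simp add: is_initial_def)
  have "\<forall>B \<in> Obj V. \<exists>z. z \<in> Arr V \<and> Dom V z = ?Z \<and> Cod V z = B"
    using is_initial_arrow[OF Z] by auto
  then obtain z where z: "\<And>B. B \<in> Obj V \<Longrightarrow> z B \<in> Arr V" "\<And>B. B \<in> Obj V \<Longrightarrow> Dom V (z B) = ?Z"
    "\<And>B. B \<in> Obj V \<Longrightarrow> Cod V (z B) = B" by metis
  define a where "a = (\<lambda>k\<in>I. if k = i then g else z (X k))"
  define b where "b = (\<lambda>k\<in>I. if k = j then h else z (X k))"
  have a: "a k \<in> Arr V" "Cod V (a k) = X k" and b: "b k \<in> Arr V" "Cod V (b k) = X k" if "k \<in> I" for k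
    using that I g h z by (auto simp: a_def b_def)
  have ab: "a \<in> Obj ?A" "b \<in> Obj ?A"
    using a b by (auto simp: prod_cat_def slice_def a_def b_def)
  let ?Da = "\<lambda>k. Dom V (a k)" and ?Db = "\<lambda>k. Dom V (b k)"
  have Da: "?Da i = Dom V g" "k \<in> I \<Longrightarrow> k \<noteq> i \<Longrightarrow> ?Da k = ?Z" for k
    using ij I z by (auto simp: a_def)
  have Db: "?Db j = Dom V g" "k \<in> I \<Longrightarrow> k \<noteq> j \<Longrightarrow> ?Db k = ?Z" for k
    using ij I z h by (auto simp: b_def)
  define \<phi> where "\<phi> = cotuple V I ?Da (coprod V I ?Db) (\<lambda>k. if k = i then incl V I ?Db j else z (coprod V I ?Db))"
  have cDb: "coprod V I ?Db \<in> Obj V" using I b by simp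
  note phi = cotuple_simps[of I "coprod V I ?Db" "\<lambda>k. if k = i then incl V I ?Db j else z (coprod V I ?Db)" ?Da, folded \<phi>_def]
  have phi: "\<phi> \<in> Arr V" "Dom V \<phi> = coprod V I ?Da" "Cod V \<phi> = coprod V I ?Db" "\<phi> \<cdot> incl V I ?Da i = incl V I ?Db j"
    unfolding \<phi>_def using ij I a b Da Db z cDb by (subst cotuple_simps; auto)+
  have XX: "coprod V I (\<lambda>k. Cod V (a k)) = coprod V I X" "incl V I (\<lambda>k. Cod V (a k)) = incl V I X"
     "coprod V I (\<lambda>k. Cod V (b k)) = coprod V I X" "incl V I (\<lambda>k. Cod V (b k)) = incl V I X"
    using a b by (auto intro: coprod_cong)
  note ma = coprod_map_simps[of I a, OF smalli_self[OF I(1)] a(1), simplified, unfolded XX]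
  note mb = coprod_map_simps[of I b, OF smalli_self[OF I(1)] b(1), simplified, unfolded XX]
  \<comment> \<open>On the summand \<open>i\<close> this triangle is the equation \<open>eq\<close>;
    every other summand is initial and imposes nothing.\<close>
  have tri: "coprod_map V I b \<cdot> \<phi> = coprod_map V I a"
  proof (rule coprod_eqI[of I ?Da])
    fix k assume k: "k \<in> I"
    show "(coprod_map V I b \<cdot> \<phi>) \<cdot> incl V I ?Da k = coprod_map V I a \<cdot> incl V I ?Da k"
    proof (cases "k = i")
      case True
      have "(coprod_map V I b \<cdot> \<phi>) \<cdot> incl V I ?Da i = coprod_map V I b \<cdot> incl V I ?Db j"
        using phi mb a I ij by simp
      also have "\<dots> = incl V I X j \<cdot> h" using mb ij by (simp add: b_def)
      also have "\<dots> = coprod_map V I a \<cdot> incl V I ?Da i" using ma ij eq by (simp add: a_def)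
      finally show ?thesis using True by simp
    next
      case False
      show ?thesis
        by (rule is_initial_unique[OF Z]) (use False k Da phi ma mb a I in simp_all)
    qed
  qed (use I phi ma mb a in auto)
  have "(coprod_map V I a, coprod_map V I b, \<phi>) \<in> Hom ?B (omap (sum_functor V I) a) (omap (sum_functor V I) b)"
    using phi ma mb tri by (simp add: slice_def sum_functor_def)
  from equivalence_full[OF equiv ab this] obtain t where t: "t \<in> Hom ?A a b"
    "amap (sum_functor V I) t = (coprod_map V I a, coprod_map V I b, \<phi>)" by blast
  define s where "s k = snd (snd (t k))" for k
  have tk: "t k \<in> Arr (slice V (X k)) \<and> fst (t k) = a k \<and> fst (snd (t k)) = b k" if k: "k \<in> I" for k
  proof -
    have "t k \<in> Arr (slice V (X k))" using t(1) k by (auto simp: prod_cat_def)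
    moreover have "(\<lambda>i\<in>I. Dom (slice V (X i)) (t i)) = a" "(\<lambda>i\<in>I. Cod (slice V (X i)) (t i)) = b"
      using t(1) by (auto simp: prod_cat_def)
    then have "Dom (slice V (X k)) (t k) = a k" "Cod (slice V (X k)) (t k) = b k"
      using k by (metis (no_types, lifting) restrict_apply')+
    ultimately show ?thesis by (simp add: slice_def split_beta)
  qed
  have s: "s k \<in> Arr V" "Dom V (s k) = ?Da k" "Cod V (s k) = ?Db k" "b k \<cdot> s k = a k" if "k \<in> I" for k
    using tk[OF that] by (cases "t k"; simp add: slice_def s_def; metis)+
  have "\<phi> = coprod_map V I s" using t(2) by (simp add: sum_functor_def s_def[abs_def])
  moreover have "coprod V I (\<lambda>k. Dom V (s k)) = coprod V I ?Da" "incl V I (\<lambda>k. Dom V (s k)) = incl V I ?Da"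
     "coprod V I (\<lambda>k. Cod V (s k)) = coprod V I ?Db" "incl V I (\<lambda>k. Cod V (s k)) = incl V I ?Db"
    using s by (auto intro: coprod_cong)
  \<comment> \<open>Two descriptions of \<phi> on the summand \<open>i\<close>: by definition it is
    the inclusion of the summand \<open>j\<close>, and as a sum it is \<open>s i\<close> followed by
    the inclusion of the summand \<open>i\<close>.\<close>
  ultimately have key: "incl V I ?Db j = incl V I ?Db i \<cdot> s i"
    using coprod_map_simps(4)[of I s i] s I ij phi by simp
  show ?thesis
  proof (cases "i = j")
    case False
    then have "is_initial V (Dom V (s i))"
      using strict_initial[OF Z, of "s i"] s(1,3)[OF ij(1)] Db(2)[OF ij(1)] by simp
    then show ?thesis using s(2)[OF ij(1)] Da(1) by simp
  next
    case True
    \<comment> \<open>A retraction of the inclusion of the summand \<open>i\<close>, available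
      because all the other summands are initial.\<close>
    define \<rho> where "\<rho> = cotuple V I ?Db (Dom V g) (\<lambda>k. if k = j then Ident V (Dom V g) else z (Dom V g))"
    have rho: "\<rho> \<in> Arr V" "Dom V \<rho> = coprod V I ?Db" "Cod V \<rho> = Dom V g" "\<rho> \<cdot> incl V I ?Db i = Ident V (Dom V g)"
      unfolding \<rho>_def using ij I b Db z g True by (subst cotuple_simps; auto)+
    have "\<rho> \<cdot> (incl V I ?Db i \<cdot> s i) = Ident V (Dom V g) \<cdot> s i"
      by (rule Cmp_extend1[OF rho(4)]) (use rho s ij I b in auto)
    also have "\<dots> = s i" using s(1,3)[OF ij(1)] Db(1) True by simp
    finally have "s i = Ident V (Dom V g)" unfolding key[symmetric] using rho(4) True by simp
    then have "b i = a i" using s(4)[OF ij(1)] b[OF ij(1)] Db(1) True by simp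
    then show ?thesis using True ij by (simp add: a_def b_def)
  qed
qed

lemma disjoint:
  assumes cop: "is_coproduct V I X S \<iota>" and I: "smalli small I" and ij: "i \<in> I" "j \<in> I"
    and g: "g \<in> Arr V" "Cod V g = X i" and h: "h \<in> Arr V" "Cod V h = X j" "Dom V h = Dom V g"
    and eq: "\<iota> i \<cdot> g = \<iota> j \<cdot> h"
  shows "i = j \<and> g = h \<or> is_initial V (Dom V g)"
proof -
  note [simp] = is_coproduct_simps[OF cop]
  obtain \<phi> :: "'b \<Rightarrow> 'a" where phi: "inj_on \<phi> I" "small (\<phi> ` I)" using I by (auto simp: smalli_def)
  let ?J = "\<phi> ` I" and ?Y = "\<lambda>k. X (inv_into I \<phi> k)"
  have Y: "k \<in> ?J \<Longrightarrow> ?Y k \<in> Obj V" for k using phi(1) by auto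
  have cop': "is_coproduct V ?J ?Y (coprod V ?J ?Y) (incl V ?J ?Y)"
    by (rule coproduct) (use phi in auto)
  have "is_coproduct V I (\<lambda>i. ?Y (\<phi> i)) (coprod V ?J ?Y) (\<lambda>i. incl V ?J ?Y (\<phi> i))"
    by (rule is_coproduct_reindex[OF _ cop']) (use phi inj_on_imp_bij_betw in auto)
  then have "is_coproduct V I X (coprod V ?J ?Y) (\<lambda>i. incl V ?J ?Y (\<phi> i))"
    using phi(1) by (subst (asm) is_coproduct_cong[of I _ X _ "\<lambda>i. incl V ?J ?Y (\<phi> i)"]) auto
  from is_coproduct_compare[OF cop this] obtain c where c: "is_iso V c" "Dom V c = S" "Cod V c = coprod V ?J ?Y"
    and ci: "\<And>i. i \<in> I \<Longrightarrow> c \<cdot> \<iota> i = incl V ?J ?Y (\<phi> i)" by blast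
  have "incl V ?J ?Y (\<phi> i) \<cdot> g = c \<cdot> (\<iota> i \<cdot> g)"
    by (rule Cmp_extend1[symmetric, OF ci]) (use ij g c is_iso_Arr in auto)
  also have "\<dots> = incl V ?J ?Y (\<phi> j) \<cdot> h"
    unfolding eq by (rule Cmp_extend1[OF ci]) (use ij h c is_iso_Arr in auto)
  finally have "\<phi> i = \<phi> j \<and> g = h \<or> is_initial V (Dom V g)"
    using disjoint_chosen[OF phi(2), of ?Y "\<phi> i" "\<phi> j" g h] Y ij g h phi(1) by auto
  then show ?thesis using phi(1) ij by (auto dest: inj_onD)
qed

text \<open>The comparison from the chosen coproduct to \<open>S\<close> is monic by disjointness of
  the arrows \<kappa>, and it has a section by the covering condition. That condition is phrased for
  an arbitrary arrow \<open>m\<close> into \<open>S\<close>: if all elements coming from some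
  \<open>\<kappa> i\<close> lift through \<open>m\<close>, then so does the identity of
  \<open>S\<close>. In this form it is what \<open>local_lift\<close> delivers.\<close>

lemma is_coproductI_local:
  assumes I: "smalli small I" and S: "S \<in> Obj V"
    and k: "\<And>i. i \<in> I \<Longrightarrow> \<kappa> i \<in> Hom V (X i) S"
    and disj: "\<And>i j g h. \<lbrakk>i \<in> I; j \<in> I; g \<in> Arr V; h \<in> Arr V; Cod V g = X i; Cod V h = X j; Dom V h = Dom V g; \<kappa> i \<cdot> g = \<kappa> j \<cdot> h\<rbrakk> \<Longrightarrow> i = j \<and> g = h \<or> is_initial V (Dom V g)"
    and cover: "\<And>m. m \<in> Arr V \<Longrightarrow> Cod V m = S \<Longrightarrow>
      (\<And>h i g. h \<in> Arr V \<Longrightarrow> Cod V h = S \<Longrightarrow> i \<in> I \<Longrightarrow> g \<in> Arr V \<Longrightarrow> Dom V g = Dom V h \<Longrightarrow> Cod V g = X i \<Longrightarrow>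
        h = \<kappa> i \<cdot> g \<Longrightarrow> \<exists>w \<in> Arr V. Dom V w = Dom V h \<and> Cod V w = Dom V m \<and> m \<cdot> w = h) \<Longrightarrow>
      \<exists>w \<in> Arr V. Dom V w = S \<and> Cod V w = Dom V m \<and> m \<cdot> w = Ident V S"
  shows "is_coproduct V I X S \<kappa>"
proof -
  have X: "i \<in> I \<Longrightarrow> X i \<in> Obj V" for i using k[of i] Dom_in_Obj[of "\<kappa> i"] by simp
  define m where "m = cotuple V I X S \<kappa>"
  have m: "m \<in> Arr V" "Dom V m = coprod V I X" "Cod V m = S" "\<And>i. i \<in> I \<Longrightarrow> m \<cdot> incl V I X i = \<kappa> i"
    "\<And>i e. \<lbrakk>i \<in> I; e \<in> Arr V; Cod V e = X i\<rbrakk> \<Longrightarrow> m \<cdot> (incl V I X i \<cdot> e) = \<kappa> i \<cdot> e"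
    unfolding m_def by (rule cotuple_simps; use I S k in simp)+
  have cop: "is_coproduct V I X (coprod V I X) (incl V I X)" by (rule coproduct[OF I X])
  have "is_iso V m"
  proof (rule is_isoI_mono_lift[OF m(1)])
    fix u v assume uv: "u \<in> Arr V" "v \<in> Arr V" "Dom V u = Dom V v" "Cod V u = Dom V m" "Cod V v = Dom V m" "m \<cdot> u = m \<cdot> v"
    show "u = v"
    \<comment> \<open>The domain is split first along \<open>u\<close> and then along
      \<open>v\<close>, so that in the end both arrows factor through summands and disjointness can
      be applied.\<close>
    proof (rule local_eqI[OF cop I, of u u v])
      fix i h g assume 1: "i \<in> I" "h \<in> Arr V" "g \<in> Arr V" "Dom V g = Dom V h" "Cod V h = Dom V u" "Cod V g = X i" "u \<cdot> h = incl V I X i \<cdot> g"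
      show "u \<cdot> h = v \<cdot> h"
      proof (rule local_eqI[OF cop I, of "v \<cdot> h" "u \<cdot> h" "v \<cdot> h"])
        fix j h' g' assume 2: "j \<in> I" "h' \<in> Arr V" "g' \<in> Arr V" "Dom V g' = Dom V h'" "Cod V h' = Dom V (v \<cdot> h)" "Cod V g' = X j" "(v \<cdot> h) \<cdot> h' = incl V I X j \<cdot> g'"
        have "(u \<cdot> h) \<cdot> h' = (incl V I X i \<cdot> g) \<cdot> h'" using 1(7) by simp
        then have u: "(u \<cdot> h) \<cdot> h' = incl V I X i \<cdot> (g \<cdot> h')" using uv 1 2 m I X by simp
        have "m \<cdot> (u \<cdot> (h \<cdot> h')) = m \<cdot> (v \<cdot> (h \<cdot> h'))" by (rule Cmp_extend[OF uv(6)]) (use uv 1 2 m in auto)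
        then have "m \<cdot> (incl V I X i \<cdot> (g \<cdot> h')) = m \<cdot> (incl V I X j \<cdot> g')"
          using u 2(7) uv 1(1-6) 2(1-6) m by simp
        then have "\<kappa> i \<cdot> (g \<cdot> h') = \<kappa> j \<cdot> g'" using m uv 1(1-6) 2(1-6) by simp
        from disj[OF 1(1) 2(1) _ _ _ _ _ this] have "i = j \<and> g \<cdot> h' = g' \<or> is_initial V (Dom V h')"
          using uv 1(1-6) 2(1-6) m(1-3) by auto
        then show "(u \<cdot> h) \<cdot> h' = (v \<cdot> h) \<cdot> h'"
        proof
          assume "is_initial V (Dom V h')"
          then show ?thesis by (rule is_initial_unique) (use uv 1(1-6) 2(1-6) m(1-3) in auto)
        qed (use u 2(7) in simp)
      qed (use uv 1 m I X in auto)
    qed (use uv m I X in auto)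
  next
    have "\<exists>w \<in> Arr V. Dom V w = S \<and> Cod V w = Dom V m \<and> m \<cdot> w = Ident V S"
    proof (rule cover)
      fix h i g assume "h \<in> Arr V" "Cod V h = S" "i \<in> I" "g \<in> Arr V" "Dom V g = Dom V h" "Cod V g = X i" "h = \<kappa> i \<cdot> g"
      then show "\<exists>w \<in> Arr V. Dom V w = Dom V h \<and> Cod V w = Dom V m \<and> m \<cdot> w = h"
        using m I X by (intro bexI[of _ "incl V I X i \<cdot> g"]) auto
    qed (use m in auto)
    then show "\<exists>w\<in>Arr V. Dom V w = Cod V m \<and> Cod V w = Dom V m \<and> m \<cdot> w = Ident V (Cod V m)" using m by simp
  qed
  from is_coproduct_iso[OF cop this m(2)] show ?thesis
    using m is_coproduct_cong[of I X X "\<lambda>i. m \<cdot> incl V I X i" \<kappa>] by simp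
qed

lemma is_coproduct_comparison_iso:
  assumes "is_coproduct V I X S \<iota>" "is_coproduct V I X R \<kappa>" "f \<in> Arr V" "Dom V f = S" "Cod V f = R"
    "\<And>i. i \<in> I \<Longrightarrow> f \<cdot> \<iota> i = \<kappa> i"
  shows "is_iso V f"
proof -
  obtain e where e: "is_iso V e" "Dom V e = S" "Cod V e = R" "\<forall>i\<in>I. e \<cdot> \<iota> i = \<kappa> i"
    using is_coproduct_compare[OF assms(1,2)] by blast
  have "e = f" by (rule is_coproduct_eqI[OF assms(1)]) (use e assms is_iso_Arr in auto)
  then show ?thesis using e by simp
qed

lemma is_coproduct_nested:
  assumes S: "is_coproduct V I X S \<iota>" and X: "\<And>i. i \<in> I \<Longrightarrow> is_coproduct V J (Y i) (X i) (\<kappa> i)"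
  shows "is_coproduct V (I \<times> J) (\<lambda>(i, j). Y i j) S (\<lambda>(i, j). \<iota> i \<cdot> \<kappa> i j)"
  unfolding is_coproduct_def
proof (intro conjI ballI allI impI)
  note [simp] = is_coproduct_simps[OF S] is_coproduct_simps[OF X]
  fix B g assume B: "B \<in> Obj V" and g: "\<forall>z\<in>I \<times> J. g z \<in> Hom V (case z of (i, j) \<Rightarrow> Y i j) B"
  have "\<exists>u. u \<in> Hom V (X i) B \<and> (\<forall>j\<in>J. u \<cdot> \<kappa> i j = g (i, j))" if i: "i \<in> I" for i
  proof -
    have "\<exists>!u. u \<in> Hom V (X i) B \<and> (\<forall>j\<in>J. u \<cdot> \<kappa> i j = g (i, j))"
      by (rule is_coproduct_ex1[OF X[OF i] B]) (use g i in auto)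
    then show ?thesis by blast
  qed
  then obtain u where u: "\<And>i. i \<in> I \<Longrightarrow> u i \<in> Hom V (X i) B \<and> (\<forall>j\<in>J. u i \<cdot> \<kappa> i j = g (i, j))" by metis
  obtain w where w: "w \<in> Hom V S B" "\<forall>i\<in>I. w \<cdot> \<iota> i = u i"
    using is_coproduct_ex1[OF S B, of u] u by blast
  show "\<exists>!w. w \<in> Hom V S B \<and> (\<forall>z\<in>I \<times> J. w \<cdot> (case z of (i, j) \<Rightarrow> \<iota> i \<cdot> \<kappa> i j) = g z)"
  proof (rule ex1I[of _ w])
    have "w \<cdot> (\<iota> i \<cdot> \<kappa> i j) = u i \<cdot> \<kappa> i j" if "i \<in> I" "j \<in> J" for i j
      by (rule Cmp_extend1) (use w that in auto)
    then show "w \<in> Hom V S B \<and> (\<forall>z\<in>I \<times> J. w \<cdot> (case z of (i, j) \<Rightarrow> \<iota> i \<cdot> \<kappa> i j) = g z)" using w u by auto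
    fix v assume v: "v \<in> Hom V S B \<and> (\<forall>z\<in>I \<times> J. v \<cdot> (case z of (i, j) \<Rightarrow> \<iota> i \<cdot> \<kappa> i j) = g z)"
    show "v = w"
    proof (rule is_coproduct_eqI[OF S])
      fix i assume i: "i \<in> I"
      have "v \<cdot> \<iota> i = u i"
      proof (rule is_coproduct_eqI[OF X[OF i]])
        fix j assume j: "j \<in> J"
        have "v \<cdot> (\<iota> i \<cdot> \<kappa> i j) = g (i, j)" using v i j by force
        then show "(v \<cdot> \<iota> i) \<cdot> \<kappa> i j = u i \<cdot> \<kappa> i j" using u i j v by simp
      qed (use i u v in auto)
      then show "v \<cdot> \<iota> i = w \<cdot> \<iota> i" using w i by simp
    qed (use v w in auto)
  qed
qed (use assms in \<open>auto simp: is_coproduct_def\<close>)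

text \<open>Distributivity is derived from extensivity: splitting the projection to \<open>S\<close>
  along the coproduct splits the whole product, which gives the covering condition. Disjointness is
  read off on the same projection. The mirrored statement \<open>is_coproduct_prd_right\<close>
  splits the other projection.\<close>

lemma is_coproduct_prd_left:
  assumes S: "is_coproduct V I X S \<iota>" and I: "smalli small I" and B: "B \<in> Obj V"
  shows "is_coproduct V I (\<lambda>i. prd V (X i) B) (prd V S B) (\<lambda>i. prd_map V (\<iota> i) (Ident V B))"
proof (rule is_coproductI_local[OF I])
  note [simp] = is_coproduct_simps[OF S] B
  show "prd V S B \<in> Obj V" by simp
  show "i \<in> I \<Longrightarrow> prd_map V (\<iota> i) (Ident V B) \<in> Hom V (prd V (X i) B) (prd V S B)" for i by simp
  fix i j g h assume 1: "i \<in> I" "j \<in> I" "g \<in> Arr V" "h \<in> Arr V" "Cod V g = prd V (X i) B" "Cod V h = prd V (X j) B" "Dom V h = Dom V g"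
    and eq: "prd_map V (\<iota> i) (Ident V B) \<cdot> g = prd_map V (\<iota> j) (Ident V B) \<cdot> h"
  let ?g1 = "pr1 V (X i) B \<cdot> g" and ?g2 = "pr2 V (X i) B \<cdot> g" and ?h1 = "pr1 V (X j) B \<cdot> h" and ?h2 = "pr2 V (X j) B \<cdot> h"
  have "pair V (\<iota> i \<cdot> ?g1) ?g2 = pair V (\<iota> j \<cdot> ?h1) ?h2"
    using eq 1 by (simp add: prd_map_def)
  then have "pr1 V S B \<cdot> pair V (\<iota> i \<cdot> ?g1) ?g2 = pr1 V S B \<cdot> pair V (\<iota> j \<cdot> ?h1) ?h2"
    "pr2 V S B \<cdot> pair V (\<iota> i \<cdot> ?g1) ?g2 = pr2 V S B \<cdot> pair V (\<iota> j \<cdot> ?h1) ?h2" by simp_all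
  then have e: "\<iota> i \<cdot> ?g1 = \<iota> j \<cdot> ?h1" "?g2 = ?h2" using 1 by simp_all
  from disjoint[OF S I 1(1,2) _ _ _ _ _ e(1)] have "i = j \<and> ?g1 = ?h1 \<or> is_initial V (Dom V g)" using 1 by simp
  then show "i = j \<and> g = h \<or> is_initial V (Dom V g)"
  proof
    assume ij: "i = j \<and> ?g1 = ?h1"
    have "g = h" by (rule prd_eqI[of "X i" B]) (use ij e 1 in auto)
    then show ?thesis using ij by simp
  qed simp
next
  note [simp] = is_coproduct_simps[OF S] B
  fix m assume m: "m \<in> Arr V" "Cod V m = prd V S B" and lift: "\<And>h i g. \<lbrakk>h \<in> Arr V; Cod V h = prd V S B; i \<in> I; g \<in> Arr V; Dom V g = Dom V h; Cod V g = prd V (X i) B; h = prd_map V (\<iota> i) (Ident V B) \<cdot> g\<rbrakk> \<Longrightarrow> \<exists>w \<in> Arr V. Dom V w = Dom V h \<and> Cod V w = Dom V m \<and> m \<cdot> w = h"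
  have "\<exists>w\<in>Arr V. Dom V w = Dom V (pr1 V S B) \<and> Cod V w = Dom V m \<and> m \<cdot> w = Ident V (prd V S B)"
  proof (rule local_lift[OF S I, of "pr1 V S B"])
    fix i h g assume 1: "i \<in> I" "h \<in> Arr V" "g \<in> Arr V" "Dom V g = Dom V h" "Cod V h = Dom V (pr1 V S B)" "Cod V g = X i" "pr1 V S B \<cdot> h = \<iota> i \<cdot> g"
    have h: "h = prd_map V (\<iota> i) (Ident V B) \<cdot> pair V g (pr2 V S B \<cdot> h)"
      by (rule prd_eqI[of S B]) (use 1 in auto)
    show "\<exists>w\<in>Arr V. Dom V w = Dom V h \<and> Cod V w = Dom V m \<and> m \<cdot> w = Ident V (prd V S B) \<cdot> h"
      using lift[OF _ _ _ _ _ _ h] 1(1-6) by simp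
  qed (use m in auto)
  then show "\<exists>w\<in>Arr V. Dom V w = prd V S B \<and> Cod V w = Dom V m \<and> m \<cdot> w = Ident V (prd V S B)" by simp
qed

lemma is_coproduct_prd_right:
  assumes S: "is_coproduct V I X S \<iota>" and I: "smalli small I" and B: "B \<in> Obj V"
  shows "is_coproduct V I (\<lambda>i. prd V B (X i)) (prd V B S) (\<lambda>i. prd_map V (Ident V B) (\<iota> i))"
proof (rule is_coproductI_local[OF I])
  note [simp] = is_coproduct_simps[OF S] B
  show "prd V B S \<in> Obj V" by simp
  show "i \<in> I \<Longrightarrow> prd_map V (Ident V B) (\<iota> i) \<in> Hom V (prd V B (X i)) (prd V B S)" for i by simp
  fix i j g h assume 1: "i \<in> I" "j \<in> I" "g \<in> Arr V" "h \<in> Arr V" "Cod V g = prd V B (X i)" "Cod V h = prd V B (X j)" "Dom V h = Dom V g"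
    and eq: "prd_map V (Ident V B) (\<iota> i) \<cdot> g = prd_map V (Ident V B) (\<iota> j) \<cdot> h"
  let ?g1 = "pr1 V B (X i) \<cdot> g" and ?g2 = "pr2 V B (X i) \<cdot> g" and ?h1 = "pr1 V B (X j) \<cdot> h" and ?h2 = "pr2 V B (X j) \<cdot> h"
  have "pair V ?g1 (\<iota> i \<cdot> ?g2) = pair V ?h1 (\<iota> j \<cdot> ?h2)"
    using eq 1 by (simp add: prd_map_def)
  then have "pr1 V B S \<cdot> pair V ?g1 (\<iota> i \<cdot> ?g2) = pr1 V B S \<cdot> pair V ?h1 (\<iota> j \<cdot> ?h2)"
    "pr2 V B S \<cdot> pair V ?g1 (\<iota> i \<cdot> ?g2) = pr2 V B S \<cdot> pair V ?h1 (\<iota> j \<cdot> ?h2)" by simp_all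
  then have e: "\<iota> i \<cdot> ?g2 = \<iota> j \<cdot> ?h2" "?g1 = ?h1" using 1 by simp_all
  from disjoint[OF S I 1(1,2) _ _ _ _ _ e(1)] have "i = j \<and> ?g2 = ?h2 \<or> is_initial V (Dom V g)" using 1 by simp
  then show "i = j \<and> g = h \<or> is_initial V (Dom V g)"
  proof
    assume ij: "i = j \<and> ?g2 = ?h2"
    have "g = h" by (rule prd_eqI[of B "X i"]) (use ij e 1 in auto)
    then show ?thesis using ij by simp
  qed simp
next
  note [simp] = is_coproduct_simps[OF S] B
  fix m assume m: "m \<in> Arr V" "Cod V m = prd V B S" and lift: "\<And>h i g. \<lbrakk>h \<in> Arr V; Cod V h = prd V B S; i \<in> I; g \<in> Arr V; Dom V g = Dom V h; Cod V g = prd V B (X i); h = prd_map V (Ident V B) (\<iota> i) \<cdot> g\<rbrakk> \<Longrightarrow> \<exists>w \<in> Arr V. Dom V w = Dom V h \<and> Cod V w = Dom V m \<and> m \<cdot> w = h"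
  have "\<exists>w\<in>Arr V. Dom V w = Dom V (pr2 V B S) \<and> Cod V w = Dom V m \<and> m \<cdot> w = Ident V (prd V B S)"
  proof (rule local_lift[OF S I, of "pr2 V B S"])
    fix i h g assume 1: "i \<in> I" "h \<in> Arr V" "g \<in> Arr V" "Dom V g = Dom V h" "Cod V h = Dom V (pr2 V B S)" "Cod V g = X i" "pr2 V B S \<cdot> h = \<iota> i \<cdot> g"
    have h: "h = prd_map V (Ident V B) (\<iota> i) \<cdot> pair V (pr1 V B S \<cdot> h) g"
      by (rule prd_eqI[of B S]) (use 1 in auto)
    show "\<exists>w\<in>Arr V. Dom V w = Dom V h \<and> Cod V w = Dom V m \<and> m \<cdot> w = Ident V (prd V B S) \<cdot> h"
      using lift[OF _ _ _ _ _ _ h] 1(1-6) by simp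
  qed (use m in auto)
  then show "\<exists>w\<in>Arr V. Dom V w = prd V B S \<and> Cod V w = Dom V m \<and> m \<cdot> w = Ident V (prd V B S)" by simp
qed

end

definition is_span :: "('o, 'a) cat \<Rightarrow> 'a span \<Rightarrow> bool" where
  "is_span C s \<longleftrightarrow> sl s \<in> Arr C \<and> sr s \<in> Arr C \<and> Dom C (sr s) = Dom C (sl s)"

section \<open>The terminal object and global points\<close>

context lextensive_category
begin

abbreviation "bng \<equiv> bang V one"
abbreviation "cpi \<equiv> copow_incl V one"
abbreviation "cpm \<equiv> copow_map V one"
abbreviation "cp \<equiv> copow V one"
abbreviation "mti \<equiv> mtot_incl V"
abbreviation "eps \<equiv> eps_obj V one"
abbreviation "fbi \<equiv> fib_incl V"
abbreviation "stc \<equiv> star_cell V one"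
abbreviation "ptc \<equiv> pts_cell V one"
abbreviation "psp \<equiv> pts_span V one"
abbreviation "sm \<equiv> star_mat V one"
abbreviation "mci \<equiv> mincl V"

lemma one_Obj [simp]: "one \<in> Obj V"
  using terminal by (simp add: is_terminal_def)

lemma to_one_unique: "\<lbrakk>f \<in> Arr V; g \<in> Arr V; Dom V f = Dom V g; Cod V f = one; Cod V g = one\<rbrakk> \<Longrightarrow> f = g"
  using terminal unfolding is_terminal_def by (metis Dom_Obj Hom_iff)

lemma bang_simps [simp]:
  assumes "A \<in> Obj V"
  shows "bng A \<in> Arr V" "Dom V (bng A) = A" "Cod V (bng A) = one"
proof -
  have "\<exists>!f. f \<in> Hom V A one" using terminal assms by (simp add: is_terminal_def)
  from theI'[OF this] show "bng A \<in> Arr V" "Dom V (bng A) = A" "Cod V (bng A) = one"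
    by (simp_all add: bang_def)
qed

lemma bang_Cmp [simp]: "\<lbrakk>A \<in> Obj V; f \<in> Arr V; Cod V f = A\<rbrakk> \<Longrightarrow> bng A \<cdot> f = bng (Dom V f)"
  by (rule to_one_unique) auto

lemma bang_one [simp]: "bng one = Ident V one"
  by (rule to_one_unique) auto

lemma pts_iff [simp]: "v \<in> pts V one A \<longleftrightarrow> v \<in> Arr V \<and> Dom V v = one \<and> Cod V v = A"
  by (simp add: pts_def)

text \<open>Local smallness makes the points of an object an admissible index set, so that copowers
  and matrices over points exist.\<close>

lemma small_pts [simp]: "A \<in> Obj V \<Longrightarrow> small (pts V one A)"
  using loc_small by (simp add: locally_small_def pts_def)

subsection \<open>Fibres of spans\<close>

lemma is_spanD [simp]:
  "is_span V s \<Longrightarrow> sl s \<in> Arr V" "is_span V s \<Longrightarrow> sr s \<in> Arr V"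
  "is_span V s \<Longrightarrow> Dom V (sr s) = Dom V (sl s)"
  by (simp_all add: is_span_def)

lemma fib_simps [simp]:
  assumes "is_span V s" "v \<in> Arr V" "w \<in> Arr V" "Dom V v = one" "Dom V w = one"
    "Cod V v = Cod V (sl s)" "Cod V w = Cod V (sr s)"
  shows "fib V s (v, w) \<in> Obj V" "fbi s (v, w) \<in> Arr V"
    "Dom V (fbi s (v, w)) = fib V s (v, w)" (is ?A) "Cod V (fbi s (v, w)) = Dom V (sl s)"
    "sl s \<cdot> fbi s (v, w) = v \<cdot> bng (fib V s (v, w))" (is ?B)
    "sr s \<cdot> fbi s (v, w) = w \<cdot> bng (fib V s (v, w))" (is ?C)
proof -
  let ?f = "pair V (sl s) (sr s)" and ?g = "pair V v w"
  show 1: "fib V s (v, w) \<in> Obj V" "fbi s (v, w) \<in> Arr V"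
    ?A "Cod V (fbi s (v, w)) = Dom V (sl s)"
    using assms by (simp_all add: fib_def fib_incl_def)
  have "?f \<cdot> pb1 V ?f ?g = ?g \<cdot> pb2 V ?f ?g"
    by (rule pb_commute) (use assms in auto)
  moreover have "pb2 V ?f ?g = bng (fib V s (v, w))"
    by (rule to_one_unique) (use assms 1 in \<open>auto simp: fib_def\<close>)
  ultimately have "?f \<cdot> fbi s (v, w) = ?g \<cdot> bng (fib V s (v, w))" by (simp add: fib_incl_def)
  then have "pair V (sl s \<cdot> fbi s (v, w)) (sr s \<cdot> fbi s (v, w)) =
    pair V (v \<cdot> bng (fib V s (v, w))) (w \<cdot> bng (fib V s (v, w)))" (is "?l = ?r")
    using assms 1 by simp
  then have "pr1 V (Cod V v) (Cod V w) \<cdot> ?l = pr1 V (Cod V v) (Cod V w) \<cdot> ?r"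
    "pr2 V (Cod V v) (Cod V w) \<cdot> ?l = pr2 V (Cod V v) (Cod V w) \<cdot> ?r" by simp_all
  then show ?B
    ?C
    using assms 1 by simp_all
qed

lemma fib_simps' [simp]:
  assumes "is_span V s" "v \<in> Arr V" "w \<in> Arr V" "Dom V v = one" "Dom V w = one"
    "Cod V v = Cod V (sl s)" "Cod V w = Cod V (sr s)" "g \<in> Arr V" "Cod V g = fib V s (v, w)"
  shows "sl s \<cdot> (fbi s (v, w) \<cdot> g) = v \<cdot> bng (Dom V g)"
    "sr s \<cdot> (fbi s (v, w) \<cdot> g) = w \<cdot> bng (Dom V g)"
  using Cmp_extend1[OF fib_simps(5)[OF assms(1-7)], of g] Cmp_extend1[OF fib_simps(6)[OF assms(1-7)], of g] assms
  by simp_all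

lemma fib_lift_simps [simp]:
  assumes "is_span V s" "v \<in> Arr V" "w \<in> Arr V" "Dom V v = one" "Dom V w = one"
    "Cod V v = Cod V (sl s)" "Cod V w = Cod V (sr s)"
    "h \<in> Arr V" "Cod V h = Dom V (sl s)" "sl s \<cdot> h = v \<cdot> bng (Dom V h)" "sr s \<cdot> h = w \<cdot> bng (Dom V h)"
  shows "fib_lift V one s (v, w) h \<in> Arr V" (is ?A) "Dom V (fib_lift V one s (v, w) h) = Dom V h" (is ?B)
    "Cod V (fib_lift V one s (v, w) h) = fib V s (v, w)" (is ?C)
    "fbi s (v, w) \<cdot> fib_lift V one s (v, w) h = h" (is ?D)
proof -
  have "pair V (sl s) (sr s) \<cdot> h = pair V v w \<cdot> bng (Dom V h)" using assms by simp
  then show ?A ?B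
    ?C
    ?D
    using pb_pair_simps[of "pair V (sl s) (sr s)" "pair V v w" h "bng (Dom V h)"] assms
    by (auto simp: fib_lift_def fib_def fib_incl_def)
qed

lemma fib_lift_cancel [simp]:
  assumes "is_span V s" "v \<in> Arr V" "w \<in> Arr V" "Dom V v = one" "Dom V w = one"
    "Cod V v = Cod V (sl s)" "Cod V w = Cod V (sr s)"
    "h \<in> Arr V" "Cod V h = Dom V (sl s)" "sl s \<cdot> h = v \<cdot> bng (Dom V h)" "sr s \<cdot> h = w \<cdot> bng (Dom V h)"
    "g \<in> Arr V" "Cod V g = Dom V h"
  shows "fbi s (v, w) \<cdot> (fib_lift V one s (v, w) h \<cdot> g) = h \<cdot> g"
  by (rule Cmp_extend1) (use assms in auto)

text \<open>The fibre is a pullback along an arrow out of the terminal object. Its second projection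
  therefore carries no information, and the first projection alone is monic. Equations between
  elements of entries of \<open>V(1, -)\<close> are all reduced to the apex of the span in this
  way.\<close>

lemma fib_mono:
  assumes "is_span V s" "v \<in> Arr V" "w \<in> Arr V" "Dom V v = one" "Dom V w = one"
    "Cod V v = Cod V (sl s)" "Cod V w = Cod V (sr s)"
    "g \<in> Arr V" "h \<in> Arr V" "Dom V g = Dom V h" "Cod V g = fib V s (v, w)" "Cod V h = fib V s (v, w)"
    "fbi s (v, w) \<cdot> g = fbi s (v, w) \<cdot> h"
  shows "g = h"
proof (rule pb_eqI[of "pair V (sl s) (sr s)" "pair V v w"])
  show "pb2 V (pair V (sl s) (sr s)) (pair V v w) \<cdot> g = pb2 V (pair V (sl s) (sr s)) (pair V v w) \<cdot> h"
    by (rule to_one_unique) (use assms in \<open>auto simp: fib_def\<close>)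
qed (use assms in \<open>auto simp: fib_def fib_incl_def\<close>)

subsection \<open>Matrices\<close>

lemma is_matD [simp]:
  "is_mat small V p \<Longrightarrow> small (msrc p)" "is_mat small V p \<Longrightarrow> small (mtgt p)"
  "\<lbrakk>is_mat small V p; x \<in> msrc p; y \<in> mtgt p\<rbrakk> \<Longrightarrow> ment p (x, y) \<in> Obj V"
  by (auto simp: is_mat_def)

lemma is_matD' [simp]:
  "is_mat small V p \<Longrightarrow> z \<in> msrc p \<times> mtgt p \<Longrightarrow> ment p z \<in> Obj V"
  using is_matD(3)[of p "fst z" "snd z"] by (cases z) simp

lemma mtot_coproduct:
  assumes "is_mat small V p"
  shows "is_coproduct V (msrc p \<times> mtgt p) (ment p) (mtot V p) (mti p)"
  unfolding mtot_def mtot_incl_def by (rule coproduct) (use assms in auto)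

lemma mtot_simps [simp]:
  assumes "is_mat small V p"
  shows "mtot V p \<in> Obj V" "x \<in> msrc p \<Longrightarrow> y \<in> mtgt p \<Longrightarrow> mti p (x, y) \<in> Arr V"
    "x \<in> msrc p \<Longrightarrow> y \<in> mtgt p \<Longrightarrow> Dom V (mti p (x, y)) = ment p (x, y)"
    "x \<in> msrc p \<Longrightarrow> y \<in> mtgt p \<Longrightarrow> Cod V (mti p (x, y)) = mtot V p"
  using is_coproduct_simps[OF mtot_coproduct[OF assms]] by auto

lemma mtot_cotuple_simps:
  assumes "is_mat small V p" "B \<in> Obj V"
    "\<And>x y. x \<in> msrc p \<Longrightarrow> y \<in> mtgt p \<Longrightarrow> g (x, y) \<in> Arr V \<and> Dom V (g (x, y)) = ment p (x, y) \<and> Cod V (g (x, y)) = B"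
  shows "mtot_cotuple V p B g \<in> Arr V" "Dom V (mtot_cotuple V p B g) = mtot V p"
    "Cod V (mtot_cotuple V p B g) = B"
    "x \<in> msrc p \<Longrightarrow> y \<in> mtgt p \<Longrightarrow> mtot_cotuple V p B g \<cdot> mti p (x, y) = g (x, y)"
    "\<lbrakk>x \<in> msrc p; y \<in> mtgt p; e \<in> Arr V; Cod V e = ment p (x, y)\<rbrakk> \<Longrightarrow>
      mtot_cotuple V p B g \<cdot> (mti p (x, y) \<cdot> e) = g (x, y) \<cdot> e"
  unfolding mtot_def mtot_incl_def mtot_cotuple_def
  by (rule cotuple_simps; use assms in auto)+

lemma mtot_eqI:
  assumes "is_mat small V p" "u \<in> Arr V" "v \<in> Arr V" "Dom V u = mtot V p" "Dom V v = mtot V p" "Cod V u = Cod V v"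
    "\<And>x y. x \<in> msrc p \<Longrightarrow> y \<in> mtgt p \<Longrightarrow> u \<cdot> mti p (x, y) = v \<cdot> mti p (x, y)"
  shows "u = v"
  by (rule is_coproduct_eqI[OF mtot_coproduct[OF assms(1)]]) (use assms in auto)

lemma mtot_local_eqI:
  assumes "is_mat small V p" "f \<in> Arr V" "Cod V f = mtot V p" "u \<in> Arr V" "v \<in> Arr V"
    "Dom V u = Dom V f" "Dom V v = Dom V f" "Cod V u = Cod V v"
    "\<And>x y h g. \<lbrakk>x \<in> msrc p; y \<in> mtgt p; h \<in> Arr V; g \<in> Arr V; Dom V g = Dom V h; Cod V h = Dom V f; Cod V g = ment p (x, y); f \<cdot> h = mti p (x, y) \<cdot> g\<rbrakk> \<Longrightarrow> u \<cdot> h = v \<cdot> h"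
  shows "u = v"
  by (rule local_eqI[OF mtot_coproduct[OF assms(1)] _ assms(2-8)]) (use assms(1,9) in auto)

lemma mtot_local_lift:
  assumes "is_mat small V p" "f \<in> Arr V" "Cod V f = mtot V p" "u \<in> Arr V" "m \<in> Arr V" "Dom V u = Dom V f" "Cod V u = Cod V m"
    "\<And>x y h g. \<lbrakk>x \<in> msrc p; y \<in> mtgt p; h \<in> Arr V; g \<in> Arr V; Dom V g = Dom V h; Cod V h = Dom V f; Cod V g = ment p (x, y); f \<cdot> h = mti p (x, y) \<cdot> g\<rbrakk> \<Longrightarrow>
      \<exists>w \<in> Arr V. Dom V w = Dom V h \<and> Cod V w = Dom V m \<and> m \<cdot> w = u \<cdot> h"
  shows "\<exists>w \<in> Arr V. Dom V w = Dom V f \<and> Cod V w = Dom V m \<and> m \<cdot> w = u"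
  by (rule local_lift[OF mtot_coproduct[OF assms(1)] _ assms(2-7)]) (use assms(1,8) in auto)

lemma mtot_disjoint:
  assumes "is_mat small V p" "x \<in> msrc p" "y \<in> mtgt p" "x' \<in> msrc p" "y' \<in> mtgt p"
    "g \<in> Arr V" "Cod V g = ment p (x, y)" "h \<in> Arr V" "Cod V h = ment p (x', y')" "Dom V h = Dom V g"
    "mti p (x, y) \<cdot> g = mti p (x', y') \<cdot> h"
  shows "x = x' \<and> y = y' \<and> g = h \<or> is_initial V (Dom V g)"
  using disjoint[OF mtot_coproduct[OF assms(1)], of "(x, y)" "(x', y')" g h] assms by auto

lemma copow_coproduct: "smalli small I \<Longrightarrow> is_coproduct V I (\<lambda>_. one) (cp I) (cpi I)"
  unfolding copow_def copow_incl_def by (rule coproduct) auto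

lemma copow_simps [simp]:
  assumes "smalli small I"
  shows "cp I \<in> Obj V" "x \<in> I \<Longrightarrow> cpi I x \<in> Arr V"
    "x \<in> I \<Longrightarrow> Dom V (cpi I x) = one" "x \<in> I \<Longrightarrow> Cod V (cpi I x) = cp I"
  using is_coproduct_simps[OF copow_coproduct[OF assms]] by auto

lemma copow_cotuple_simps:
  assumes "smalli small I" "B \<in> Obj V"
    "\<And>x. x \<in> I \<Longrightarrow> g x \<in> Arr V \<and> Dom V (g x) = one \<and> Cod V (g x) = B"
  shows "copow_cotuple V one I B g \<in> Arr V" "Dom V (copow_cotuple V one I B g) = cp I"
    "Cod V (copow_cotuple V one I B g) = B"
    "x \<in> I \<Longrightarrow> copow_cotuple V one I B g \<cdot> cpi I x = g x"
    "\<lbrakk>x \<in> I; e \<in> Arr V; Cod V e = one\<rbrakk> \<Longrightarrow> copow_cotuple V one I B g \<cdot> (cpi I x \<cdot> e) = g x \<cdot> e"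
  unfolding copow_def copow_incl_def copow_cotuple_def
  by (rule cotuple_simps; use assms in auto)+

lemma copow_eqI:
  assumes "smalli small I" "u \<in> Arr V" "v \<in> Arr V" "Dom V u = cp I" "Dom V v = cp I" "Cod V u = Cod V v"
    "\<And>x. x \<in> I \<Longrightarrow> u \<cdot> cpi I x = v \<cdot> cpi I x"
  shows "u = v"
  by (rule is_coproduct_eqI[OF copow_coproduct[OF assms(1)]]) (use assms in auto)

text \<open>Over a domain that is not initial, the index of a constant element of a copower is
  determined. This matches the middle indices in composites of spans.\<close>

lemma copow_disjoint:
  assumes "smalli small I" "x \<in> I" "y \<in> I" "D \<in> Obj V" "cpi I x \<cdot> bng D = cpi I y \<cdot> bng D"
  shows "x = y \<or> is_initial V D"
  using disjoint[OF copow_coproduct[OF assms(1)] assms(1), of x y "bng D" "bng D"] assms by auto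

lemma copow_map_simps [simp]:
  assumes "smalli small I" "smalli small J" "f \<in> I \<rightarrow> J"
  shows "cpm I J f \<in> Arr V" "Dom V (cpm I J f) = cp I"
    "Cod V (cpm I J f) = cp J"
    "x \<in> I \<Longrightarrow> cpm I J f \<cdot> cpi I x = cpi J (f x)" (is "PROP ?A")
    "\<lbrakk>x \<in> I; e \<in> Arr V; Cod V e = one\<rbrakk> \<Longrightarrow> cpm I J f \<cdot> (cpi I x \<cdot> e) = cpi J (f x) \<cdot> e" (is "PROP ?B")
proof -
  have *: "x \<in> I \<Longrightarrow> f x \<in> J" for x using assms(3) by auto
  show "cpm I J f \<in> Arr V" "Dom V (cpm I J f) = cp I"
    "Cod V (cpm I J f) = cp J"
    "PROP ?A"
    "PROP ?B"
    unfolding copow_map_def by (rule copow_cotuple_simps; use assms * in simp)+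
qed

lemma copow_map_PiE [simp]: "f \<in> X \<rightarrow>\<^sub>E Y \<Longrightarrow> f \<in> X \<rightarrow> Y"
  by auto

lemma eps_obj_simps [simp]:
  assumes "A \<in> Obj V"
  shows "eps A \<in> Arr V" "Dom V (eps A) = cp (pts V one A)" "Cod V (eps A) = A"
    "\<lbrakk>v \<in> Arr V; Dom V v = one; Cod V v = A\<rbrakk> \<Longrightarrow> eps A \<cdot> cpi (pts V one A) v = v"
    "\<lbrakk>v \<in> Arr V; Dom V v = one; Cod V v = A; e \<in> Arr V; Cod V e = one\<rbrakk> \<Longrightarrow>
       eps A \<cdot> (cpi (pts V one A) v \<cdot> e) = v \<cdot> e"
  unfolding eps_obj_def by (rule copow_cotuple_simps; use assms in auto)+

subsection \<open>The span of a matrix\<close>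

lemma star_mat_simps [simp]:
  assumes "is_mat small V p"
  shows "sl (sm p) \<in> Arr V" "Dom V (sl (sm p)) = mtot V p" "Cod V (sl (sm p)) = cp (msrc p)"
    "sr (sm p) \<in> Arr V" "Dom V (sr (sm p)) = mtot V p" "Cod V (sr (sm p)) = cp (mtgt p)"
    "x \<in> msrc p \<Longrightarrow> y \<in> mtgt p \<Longrightarrow>
      sl (sm p) \<cdot> mti p (x, y) = cpi (msrc p) x \<cdot> bng (ment p (x, y))"
    "\<lbrakk>x \<in> msrc p; y \<in> mtgt p; e \<in> Arr V; Cod V e = ment p (x, y)\<rbrakk> \<Longrightarrow>
      sl (sm p) \<cdot> (mti p (x, y) \<cdot> e) = cpi (msrc p) x \<cdot> bng (Dom V e)"
    "x \<in> msrc p \<Longrightarrow> y \<in> mtgt p \<Longrightarrow>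
      sr (sm p) \<cdot> mti p (x, y) = cpi (mtgt p) y \<cdot> bng (ment p (x, y))"
    "\<lbrakk>x \<in> msrc p; y \<in> mtgt p; e \<in> Arr V; Cod V e = ment p (x, y)\<rbrakk> \<Longrightarrow>
      sr (sm p) \<cdot> (mti p (x, y) \<cdot> e) = cpi (mtgt p) y \<cdot> bng (Dom V e)"
  unfolding star_mat_def using assms by (simp_all add: mtot_cotuple_simps)

lemma is_span_star_mat [simp]: "is_mat small V p \<Longrightarrow> is_span V (sm p)"
  unfolding is_span_def by simp

lemma apex_star_mat [simp]: "is_mat small V p \<Longrightarrow> apex V (sm p) = mtot V p"
  by (simp add: apex_def)

lemma pts_span_simps [simp]:
  "msrc (psp s) = pts V one (Cod V (sl s))" "mtgt (psp s) = pts V one (Cod V (sr s))"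
  "\<lbrakk>v \<in> Arr V; Dom V v = one; Cod V v = Cod V (sl s); w \<in> Arr V; Dom V w = one; Cod V w = Cod V (sr s)\<rbrakk> \<Longrightarrow>
     ment (psp s) (v, w) = fib V s (v, w)"
  by (simp_all add: pts_span_def)

lemma is_mat_pts_span [simp]: "is_span V s \<Longrightarrow> is_mat small V (psp s)"
  unfolding is_mat_def by (auto simp: pts_span_def)

subsection \<open>2-cells\<close>

abbreviation "mcell \<equiv> is_mcell small V"

lemma mcellD [simp]:
  assumes "mcell \<Phi>"
  shows "is_mat small V (cdom \<Phi>)" "is_mat small V (ccod \<Phi>)"
    "x \<in> msrc (cdom \<Phi>) \<Longrightarrow> msrc (ccod \<Phi>) = S \<Longrightarrow> cleft \<Phi> x \<in> S" (is "PROP ?A") "y \<in> mtgt (cdom \<Phi>) \<Longrightarrow> mtgt (ccod \<Phi>) = S \<Longrightarrow> cright \<Phi> y \<in> S" (is "PROP ?B")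
    "cleft \<Phi> \<in> msrc (cdom \<Phi>) \<rightarrow>\<^sub>E msrc (ccod \<Phi>)" (is ?C) "cright \<Phi> \<in> mtgt (cdom \<Phi>) \<rightarrow>\<^sub>E mtgt (ccod \<Phi>)" (is ?D)
    "x \<in> msrc (cdom \<Phi>) \<Longrightarrow> y \<in> mtgt (cdom \<Phi>) \<Longrightarrow> cmap \<Phi> (x, y) \<in> Arr V" (is "PROP ?E")
    "x \<in> msrc (cdom \<Phi>) \<Longrightarrow> y \<in> mtgt (cdom \<Phi>) \<Longrightarrow> Dom V (cmap \<Phi> (x, y)) = ment (cdom \<Phi>) (x, y)" (is "PROP ?G")
    "x \<in> msrc (cdom \<Phi>) \<Longrightarrow> y \<in> mtgt (cdom \<Phi>) \<Longrightarrow> Cod V (cmap \<Phi> (x, y)) = ment (ccod \<Phi>) (cleft \<Phi> x, cright \<Phi> y)" (is "PROP ?H")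
proof -
  show "is_mat small V (cdom \<Phi>)" "is_mat small V (ccod \<Phi>)"
    "PROP ?A" "PROP ?B"
    ?C ?D
    using assms unfolding is_mcell_def by auto
  have *: "cmap \<Phi> \<in> (\<Pi>\<^sub>E (x, y) \<in> msrc (cdom \<Phi>) \<times> mtgt (cdom \<Phi>).
        Hom V (ment (cdom \<Phi>) (x, y)) (ment (ccod \<Phi>) (cleft \<Phi> x, cright \<Phi> y)))"
    using assms unfolding is_mcell_def by blast
  show "PROP ?E"
    "PROP ?G"
    "PROP ?H"
    using PiE_mem[OF *, of "(x, y)"] by auto
qed

lemma mcell_extensional: "mcell \<Phi> \<Longrightarrow> cmap \<Phi> \<in> extensional (msrc (cdom \<Phi>) \<times> mtgt (cdom \<Phi>))"
  unfolding is_mcell_def PiE_def by blast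

lemma mcellI:
  assumes "is_mat small V (cdom \<Phi>)" "is_mat small V (ccod \<Phi>)"
    "\<And>x. x \<in> msrc (cdom \<Phi>) \<Longrightarrow> cleft \<Phi> x \<in> msrc (ccod \<Phi>)" "\<And>y. y \<in> mtgt (cdom \<Phi>) \<Longrightarrow> cright \<Phi> y \<in> mtgt (ccod \<Phi>)"
    "cleft \<Phi> \<in> extensional (msrc (cdom \<Phi>))" "cright \<Phi> \<in> extensional (mtgt (cdom \<Phi>))"
    "cmap \<Phi> \<in> extensional (msrc (cdom \<Phi>) \<times> mtgt (cdom \<Phi>))"
    "\<And>x y. x \<in> msrc (cdom \<Phi>) \<Longrightarrow> y \<in> mtgt (cdom \<Phi>) \<Longrightarrow>
       cmap \<Phi> (x, y) \<in> Arr V \<and> Dom V (cmap \<Phi> (x, y)) = ment (cdom \<Phi>) (x, y) \<and> Cod V (cmap \<Phi> (x, y)) = ment (ccod \<Phi>) (cleft \<Phi> x, cright \<Phi> y)"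
  shows "mcell \<Phi>"
  unfolding is_mcell_def using assms by (auto simp: PiE_def)

text \<open>Boundary functions and components are extensional functions, so equality of the records
  reduces to equality on the index sets.\<close>

lemma mcell_eqI:
  assumes "mcell \<Phi>" "mcell \<Psi>" "cdom \<Phi> = cdom \<Psi>" "ccod \<Phi> = ccod \<Psi>"
    "\<And>x. x \<in> msrc (cdom \<Psi>) \<Longrightarrow> cleft \<Phi> x = cleft \<Psi> x" "\<And>y. y \<in> mtgt (cdom \<Psi>) \<Longrightarrow> cright \<Phi> y = cright \<Psi> y"
    "\<And>x y. x \<in> msrc (cdom \<Psi>) \<Longrightarrow> y \<in> mtgt (cdom \<Psi>) \<Longrightarrow> cmap \<Phi> (x, y) = cmap \<Psi> (x, y)"
  shows "\<Phi> = \<Psi>"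
proof (rule mcell.equality)
  show "cleft \<Phi> = cleft \<Psi>"
    using PiE_ext[OF mcellD(5)[OF assms(1), unfolded assms(3,4)] mcellD(5)[OF assms(2)]] assms(5) by blast
  show "cright \<Phi> = cright \<Psi>"
    using PiE_ext[OF mcellD(6)[OF assms(1), unfolded assms(3,4)] mcellD(6)[OF assms(2)]] assms(6) by blast
  have "cmap \<Phi> \<in> extensional (msrc (cdom \<Psi>) \<times> mtgt (cdom \<Psi>))" "cmap \<Psi> \<in> extensional (msrc (cdom \<Psi>) \<times> mtgt (cdom \<Psi>))"
    using mcell_extensional[OF assms(1)] mcell_extensional[OF assms(2)] assms(3) by simp_all
  then show "cmap \<Phi> = cmap \<Psi>"
    by (rule extensionalityI) (use assms(7) in auto)
qed (use assms in auto)

lemma mcid_simps [simp]: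
  "cdom (mcid V p) = p" "ccod (mcid V p) = p" "x \<in> msrc p \<Longrightarrow> cleft (mcid V p) x = x" "y \<in> mtgt p \<Longrightarrow> cright (mcid V p) y = y"
  "x \<in> msrc p \<Longrightarrow> y \<in> mtgt p \<Longrightarrow> cmap (mcid V p) (x, y) = Ident V (ment p (x, y))"
  by (simp_all add: mcid_def)

lemma mcell_mcid [simp]: "is_mat small V p \<Longrightarrow> mcell (mcid V p)"
  by (rule mcellI) (auto simp: mcid_def)

lemma vcomp_simps [simp]:
  "cdom (vcomp V \<Psi> \<Phi>) = cdom \<Phi>" "ccod (vcomp V \<Psi> \<Phi>) = ccod \<Psi>"
  "x \<in> msrc (cdom \<Phi>) \<Longrightarrow> cleft (vcomp V \<Psi> \<Phi>) x = cleft \<Psi> (cleft \<Phi> x)"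
  "y \<in> mtgt (cdom \<Phi>) \<Longrightarrow> cright (vcomp V \<Psi> \<Phi>) y = cright \<Psi> (cright \<Phi> y)"
  "x \<in> msrc (cdom \<Phi>) \<Longrightarrow> y \<in> mtgt (cdom \<Phi>) \<Longrightarrow> cmap (vcomp V \<Psi> \<Phi>) (x, y) = cmap \<Psi> (cleft \<Phi> x, cright \<Phi> y) \<cdot> cmap \<Phi> (x, y)"
  by (simp_all add: vcomp_def compose_eq)

lemma mcell_vcomp [simp]: "\<lbrakk>mcell \<Phi>; mcell \<Psi>; ccod \<Phi> = cdom \<Psi>\<rbrakk> \<Longrightarrow> mcell (vcomp V \<Psi> \<Phi>)"
  by (rule mcellI) (auto simp: vcomp_def compose_eq compose_extensional)

lemma mcomp_simps [simp]:
  "msrc (mcomp V q p) = msrc p" "mtgt (mcomp V q p) = mtgt q"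
  by (simp_all add: mcomp_def)

lemma mcomp_coproduct:
  assumes "is_mat small V p" "is_mat small V q" "msrc q = mtgt p" "x \<in> msrc p" "z \<in> mtgt q"
  shows "is_coproduct V (mtgt p) (\<lambda>y. prd V (ment q (y, z)) (ment p (x, y))) (ment (mcomp V q p) (x, z)) (\<lambda>y. mci q p x y z)"
proof -
  have "is_coproduct V (mtgt p) (mcomp_fam V q p x z) (coprod V (mtgt p) (mcomp_fam V q p x z)) (incl V (mtgt p) (mcomp_fam V q p x z))"
    by (rule coproduct) (use assms in \<open>auto simp: mcomp_fam_def\<close>)
  then show ?thesis using assms by (simp add: mcomp_def mincl_def[abs_def] mcomp_fam_def[abs_def])
qed

lemma is_mat_mcomp [simp]:
  assumes "is_mat small V p" "is_mat small V q" "msrc q = mtgt p"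
  shows "is_mat small V (mcomp V q p)"
proof -
  have "ment (mcomp V q p) (x, z) \<in> Obj V" if "x \<in> msrc p" "z \<in> mtgt q" for x z
    using is_coproduct_simps(1)[OF mcomp_coproduct[OF assms that]] .
  moreover have "ment (mcomp V q p) \<in> extensional (msrc p \<times> mtgt q)" by (simp add: mcomp_def)
  ultimately show ?thesis using assms(1,2) unfolding is_mat_def PiE_def by auto
qed

lemma mincl_simps [simp]:
  assumes "is_mat small V p" "is_mat small V q" "msrc q = mtgt p" "x \<in> msrc p" "y \<in> mtgt p" "z \<in> mtgt q"
  shows "mci q p x y z \<in> Arr V" "Dom V (mci q p x y z) = prd V (ment q (y, z)) (ment p (x, y))"
    "Cod V (mci q p x y z) = ment (mcomp V q p) (x, z)"
  using is_coproduct_simps[OF mcomp_coproduct[OF assms(1-4,6)]] assms(5) by auto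

lemma mcomp_cotuple_simps:
  assumes "is_mat small V p" "is_mat small V q" "msrc q = mtgt p" "x \<in> msrc p" "z \<in> mtgt q" "B \<in> Obj V"
    "\<And>y. y \<in> mtgt p \<Longrightarrow> g y \<in> Arr V \<and> Dom V (g y) = prd V (ment q (y, z)) (ment p (x, y)) \<and> Cod V (g y) = B"
  shows "cotuple V (mtgt p) (mcomp_fam V q p x z) B g \<in> Arr V"
    "Dom V (cotuple V (mtgt p) (mcomp_fam V q p x z) B g) = ment (mcomp V q p) (x, z)"
    "Cod V (cotuple V (mtgt p) (mcomp_fam V q p x z) B g) = B"
    "y \<in> mtgt p \<Longrightarrow> cotuple V (mtgt p) (mcomp_fam V q p x z) B g \<cdot> mci q p x y z = g y"
    "\<lbrakk>y \<in> mtgt p; e \<in> Arr V; Cod V e = prd V (ment q (y, z)) (ment p (x, y))\<rbrakk> \<Longrightarrow>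
      cotuple V (mtgt p) (mcomp_fam V q p x z) B g \<cdot> (mci q p x y z \<cdot> e) = g y \<cdot> e"
  using cotuple_simps[of "mtgt p" B g "mcomp_fam V q p x z"] assms
  by (simp_all add: mincl_def mcomp_def mcomp_fam_def)

text \<open>Each summand of a composite entry is a product, tested on its universal element, the
  pair of its projections. Quantifying over all pairs \<open>g\<close>, \<open>h\<close> gives the
  shape in which horizontal composites are evaluated.\<close>

lemma mcomp_eqI:
  assumes "is_mat small V p" "is_mat small V q" "msrc q = mtgt p" "x \<in> msrc p" "z \<in> mtgt q"
    "u \<in> Arr V" "v \<in> Arr V" "Dom V u = ment (mcomp V q p) (x, z)" "Dom V v = ment (mcomp V q p) (x, z)" "Cod V u = Cod V v"
    "\<And>y h g. \<lbrakk>y \<in> mtgt p; g \<in> Arr V; h \<in> Arr V; Dom V g = Dom V h; Cod V g = ment q (y, z); Cod V h = ment p (x, y)\<rbrakk> \<Longrightarrow>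
       u \<cdot> (mci q p x y z \<cdot> pair V g h) = v \<cdot> (mci q p x y z \<cdot> pair V g h)"
  shows "u = v"
proof (rule is_coproduct_eqI[OF mcomp_coproduct[OF assms(1-5)] assms(6-10)])
  fix y assume y: "y \<in> mtgt p"
  let ?A = "ment q (y, z)" and ?B = "ment p (x, y)"
  have o: "?A \<in> Obj V" "?B \<in> Obj V" using y assms by auto
  have "pair V (pr1 V ?A ?B) (pr2 V ?A ?B) = Ident V (prd V ?A ?B)"
    using pair_pr[of ?A ?B "Ident V (prd V ?A ?B)"] o by simp
  then show "u \<cdot> mci q p x y z = v \<cdot> mci q p x y z"
    using assms(11)[OF y, of "pr1 V ?A ?B" "pr2 V ?A ?B"] o y assms(1-5) by simp
qed

lemma mcomp_local_eqI:
  assumes "is_mat small V p" "is_mat small V q" "msrc q = mtgt p" "x \<in> msrc p" "z \<in> mtgt q"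
    "f \<in> Arr V" "Cod V f = ment (mcomp V q p) (x, z)"
    "u \<in> Arr V" "v \<in> Arr V" "Dom V u = Dom V f" "Dom V v = Dom V f" "Cod V u = Cod V v"
    "\<And>y k g h. \<lbrakk>y \<in> mtgt p; k \<in> Arr V; g \<in> Arr V; h \<in> Arr V; Dom V g = Dom V k; Dom V h = Dom V k; Cod V k = Dom V f; Cod V g = ment q (y, z); Cod V h = ment p (x, y); f \<cdot> k = mci q p x y z \<cdot> pair V g h\<rbrakk> \<Longrightarrow> u \<cdot> k = v \<cdot> k"
  shows "u = v"
proof (rule local_eqI[OF mcomp_coproduct[OF assms(1-5)] _ assms(6-12)])
  fix y k g assume 1: "y \<in> mtgt p" "k \<in> Arr V" "g \<in> Arr V" "Dom V g = Dom V k" "Cod V k = Dom V f"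
    "Cod V g = prd V (ment q (y, z)) (ment p (x, y))" "f \<cdot> k = mci q p x y z \<cdot> g"
  let ?A = "ment q (y, z)" and ?B = "ment p (x, y)"
  have o: "?A \<in> Obj V" "?B \<in> Obj V" using 1 assms by auto
  show "u \<cdot> k = v \<cdot> k"
    by (rule assms(13)[of y k "pr1 V ?A ?B \<cdot> g" "pr2 V ?A ?B \<cdot> g"]) (use 1 o in \<open>auto simp: pair_pr simp del: pair_Cmp\<close>)
qed (use assms in auto)

lemma hcomp_simps [simp]:
  "cdom (hcomp V \<Psi> \<Phi>) = mcomp V (cdom \<Psi>) (cdom \<Phi>)" "ccod (hcomp V \<Psi> \<Phi>) = mcomp V (ccod \<Psi>) (ccod \<Phi>)"
  "cleft (hcomp V \<Psi> \<Phi>) = cleft \<Phi>" "cright (hcomp V \<Psi> \<Phi>) = cright \<Psi>"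
  by (simp_all add: hcomp_def)

lemma hcomp_cmap:
  assumes "mcell \<Phi>" "mcell \<Psi>" "msrc (cdom \<Psi>) = mtgt (cdom \<Phi>)" "msrc (ccod \<Psi>) = mtgt (ccod \<Phi>)"
    "\<And>y. y \<in> mtgt (cdom \<Phi>) \<Longrightarrow> cleft \<Psi> y = cright \<Phi> y" "x \<in> msrc (cdom \<Phi>)" "z \<in> mtgt (cdom \<Psi>)"
  shows "cmap (hcomp V \<Psi> \<Phi>) (x, z) \<in> Arr V" (is ?A)
    "Dom V (cmap (hcomp V \<Psi> \<Phi>) (x, z)) = ment (mcomp V (cdom \<Psi>) (cdom \<Phi>)) (x, z)" (is ?C)
    "Cod V (cmap (hcomp V \<Psi> \<Phi>) (x, z)) = ment (mcomp V (ccod \<Psi>) (ccod \<Phi>)) (cleft \<Phi> x, cright \<Psi> z)"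
    "\<lbrakk>y \<in> mtgt (cdom \<Phi>); g \<in> Arr V; h \<in> Arr V; Dom V g = Dom V h; Cod V g = ment (cdom \<Psi>) (y, z); Cod V h = ment (cdom \<Phi>) (x, y)\<rbrakk> \<Longrightarrow>
      cmap (hcomp V \<Psi> \<Phi>) (x, z) \<cdot> (mci (cdom \<Psi>) (cdom \<Phi>) x y z \<cdot> pair V g h) =
      mci (ccod \<Psi>) (ccod \<Phi>) (cleft \<Phi> x) (cright \<Phi> y) (cright \<Psi> z) \<cdot> pair V (cmap \<Psi> (y, z) \<cdot> g) (cmap \<Phi> (x, y) \<cdot> h)"
proof -
  let ?B = "ment (mcomp V (ccod \<Psi>) (ccod \<Phi>)) (cleft \<Phi> x, cright \<Psi> z)"
  let ?g = "\<lambda>y. mci (ccod \<Psi>) (ccod \<Phi>) (cleft \<Phi> x) (cright \<Phi> y) (cright \<Psi> z) \<cdot> prd_map V (cmap \<Psi> (y, z)) (cmap \<Phi> (x, y))"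
  have lr: "y \<in> mtgt (cdom \<Phi>) \<Longrightarrow> cright \<Phi> y \<in> mtgt (ccod \<Phi>)" for y using assms by auto
  have B: "?B \<in> Obj V" using assms lr by (intro is_matD(3)[OF is_mat_mcomp]) auto
  have eq: "cmap (hcomp V \<Psi> \<Phi>) (x, z) = cotuple V (mtgt (cdom \<Phi>)) (mcomp_fam V (cdom \<Psi>) (cdom \<Phi>) x z) ?B ?g"
    using assms by (simp add: hcomp_def)
  have g: "?g y \<in> Arr V \<and> Dom V (?g y) = prd V (ment (cdom \<Psi>) (y, z)) (ment (cdom \<Phi>) (x, y)) \<and> Cod V (?g y) = ?B" if "y \<in> mtgt (cdom \<Phi>)" for y
    using that assms lr by simp
  note * = mcomp_cotuple_simps[of "cdom \<Phi>" "cdom \<Psi>" x z ?B ?g, OF _ _ _ _ _ B g]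
  show ?A
    ?C
    "Cod V (cmap (hcomp V \<Psi> \<Phi>) (x, z)) = ?B"
    unfolding eq using * assms by simp_all
  assume "y \<in> mtgt (cdom \<Phi>)" "g \<in> Arr V" "h \<in> Arr V" "Dom V g = Dom V h"
      "Cod V g = ment (cdom \<Psi>) (y, z)" "Cod V h = ment (cdom \<Phi>) (x, y)"
  then show "cmap (hcomp V \<Psi> \<Phi>) (x, z) \<cdot> (mci (cdom \<Psi>) (cdom \<Phi>) x y z \<cdot> pair V g h) =
      mci (ccod \<Psi>) (ccod \<Phi>) (cleft \<Phi> x) (cright \<Phi> y) (cright \<Psi> z) \<cdot> pair V (cmap \<Psi> (y, z) \<cdot> g) (cmap \<Phi> (x, y) \<cdot> h)"
    unfolding eq using * assms lr by simp
qed

lemma mcell_hcomp: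
  assumes "mcell \<Phi>" "mcell \<Psi>" "msrc (cdom \<Psi>) = mtgt (cdom \<Phi>)" "msrc (ccod \<Psi>) = mtgt (ccod \<Phi>)"
    "\<And>y. y \<in> mtgt (cdom \<Phi>) \<Longrightarrow> cleft \<Psi> y = cright \<Phi> y"
  shows "mcell (hcomp V \<Psi> \<Phi>)"
proof (rule mcellI)
  show "cmap (hcomp V \<Psi> \<Phi>) \<in> extensional (msrc (cdom (hcomp V \<Psi> \<Phi>)) \<times> mtgt (cdom (hcomp V \<Psi> \<Phi>)))"
    by (simp add: hcomp_def)
  show "cleft (hcomp V \<Psi> \<Phi>) \<in> extensional (msrc (cdom (hcomp V \<Psi> \<Phi>)))" "cright (hcomp V \<Psi> \<Phi>) \<in> extensional (mtgt (cdom (hcomp V \<Psi> \<Phi>)))"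
    using mcellD(5)[OF assms(1)] mcellD(6)[OF assms(2)] by (simp_all add: PiE_def)
qed (use assms hcomp_cmap[OF assms] in auto)

subsection \<open>Unit matrices, unitors and associators\<close>

lemma eqv_same [simp]: "eqv x x = {()}"
  by (auto simp: eqv_def)

lemma eqv_diff [simp]: "x \<noteq> y \<Longrightarrow> eqv x y = {}"
  by (auto simp: eqv_def)

lemma munit_simps [simp]:
  "msrc (munit V one X) = X" "mtgt (munit V one X) = X"
  "x \<in> X \<Longrightarrow> y \<in> X \<Longrightarrow> ment (munit V one X) (x, y) = cp (eqv x y)"
  by (simp_all add: munit_def)

lemma is_mat_munit [simp]: "small X \<Longrightarrow> is_mat small V (munit V one X)"
  unfolding is_mat_def by (auto simp: munit_def)

text \<open>A copower by a one-element set is terminal again: after splitting along its only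
  summand, both sides agree because the remaining factor ends in the terminal object.\<close>

lemma to_copow_singleton:
  assumes "g \<in> Arr V" "Cod V g = cp {()}"
  shows "g = cpi {()} () \<cdot> bng (Dom V g)"
proof (rule local_eqI[OF copow_coproduct[of "{()}"], of g])
  fix i h k assume "i \<in> {()}" "h \<in> Arr V" "k \<in> Arr V" "Dom V k = Dom V h" "Cod V h = Dom V g"
       "Cod V k = one" "g \<cdot> h = cpi {()} i \<cdot> k"
  moreover then have "k = bng (Dom V h)" by (intro to_one_unique) auto
  ultimately show "g \<cdot> h = (cpi {()} () \<cdot> bng (Dom V g)) \<cdot> h" using assms by simp
qed (use assms in auto)

lemma copow_empty_initial [simp]: "is_initial V (cp {})"
  by (simp add: copow_def ex_initial)

lemma to_copow_empty:
  assumes "g \<in> Arr V" "Cod V g = cp {}"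
  shows "is_initial V (Dom V g)"
  by (rule strict_initial[OF copow_empty_initial]) (use assms in auto)

text \<open>Off the diagonal the entry of the unit matrix is an empty copower, hence initial, and by
  strictness so is the domain of any arrow into it.\<close>

lemma to_munit_cases:
  assumes "x \<in> X" "y \<in> X" "g \<in> Arr V" "Cod V g = ment (munit V one X) (x, y)"
  obtains "x = y" "g = cpi {()} () \<cdot> bng (Dom V g)" | "is_initial V (Dom V g)"
proof (cases "x = y")
  case True
  then show ?thesis using that(1) to_copow_singleton[of g] assms by simp
next
  case False
  then have "Cod V g = cp (eqv x y)" using assms by simp
  then have "Cod V g = cp ({} :: Product_Type.unit set)" using False by simp
  then show ?thesis by (rule that(2)[OF to_copow_empty[OF assms(3)]])
qed

text \<open>The definition prescribes the unitor on the diagonal summand alone. The other summands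
  are products with an initial object, hence initial by strictness, so that an arrow with the
  prescribed restriction exists and is unique. The same reasoning applies to
  \<open>runitor_cmap\<close>.\<close>

lemma lunitor_cmap:
  assumes p: "is_mat small V p" and x: "x \<in> msrc p" and y: "y \<in> mtgt p"
  shows "cmap (lunitor V one p) (x, y) \<in> Arr V" (is ?A) "Dom V (cmap (lunitor V one p) (x, y)) = ment (mcomp V (munit V one (mtgt p)) p) (x, y)"
    "Cod V (cmap (lunitor V one p) (x, y)) = ment p (x, y)"
    "\<lbrakk>g \<in> Arr V; h \<in> Arr V; Dom V g = Dom V h; Cod V g = cp {()}; Cod V h = ment p (x, y)\<rbrakk> \<Longrightarrow>
      cmap (lunitor V one p) (x, y) \<cdot> (mci (munit V one (mtgt p)) p x y y \<cdot> pair V g h) = h"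
proof -
  let ?I = "munit V one (mtgt p)" and ?B = "ment p (x, y)"
  have I: "is_mat small V ?I" using p by simp
  have B: "?B \<in> Obj V" using p x y by simp
  let ?D = "\<lambda>y'. prd V (ment ?I (y', y)) (ment p (x, y'))"
  have init: "is_initial V (?D y')" if "y' \<in> mtgt p" "y' \<noteq> y" for y'
    using strict_initial[of "cp ({} :: Product_Type.unit set)" "pr1 V (ment ?I (y', y)) (ment p (x, y'))"] that p x y by simp
  have "\<exists>f. f \<in> Arr V \<and> Dom V f = ?D y' \<and> Cod V f = ?B" if "y' \<in> mtgt p" "y' \<noteq> y" for y'
    using is_initial_arrow[OF init[OF that] B] by blast
  then obtain f where f: "\<And>y'. y' \<in> mtgt p \<Longrightarrow> y' \<noteq> y \<Longrightarrow> f y' \<in> Arr V \<and> Dom V (f y') = ?D y' \<and> Cod V (f y') = ?B" by metis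
  define c where "c = (\<lambda>y'. if y' = y then pr2 V (cp {()}) ?B else f y')"
  let ?u = "cotuple V (mtgt p) (mcomp_fam V ?I p x y) ?B c"
  have c: "y' \<in> mtgt p \<Longrightarrow> c y' \<in> Arr V \<and> Dom V (c y') = ?D y' \<and> Cod V (c y') = ?B" for y'
    using f x y p by (simp add: c_def)
  have u: "?u \<in> Arr V" "Dom V ?u = ment (mcomp V ?I p) (x, y)" "Cod V ?u = ?B" "?u \<cdot> mci ?I p x y y = pr2 V (cp {()}) ?B"
    using mcomp_cotuple_simps[of p ?I x y ?B c, OF p I _ x _ B c] y by (simp_all add: c_def)
  have uniq: "v = ?u" if v: "v \<in> Arr V" "Dom V v = ment (mcomp V ?I p) (x, y)" "Cod V v = ?B" "v \<cdot> mci ?I p x y y = pr2 V (cp {()}) ?B" for v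
  proof (rule is_coproduct_eqI[OF mcomp_coproduct[OF p I _ x]])
    fix y' assume y': "y' \<in> mtgt p"
    show "v \<cdot> mci ?I p x y' y = ?u \<cdot> mci ?I p x y' y"
    proof (cases "y' = y")
      case False
      show ?thesis by (rule is_initial_unique[OF init[OF y' False]]) (use u v y y' p x in auto)
    qed (use u v in simp)
  qed (use u v y in auto)
  have "cmap (lunitor V one p) (x, y) = (THE u. u \<in> Hom V (ment (mcomp V ?I p) (x, y)) ?B \<and>
         u \<cdot> mci ?I p x y y = pr2 V (ment ?I (y, y)) ?B)"
    using x y by (simp add: lunitor_def)
  also have "\<dots> = ?u"
    by (rule the_equality, (use u y in simp)[1], rule uniq) (use y in auto)
  finally have eq: "cmap (lunitor V one p) (x, y) = ?u" .
  show ?A "Dom V (cmap (lunitor V one p) (x, y)) = ment (mcomp V ?I p) (x, y)"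
    "Cod V (cmap (lunitor V one p) (x, y)) = ?B" using u eq by simp_all
  assume *: "g \<in> Arr V" "h \<in> Arr V" "Dom V g = Dom V h" "Cod V g = cp {()}" "Cod V h = ment p (x, y)"
  have "?u \<cdot> (mci ?I p x y y \<cdot> pair V g h) = pr2 V (cp {()}) ?B \<cdot> pair V g h"
    by (rule Cmp_extend1[OF u(4)]) (use * u x y p in auto)
  then show "cmap (lunitor V one p) (x, y) \<cdot> (mci ?I p x y y \<cdot> pair V g h) = h" using eq * by simp
qed

lemma runitor_cmap:
  assumes p: "is_mat small V p" and x: "x \<in> msrc p" and y: "y \<in> mtgt p"
  shows "cmap (runitor V one p) (x, y) \<in> Arr V" (is ?A) "Dom V (cmap (runitor V one p) (x, y)) = ment (mcomp V p (munit V one (msrc p))) (x, y)"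
    "Cod V (cmap (runitor V one p) (x, y)) = ment p (x, y)"
    "\<lbrakk>g \<in> Arr V; h \<in> Arr V; Dom V g = Dom V h; Cod V h = cp {()}; Cod V g = ment p (x, y)\<rbrakk> \<Longrightarrow>
      cmap (runitor V one p) (x, y) \<cdot> (mci p (munit V one (msrc p)) x x y \<cdot> pair V g h) = g"
proof -
  let ?I = "munit V one (msrc p)" and ?B = "ment p (x, y)"
  have I: "is_mat small V ?I" using p by simp
  have B: "?B \<in> Obj V" using p x y by simp
  let ?D = "\<lambda>x'. prd V (ment p (x', y)) (ment ?I (x, x'))"
  have init: "is_initial V (?D x')" if "x' \<in> msrc p" "x' \<noteq> x" for x'
    using strict_initial[of "cp ({} :: Product_Type.unit set)" "pr2 V (ment p (x', y)) (ment ?I (x, x'))"] that p x y by simp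
  have "\<exists>f. f \<in> Arr V \<and> Dom V f = ?D x' \<and> Cod V f = ?B" if "x' \<in> msrc p" "x' \<noteq> x" for x'
    using is_initial_arrow[OF init[OF that] B] by blast
  then obtain f where f: "\<And>x'. x' \<in> msrc p \<Longrightarrow> x' \<noteq> x \<Longrightarrow> f x' \<in> Arr V \<and> Dom V (f x') = ?D x' \<and> Cod V (f x') = ?B" by metis
  define c where "c = (\<lambda>x'. if x' = x then pr1 V ?B (cp {()}) else f x')"
  let ?u = "cotuple V (msrc p) (mcomp_fam V p ?I x y) ?B c"
  have c: "x' \<in> msrc p \<Longrightarrow> c x' \<in> Arr V \<and> Dom V (c x') = ?D x' \<and> Cod V (c x') = ?B" for x'
    using f x y p by (simp add: c_def)
  have u: "?u \<in> Arr V" "Dom V ?u = ment (mcomp V p ?I) (x, y)" "Cod V ?u = ?B" "?u \<cdot> mci p ?I x x y = pr1 V ?B (cp {()})"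
    using mcomp_cotuple_simps[of ?I p x y ?B c, OF I p _ _ y B] c x by (simp_all add: c_def)
  have uniq: "v = ?u" if v: "v \<in> Arr V" "Dom V v = ment (mcomp V p ?I) (x, y)" "Cod V v = ?B" "v \<cdot> mci p ?I x x y = pr1 V ?B (cp {()})" for v
  proof (rule is_coproduct_eqI[OF mcomp_coproduct[OF I p _ _ y]])
    fix x' assume x': "x' \<in> mtgt ?I"
    show "v \<cdot> mci p ?I x x' y = ?u \<cdot> mci p ?I x x' y"
    proof (cases "x' = x")
      case False
      show ?thesis by (rule is_initial_unique[OF init[OF _ False]]) (use u v y x' p x in auto)
    qed (use u v in simp)
  qed (use u v x in auto)
  have "cmap (runitor V one p) (x, y) = (THE u. u \<in> Hom V (ment (mcomp V p ?I) (x, y)) ?B \<and>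
         u \<cdot> mci p ?I x x y = pr1 V ?B (ment ?I (x, x)))"
    using x y by (simp add: runitor_def)
  also have "\<dots> = ?u"
    by (rule the_equality, (use u x in simp)[1], rule uniq) (use x in auto)
  finally have eq: "cmap (runitor V one p) (x, y) = ?u" .
  show ?A "Dom V (cmap (runitor V one p) (x, y)) = ment (mcomp V p ?I) (x, y)"
    "Cod V (cmap (runitor V one p) (x, y)) = ?B" using u eq by simp_all
  assume *: "g \<in> Arr V" "h \<in> Arr V" "Dom V g = Dom V h" "Cod V h = cp {()}" "Cod V g = ment p (x, y)"
  have "?u \<cdot> (mci p ?I x x y \<cdot> pair V g h) = pr1 V ?B (cp {()}) \<cdot> pair V g h"
    by (rule Cmp_extend1[OF u(4)]) (use * u x y p in auto)
  then show "cmap (runitor V one p) (x, y) \<cdot> (mci p ?I x x y \<cdot> pair V g h) = g" using eq * by simp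
qed

lemma lunitor_simps [simp]:
  "cdom (lunitor V one p) = mcomp V (munit V one (mtgt p)) p" "ccod (lunitor V one p) = p"
  "x \<in> msrc p \<Longrightarrow> cleft (lunitor V one p) x = x" "y \<in> mtgt p \<Longrightarrow> cright (lunitor V one p) y = y"
  by (simp_all add: lunitor_def)

lemma runitor_simps [simp]:
  "cdom (runitor V one p) = mcomp V p (munit V one (msrc p))" "ccod (runitor V one p) = p"
  "x \<in> msrc p \<Longrightarrow> cleft (runitor V one p) x = x" "y \<in> mtgt p \<Longrightarrow> cright (runitor V one p) y = y"
  by (simp_all add: runitor_def)

lemma mcell_lunitor [simp]: "is_mat small V p \<Longrightarrow> mcell (lunitor V one p)"
  by (rule mcellI) (use lunitor_cmap[of p] in \<open>auto simp: lunitor_def\<close>)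

lemma mcell_runitor [simp]: "is_mat small V p \<Longrightarrow> mcell (runitor V one p)"
  by (rule mcellI) (use runitor_cmap[of p] in \<open>auto simp: runitor_def\<close>)

text \<open>The outer sum is tested first. The second component of the resulting pair is an arrow
  into an entry of \<open>q \<odot> p\<close>, and it is split in turn, at the cost of restricting
  the other component along the splitting.\<close>

lemma mcomp3_eqI_right:
  assumes m: "is_mat small V p" "is_mat small V q" "is_mat small V r" "msrc q = mtgt p" "msrc r = mtgt q" "x \<in> msrc p" "w \<in> mtgt r"
    and uv: "u \<in> Arr V" "v \<in> Arr V" "Dom V u = ment (mcomp V r (mcomp V q p)) (x, w)" "Dom V v = ment (mcomp V r (mcomp V q p)) (x, w)" "Cod V u = Cod V v"
    and eq: "\<And>y z a b c. \<lbrakk>y \<in> mtgt p; z \<in> mtgt q; a \<in> Arr V; b \<in> Arr V; c \<in> Arr V; Dom V a = Dom V c; Dom V b = Dom V c; Cod V a = ment r (z, w); Cod V b = ment q (y, z); Cod V c = ment p (x, y)\<rbrakk> \<Longrightarrow>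
      u \<cdot> (mci r (mcomp V q p) x z w \<cdot> pair V a (mci q p x y z \<cdot> pair V b c)) = v \<cdot> (mci r (mcomp V q p) x z w \<cdot> pair V a (mci q p x y z \<cdot> pair V b c))"
  shows "u = v"
proof (rule mcomp_eqI[OF _ m(3) _ _ m(7) uv])
  fix z a f assume 1: "z \<in> mtgt (mcomp V q p)" "a \<in> Arr V" "f \<in> Arr V" "Dom V a = Dom V f" "Cod V a = ment r (z, w)" "Cod V f = ment (mcomp V q p) (x, z)"
  show "u \<cdot> (mci r (mcomp V q p) x z w \<cdot> pair V a f) = v \<cdot> (mci r (mcomp V q p) x z w \<cdot> pair V a f)"
  proof (rule mcomp_local_eqI[OF m(1,2,4,6) _ 1(3,6)])
    fix y k b c assume 2: "y \<in> mtgt p" "k \<in> Arr V" "b \<in> Arr V" "c \<in> Arr V" "Dom V b = Dom V k" "Dom V c = Dom V k" "Cod V k = Dom V f"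
       "Cod V b = ment q (y, z)" "Cod V c = ment p (x, y)" and 3: "f \<cdot> k = mci q p x y z \<cdot> pair V b c"
    show "(u \<cdot> (mci r (mcomp V q p) x z w \<cdot> pair V a f)) \<cdot> k = (v \<cdot> (mci r (mcomp V q p) x z w \<cdot> pair V a f)) \<cdot> k"
      using eq[of y z "a \<cdot> k" b c] 1 2 3 m uv by simp
  qed (use 1 m uv in auto)
qed (use m in auto)

lemma mcomp3_eqI_left:
  assumes m: "is_mat small V p" "is_mat small V q" "is_mat small V r" "msrc q = mtgt p" "msrc r = mtgt q" "x \<in> msrc p" "w \<in> mtgt r"
    and uv: "u \<in> Arr V" "v \<in> Arr V" "Dom V u = ment (mcomp V (mcomp V r q) p) (x, w)" "Dom V v = ment (mcomp V (mcomp V r q) p) (x, w)" "Cod V u = Cod V v"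
    and eq: "\<And>y z a b c. \<lbrakk>y \<in> mtgt p; z \<in> mtgt q; a \<in> Arr V; b \<in> Arr V; c \<in> Arr V; Dom V a = Dom V c; Dom V b = Dom V c; Cod V a = ment r (z, w); Cod V b = ment q (y, z); Cod V c = ment p (x, y)\<rbrakk> \<Longrightarrow>
      u \<cdot> (mci (mcomp V r q) p x y w \<cdot> pair V (mci r q y z w \<cdot> pair V a b) c) = v \<cdot> (mci (mcomp V r q) p x y w \<cdot> pair V (mci r q y z w \<cdot> pair V a b) c)"
  shows "u = v"
proof (rule mcomp_eqI[OF m(1) _ _ m(6) _ uv])
  fix y f c assume 1: "y \<in> mtgt p" "f \<in> Arr V" "c \<in> Arr V" "Dom V f = Dom V c" "Cod V f = ment (mcomp V r q) (y, w)" "Cod V c = ment p (x, y)"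
  show "u \<cdot> (mci (mcomp V r q) p x y w \<cdot> pair V f c) = v \<cdot> (mci (mcomp V r q) p x y w \<cdot> pair V f c)"
  proof (rule mcomp_local_eqI[OF m(2,3,5) _ m(7) 1(2,5)])
    fix z k a b assume 2: "z \<in> mtgt q" "k \<in> Arr V" "a \<in> Arr V" "b \<in> Arr V" "Dom V a = Dom V k" "Dom V b = Dom V k" "Cod V k = Dom V f"
       "Cod V a = ment r (z, w)" "Cod V b = ment q (y, z)" and 3: "f \<cdot> k = mci r q y z w \<cdot> pair V a b"
    show "(u \<cdot> (mci (mcomp V r q) p x y w \<cdot> pair V f c)) \<cdot> k = (v \<cdot> (mci (mcomp V r q) p x y w \<cdot> pair V f c)) \<cdot> k"
      using eq[of y z a b "c \<cdot> k"] 1 2 3 m uv by simp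
  qed (use 1 m uv in auto)
qed (use m in auto)

text \<open>By distributivity both bracketings are coproducts of triple products, indexed by the
  pairs of middle indices. Therefore the description defining the associator has exactly one
  solution, and the inverse is induced in the same way by reassociating products in the other
  direction. Only the action of the inverse on triples is recorded, as the associativity axiom of
  enriched categories uses the inverse associator.\<close>

lemma associator_cmap:
  assumes m: "is_mat small V p" "is_mat small V q" "is_mat small V r" "msrc q = mtgt p" "msrc r = mtgt q" "x \<in> msrc p" "w \<in> mtgt r"
  shows "is_iso V (cmap (associator V r q p) (x, w))" (is ?A)
    "Dom V (cmap (associator V r q p) (x, w)) = ment (mcomp V (mcomp V r q) p) (x, w)"
    "Cod V (cmap (associator V r q p) (x, w)) = ment (mcomp V r (mcomp V q p)) (x, w)"
    "\<lbrakk>y \<in> mtgt p; z \<in> mtgt q; a \<in> Arr V; b \<in> Arr V; c \<in> Arr V; Dom V a = Dom V c; Dom V b = Dom V c; Cod V a = ment r (z, w); Cod V b = ment q (y, z); Cod V c = ment p (x, y)\<rbrakk> \<Longrightarrow>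
      inv_arr V (cmap (associator V r q p) (x, w)) \<cdot> (mci r (mcomp V q p) x z w \<cdot> pair V a (mci q p x y z \<cdot> pair V b c)) =
      mci (mcomp V r q) p x y w \<cdot> pair V (mci r q y z w \<cdot> pair V a b) c" (is "PROP ?B")
proof -
  let ?L = "ment (mcomp V (mcomp V r q) p) (x, w)" and ?R = "ment (mcomp V r (mcomp V q p)) (x, w)"
  let ?kl = "\<lambda>y z. mci (mcomp V r q) p x y w \<cdot> prd_map V (mci r q y z w) (Ident V (ment p (x, y)))"
  let ?kr = "\<lambda>z y. mci r (mcomp V q p) x z w \<cdot> prd_map V (Ident V (ment r (z, w))) (mci q p x y z)"
  have [simp]: "is_mat small V (mcomp V q p)" "is_mat small V (mcomp V r q)" using m by auto
  note [simp] = m(1-5)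
  have obj: "?L \<in> Obj V" "?R \<in> Obj V" using m by (auto intro: is_matD(3)[OF is_mat_mcomp])
  have "is_coproduct V (mtgt p \<times> mtgt q) (\<lambda>(y, z). prd V (prd V (ment r (z, w)) (ment q (y, z))) (ment p (x, y))) ?L (\<lambda>(y, z). ?kl y z)"
    by (rule is_coproduct_nested, rule mcomp_coproduct, (use m in auto)[5], rule is_coproduct_prd_left, rule mcomp_coproduct) (use m in auto)
  note copL = this
  have "is_coproduct V (mtgt q \<times> mtgt p) (\<lambda>(z, y). prd V (ment r (z, w)) (prd V (ment q (y, z)) (ment p (x, y)))) ?R (\<lambda>(z, y). ?kr z y)"
    by (rule is_coproduct_nested, rule mcomp_coproduct[of "mcomp V q p", simplified], (use m in auto)[5], rule is_coproduct_prd_right, rule mcomp_coproduct) (use m in auto)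
  note copR = this
  define ass where "ass y z = prd_assoc V (ment r (z, w)) (ment q (y, z)) (ment p (x, y))" for y z
  \<comment> \<open>The inverse of \<open>prd_assoc\<close>, from
    \<open>A \<times> (B \<times> E)\<close> to \<open>(A \<times> B) \<times> E\<close>.\<close>
  define ssa where "ssa y z = (let A = ment r (z, w); B = ment q (y, z); E = ment p (x, y) in
     pair V (pair V (pr1 V A (prd V B E)) (pr1 V B E \<cdot> pr2 V A (prd V B E))) (pr2 V B E \<cdot> pr2 V A (prd V B E)))" for y z
  have ass: "ass y z \<in> Arr V" "Dom V (ass y z) = prd V (prd V (ment r (z, w)) (ment q (y, z))) (ment p (x, y))"
    "Cod V (ass y z) = prd V (ment r (z, w)) (prd V (ment q (y, z)) (ment p (x, y)))"
    and ssa: "ssa y z \<in> Arr V" "Cod V (ssa y z) = prd V (prd V (ment r (z, w)) (ment q (y, z))) (ment p (x, y))"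
    "Dom V (ssa y z) = prd V (ment r (z, w)) (prd V (ment q (y, z)) (ment p (x, y)))"
    if "y \<in> mtgt p" "z \<in> mtgt q" for y z
    unfolding ass_def ssa_def prd_assoc_def Let_def using that m by simp_all
  have ass_pair: "ass y z \<cdot> pair V (pair V a b) c = pair V a (pair V b c)"
    and ssa_pair: "ssa y z \<cdot> pair V a (pair V b c) = pair V (pair V a b) c"
    if "y \<in> mtgt p" "z \<in> mtgt q" "a \<in> Arr V" "b \<in> Arr V" "c \<in> Arr V" "Dom V a = Dom V c" "Dom V b = Dom V c" "Cod V a = ment r (z, w)"
       "Cod V b = ment q (y, z)" "Cod V c = ment p (x, y)" for y z a b c
    unfolding ass_def ssa_def prd_assoc_def Let_def using that m by simp_all
  have "\<exists>!u. u \<in> Hom V ?L ?R \<and> (\<forall>i \<in> mtgt p \<times> mtgt q. u \<cdot> (case i of (y, z) \<Rightarrow> ?kl y z) = (case i of (y, z) \<Rightarrow> ?kr z y \<cdot> ass y z))"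
    by (rule is_coproduct_ex1[OF copL obj(2)]) (use m ass in auto)
  then have ex1: "\<exists>!u. u \<in> Hom V ?L ?R \<and> (\<forall>y \<in> mtgt p. \<forall>z \<in> mtgt q. u \<cdot> ?kl y z = ?kr z y \<cdot> ass y z)"
    by simp
  define \<alpha> where "\<alpha> = cmap (associator V r q p) (x, w)"
  have kr: "?kr z y \<cdot> ass y z = mci r (mcomp V q p) x z w \<cdot> (prd_map V (Ident V (ment r (z, w))) (mci q p x y z) \<cdot> ass y z)"
    if "y \<in> mtgt p" "z \<in> mtgt q" for y z using that ass m by simp
  have "\<alpha> = (THE u. u \<in> Hom V ?L ?R \<and> (\<forall>y \<in> mtgt p. \<forall>z \<in> mtgt q. u \<cdot> ?kl y z = mci r (mcomp V q p) x z w \<cdot> (prd_map V (Ident V (ment r (z, w))) (mci q p x y z) \<cdot> ass y z)))"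
    unfolding \<alpha>_def ass_def using m by (simp add: associator_def)
  also have "\<dots> = (THE u. u \<in> Hom V ?L ?R \<and> (\<forall>y \<in> mtgt p. \<forall>z \<in> mtgt q. u \<cdot> ?kl y z = ?kr z y \<cdot> ass y z))"
    using kr by simp
  finally have "\<alpha> = \<dots>" .
  then have al: "\<alpha> \<in> Arr V" "Dom V \<alpha> = ?L" "Cod V \<alpha> = ?R" and al4: "\<And>y z. y \<in> mtgt p \<Longrightarrow> z \<in> mtgt q \<Longrightarrow> \<alpha> \<cdot> ?kl y z = ?kr z y \<cdot> ass y z"
    using theI'[OF ex1] by auto
  have "\<exists>!u. u \<in> Hom V ?R ?L \<and> (\<forall>i \<in> mtgt q \<times> mtgt p. u \<cdot> (case i of (z, y) \<Rightarrow> ?kr z y) = (case i of (z, y) \<Rightarrow> ?kl y z \<cdot> ssa y z))"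
    by (rule is_coproduct_ex1[OF copR obj(1)]) (use m ssa in auto)
  then have "\<exists>!u. u \<in> Hom V ?R ?L \<and> (\<forall>z \<in> mtgt q. \<forall>y \<in> mtgt p. u \<cdot> ?kr z y = ?kl y z \<cdot> ssa y z)"
    by simp
  then obtain \<beta> where "\<beta> \<in> Hom V ?R ?L" and be4: "\<And>y z. y \<in> mtgt p \<Longrightarrow> z \<in> mtgt q \<Longrightarrow> \<beta> \<cdot> ?kr z y = ?kl y z \<cdot> ssa y z"
    by blast
  then have be: "\<beta> \<in> Arr V" "Dom V \<beta> = ?R" "Cod V \<beta> = ?L" by simp_all
  have alp: "\<alpha> \<cdot> (mci (mcomp V r q) p x y w \<cdot> pair V (mci r q y z w \<cdot> pair V a b) c) = mci r (mcomp V q p) x z w \<cdot> pair V a (mci q p x y z \<cdot> pair V b c)"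
    and bep: "\<beta> \<cdot> (mci r (mcomp V q p) x z w \<cdot> pair V a (mci q p x y z \<cdot> pair V b c)) = mci (mcomp V r q) p x y w \<cdot> pair V (mci r q y z w \<cdot> pair V a b) c"
    if yz: "y \<in> mtgt p" "z \<in> mtgt q" and t: "a \<in> Arr V" "b \<in> Arr V" "c \<in> Arr V" "Dom V a = Dom V c" "Dom V b = Dom V c" "Cod V a = ment r (z, w)"
       "Cod V b = ment q (y, z)" "Cod V c = ment p (x, y)" for y z a b c
  proof -
    have "\<alpha> \<cdot> (?kl y z \<cdot> pair V (pair V a b) c) = (?kr z y \<cdot> ass y z) \<cdot> pair V (pair V a b) c"
      by (rule Cmp_extend1[OF al4[OF yz]]) (use yz t m al in auto)
    then show "\<alpha> \<cdot> (mci (mcomp V r q) p x y w \<cdot> pair V (mci r q y z w \<cdot> pair V a b) c) = mci r (mcomp V q p) x z w \<cdot> pair V a (mci q p x y z \<cdot> pair V b c)"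
      using yz t m al ass ass_pair[OF yz t] by simp
    have "\<beta> \<cdot> (?kr z y \<cdot> pair V a (pair V b c)) = (?kl y z \<cdot> ssa y z) \<cdot> pair V a (pair V b c)"
      by (rule Cmp_extend1[OF be4[OF yz]]) (use yz t m be in auto)
    then show "\<beta> \<cdot> (mci r (mcomp V q p) x z w \<cdot> pair V a (mci q p x y z \<cdot> pair V b c)) = mci (mcomp V r q) p x y w \<cdot> pair V (mci r q y z w \<cdot> pair V a b) c"
      using yz t m be ssa ssa_pair[OF yz t] by simp
  qed
  have "\<beta> \<cdot> \<alpha> = Ident V ?L"
    by (rule mcomp3_eqI_left[OF m]) (use al be obj alp bep m in auto)
  moreover have "\<alpha> \<cdot> \<beta> = Ident V ?R"
    by (rule mcomp3_eqI_right[OF m]) (use al be obj alp bep m in auto)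
  ultimately have iso: "is_iso V \<alpha>" "inv_arr V \<alpha> = \<beta>" using al be by (auto intro: isoI[of \<alpha> \<beta>])
  then show ?A
    "Dom V (cmap (associator V r q p) (x, w)) = ?L" "Cod V (cmap (associator V r q p) (x, w)) = ?R"
    using al by (simp_all add: \<alpha>_def)
  show "PROP ?B"
    using bep iso by (simp add: \<alpha>_def)
qed

lemma globular_inv_simps [simp]:
  "cdom (globular_inv V (associator V r q p)) = mcomp V r (mcomp V q p)"
  "ccod (globular_inv V (associator V r q p)) = mcomp V (mcomp V r q) p"
  "x \<in> msrc p \<Longrightarrow> cleft (globular_inv V (associator V r q p)) x = x"
  "w \<in> mtgt r \<Longrightarrow> cright (globular_inv V (associator V r q p)) w = w"
  "x \<in> msrc p \<Longrightarrow> w \<in> mtgt r \<Longrightarrow> cmap (globular_inv V (associator V r q p)) (x, w) = inv_arr V (cmap (associator V r q p) (x, w))"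
  by (simp_all add: globular_inv_def associator_def)

lemma mcell_assoc_inv:
  assumes "is_mat small V p" "is_mat small V q" "is_mat small V r" "msrc q = mtgt p" "msrc r = mtgt q"
  shows "mcell (globular_inv V (associator V r q p))"
proof (rule mcellI)
  show "cleft (globular_inv V (associator V r q p)) \<in> extensional (msrc (cdom (globular_inv V (associator V r q p))))"
    "cright (globular_inv V (associator V r q p)) \<in> extensional (mtgt (cdom (globular_inv V (associator V r q p))))"
    "cmap (globular_inv V (associator V r q p)) \<in> extensional (msrc (cdom (globular_inv V (associator V r q p))) \<times> mtgt (cdom (globular_inv V (associator V r q p))))"
    by (simp_all add: globular_inv_def associator_def)
qed (use assms associator_cmap[OF assms] in auto)

end

section \<open>2-cells of spans and their passage to and from matrices\<close>

definition is_scell :: "('o, 'a) cat \<Rightarrow> 'a scell \<Rightarrow> bool" where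
  "is_scell C \<Theta> \<longleftrightarrow> is_span C (sdom \<Theta>) \<and> is_span C (scod \<Theta>) \<and>
     sleft \<Theta> \<in> Hom C (Cod C (sl (sdom \<Theta>))) (Cod C (sl (scod \<Theta>))) \<and>
     sright \<Theta> \<in> Hom C (Cod C (sr (sdom \<Theta>))) (Cod C (sr (scod \<Theta>))) \<and>
     smap \<Theta> \<in> Hom C (Dom C (sl (sdom \<Theta>))) (Dom C (sl (scod \<Theta>))) \<and>
     sl (scod \<Theta>) \<cdot>\<^bsub>C\<^esub> smap \<Theta> = sleft \<Theta> \<cdot>\<^bsub>C\<^esub> sl (sdom \<Theta>) \<and>
     sr (scod \<Theta>) \<cdot>\<^bsub>C\<^esub> smap \<Theta> = sright \<Theta> \<cdot>\<^bsub>C\<^esub> sr (sdom \<Theta>)"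

context lextensive_category
begin

lemma pts_map_apply [simp]:
  "\<lbrakk>v \<in> Arr V; Dom V v = one; Dom V f = Cod V v\<rbrakk> \<Longrightarrow> pts_map V one f v = f \<cdot> v"
  by (simp add: pts_map_def)

lemma pts_map_extensional: "Dom V f = A \<Longrightarrow> pts_map V one f \<in> extensional (pts V one A)"
  by (simp add: pts_map_def)

lemma is_scellD:
  assumes "is_scell V \<Theta>"
  shows "is_span V (sdom \<Theta>)" "is_span V (scod \<Theta>)"
    "sleft \<Theta> \<in> Arr V" "Dom V (sleft \<Theta>) = Cod V (sl (sdom \<Theta>))" "Cod V (sleft \<Theta>) = Cod V (sl (scod \<Theta>))"
    "sright \<Theta> \<in> Arr V" "Dom V (sright \<Theta>) = Cod V (sr (sdom \<Theta>))" "Cod V (sright \<Theta>) = Cod V (sr (scod \<Theta>))"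
    "smap \<Theta> \<in> Arr V" "Dom V (smap \<Theta>) = Dom V (sl (sdom \<Theta>))" "Cod V (smap \<Theta>) = Dom V (sl (scod \<Theta>))"
    "sl (scod \<Theta>) \<cdot> smap \<Theta> = sleft \<Theta> \<cdot> sl (sdom \<Theta>)" "sr (scod \<Theta>) \<cdot> smap \<Theta> = sright \<Theta> \<cdot> sr (sdom \<Theta>)"
  using assms unfolding is_scell_def by auto

lemma pts_cell_simps [simp]:
  "cdom (ptc \<Theta>) = psp (sdom \<Theta>)" "ccod (ptc \<Theta>) = psp (scod \<Theta>)"
  "cleft (ptc \<Theta>) = pts_map V one (sleft \<Theta>)" "cright (ptc \<Theta>) = pts_map V one (sright \<Theta>)"
  by (simp_all add: pts_cell_def)

text \<open>The last equation characterizes the component, since the fibre inclusion on its left is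
  monic. Computations with components of \<open>pts_cell\<close> go through this equation.\<close>

lemma pts_cell_cmap:
  assumes "is_scell V \<Theta>" "v \<in> Arr V" "w \<in> Arr V" "Dom V v = one" "Dom V w = one"
    "Cod V v = Cod V (sl (sdom \<Theta>))" "Cod V w = Cod V (sr (sdom \<Theta>))"
  shows "cmap (ptc \<Theta>) (v, w) \<in> Arr V" (is ?A) "Dom V (cmap (ptc \<Theta>) (v, w)) = fib V (sdom \<Theta>) (v, w)" (is ?B)
    "Cod V (cmap (ptc \<Theta>) (v, w)) = fib V (scod \<Theta>) (sleft \<Theta> \<cdot> v, sright \<Theta> \<cdot> w)" (is ?C)
    "fbi (scod \<Theta>) (sleft \<Theta> \<cdot> v, sright \<Theta> \<cdot> w) \<cdot> cmap (ptc \<Theta>) (v, w) = smap \<Theta> \<cdot> fbi (sdom \<Theta>) (v, w)" (is ?D)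
proof -
  note [simp] = is_scellD[OF assms(1)] assms
  let ?i = "fbi (sdom \<Theta>) (v, w)"
  have "sl (scod \<Theta>) \<cdot> (smap \<Theta> \<cdot> ?i) = sleft \<Theta> \<cdot> (sl (sdom \<Theta>) \<cdot> ?i)" "sr (scod \<Theta>) \<cdot> (smap \<Theta> \<cdot> ?i) = sright \<Theta> \<cdot> (sr (sdom \<Theta>) \<cdot> ?i)"
    by (rule Cmp_extend; simp)+
  then have *: "sl (scod \<Theta>) \<cdot> (smap \<Theta> \<cdot> ?i) = (sleft \<Theta> \<cdot> v) \<cdot> bng (Dom V (smap \<Theta> \<cdot> ?i))"
    "sr (scod \<Theta>) \<cdot> (smap \<Theta> \<cdot> ?i) = (sright \<Theta> \<cdot> w) \<cdot> bng (Dom V (smap \<Theta> \<cdot> ?i))"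
    by simp_all
  have eq: "cmap (ptc \<Theta>) (v, w) = fib_lift V one (scod \<Theta>) (sleft \<Theta> \<cdot> v, sright \<Theta> \<cdot> w) (smap \<Theta> \<cdot> ?i)"
    by (simp add: pts_cell_def)
  show ?A ?B
    ?C
    ?D
    unfolding eq by (subst fib_lift_simps[OF _ _ _ _ _ _ _ _ _ *]; simp)+
qed

lemma mcell_pts_cell: "is_scell V \<Theta> \<Longrightarrow> mcell (ptc \<Theta>)"
proof (rule mcellI)
  assume \<Theta>: "is_scell V \<Theta>"
  note [simp] = is_scellD[OF \<Theta>]
  show "is_mat small V (cdom (ptc \<Theta>))" "is_mat small V (ccod (ptc \<Theta>))" by simp_all
  show "x \<in> msrc (cdom (ptc \<Theta>)) \<Longrightarrow> cleft (ptc \<Theta>) x \<in> msrc (ccod (ptc \<Theta>))"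
    "x \<in> mtgt (cdom (ptc \<Theta>)) \<Longrightarrow> cright (ptc \<Theta>) x \<in> mtgt (ccod (ptc \<Theta>))" for x
    by simp_all
  show "cleft (ptc \<Theta>) \<in> extensional (msrc (cdom (ptc \<Theta>)))"
    "cright (ptc \<Theta>) \<in> extensional (mtgt (cdom (ptc \<Theta>)))" by (simp_all add: pts_map_extensional)
  show "cmap (ptc \<Theta>) \<in> extensional (msrc (cdom (ptc \<Theta>)) \<times> mtgt (cdom (ptc \<Theta>)))"
    by (simp add: pts_cell_def)
  fix x y assume "x \<in> msrc (cdom (ptc \<Theta>))" "y \<in> mtgt (cdom (ptc \<Theta>))"
  then show "cmap (ptc \<Theta>) (x, y) \<in> Arr V \<and> Dom V (cmap (ptc \<Theta>) (x, y)) = ment (cdom (ptc \<Theta>)) (x, y) \<and>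
           Cod V (cmap (ptc \<Theta>) (x, y)) = ment (ccod (ptc \<Theta>)) (cleft (ptc \<Theta>) x, cright (ptc \<Theta>) y)"
    using pts_cell_cmap[OF \<Theta>, of x y] by simp
qed

lemma svcomp_simps [simp]:
  "sdom (svcomp V \<Psi> \<Phi>) = sdom \<Phi>" "scod (svcomp V \<Psi> \<Phi>) = scod \<Psi>" "sleft (svcomp V \<Psi> \<Phi>) = sleft \<Psi> \<cdot> sleft \<Phi>"
  "sright (svcomp V \<Psi> \<Phi>) = sright \<Psi> \<cdot> sright \<Phi>" "smap (svcomp V \<Psi> \<Phi>) = smap \<Psi> \<cdot> smap \<Phi>"
  by (simp_all add: svcomp_def)

lemma is_scell_svcomp:
  assumes "is_scell V \<Phi>" "is_scell V \<Psi>" "scod \<Phi> = sdom \<Psi>"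
  shows "is_scell V (svcomp V \<Psi> \<Phi>)"
proof -
  note [simp] = is_scellD[OF assms(1), unfolded assms(3)] is_scellD[OF assms(2)]
  have "sl (scod \<Psi>) \<cdot> (smap \<Psi> \<cdot> smap \<Phi>) = sleft \<Psi> \<cdot> (sl (sdom \<Psi>) \<cdot> smap \<Phi>)"
    "sr (scod \<Psi>) \<cdot> (smap \<Psi> \<cdot> smap \<Phi>) = sright \<Psi> \<cdot> (sr (sdom \<Psi>) \<cdot> smap \<Phi>)"
    by (rule Cmp_extend; simp)+
  then show ?thesis unfolding is_scell_def by simp
qed

lemma star_cell_simps [simp]:
  "sdom (stc \<Phi>) = sm (cdom \<Phi>)" "scod (stc \<Phi>) = sm (ccod \<Phi>)"
  "sleft (stc \<Phi>) = cpm (msrc (cdom \<Phi>)) (msrc (ccod \<Phi>)) (cleft \<Phi>)"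
  "sright (stc \<Phi>) = cpm (mtgt (cdom \<Phi>)) (mtgt (ccod \<Phi>)) (cright \<Phi>)"
  by (simp_all add: star_cell_def)

lemma star_cell_smap [simp]:
  assumes "mcell \<Phi>"
  shows "smap (stc \<Phi>) \<in> Arr V" "Dom V (smap (stc \<Phi>)) = mtot V (cdom \<Phi>)"
    "Cod V (smap (stc \<Phi>)) = mtot V (ccod \<Phi>)"
    "\<lbrakk>cdom \<Phi> = p; x \<in> msrc p; y \<in> mtgt p\<rbrakk> \<Longrightarrow> smap (stc \<Phi>) \<cdot> mti p (x, y) =
       mti (ccod \<Phi>) (cleft \<Phi> x, cright \<Phi> y) \<cdot> cmap \<Phi> (x, y)"
    "\<lbrakk>cdom \<Phi> = p; x \<in> msrc p; y \<in> mtgt p; e \<in> Arr V; Cod V e = ment p (x, y)\<rbrakk> \<Longrightarrow>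
       smap (stc \<Phi>) \<cdot> (mti p (x, y) \<cdot> e) =
       mti (ccod \<Phi>) (cleft \<Phi> x, cright \<Phi> y) \<cdot> (cmap \<Phi> (x, y) \<cdot> e)"
  unfolding star_cell_def using assms by (auto simp: mtot_cotuple_simps)

lemma is_scell_star_cell:
  assumes "mcell \<Phi>" shows "is_scell V (stc \<Phi>)"
proof -
  note [simp] = assms
  have "sl (sm (ccod \<Phi>)) \<cdot> smap (stc \<Phi>) =
    cpm (msrc (cdom \<Phi>)) (msrc (ccod \<Phi>)) (cleft \<Phi>) \<cdot> sl (sm (cdom \<Phi>))"
    by (rule mtot_eqI[of "cdom \<Phi>"]) auto
  moreover have "sr (sm (ccod \<Phi>)) \<cdot> smap (stc \<Phi>) =
    cpm (mtgt (cdom \<Phi>)) (mtgt (ccod \<Phi>)) (cright \<Phi>) \<cdot> sr (sm (cdom \<Phi>))"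
    by (rule mtot_eqI[of "cdom \<Phi>"]) auto
  ultimately show ?thesis unfolding is_scell_def by simp
qed

subsection \<open>The composition comparison of the functor to spans\<close>

text \<open>The pullback of the two legs is the coproduct of the products
  \<open>q (y, z) \<times> p (x, y)\<close>: a piece in which the middle indices of the two factors
  differ is initial, by disjointness of the copower of the middle set. The total of the composite
  matrix is the same coproduct, formed in two stages, and the comparison identifies the inclusions.
  The last clause evaluates the inverse on pairs of elements.\<close>

lemma star_cocomp:
  assumes p: "is_mat small V p" and q: "is_mat small V q" and qp: "msrc q = mtgt p"
  defines "P \<equiv> pb V (sl (sm q)) (sr (sm p))"
  shows "is_iso V (star_cocomp_map V one q p)" (is ?A) "Dom V (star_cocomp_map V one q p) = mtot V (mcomp V q p)" (is ?B)
    "Cod V (star_cocomp_map V one q p) = P" (is ?C)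
    "\<lbrakk>x \<in> msrc p; y \<in> mtgt p; z \<in> mtgt q; g \<in> Arr V; h \<in> Arr V; Dom V g = Dom V h; Cod V g = ment q (y, z); Cod V h = ment p (x, y)\<rbrakk> \<Longrightarrow>
      inv_arr V (star_cocomp_map V one q p) \<cdot> pb_pair V (sl (sm q)) (sr (sm p)) (mti q (y, z) \<cdot> g) (mti p (x, y) \<cdot> h)
      = mti (mcomp V q p) (x, z) \<cdot> (mci q p x y z \<cdot> pair V g h)"
proof -
  note [simp] = p q qp
  let ?q = "sl (sm q)" and ?p = "sr (sm p)"
  let ?I = "(msrc p \<times> mtgt q) \<times> mtgt p"
  let ?X = "\<lambda>(x, z) y. prd V (ment q (y, z)) (ment p (x, y))"
  let ?k = "\<lambda>(x, z) y. pb_pair V ?q ?p (mti q (y, z) \<cdot> pr1 V (ment q (y, z)) (ment p (x, y)))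
             (mti p (x, y) \<cdot> pr2 V (ment q (y, z)) (ment p (x, y)))"
  have smI: "smalli small ?I" by simp
  have P: "P \<in> Obj V" by (simp add: P_def)
  have qp': "is_mat small V (mcomp V q p)" by simp
  have apx: "apex V (scomp V (sm q) (sm p)) = P" by (simp add: apex_def scomp_def P_def)
  have k: "?k (x, z) y \<in> Arr V" "Dom V (?k (x, z) y) = ?X (x, z) y" "Cod V (?k (x, z) y) = P"
    "pb1 V ?q ?p \<cdot> ?k (x, z) y = mti q (y, z) \<cdot> pr1 V (ment q (y, z)) (ment p (x, y))"
    "pb2 V ?q ?p \<cdot> ?k (x, z) y = mti p (x, y) \<cdot> pr2 V (ment q (y, z)) (ment p (x, y))"
    if "x \<in> msrc p" "y \<in> mtgt p" "z \<in> mtgt q" for x y z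
    using that by (simp_all add: P_def)
  have kg: "?k (x, z) y \<cdot> pair V g h = pb_pair V ?q ?p (mti q (y, z) \<cdot> g) (mti p (x, y) \<cdot> h)"
    if "x \<in> msrc p" "y \<in> mtgt p" "z \<in> mtgt q" "g \<in> Arr V" "h \<in> Arr V" "Dom V g = Dom V h" "Cod V g = ment q (y, z)" "Cod V h = ment p (x, y)"
    for x y z g h
  proof -
    have "?k (x, z) y \<cdot> pair V g h = pb_pair V ?q ?p ((mti q (y, z) \<cdot> pr1 V (ment q (y, z)) (ment p (x, y))) \<cdot> pair V g h)
             ((mti p (x, y) \<cdot> pr2 V (ment q (y, z)) (ment p (x, y))) \<cdot> pair V g h)"
      unfolding prod.case by (rule pb_pair_Cmp) (use that in auto)
    then show ?thesis using that by simp
  qed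
  \<comment> \<open>Elements of the pullback are recognized by splitting both projections, each
    along the total of its matrix.\<close>
  have copP: "is_coproduct V ?I (\<lambda>(i, j). ?X i j) P (\<lambda>(i, j). ?k i j)"
  proof (rule is_coproductI_local[OF smI P])
    fix i assume "i \<in> ?I" then show "(case i of (i, j) \<Rightarrow> ?k i j) \<in> Hom V (case i of (i, j) \<Rightarrow> ?X i j) P"
      using k by auto
  next
    fix i j g h assume i: "i \<in> ?I" and j: "j \<in> ?I" and 1: "g \<in> Arr V" "h \<in> Arr V" "Cod V g = (case i of (i, j) \<Rightarrow> ?X i j)"
      "Cod V h = (case j of (i, j) \<Rightarrow> ?X i j)" "Dom V h = Dom V g" and eq: "(case i of (i, j) \<Rightarrow> ?k i j) \<cdot> g = (case j of (i, j) \<Rightarrow> ?k i j) \<cdot> h"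
    obtain x y z x' y' z' where [simp]: "i = ((x, z), y)" "j = ((x', z'), y')" using prod.exhaust by metis
    have xs: "x \<in> msrc p" "y \<in> mtgt p" "z \<in> mtgt q" "x' \<in> msrc p" "y' \<in> mtgt p" "z' \<in> mtgt q" using i j by auto
    note k1 = k[OF xs(1-3)] and k2 = k[OF xs(4-6)]
    have e1: "pb1 V ?q ?p \<cdot> (?k (x, z) y \<cdot> g) = (mti q (y, z) \<cdot> pr1 V (ment q (y, z)) (ment p (x, y))) \<cdot> g"
      "pb2 V ?q ?p \<cdot> (?k (x, z) y \<cdot> g) = (mti p (x, y) \<cdot> pr2 V (ment q (y, z)) (ment p (x, y))) \<cdot> g"
      by (rule Cmp_extend1, use k1 1 xs in \<open>auto simp: P_def\<close>)+
    have e2: "pb1 V ?q ?p \<cdot> (?k (x', z') y' \<cdot> h) = (mti q (y', z') \<cdot> pr1 V (ment q (y', z')) (ment p (x', y'))) \<cdot> h"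
      "pb2 V ?q ?p \<cdot> (?k (x', z') y' \<cdot> h) = (mti p (x', y') \<cdot> pr2 V (ment q (y', z')) (ment p (x', y'))) \<cdot> h"
      by (rule Cmp_extend1, use k2 1 xs in \<open>auto simp: P_def\<close>)+
    have eq': "?k (x, z) y \<cdot> g = ?k (x', z') y' \<cdot> h" using eq by simp
    have 2: "mti q (y, z) \<cdot> (pr1 V (ment q (y, z)) (ment p (x, y)) \<cdot> g) = mti q (y', z') \<cdot> (pr1 V (ment q (y', z')) (ment p (x', y')) \<cdot> h)"
      using e1(1)[unfolded eq' e2(1)] 1 xs by simp
    have 3: "mti p (x, y) \<cdot> (pr2 V (ment q (y, z)) (ment p (x, y)) \<cdot> g) = mti p (x', y') \<cdot> (pr2 V (ment q (y', z')) (ment p (x', y')) \<cdot> h)"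
      using e1(2)[unfolded eq' e2(2)] 1 xs by simp
    from mtot_disjoint[OF q _ _ _ _ _ _ _ _ _ 2] mtot_disjoint[OF p _ _ _ _ _ _ _ _ _ 3]
    show "i = j \<and> g = h \<or> is_initial V (Dom V g)"
      using 1 xs prd_eqI[of "ment q (y, z)" "ment p (x, y)" g h] by auto
  next
    fix m assume m: "m \<in> Arr V" "Cod V m = P" and lift: "\<And>h i g. \<lbrakk>h \<in> Arr V; Cod V h = P; i \<in> ?I; g \<in> Arr V; Dom V g = Dom V h; Cod V g = (case i of (i, j) \<Rightarrow> ?X i j); h = (case i of (i, j) \<Rightarrow> ?k i j) \<cdot> g\<rbrakk> \<Longrightarrow> \<exists>w\<in>Arr V. Dom V w = Dom V h \<and> Cod V w = Dom V m \<and> m \<cdot> w = h"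
    have "\<exists>w\<in>Arr V. Dom V w = Dom V (pb1 V ?q ?p) \<and> Cod V w = Dom V m \<and> m \<cdot> w = Ident V P"
    proof (rule mtot_local_lift[OF q, of "pb1 V ?q ?p"])
      fix y z h g assume 1: "y \<in> msrc q" "z \<in> mtgt q" "h \<in> Arr V" "g \<in> Arr V" "Dom V g = Dom V h" "Cod V h = Dom V (pb1 V ?q ?p)"
        "Cod V g = ment q (y, z)" "pb1 V ?q ?p \<cdot> h = mti q (y, z) \<cdot> g"
      have h: "Cod V h = P" using 1(6) by (simp add: P_def)
      have "\<exists>w\<in>Arr V. Dom V w = Dom V (pb2 V ?q ?p \<cdot> h) \<and> Cod V w = Dom V m \<and> m \<cdot> w = h"
      proof (rule mtot_local_lift[OF p, of "pb2 V ?q ?p \<cdot> h"])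
        fix x y' k f assume 2: "x \<in> msrc p" "y' \<in> mtgt p" "k \<in> Arr V" "f \<in> Arr V" "Dom V f = Dom V k" "Cod V k = Dom V (pb2 V ?q ?p \<cdot> h)"
          "Cod V f = ment p (x, y')" "(pb2 V ?q ?p \<cdot> h) \<cdot> k = mti p (x, y') \<cdot> f"
        have ck: "Cod V k = Dom V h" using 1 2 by simp
        have pk: "pb1 V ?q ?p \<cdot> (h \<cdot> k) = mti q (y, z) \<cdot> (g \<cdot> k)"
          using Cmp_extend1[OF 1(8), of k] 1 2 ck by simp
        have pk2: "pb2 V ?q ?p \<cdot> (h \<cdot> k) = mti p (x, y') \<cdot> f" using 1 2 ck by simp
        have "?q \<cdot> (pb1 V ?q ?p \<cdot> (h \<cdot> k)) = ?p \<cdot> (pb2 V ?q ?p \<cdot> (h \<cdot> k))"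
          by (rule Cmp_extend[OF pb_commute]) (use 1 2 ck in auto)
        \<comment> \<open>The middle index is read off from both factors. By commutativity of the
          pullback square the two readings give the same element of the copower, so they coincide
          unless the domain is initial.\<close>
        then have "cpi (mtgt p) y \<cdot> bng (Dom V k) = cpi (mtgt p) y' \<cdot> bng (Dom V k)"
          unfolding pk pk2 using 1(1-7) 2(1-7) ck by simp
        then have "y = y' \<or> is_initial V (Dom V k)" using copow_disjoint[of "mtgt p" y y' "Dom V k"] 1 2 by simp
        then show "\<exists>w\<in>Arr V. Dom V w = Dom V k \<and> Cod V w = Dom V m \<and> m \<cdot> w = h \<cdot> k"
        proof
          assume "is_initial V (Dom V k)"
          moreover then obtain w where "w \<in> Arr V" "Dom V w = Dom V k" "Cod V w = Dom V m"
            using is_initial_arrow[of "Dom V k" "Dom V m"] m by auto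
          ultimately show ?thesis using is_initial_unique[of "Dom V k" "m \<cdot> w" "h \<cdot> k"] 1(1-6) 2(1-6) ck m h by (intro bexI[of _ w]) auto
        next
          assume [simp]: "y = y'"
          have "h \<cdot> k = pb_pair V ?q ?p (mti q (y, z) \<cdot> (g \<cdot> k)) (mti p (x, y) \<cdot> f)"
            by (rule pb_eqI[of ?q ?p]) (use 1(1-7) 2(1-7) ck pk pk2 in auto)
          also have "\<dots> = (case ((x, z), y) of (i, j) \<Rightarrow> ?k i j) \<cdot> pair V (g \<cdot> k) f"
            unfolding prod.case by (rule kg[unfolded prod.case, symmetric]) (use 1(1-7) 2(1-7) ck in auto)
          finally show ?thesis using lift[of "h \<cdot> k" "((x, z), y)" "pair V (g \<cdot> k) f"] 1(1-7) 2(1-7) ck h by simp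
        qed
      qed (use 1 m h in auto)
      then show "\<exists>w\<in>Arr V. Dom V w = Dom V h \<and> Cod V w = Dom V m \<and> m \<cdot> w = Ident V P \<cdot> h" using 1 h by simp
    qed (use m P in \<open>auto simp: P_def\<close>)
    then show "\<exists>w\<in>Arr V. Dom V w = P \<and> Cod V w = Dom V m \<and> m \<cdot> w = Ident V P" by (simp add: P_def)
  qed
  let ?l = "\<lambda>(x, z) y. mti (mcomp V q p) (x, z) \<cdot> mci q p x y z"
  \<comment> \<open>The total of the composite matrix, with the sum over the outer indices and the
    sum over the middle index merged.\<close>
  have copM: "is_coproduct V ?I (\<lambda>(i, j). ?X i j) (mtot V (mcomp V q p)) (\<lambda>(i, j). mti (mcomp V q p) i \<cdot> (case i of (x, z) \<Rightarrow> \<lambda>y. mci q p x y z) j)"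
    by (rule is_coproduct_nested[OF mtot_coproduct[OF qp', simplified]]) (auto intro!: mcomp_coproduct)
  define c where "c = star_cocomp_map V one q p"
  have inner: "cotuple V (mtgt p) (mcomp_fam V q p x z) P (?k (x, z)) \<in> Arr V"
      "Dom V (cotuple V (mtgt p) (mcomp_fam V q p x z) P (?k (x, z))) = ment (mcomp V q p) (x, z)"
      "Cod V (cotuple V (mtgt p) (mcomp_fam V q p x z) P (?k (x, z))) = P"
      "y \<in> mtgt p \<Longrightarrow> cotuple V (mtgt p) (mcomp_fam V q p x z) P (?k (x, z)) \<cdot> mci q p x y z = ?k (x, z) y"
    if "x \<in> msrc p" "z \<in> mtgt q" for x y z
    by (rule mcomp_cotuple_simps; use that k P in simp)+
  have c: "c \<in> Arr V" "Dom V c = mtot V (mcomp V q p)" "Cod V c = P"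
    "x \<in> msrc p \<Longrightarrow> z \<in> mtgt q \<Longrightarrow> c \<cdot> mti (mcomp V q p) (x, z) = cotuple V (mtgt p) (mcomp_fam V q p x z) P (?k (x, z))" for x z
    unfolding c_def star_cocomp_map_def apx
    using mtot_cotuple_simps[of "mcomp V q p" P "\<lambda>(x, z). cotuple V (mtgt p) (mcomp_fam V q p x z) P (?k (x, z))"] inner P
    by simp_all
  have ck: "c \<cdot> (mti (mcomp V q p) (x, z) \<cdot> mci q p x y z) = ?k (x, z) y" if "x \<in> msrc p" "y \<in> mtgt p" "z \<in> mtgt q" for x y z
  proof -
    have "c \<cdot> (mti (mcomp V q p) (x, z) \<cdot> mci q p x y z) = cotuple V (mtgt p) (mcomp_fam V q p x z) P (?k (x, z)) \<cdot> mci q p x y z"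
      by (rule Cmp_extend1[OF c(4)]) (use c that in auto)
    also have "\<dots> = ?k (x, z) y" using inner(4) that by simp
    finally show ?thesis .
  qed
  have iso: "is_iso V c"
    by (rule is_coproduct_comparison_iso[OF copM copP]) (use c ck in auto)
  then show ?A ?B
    ?C using c by (simp_all add: c_def)
  assume 1: "x \<in> msrc p" "y \<in> mtgt p" "z \<in> mtgt q" "g \<in> Arr V" "h \<in> Arr V" "Dom V g = Dom V h" "Cod V g = ment q (y, z)" "Cod V h = ment p (x, y)"
  let ?e = "mti (mcomp V q p) (x, z) \<cdot> (mci q p x y z \<cdot> pair V g h)"
  have "c \<cdot> ((mti (mcomp V q p) (x, z) \<cdot> mci q p x y z) \<cdot> pair V g h) = ?k (x, z) y \<cdot> pair V g h"
    by (rule Cmp_extend1[OF ck]) (use 1 c in auto)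
  then have "c \<cdot> ?e = pb_pair V ?q ?p (mti q (y, z) \<cdot> g) (mti p (x, y) \<cdot> h)"
    using kg[OF 1] 1 c by simp
  then have "inv_arr V c \<cdot> pb_pair V ?q ?p (mti q (y, z) \<cdot> g) (mti p (x, y) \<cdot> h) = inv_arr V c \<cdot> (c \<cdot> ?e)" by simp
  also have "\<dots> = ?e" by (rule inv_arr_cancel(1)[OF iso]) (use 1 c in auto)
  finally show "inv_arr V (star_cocomp_map V one q p) \<cdot> pb_pair V ?q ?p (mti q (y, z) \<cdot> g) (mti p (x, y) \<cdot> h) = ?e"
    by (simp add: c_def)
qed

lemma star_comp_simps [simp]:
  "sdom (star_comp V one q p) = scomp V (sm q) (sm p)" "scod (star_comp V one q p) = sm (mcomp V q p)"
  by (simp_all add: star_comp_def globular_scell_def)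

lemma scomp_simps [simp]:
  "sl (scomp V t s) = sl s \<cdot> pb2 V (sl t) (sr s)" "sr (scomp V t s) = sr t \<cdot> pb1 V (sl t) (sr s)"
  by (simp_all add: scomp_def)

lemma is_span_scomp [simp]: "\<lbrakk>is_span V s; is_span V t; Cod V (sl t) = Cod V (sr s)\<rbrakk> \<Longrightarrow> is_span V (scomp V t s)"
  by (subst is_span_def) simp

lemma star_comp_smap [simp]:
  assumes "is_mat small V p" "is_mat small V q" "msrc q = mtgt p"
  shows "smap (star_comp V one q p) \<in> Arr V" "Dom V (smap (star_comp V one q p)) = pb V (sl (sm q)) (sr (sm p))"
    "Cod V (smap (star_comp V one q p)) = mtot V (mcomp V q p)"
    "\<lbrakk>x \<in> msrc p; y \<in> mtgt p; z \<in> mtgt q; g \<in> Arr V; h \<in> Arr V; Dom V g = Dom V h; Cod V g = ment q (y, z); Cod V h = ment p (x, y)\<rbrakk> \<Longrightarrow>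
      smap (star_comp V one q p) \<cdot> pb_pair V (sl (sm q)) (sr (sm p)) (mti q (y, z) \<cdot> g) (mti p (x, y) \<cdot> h)
      = mti (mcomp V q p) (x, z) \<cdot> (mci q p x y z \<cdot> pair V g h)"
  using star_cocomp[OF assms] by (simp_all add: star_comp_def globular_scell_def)

text \<open>An element of the pullback is transported to the total of the composite matrix, where it
  splits first over the outer indices and then over the middle one.\<close>

lemma star_comp_local_eqI:
  assumes m: "is_mat small V p" "is_mat small V q" "msrc q = mtgt p"
    and f: "f \<in> Arr V" "Cod V f = pb V (sl (sm q)) (sr (sm p))"
    and uv: "u \<in> Arr V" "v \<in> Arr V" "Dom V u = Dom V f" "Dom V v = Dom V f" "Cod V u = Cod V v"
    and loc: "\<And>x y z k g h. \<lbrakk>x \<in> msrc p; y \<in> mtgt p; z \<in> mtgt q; k \<in> Arr V; g \<in> Arr V; h \<in> Arr V; Cod V k = Dom V f; Dom V k = Dom V h; Dom V g = Dom V h; Cod V g = ment q (y, z); Cod V h = ment p (x, y); f \<cdot> k = pb_pair V (sl (sm q)) (sr (sm p)) (mti q (y, z) \<cdot> g) (mti p (x, y) \<cdot> h)\<rbrakk> \<Longrightarrow>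
      u \<cdot> k = v \<cdot> k"
  shows "u = v"
proof -
  note [simp] = m f(1) uv(1-4)
  let ?c = "star_cocomp_map V one q p" and ?q = "sl (sm q)" and ?p = "sr (sm p)"
  note c = star_cocomp[OF m]
  note [simp] = is_iso_Arr[OF c(1)] c(1-3)
  have icf: "inv_arr V ?c \<cdot> f \<in> Arr V" "Dom V (inv_arr V ?c \<cdot> f) = Dom V f" "Cod V (inv_arr V ?c \<cdot> f) = mtot V (mcomp V q p)"
    using f(2) by simp_all
  show ?thesis
  proof (rule mtot_local_eqI[OF is_mat_mcomp[OF m] icf(1,3)])
    fix x z k g assume 1: "x \<in> msrc (mcomp V q p)" "z \<in> mtgt (mcomp V q p)" "k \<in> Arr V" "g \<in> Arr V" "Dom V g = Dom V k"
      "Cod V k = Dom V (inv_arr V ?c \<cdot> f)" "Cod V g = ment (mcomp V q p) (x, z)" "(inv_arr V ?c \<cdot> f) \<cdot> k = mti (mcomp V q p) (x, z) \<cdot> g"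
    have ck: "Cod V k = Dom V f" using 1 icf by simp
    show "u \<cdot> k = v \<cdot> k"
    proof (rule mcomp_local_eqI[OF m, of x z g])
      fix y k' g' h' assume 2: "y \<in> mtgt p" "k' \<in> Arr V" "g' \<in> Arr V" "h' \<in> Arr V" "Dom V g' = Dom V k'" "Dom V h' = Dom V k'" "Cod V k' = Dom V g"
        "Cod V g' = ment q (y, z)" "Cod V h' = ment p (x, y)" "g \<cdot> k' = mci q p x y z \<cdot> pair V g' h'"
      have "inv_arr V ?c \<cdot> (f \<cdot> (k \<cdot> k')) = mti (mcomp V q p) (x, z) \<cdot> (g \<cdot> k')"
        using Cmp_extend[OF 1(8), of k'] 1(1-7) 2(1-9) f ck by simp
      also have "\<dots> = inv_arr V ?c \<cdot> pb_pair V ?q ?p (mti q (y, z) \<cdot> g') (mti p (x, y) \<cdot> h')"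
        unfolding 2(10) by (rule c(4)[symmetric]) (use 1 2 in auto)
      finally have "?c \<cdot> (inv_arr V ?c \<cdot> (f \<cdot> (k \<cdot> k'))) = ?c \<cdot> (inv_arr V ?c \<cdot> pb_pair V ?q ?p (mti q (y, z) \<cdot> g') (mti p (x, y) \<cdot> h'))"
        by simp
      then have "f \<cdot> (k \<cdot> k') = pb_pair V ?q ?p (mti q (y, z) \<cdot> g') (mti p (x, y) \<cdot> h')"
        using 1(1-7) 2(1-9) f ck by simp
      then have "u \<cdot> (k \<cdot> k') = v \<cdot> (k \<cdot> k')"
        by (intro loc[of x y z "k \<cdot> k'" g' h']) (use 1(1-7) 2(1-9) ck in auto)
      then show "(u \<cdot> k) \<cdot> k' = (v \<cdot> k) \<cdot> k'" using 1(1-7) 2(1-9) ck by simp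
    qed (use 1(1-7) ck uv in simp_all)
  qed (use icf uv in simp_all)
qed

lemma is_scell_star_comp:
  assumes m: "is_mat small V p" "is_mat small V q" "msrc q = mtgt p"
  shows "is_scell V (star_comp V one q p)"
proof -
  note [simp] = m
  let ?q = "sl (sm q)" and ?p = "sr (sm p)" and ?P = "pb V (sl (sm q)) (sr (sm p))"
  have "sl (sm (mcomp V q p)) \<cdot> smap (star_comp V one q p) = sl (sm p) \<cdot> pb2 V ?q ?p"
    by (rule star_comp_local_eqI[OF m, of "Ident V ?P"]) auto
  moreover have "sr (sm (mcomp V q p)) \<cdot> smap (star_comp V one q p) = sr (sm q) \<cdot> pb1 V ?q ?p"
    by (rule star_comp_local_eqI[OF m, of "Ident V ?P"]) auto
  moreover have "sleft (star_comp V one q p) = Ident V (cp (msrc p))" "sright (star_comp V one q p) = Ident V (cp (mtgt q))"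
    by (simp_all add: star_comp_def globular_scell_def)
  ultimately show ?thesis unfolding is_scell_def by simp
qed

lemma sunit_simps [simp]: "sl (sunit V A) = Ident V A" "sr (sunit V A) = Ident V A"
  by (simp_all add: sunit_def)

lemma is_span_sunit [simp]: "A \<in> Obj V \<Longrightarrow> is_span V (sunit V A)"
  by (subst is_span_def) simp

lemma star_unit_simps [simp]:
  assumes "small X"
  shows "sdom (star_unit V one X) = sunit V (cp X)" "scod (star_unit V one X) = sm (munit V one X)"
    "sleft (star_unit V one X) = Ident V (cp X)" "sright (star_unit V one X) = Ident V (cp X)"
    "smap (star_unit V one X) \<in> Arr V" "Dom V (smap (star_unit V one X)) = cp X" "Cod V (smap (star_unit V one X)) = mtot V (munit V one X)"
    "x \<in> X \<Longrightarrow> smap (star_unit V one X) \<cdot> cpi X x = mti (munit V one X) (x, x) \<cdot> cpi {()} ()"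
  using assms copow_cotuple_simps[of X "mtot V (munit V one X)" "\<lambda>x. mti (munit V one X) (x, x) \<cdot> cpi (eqv x x) ()"]
  by (simp_all add: star_unit_def globular_scell_def)

lemma is_scell_star_unit:
  assumes "small X" shows "is_scell V (star_unit V one X)"
proof -
  note [simp] = assms
  have "sl (sm (munit V one X)) \<cdot> smap (star_unit V one X) = Ident V (cp X)"
    by (rule copow_eqI[of X]) auto
  moreover have "sr (sm (munit V one X)) \<cdot> smap (star_unit V one X) = Ident V (cp X)"
    by (rule copow_eqI[of X]) auto
  ultimately show ?thesis unfolding is_scell_def by simp
qed

subsection \<open>Lax structure of the functor from spans to matrices\<close>

lemma pts_unit_simps [simp]:
  "cdom (pts_unit V one A) = munit V one (pts V one A)" "ccod (pts_unit V one A) = psp (sunit V A)"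
  "\<lbrakk>v \<in> Arr V; Dom V v = one; Cod V v = A\<rbrakk> \<Longrightarrow> cleft (pts_unit V one A) v = v"
  "\<lbrakk>v \<in> Arr V; Dom V v = one; Cod V v = A\<rbrakk> \<Longrightarrow> cright (pts_unit V one A) v = v"
  by (simp_all add: pts_unit_def)

lemma pts_unit_cmap:
  assumes "A \<in> Obj V" "v \<in> Arr V" "w \<in> Arr V" "Dom V v = one" "Dom V w = one" "Cod V v = A" "Cod V w = A"
  shows "cmap (pts_unit V one A) (v, w) \<in> Arr V" (is ?A) "Dom V (cmap (pts_unit V one A) (v, w)) = cp (eqv v w)" (is ?B)
    "Cod V (cmap (pts_unit V one A) (v, w)) = fib V (sunit V A) (v, w)" (is ?C)
proof -
  have 1: "x \<in> eqv v w \<Longrightarrow> fib_lift V one (sunit V A) (v, w) v \<in> Arr V \<and> Dom V (fib_lift V one (sunit V A) (v, w) v) = one \<and>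
     Cod V (fib_lift V one (sunit V A) (v, w) v) = fib V (sunit V A) (v, w)" for x
  proof -
    assume "x \<in> eqv v w"
    then have "v = w" by (simp add: eqv_def split: if_splits)
    then show ?thesis using assms by simp
  qed
  show ?A ?B
    ?C
    using assms copow_cotuple_simps[of "eqv v w" "fib V (sunit V A) (v, w)" "\<lambda>_. fib_lift V one (sunit V A) (v, w) v", OF _ _ 1]
    by (simp_all add: pts_unit_def)
qed

lemma pts_unit_cmap_same:
  assumes "A \<in> Obj V" "v \<in> Arr V" "Dom V v = one" "Cod V v = A"
  shows "fbi (sunit V A) (v, v) \<cdot> (cmap (pts_unit V one A) (v, v) \<cdot> cpi {()} ()) = v"
    "e \<in> Arr V \<Longrightarrow> Cod V e = one \<Longrightarrow> fbi (sunit V A) (v, v) \<cdot> (cmap (pts_unit V one A) (v, v) \<cdot> (cpi {()} () \<cdot> e)) = v \<cdot> e"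
  using assms copow_cotuple_simps[of "eqv v v" "fib V (sunit V A) (v, v)" "\<lambda>_. fib_lift V one (sunit V A) (v, v) v"]
  by (simp_all add: pts_unit_def)

lemma mcell_pts_unit [simp]: "A \<in> Obj V \<Longrightarrow> mcell (pts_unit V one A)"
proof (rule mcellI)
  show "cleft (pts_unit V one A) \<in> extensional (msrc (cdom (pts_unit V one A)))"
    "cright (pts_unit V one A) \<in> extensional (mtgt (cdom (pts_unit V one A)))"
    "cmap (pts_unit V one A) \<in> extensional (msrc (cdom (pts_unit V one A)) \<times> mtgt (cdom (pts_unit V one A)))"
    by (simp_all add: pts_unit_def)
qed (auto simp: pts_unit_cmap)

lemma pts_comp_simps [simp]:
  "cdom (pts_comp V one t s) = mcomp V (psp t) (psp s)" "ccod (pts_comp V one t s) = psp (scomp V t s)"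
  "\<lbrakk>v \<in> Arr V; Dom V v = one; Cod V v = Cod V (sl s)\<rbrakk> \<Longrightarrow> cleft (pts_comp V one t s) v = v"
  "\<lbrakk>v \<in> Arr V; Dom V v = one; Cod V v = Cod V (sr t)\<rbrakk> \<Longrightarrow> cright (pts_comp V one t s) v = v"
  by (simp_all add: pts_comp_def)

lemma pts_comp_cmap:
  assumes s: "is_span V s" and t: "is_span V t" and ts: "Cod V (sl t) = Cod V (sr s)"
    and v: "v \<in> Arr V" "Dom V v = one" "Cod V v = Cod V (sl s)" and w: "w \<in> Arr V" "Dom V w = one" "Cod V w = Cod V (sr t)"
  shows "cmap (pts_comp V one t s) (v, w) \<in> Arr V" (is ?A)
    "Dom V (cmap (pts_comp V one t s) (v, w)) = ment (mcomp V (psp t) (psp s)) (v, w)" (is ?C)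
    "Cod V (cmap (pts_comp V one t s) (v, w)) = fib V (scomp V t s) (v, w)"
    "\<lbrakk>u \<in> Arr V; Dom V u = one; Cod V u = Cod V (sr s); g \<in> Arr V; h \<in> Arr V; Dom V g = Dom V h; Cod V g = fib V t (u, w); Cod V h = fib V s (v, u)\<rbrakk> \<Longrightarrow>
      fbi (scomp V t s) (v, w) \<cdot> (cmap (pts_comp V one t s) (v, w) \<cdot> (mci (psp t) (psp s) v u w \<cdot> pair V g h)) =
      pb_pair V (sl t) (sr s) (fbi t (u, w) \<cdot> g) (fbi s (v, u) \<cdot> h)"
proof -
  note [simp] = s t ts v w
  let ?k = "\<lambda>u. pb_pair V (sl t) (sr s)
              (fbi t (u, w) \<cdot> pr1 V (fib V t (u, w)) (fib V s (v, u)))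
              (fbi s (v, u) \<cdot> pr2 V (fib V t (u, w)) (fib V s (v, u)))"
  let ?g = "\<lambda>u. fib_lift V one (scomp V t s) (v, w) (?k u)"
  let ?B = "fib V (scomp V t s) (v, w)"
  have k: "?k u \<in> Arr V" "Dom V (?k u) = prd V (fib V t (u, w)) (fib V s (v, u))" "Cod V (?k u) = pb V (sl t) (sr s)"
    and g: "?g u \<in> Arr V" "Dom V (?g u) = prd V (fib V t (u, w)) (fib V s (v, u))" "Cod V (?g u) = ?B"
    "fbi (scomp V t s) (v, w) \<cdot> ?g u = ?k u"
    if "u \<in> pts V one (Cod V (sr s))" for u
    using that by simp_all
  have eq: "cmap (pts_comp V one t s) (v, w) = cotuple V (mtgt (psp s)) (mcomp_fam V (psp t) (psp s) v w) ?B ?g"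
    by (simp add: pts_comp_def)
  note * = mcomp_cotuple_simps[of "psp s" "psp t" v w ?B ?g, folded eq]
  have **: "cmap (pts_comp V one t s) (v, w) \<in> Arr V"
    "Dom V (cmap (pts_comp V one t s) (v, w)) = ment (mcomp V (psp t) (psp s)) (v, w)"
    "Cod V (cmap (pts_comp V one t s) (v, w)) = ?B"
    "u \<in> pts V one (Cod V (sr s)) \<Longrightarrow> cmap (pts_comp V one t s) (v, w) \<cdot> mci (psp t) (psp s) v u w = ?g u" for u
    by (rule *; use g in simp)+
  then show ?A
    ?C
    "Cod V (cmap (pts_comp V one t s) (v, w)) = ?B" by simp_all
  assume 1: "u \<in> Arr V" "Dom V u = one" "Cod V u = Cod V (sr s)" "g \<in> Arr V" "h \<in> Arr V" "Dom V g = Dom V h"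
      "Cod V g = fib V t (u, w)" "Cod V h = fib V s (v, u)"
  have u: "u \<in> pts V one (Cod V (sr s))" using 1 by simp
  have "cmap (pts_comp V one t s) (v, w) \<cdot> (mci (psp t) (psp s) v u w \<cdot> pair V g h) = ?g u \<cdot> pair V g h"
    by (rule Cmp_extend1[OF **(4)[OF u]]) (use 1 ** in auto)
  then have "fbi (scomp V t s) (v, w) \<cdot> (cmap (pts_comp V one t s) (v, w) \<cdot> (mci (psp t) (psp s) v u w \<cdot> pair V g h))
    = fbi (scomp V t s) (v, w) \<cdot> (?g u \<cdot> pair V g h)" by simp
  also have "\<dots> = ?k u \<cdot> pair V g h" by (rule Cmp_extend1[OF g(4)[OF u]]) (use 1 g[OF u] in auto)
  also have "\<dots> = pb_pair V (sl t) (sr s)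
              ((fbi t (u, w) \<cdot> pr1 V (fib V t (u, w)) (fib V s (v, u))) \<cdot> pair V g h)
              ((fbi s (v, u) \<cdot> pr2 V (fib V t (u, w)) (fib V s (v, u))) \<cdot> pair V g h)"
    by (rule pb_pair_Cmp) (use 1 in auto)
  also have "\<dots> = pb_pair V (sl t) (sr s) (fbi t (u, w) \<cdot> g) (fbi s (v, u) \<cdot> h)"
    using 1 by simp
  finally show "fbi (scomp V t s) (v, w) \<cdot> (cmap (pts_comp V one t s) (v, w) \<cdot> (mci (psp t) (psp s) v u w \<cdot> pair V g h)) =
      pb_pair V (sl t) (sr s) (fbi t (u, w) \<cdot> g) (fbi s (v, u) \<cdot> h)" .
qed

lemma mcell_pts_comp:
  assumes "is_span V s" "is_span V t" "Cod V (sl t) = Cod V (sr s)"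
  shows "mcell (pts_comp V one t s)"
proof (rule mcellI)
  show "cleft (pts_comp V one t s) \<in> extensional (msrc (cdom (pts_comp V one t s)))"
    "cright (pts_comp V one t s) \<in> extensional (mtgt (cdom (pts_comp V one t s)))"
    "cmap (pts_comp V one t s) \<in> extensional (msrc (cdom (pts_comp V one t s)) \<times> mtgt (cdom (pts_comp V one t s)))"
    by (simp_all add: pts_comp_def)
qed (use assms in \<open>auto simp: pts_comp_cmap\<close>)

subsection \<open>Unit and counit\<close>

lemma eta_mat_simps [simp]:
  "cdom (eta_mat V one p) = p" "ccod (eta_mat V one p) = psp (sm p)"
  "x \<in> msrc p \<Longrightarrow> cleft (eta_mat V one p) x = cpi (msrc p) x"
  "y \<in> mtgt p \<Longrightarrow> cright (eta_mat V one p) y = cpi (mtgt p) y"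
  by (simp_all add: eta_mat_def eta_set_def)

lemma eta_mat_cmap [simp]:
  assumes "is_mat small V p" "x \<in> msrc p" "y \<in> mtgt p"
  shows "cmap (eta_mat V one p) (x, y) \<in> Arr V" "Dom V (cmap (eta_mat V one p) (x, y)) = ment p (x, y)"
    "Cod V (cmap (eta_mat V one p) (x, y)) = fib V (sm p) (cpi (msrc p) x, cpi (mtgt p) y)"
    "fbi (sm p) (cpi (msrc p) x, cpi (mtgt p) y) \<cdot> cmap (eta_mat V one p) (x, y) = mti p (x, y)"
    "e \<in> Arr V \<Longrightarrow> Cod V e = ment p (x, y) \<Longrightarrow>
    fbi (sm p) (cpi (msrc p) x, cpi (mtgt p) y) \<cdot> (cmap (eta_mat V one p) (x, y) \<cdot> e) = mti p (x, y) \<cdot> e"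
  using assms by (simp_all add: eta_mat_def eta_set_def)

lemma mcell_eta_mat [simp]: "is_mat small V p \<Longrightarrow> mcell (eta_mat V one p)"
proof (rule mcellI)
  show "cleft (eta_mat V one p) \<in> extensional (msrc (cdom (eta_mat V one p)))"
    "cright (eta_mat V one p) \<in> extensional (mtgt (cdom (eta_mat V one p)))"
    "cmap (eta_mat V one p) \<in> extensional (msrc (cdom (eta_mat V one p)) \<times> mtgt (cdom (eta_mat V one p)))"
    by (simp_all add: eta_mat_def eta_set_def)
qed auto

lemma eps_span_simps [simp]:
  "sdom (eps_span V one s) = sm (psp s)" "scod (eps_span V one s) = s"
  "sleft (eps_span V one s) = eps (Cod V (sl s))" "sright (eps_span V one s) = eps (Cod V (sr s))"
  by (simp_all add: eps_span_def)

lemma eps_span_smap [simp]: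
  assumes "is_span V s"
  shows "smap (eps_span V one s) \<in> Arr V" "Dom V (smap (eps_span V one s)) = mtot V (psp s)" (is ?A) "Cod V (smap (eps_span V one s)) = Dom V (sl s)" (is ?B)
    "\<lbrakk>v \<in> Arr V; Dom V v = one; Cod V v = Cod V (sl s); w \<in> Arr V; Dom V w = one; Cod V w = Cod V (sr s)\<rbrakk> \<Longrightarrow>
      smap (eps_span V one s) \<cdot> mti (psp s) (v, w) = fbi s (v, w)" (is "PROP ?C")
    "\<lbrakk>v \<in> Arr V; Dom V v = one; Cod V v = Cod V (sl s); w \<in> Arr V; Dom V w = one; Cod V w = Cod V (sr s); e \<in> Arr V; Cod V e = fib V s (v, w)\<rbrakk> \<Longrightarrow>
      smap (eps_span V one s) \<cdot> (mti (psp s) (v, w) \<cdot> e) = fbi s (v, w) \<cdot> e" (is "PROP ?D")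
proof -
  have 1: "fbi s (x, y) \<in> Arr V \<and> Dom V (fbi s (x, y)) = ment (psp s) (x, y) \<and> Cod V (fbi s (x, y)) = Dom V (sl s)"
    if "x \<in> msrc (psp s)" "y \<in> mtgt (psp s)" for x y
    using that assms by simp
  note * = mtot_cotuple_simps[OF is_mat_pts_span[OF assms], of "Dom V (sl s)" "fbi s", OF _ 1]
  show "smap (eps_span V one s) \<in> Arr V" ?A ?B
    "PROP ?C"
    "PROP ?D"
    unfolding eps_span_def apex_def using * assms by simp_all
qed

lemma is_scell_eps_span:
  assumes "is_span V s" shows "is_scell V (eps_span V one s)"
proof -
  note [simp] = assms
  have "sl s \<cdot> smap (eps_span V one s) = eps (Cod V (sl s)) \<cdot> sl (sm (psp s))"
    by (rule mtot_eqI[of "psp s"]) auto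
  moreover have "sr s \<cdot> smap (eps_span V one s) = eps (Cod V (sr s)) \<cdot> sr (sm (psp s))"
    by (rule mtot_eqI[of "psp s"]) auto
  ultimately show ?thesis unfolding is_scell_def by simp
qed

end

section \<open>The monad and its action on spans\<close>

locale star_points = lextensive_category small V one
  for small :: "'a set \<Rightarrow> bool" and V :: "('o, 'a) cat" (structure) and one :: 'o +
  fixes T :: "('o, 'a) monad_data"
  assumes cartesian: "cartesian_monad V T" and strong_conjoint: "strong_conjoint small V one T"
begin

abbreviation "TO \<equiv> omap (endo T)"
abbreviation "TA \<equiv> amap (endo T)"

lemma T_functor: "is_functor V V (endo T)"
  using cartesian by (simp add: cartesian_monad_def is_monad_def)

lemmas T_simps [simp] = functor_simps[OF T_functor]

lemma mult_simps [simp]: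
  assumes "A \<in> Obj V"
  shows "mult T A \<in> Arr V" "Dom V (mult T A) = TO (TO A)" "Cod V (mult T A) = TO A"
    "unit T A \<in> Arr V" "Dom V (unit T A) = A" "Cod V (unit T A) = TO A"
  using cartesian assms
  unfolding cartesian_monad_def is_monad_def is_nat_trans_def comp_functor_def id_functor_def by auto

lemma mult_nat: "\<lbrakk>f \<in> Arr V; Dom V f = A; Cod V f = B\<rbrakk> \<Longrightarrow> TA f \<cdot> mult T A = mult T B \<cdot> TA (TA f)"
  and unit_nat: "\<lbrakk>f \<in> Arr V; Dom V f = A; Cod V f = B\<rbrakk> \<Longrightarrow> TA f \<cdot> unit T A = unit T B \<cdot> f"
  using cartesian unfolding cartesian_monad_def is_monad_def is_nat_trans_def comp_functor_def id_functor_def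
  by auto

lemma monad_laws:
  "A \<in> Obj V \<Longrightarrow> mult T A \<cdot> unit T (TO A) = Ident V (TO A)"
  "A \<in> Obj V \<Longrightarrow> mult T A \<cdot> TA (unit T A) = Ident V (TO A)"
  "A \<in> Obj V \<Longrightarrow> mult T A \<cdot> TA (mult T A) = mult T A \<cdot> mult T (TO A)"
  using cartesian unfolding cartesian_monad_def is_monad_def by auto

text \<open>Oriented so that multiplications and units of the monad move to the left, past the
  images of arrows under \<open>T\<close>. Together with \<open>monad_simps\<close> this normalizes
  composites of monad structure and images under \<open>T\<close>.\<close>

lemma nat_simps [simp]:
  "f \<in> Arr V \<Longrightarrow> Dom V f = A \<Longrightarrow> TA f \<cdot> mult T A = mult T (Cod V f) \<cdot> TA (TA f)" (is "PROP ?A")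
  "\<lbrakk>f \<in> Arr V; Dom V f = A; k \<in> Arr V; Cod V k = TO (TO A)\<rbrakk> \<Longrightarrow> TA f \<cdot> (mult T A \<cdot> k) = mult T (Cod V f) \<cdot> (TA (TA f) \<cdot> k)" (is "PROP ?B")
  "f \<in> Arr V \<Longrightarrow> Dom V f = A \<Longrightarrow> TA f \<cdot> unit T A = unit T (Cod V f) \<cdot> f" (is "PROP ?C")
  "\<lbrakk>f \<in> Arr V; Dom V f = A; k \<in> Arr V; Cod V k = A\<rbrakk> \<Longrightarrow> TA f \<cdot> (unit T A \<cdot> k) = unit T (Cod V f) \<cdot> (f \<cdot> k)" (is "PROP ?D")
proof -
  show "PROP ?A"
   "PROP ?C" using mult_nat unit_nat by auto
  show "PROP ?B"
    by (rule Cmp_extend[OF mult_nat]) auto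
  show "PROP ?D"
    by (rule Cmp_extend[OF unit_nat]) auto
qed

lemma monad_simps [simp]:
  "A \<in> Obj V \<Longrightarrow> B = TO A \<Longrightarrow> mult T A \<cdot> unit T B = Ident V (TO A)" (is "PROP ?A")
  "A \<in> Obj V \<Longrightarrow> mult T A \<cdot> TA (unit T A) = Ident V (TO A)" (is "PROP ?B")
  "A \<in> Obj V \<Longrightarrow> mult T A \<cdot> TA (mult T A) = mult T A \<cdot> mult T (TO A)" (is "PROP ?C")
  "\<lbrakk>A \<in> Obj V; B = TO A; k \<in> Arr V; Cod V k = TO A\<rbrakk> \<Longrightarrow> mult T A \<cdot> (unit T B \<cdot> k) = k" (is "PROP ?D")
  "\<lbrakk>A \<in> Obj V; k \<in> Arr V; Cod V k = TO A\<rbrakk> \<Longrightarrow> mult T A \<cdot> (TA (unit T A) \<cdot> k) = k" (is "PROP ?E")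
  "\<lbrakk>A \<in> Obj V; k \<in> Arr V; Cod V k = TO (TO (TO A))\<rbrakk> \<Longrightarrow> mult T A \<cdot> (TA (mult T A) \<cdot> k) = mult T A \<cdot> (mult T (TO A) \<cdot> k)" (is "PROP ?G")
proof -
  show "PROP ?A"
   "PROP ?B"
   "PROP ?C" using monad_laws by auto
  show "PROP ?D"
    using Cmp_extend1[OF monad_laws(1), of A k] by simp
  show "PROP ?E"
    using Cmp_extend1[OF monad_laws(2), of A k] by simp
  show "PROP ?G"
    by (rule Cmp_extend[OF monad_laws(3)]) auto
qed

lemma T_commute:
  "\<lbrakk>g \<cdot> f = g' \<cdot> f'; f \<in> Arr V; g \<in> Arr V; f' \<in> Arr V; g' \<in> Arr V; Dom V g = Cod V f; Dom V g' = Cod V f'\<rbrakk> \<Longrightarrow>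
    TA g \<cdot> TA f = TA g' \<cdot> TA f'"
  by (simp flip: T_simps(6))

lemma T_commute1:
  "\<lbrakk>g \<cdot> f = h; f \<in> Arr V; g \<in> Arr V; Dom V g = Cod V f\<rbrakk> \<Longrightarrow> TA g \<cdot> TA f = TA h"
  by (simp flip: T_simps(6))

subsection \<open>Preserved pullbacks\<close>

text \<open>\<open>T\<close> preserves pullbacks but need not send a chosen pullback to the chosen
  one. Pairings into \<open>T\<close> of a chosen pullback are therefore distinct from pairings into
  the chosen pullback of the images, and the two are related by the comparison
  \<open>T_comp\<close>.\<close>

definition T_pair :: "'a \<Rightarrow> 'a \<Rightarrow> 'a \<Rightarrow> 'a \<Rightarrow> 'a" where
  "T_pair f g h k = (THE u. u \<in> Hom V (Dom V h) (TO (pb V f g)) \<and> TA (pb1 V f g) \<cdot> u = h \<and> TA (pb2 V f g) \<cdot> u = k)"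

lemma T_pullback:
  assumes "f \<in> Arr V" "g \<in> Arr V" "Cod V f = Cod V g"
  shows "is_pullback V (TA f) (TA g) (TA (pb1 V f g)) (TA (pb2 V f g))"
  using cartesian pullback[OF assms] unfolding cartesian_monad_def by blast

lemma T_pair_simps [simp]:
  assumes "f \<in> Arr V" "g \<in> Arr V" "Cod V f = Cod V g"
    "h \<in> Arr V" "k \<in> Arr V" "Dom V h = Dom V k" "Cod V h = TO (Dom V f)" "Cod V k = TO (Dom V g)" "TA f \<cdot> h = TA g \<cdot> k"
  shows "T_pair f g h k \<in> Arr V" "Dom V (T_pair f g h k) = Dom V k" "Cod V (T_pair f g h k) = TO (pb V f g)" (is ?A)
    "TA (pb1 V f g) \<cdot> T_pair f g h k = h" (is ?B) "TA (pb2 V f g) \<cdot> T_pair f g h k = k" (is ?C)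
proof -
  have "\<exists>!u. u \<in> Hom V (Dom V h) (Dom V (TA (pb1 V f g))) \<and> TA (pb1 V f g) \<cdot> u = h \<and> TA (pb2 V f g) \<cdot> u = k"
    by (rule is_pullback_ex1[OF T_pullback[OF assms(1-3)]]) (use assms in auto)
  then have "\<exists>!u. u \<in> Hom V (Dom V h) (TO (pb V f g)) \<and> TA (pb1 V f g) \<cdot> u = h \<and> TA (pb2 V f g) \<cdot> u = k"
    using assms by simp
  from theI'[OF this] show "T_pair f g h k \<in> Arr V" "Dom V (T_pair f g h k) = Dom V k" ?A
    ?B ?C
    using assms by (simp_all add: T_pair_def)
qed

lemma T_pb_eqI:
  assumes "f \<in> Arr V" "g \<in> Arr V" "Cod V f = Cod V g"
    "u \<in> Arr V" "v \<in> Arr V" "Dom V u = Dom V v" "Cod V u = TO (pb V f g)" "Cod V v = TO (pb V f g)"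
    "TA (pb1 V f g) \<cdot> u = TA (pb1 V f g) \<cdot> v" "TA (pb2 V f g) \<cdot> u = TA (pb2 V f g) \<cdot> v"
  shows "u = v"
  by (rule is_pullback_eqI[OF T_pullback[OF assms(1-3)]]) (use assms in simp_all)

lemma T_span_simps [simp]: "sl (T_span T s) = TA (sl s)" "sr (T_span T s) = TA (sr s)"
  by (simp_all add: T_span_def)

lemma is_span_T_span [simp]: "is_span V s \<Longrightarrow> is_span V (T_span T s)"
  by (subst is_span_def) simp

lemma T_cell_simps [simp]:
  "sdom (T_cell T \<Theta>) = T_span T (sdom \<Theta>)" "scod (T_cell T \<Theta>) = T_span T (scod \<Theta>)" "sleft (T_cell T \<Theta>) = TA (sleft \<Theta>)"
  "sright (T_cell T \<Theta>) = TA (sright \<Theta>)" "smap (T_cell T \<Theta>) = TA (smap \<Theta>)"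
  by (simp_all add: T_cell_def)

lemma is_scell_T_cell: "is_scell V \<Theta> \<Longrightarrow> is_scell V (T_cell T \<Theta>)"
proof -
  assume \<Theta>: "is_scell V \<Theta>"
  note [simp] = is_scellD(1-11)[OF \<Theta>]
  have "TA (sl (scod \<Theta>)) \<cdot> TA (smap \<Theta>) = TA (sleft \<Theta>) \<cdot> TA (sl (sdom \<Theta>))"
    by (rule T_commute[OF is_scellD(12)[OF \<Theta>]]) auto
  moreover have "TA (sr (scod \<Theta>)) \<cdot> TA (smap \<Theta>) = TA (sright \<Theta>) \<cdot> TA (sr (sdom \<Theta>))"
    by (rule T_commute[OF is_scellD(13)[OF \<Theta>]]) auto
  ultimately show ?thesis unfolding is_scell_def by simp
qed

lemma T_comp_simps [simp]:
  assumes "is_span V s" "is_span V t" "Cod V (sl t) = Cod V (sr s)"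
  shows "sdom (T_comp V T t s) = scomp V (T_span T t) (T_span T s)" "scod (T_comp V T t s) = T_span T (scomp V t s)"
    "sleft (T_comp V T t s) = Ident V (TO (Cod V (sl s)))" "sright (T_comp V T t s) = Ident V (TO (Cod V (sr t)))"
    "smap (T_comp V T t s) = T_pair (sl t) (sr s) (pb1 V (TA (sl t)) (TA (sr s))) (pb2 V (TA (sl t)) (TA (sr s)))"
  using assms by (simp_all add: T_comp_def globular_scell_def T_pair_def apex_def)

lemma is_scell_T_comp:
  assumes "is_span V s" "is_span V t" "Cod V (sl t) = Cod V (sr s)"
  shows "is_scell V (T_comp V T t s)"
proof -
  note [simp] = assms
  have [simp]: "TA (sl t) \<cdot> pb1 V (TA (sl t)) (TA (sr s)) = TA (sr s) \<cdot> pb2 V (TA (sl t)) (TA (sr s))"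
    by (rule pb_commute) auto
  show ?thesis unfolding is_scell_def by simp
qed

lemma T_pair_pb_pair:
  assumes "is_span V s" "is_span V t" "Cod V (sl t) = Cod V (sr s)"
    and hk: "h \<in> Arr V" "k \<in> Arr V" "Dom V h = Dom V k" "Cod V h = TO (Dom V (sl t))" "Cod V k = TO (Dom V (sr s))" "TA (sl t) \<cdot> h = TA (sr s) \<cdot> k"
  shows "smap (T_comp V T t s) \<cdot> pb_pair V (TA (sl t)) (TA (sr s)) h k = T_pair (sl t) (sr s) h k"
proof -
  note [simp] = assms
  have [simp]: "TA (sl t) \<cdot> pb1 V (TA (sl t)) (TA (sr s)) = TA (sr s) \<cdot> pb2 V (TA (sl t)) (TA (sr s))"
    by (rule pb_commute) auto
  let ?T = "T_pair (sl t) (sr s) (pb1 V (TA (sl t)) (TA (sr s))) (pb2 V (TA (sl t)) (TA (sr s)))"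
  have "?T \<cdot> pb_pair V (TA (sl t)) (TA (sr s)) h k = T_pair (sl t) (sr s) h k"
  proof (rule T_pb_eqI[of "sl t" "sr s"])
    have "TA (pb1 V (sl t) (sr s)) \<cdot> (?T \<cdot> pb_pair V (TA (sl t)) (TA (sr s)) h k) = pb1 V (TA (sl t)) (TA (sr s)) \<cdot> pb_pair V (TA (sl t)) (TA (sr s)) h k"
      by (rule Cmp_extend1[OF T_pair_simps(4)]) auto
    then show "TA (pb1 V (sl t) (sr s)) \<cdot> (?T \<cdot> pb_pair V (TA (sl t)) (TA (sr s)) h k) = TA (pb1 V (sl t) (sr s)) \<cdot> T_pair (sl t) (sr s) h k"
      by simp
    have "TA (pb2 V (sl t) (sr s)) \<cdot> (?T \<cdot> pb_pair V (TA (sl t)) (TA (sr s)) h k) = pb2 V (TA (sl t)) (TA (sr s)) \<cdot> pb_pair V (TA (sl t)) (TA (sr s)) h k"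
      by (rule Cmp_extend1[OF T_pair_simps(5)]) auto
    then show "TA (pb2 V (sl t) (sr s)) \<cdot> (?T \<cdot> pb_pair V (TA (sl t)) (TA (sr s)) h k) = TA (pb2 V (sl t) (sr s)) \<cdot> T_pair (sl t) (sr s) h k"
      by simp
  qed simp_all
  then show ?thesis by simp
qed

text \<open>Naturality of the pairing with respect to maps of cospans. It serves to compute the
  image under \<open>T\<close> of the arrow that the counit induces on composable pairs.\<close>

lemma T_pair_map:
  assumes "f \<in> Arr V" "g \<in> Arr V" "Cod V f = Cod V g" "f' \<in> Arr V" "g' \<in> Arr V" "Cod V f' = Cod V g'"
    "h \<in> Arr V" "k \<in> Arr V" "Dom V h = Dom V k" "Cod V h = TO (Dom V f)" "Cod V k = TO (Dom V g)" "TA f \<cdot> h = TA g \<cdot> k"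
    "\<alpha> \<in> Arr V" "Dom V \<alpha> = Dom V f" "Cod V \<alpha> = Dom V f'" "\<beta> \<in> Arr V" "Dom V \<beta> = Dom V g" "Cod V \<beta> = Dom V g'"
    "f' \<cdot> (\<alpha> \<cdot> pb1 V f g) = g' \<cdot> (\<beta> \<cdot> pb2 V f g)" "TA f' \<cdot> (TA \<alpha> \<cdot> h) = TA g' \<cdot> (TA \<beta> \<cdot> k)"
  shows "TA (pb_pair V f' g' (\<alpha> \<cdot> pb1 V f g) (\<beta> \<cdot> pb2 V f g)) \<cdot> T_pair f g h k = T_pair f' g' (TA \<alpha> \<cdot> h) (TA \<beta> \<cdot> k)"
proof (rule T_pb_eqI[of f' g'])
  note [simp] = assms
  let ?p = "pb_pair V f' g' (\<alpha> \<cdot> pb1 V f g) (\<beta> \<cdot> pb2 V f g)"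
  have "TA (pb1 V f' g') \<cdot> TA ?p = TA (\<alpha> \<cdot> pb1 V f g)" by (rule T_commute1) auto
  then have "TA (pb1 V f' g') \<cdot> (TA ?p \<cdot> T_pair f g h k) = TA (\<alpha> \<cdot> pb1 V f g) \<cdot> T_pair f g h k"
    by (rule Cmp_extend1) auto
  then show "TA (pb1 V f' g') \<cdot> (TA ?p \<cdot> T_pair f g h k) = TA (pb1 V f' g') \<cdot> T_pair f' g' (TA \<alpha> \<cdot> h) (TA \<beta> \<cdot> k)" by simp
  have "TA (pb2 V f' g') \<cdot> TA ?p = TA (\<beta> \<cdot> pb2 V f g)" by (rule T_commute1) auto
  then have "TA (pb2 V f' g') \<cdot> (TA ?p \<cdot> T_pair f g h k) = TA (\<beta> \<cdot> pb2 V f g) \<cdot> T_pair f g h k"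
    by (rule Cmp_extend1) auto
  then show "TA (pb2 V f' g') \<cdot> (TA ?p \<cdot> T_pair f g h k) = TA (pb2 V f' g') \<cdot> T_pair f' g' (TA \<alpha> \<cdot> h) (TA \<beta> \<cdot> k)" by simp
qed (use assms in simp_all)

subsection \<open>The strong conjoint hypothesis\<close>

declare Tb_set_def [simp] Tb_mat_def [simp]

abbreviation "Tm a \<equiv> psp (T_span T (sm a))"
abbreviation "\<phi> a \<equiv> fbi (T_span T (sm a))"
abbreviation "epsT a \<equiv> smap (eps_span V one (T_span T (sm a)))"
abbreviation "Pts X \<equiv> pts V one (TO (cp X))"

lemma conjoint_iso:
  "is_mat small V a \<Longrightarrow> is_iso V (pb_pair V (TA (sr (sm a))) (eps (TO (cp (mtgt a)))) (epsT a) (sr (sm (Tm a))))"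
  using strong_conjoint unfolding strong_conjoint_def by simp

lemma conjoint_commute:
  assumes "is_mat small V a"
  shows "TA (sr (sm a)) \<cdot> epsT a = eps (TO (cp (mtgt a))) \<cdot> sr (sm (Tm a))"
  using is_scellD(13)[OF is_scell_eps_span[of "T_span T (sm a)"]] assms by simp

text \<open>The strong conjoint hypothesis says that the square of \<open>conjoint_commute\<close>
  is a pullback. This is the existence half of the universal property; \<open>conjoint_mono\<close>
  is the uniqueness half.\<close>

lemma conjoint_lift:
  assumes a: "is_mat small V a" and hk: "h \<in> Arr V" "k \<in> Arr V" "Dom V h = Dom V k" "Cod V h = TO (mtot V a)" "Cod V k = cp (Pts (mtgt a))"
    "TA (sr (sm a)) \<cdot> h = eps (TO (cp (mtgt a))) \<cdot> k"
  obtains u where "u \<in> Arr V" "Dom V u = Dom V k" "Cod V u = mtot V (Tm a)" "epsT a \<cdot> u = h" "sr (sm (Tm a)) \<cdot> u = k"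
proof -
  note [simp] = a hk
  let ?R = "TA (sr (sm a))" and ?E = "eps (TO (cp (mtgt a)))"
  define c where "c = pb_pair V ?R ?E (epsT a) (sr (sm (Tm a)))"
  have iso: "is_iso V c" unfolding c_def by (rule conjoint_iso[OF a])
  have c: "c \<in> Arr V" "Dom V c = mtot V (Tm a)" "Cod V c = pb V ?R ?E" "pb1 V ?R ?E \<cdot> c = epsT a" "pb2 V ?R ?E \<cdot> c = sr (sm (Tm a))"
    unfolding c_def using conjoint_commute[OF a] by simp_all
  let ?u = "inv_arr V c \<cdot> pb_pair V ?R ?E h k"
  have u: "?u \<in> Arr V" "Dom V ?u = Dom V k" "Cod V ?u = mtot V (Tm a)" using iso c by simp_all
  have cu: "c \<cdot> ?u = pb_pair V ?R ?E h k" by (rule inv_arr_cancel(2)[OF iso]) (use c in simp_all)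
  have "pb1 V ?R ?E \<cdot> (c \<cdot> ?u) = epsT a \<cdot> ?u" by (rule Cmp_extend1[OF c(4)]) (use u c in simp_all)
  moreover have "pb2 V ?R ?E \<cdot> (c \<cdot> ?u) = sr (sm (Tm a)) \<cdot> ?u" by (rule Cmp_extend1[OF c(5)]) (use u c in simp_all)
  ultimately show thesis using that[OF u] cu by simp
qed

lemma conjoint_mono:
  assumes a: "is_mat small V a" and u: "u \<in> Arr V" "v \<in> Arr V" "Dom V u = Dom V v" "Cod V u = mtot V (Tm a)" "Cod V v = mtot V (Tm a)"
    "epsT a \<cdot> u = epsT a \<cdot> v" "sr (sm (Tm a)) \<cdot> u = sr (sm (Tm a)) \<cdot> v"
  shows "u = v"
proof -
  note [simp] = a u(1-5)
  let ?R = "TA (sr (sm a))" and ?E = "eps (TO (cp (mtgt a)))"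
  define c where "c = pb_pair V ?R ?E (epsT a) (sr (sm (Tm a)))"
  have iso: "is_iso V c" unfolding c_def by (rule conjoint_iso[OF a])
  have c: "c \<in> Arr V" "Dom V c = mtot V (Tm a)" "Cod V c = pb V ?R ?E" "pb1 V ?R ?E \<cdot> c = epsT a" "pb2 V ?R ?E \<cdot> c = sr (sm (Tm a))"
    unfolding c_def using conjoint_commute[OF a] by simp_all
  have 1: "pb1 V ?R ?E \<cdot> (c \<cdot> w) = epsT a \<cdot> w" "pb2 V ?R ?E \<cdot> (c \<cdot> w) = sr (sm (Tm a)) \<cdot> w" if "w \<in> Arr V" "Cod V w = mtot V (Tm a)" for w
    by (rule Cmp_extend1[OF c(4)] Cmp_extend1[OF c(5)]; use that c in simp)+
  have "c \<cdot> u = c \<cdot> v"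
  proof (rule pb_eqI[of ?R ?E])
    show "pb1 V ?R ?E \<cdot> (c \<cdot> u) = pb1 V ?R ?E \<cdot> (c \<cdot> v)" unfolding 1(1)[OF u(1,4)] 1(1)[OF u(2,5)] by (rule u(6))
    show "pb2 V ?R ?E \<cdot> (c \<cdot> u) = pb2 V ?R ?E \<cdot> (c \<cdot> v)" unfolding 1(2)[OF u(1,4)] 1(2)[OF u(2,5)] by (rule u(7))
  qed (use c(1-3) u(1-5) in simp_all)
  show ?thesis by (rule iso_cancel_left[OF iso _ _ _ _ \<open>c \<cdot> u = c \<cdot> v\<close>]) (use c(1-3) in simp_all)
qed

text \<open>If \<open>T r \<circ> f\<close> is constant at a point, then \<open>f\<close> lies locally in the fibres of \<open>T (a * 1)\<close>.\<close>

lemma conjoint_local_eqI: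
  assumes a: "is_mat small V a" and f: "f \<in> Arr V" "Cod V f = TO (mtot V a)"
    and y: "y \<in> Arr V" "Dom V y = one" "Cod V y = TO (cp (mtgt a))" "TA (sr (sm a)) \<cdot> f = y \<cdot> bng (Dom V f)"
    and uv: "u \<in> Arr V" "v \<in> Arr V" "Dom V u = Dom V f" "Dom V v = Dom V f" "Cod V u = Cod V v"
    and loc: "\<And>x k g. \<lbrakk>x \<in> Arr V; Dom V x = one; Cod V x = TO (cp (msrc a)); k \<in> Arr V; g \<in> Arr V; Dom V k = Dom V g; Cod V k = Dom V f; Cod V g = fib V (T_span T (sm a)) (x, y); f \<cdot> k = \<phi> a (x, y) \<cdot> g\<rbrakk> \<Longrightarrow> u \<cdot> k = v \<cdot> k"
  shows "u = v"
proof -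
  note [simp] = a f y(1-3) uv
  \<comment> \<open>Since \<open>T r \<circ> f\<close> is constant at \<open>y\<close>, it factors
    through the counit by way of the summand with index \<open>y\<close> of the copower on points.
    This is the second coordinate that the pullback property requires.\<close>
  have "TA (sr (sm a)) \<cdot> f = eps (TO (cp (mtgt a))) \<cdot> (cpi (Pts (mtgt a)) y \<cdot> bng (Dom V f))"
    using y(4) by simp
  from conjoint_lift[OF a f(1) _ _ f(2) _ this] obtain w where
    w: "w \<in> Arr V" "Dom V w = Dom V f" "Cod V w = mtot V (Tm a)" "epsT a \<cdot> w = f" "sr (sm (Tm a)) \<cdot> w = cpi (Pts (mtgt a)) y \<cdot> bng (Dom V f)"
    by auto
  show ?thesis
  proof (rule mtot_local_eqI[of "Tm a" w])
    fix x y' k g assume 1: "x \<in> msrc (Tm a)" "y' \<in> mtgt (Tm a)" "k \<in> Arr V" "g \<in> Arr V" "Dom V g = Dom V k" "Cod V k = Dom V w" "Cod V g = ment (Tm a) (x, y')"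
      "w \<cdot> k = mti (Tm a) (x, y') \<cdot> g"
    have "sr (sm (Tm a)) \<cdot> (w \<cdot> k) = (cpi (Pts (mtgt a)) y \<cdot> bng (Dom V f)) \<cdot> k"
      by (rule Cmp_extend1[OF w(5)]) (use w(1-3) 1(3-6) in simp_all)
    then have "cpi (Pts (mtgt a)) y' \<cdot> bng (Dom V k) = cpi (Pts (mtgt a)) y \<cdot> bng (Dom V k)"
      unfolding 1(8) using 1(1-7) w(1-3) by simp
    \<comment> \<open>The lift \<open>w\<close> is split over the summands of
      \<open>Tb a * 1\<close>. Its target is the summand \<open>y\<close> by construction, so that
      only fibres over \<open>y\<close> occur, up to initial domains.\<close>
    then have "y' = y \<or> is_initial V (Dom V k)" by (intro copow_disjoint[of "Pts (mtgt a)"]) (use 1(1-7) in auto)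
    then show "u \<cdot> k = v \<cdot> k"
    proof
      assume "is_initial V (Dom V k)" then show ?thesis by (rule is_initial_unique) (use 1(1-7) w(1-3) in simp_all)
    next
      assume y': "y' = y"
      have "epsT a \<cdot> (w \<cdot> k) = f \<cdot> k" by (rule Cmp_extend1[OF w(4)]) (use w(1-3) 1(3-6) in simp_all)
      then have "f \<cdot> k = \<phi> a (x, y) \<cdot> g" unfolding 1(8) using 1(1-7) y' w(1-3) by simp
      then show ?thesis by (rule loc[rotated -1]) (use 1(1-7) y' w(1-3) in auto)
    qed
  qed (use w(1-3) in simp_all)
qed

subsection \<open>Cells of the monad on matrices\<close>

declare T_comp_simps(5) [simp del]

lemma fib_T_simps [simp]:
  assumes "is_span V s" "v \<in> Arr V" "w \<in> Arr V" "Dom V v = one" "Dom V w = one"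
    "Cod V v = TO (Cod V (sl s))" "Cod V w = TO (Cod V (sr s))"
  shows "TA (sl s) \<cdot> fbi (T_span T s) (v, w) = v \<cdot> bng (fib V (T_span T s) (v, w))"
    "TA (sr s) \<cdot> fbi (T_span T s) (v, w) = w \<cdot> bng (fib V (T_span T s) (v, w))"
    "g \<in> Arr V \<Longrightarrow> Cod V g = fib V (T_span T s) (v, w) \<Longrightarrow> TA (sl s) \<cdot> (fbi (T_span T s) (v, w) \<cdot> g) = v \<cdot> bng (Dom V g)"
    "g \<in> Arr V \<Longrightarrow> Cod V g = fib V (T_span T s) (v, w) \<Longrightarrow> TA (sr s) \<cdot> (fbi (T_span T s) (v, w) \<cdot> g) = w \<cdot> bng (Dom V g)"
  using fib_simps(5,6)[of "T_span T s" v w] fib_simps'[of "T_span T s" v w g] assms by simp_all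

lemma eb_set_apply [simp]: "small X \<Longrightarrow> x \<in> X \<Longrightarrow> eb_set V one T X x = unit T (cp X) \<cdot> cpi X x"
  by (simp add: eb_set_def eta_set_def compose_eq)

lemma mb_set_apply [simp]:
  "small X \<Longrightarrow> x \<in> Pts (Pts X) \<Longrightarrow> mb_set V one T X x = mult T (cp X) \<cdot> (TA (eps (TO (cp X))) \<cdot> x)"
  by (simp add: mb_set_def)

lemma Tb_fun_apply [simp]:
  "\<lbrakk>small X; small Y; f \<in> X \<rightarrow>\<^sub>E Y; x \<in> Pts X\<rbrakk> \<Longrightarrow> Tb_fun V one T X Y f x = TA (cpm X Y f) \<cdot> x"
  by (simp add: Tb_fun_def)

lemma is_scell_e_span: "is_span V s \<Longrightarrow> is_scell V (e_span V T s)"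
  unfolding is_scell_def by (simp add: e_span_def apex_def)

lemma is_scell_m_span: "is_span V s \<Longrightarrow> is_scell V (m_span V T s)"
  unfolding is_scell_def by (simp add: m_span_def apex_def)

lemma eb_mat_simps [simp]:
  assumes p: "is_mat small V p"
  shows "mcell (eb_mat V one T p)" "cdom (eb_mat V one T p) = p" "ccod (eb_mat V one T p) = Tm p"
    "x \<in> msrc p \<Longrightarrow> cleft (eb_mat V one T p) x = unit T (cp (msrc p)) \<cdot> cpi (msrc p) x" (is "PROP ?A")
    "y \<in> mtgt p \<Longrightarrow> cright (eb_mat V one T p) y = unit T (cp (mtgt p)) \<cdot> cpi (mtgt p) y" (is "PROP ?B")
    "\<lbrakk>x \<in> msrc p; y \<in> mtgt p; g \<in> Arr V; Cod V g = ment p (x, y)\<rbrakk> \<Longrightarrow>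
      \<phi> p (unit T (cp (msrc p)) \<cdot> cpi (msrc p) x, unit T (cp (mtgt p)) \<cdot> cpi (mtgt p) y) \<cdot> (cmap (eb_mat V one T p) (x, y) \<cdot> g) =
      unit T (mtot V p) \<cdot> (mti p (x, y) \<cdot> g)"
proof -
  note [simp] = p
  have e: "is_scell V (e_span V T (sm p))" by (rule is_scell_e_span) simp
  have [simp]: "sdom (e_span V T (sm p)) = sm p" "scod (e_span V T (sm p)) = T_span T (sm p)" "sleft (e_span V T (sm p)) = unit T (cp (msrc p))"
    "sright (e_span V T (sm p)) = unit T (cp (mtgt p))" "smap (e_span V T (sm p)) = unit T (mtot V p)"
    by (simp_all add: e_span_def)
  show m: "mcell (eb_mat V one T p)" unfolding eb_mat_def by (rule mcell_vcomp) (use mcell_pts_cell[OF e] in simp_all)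
  show d: "cdom (eb_mat V one T p) = p" "ccod (eb_mat V one T p) = Tm p"
    "PROP ?A"
    "PROP ?B"
    by (simp_all add: eb_mat_def)
  assume 1: "x \<in> msrc p" "y \<in> mtgt p" "g \<in> Arr V" "Cod V g = ment p (x, y)"
  let ?v = "cpi (msrc p) x" and ?w = "cpi (mtgt p) y"
  let ?c = "cmap (ptc (e_span V T (sm p))) (?v, ?w)"
  note c = pts_cell_cmap[OF e, of ?v ?w]
  have "\<phi> p (unit T (cp (msrc p)) \<cdot> ?v, unit T (cp (mtgt p)) \<cdot> ?w) \<cdot> (?c \<cdot> (cmap (eta_mat V one p) (x, y) \<cdot> g))
     = (unit T (mtot V p) \<cdot> fbi (sm p) (?v, ?w)) \<cdot> (cmap (eta_mat V one p) (x, y) \<cdot> g)"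
    by (rule Cmp_extend1) (use c 1 in simp_all)
  then show "\<phi> p (unit T (cp (msrc p)) \<cdot> ?v, unit T (cp (mtgt p)) \<cdot> ?w) \<cdot> (cmap (eb_mat V one T p) (x, y) \<cdot> g) = unit T (mtot V p) \<cdot> (mti p (x, y) \<cdot> g)"
    using 1 c by (simp add: eb_mat_def)
qed

lemma mb_mat_simps [simp]:
  assumes p: "is_mat small V p"
  shows "mcell (mb_mat V one T p)" "cdom (mb_mat V one T p) = Tm (Tm p)" "ccod (mb_mat V one T p) = Tm p"
    "x \<in> Pts (Pts (msrc p)) \<Longrightarrow> cleft (mb_mat V one T p) x = mult T (cp (msrc p)) \<cdot> (TA (eps (TO (cp (msrc p)))) \<cdot> x)" (is "PROP ?A")
    "y \<in> Pts (Pts (mtgt p)) \<Longrightarrow> cright (mb_mat V one T p) y = mult T (cp (mtgt p)) \<cdot> (TA (eps (TO (cp (mtgt p)))) \<cdot> y)" (is "PROP ?B")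
    "\<lbrakk>x \<in> Pts (Pts (msrc p)); y \<in> Pts (Pts (mtgt p)); g \<in> Arr V; Cod V g = fib V (T_span T (sm (Tm p))) (x, y)\<rbrakk> \<Longrightarrow>
      \<phi> p (mult T (cp (msrc p)) \<cdot> (TA (eps (TO (cp (msrc p)))) \<cdot> x),
         mult T (cp (mtgt p)) \<cdot> (TA (eps (TO (cp (mtgt p)))) \<cdot> y)) \<cdot> (cmap (mb_mat V one T p) (x, y) \<cdot> g) =
      mult T (mtot V p) \<cdot> (TA (epsT p) \<cdot> (\<phi> (Tm p) (x, y) \<cdot> g))"
proof -
  note [simp] = p
  have e: "is_scell V (m_span V T (sm p))" by (rule is_scell_m_span) simp
  have [simp]: "sdom (m_span V T (sm p)) = T_span T (T_span T (sm p))" "scod (m_span V T (sm p)) = T_span T (sm p)" "sleft (m_span V T (sm p)) = mult T (cp (msrc p))"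
    "sright (m_span V T (sm p)) = mult T (cp (mtgt p))" "smap (m_span V T (sm p)) = mult T (mtot V p)"
    by (simp_all add: m_span_def)
  let ?C = "svcomp V (m_span V T (sm p)) (T_cell T (eps_span V one (T_span T (sm p))))"
  have C: "is_scell V ?C"
    by (rule is_scell_svcomp[OF is_scell_T_cell[OF is_scell_eps_span] e]) simp_all
  show m: "mcell (mb_mat V one T p)" unfolding mb_mat_def by (rule mcell_pts_cell[OF C])
  show d: "cdom (mb_mat V one T p) = Tm (Tm p)" "ccod (mb_mat V one T p) = Tm p"
    "PROP ?A"
    "PROP ?B"
    by (simp_all add: mb_mat_def)
  assume 1: "x \<in> Pts (Pts (msrc p))" "y \<in> Pts (Pts (mtgt p))" "g \<in> Arr V" "Cod V g = fib V (T_span T (sm (Tm p))) (x, y)"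
  note c = pts_cell_cmap[OF C, of x y]
  have "fbi (scod ?C) (sleft ?C \<cdot> x, sright ?C \<cdot> y) \<cdot> (cmap (mb_mat V one T p) (x, y) \<cdot> g) = (smap ?C \<cdot> fbi (sdom ?C) (x, y)) \<cdot> g"
    unfolding mb_mat_def by (rule Cmp_extend1[OF c(4)]) (use c(1-3) 1 in simp_all)
  then show "\<phi> p (mult T (cp (msrc p)) \<cdot> (TA (eps (TO (cp (msrc p)))) \<cdot> x),
         mult T (cp (mtgt p)) \<cdot> (TA (eps (TO (cp (mtgt p)))) \<cdot> y)) \<cdot> (cmap (mb_mat V one T p) (x, y) \<cdot> g) =
      mult T (mtot V p) \<cdot> (TA (epsT p) \<cdot> (\<phi> (Tm p) (x, y) \<cdot> g))"
    using 1 by simp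
qed

lemma Tb_cell_simps [simp]:
  assumes \<Phi>: "mcell \<Phi>"
  shows "mcell (Tb_cell V one T \<Phi>)" "cdom (Tb_cell V one T \<Phi>) = Tm (cdom \<Phi>)" "ccod (Tb_cell V one T \<Phi>) = Tm (ccod \<Phi>)"
    "cleft (Tb_cell V one T \<Phi>) = Tb_fun V one T (msrc (cdom \<Phi>)) (msrc (ccod \<Phi>)) (cleft \<Phi>)"
    "cright (Tb_cell V one T \<Phi>) = Tb_fun V one T (mtgt (cdom \<Phi>)) (mtgt (ccod \<Phi>)) (cright \<Phi>)"
proof -
  show "mcell (Tb_cell V one T \<Phi>)" unfolding Tb_cell_def by (rule mcell_pts_cell[OF is_scell_T_cell[OF is_scell_star_cell[OF \<Phi>]]])
qed (simp_all add: Tb_cell_def Tb_fun_def)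

lemma Tb_cell_cmap:
  assumes \<Phi>: "mcell \<Phi>" and 1: "x \<in> Pts (msrc (cdom \<Phi>))" "y \<in> Pts (mtgt (cdom \<Phi>))" "g \<in> Arr V" "Cod V g = fib V (T_span T (sm (cdom \<Phi>))) (x, y)"
  shows "\<phi> (ccod \<Phi>) (TA (cpm (msrc (cdom \<Phi>)) (msrc (ccod \<Phi>)) (cleft \<Phi>)) \<cdot> x,
      TA (cpm (mtgt (cdom \<Phi>)) (mtgt (ccod \<Phi>)) (cright \<Phi>)) \<cdot> y) \<cdot> (cmap (Tb_cell V one T \<Phi>) (x, y) \<cdot> g) =
      TA (smap (stc \<Phi>)) \<cdot> (\<phi> (cdom \<Phi>) (x, y) \<cdot> g)"
proof -
  note [simp] = \<Phi>
  let ?C = "T_cell T (stc \<Phi>)"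
  have C: "is_scell V ?C" by (rule is_scell_T_cell[OF is_scell_star_cell[OF \<Phi>]])
  note c = pts_cell_cmap[OF C, of x y]
  have "fbi (scod ?C) (sleft ?C \<cdot> x, sright ?C \<cdot> y) \<cdot> (cmap (Tb_cell V one T \<Phi>) (x, y) \<cdot> g) = (smap ?C \<cdot> fbi (sdom ?C) (x, y)) \<cdot> g"
    unfolding Tb_cell_def by (rule Cmp_extend1[OF c(4)]) (use c(1-3) 1 in simp_all)
  then show ?thesis using 1 by simp
qed

lemma Tb_unit_simps [simp]:
  assumes X: "small X"
  shows "mcell (Tb_unit V one T X)" "cdom (Tb_unit V one T X) = munit V one (Pts X)" (is ?A) "ccod (Tb_unit V one T X) = Tm (munit V one X)" (is ?B)
    "x \<in> Pts X \<Longrightarrow> cleft (Tb_unit V one T X) x = x" (is "PROP ?D") "x \<in> Pts X \<Longrightarrow> cright (Tb_unit V one T X) x = x" (is "PROP ?E")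
    "\<lbrakk>x \<in> Pts X; e \<in> Arr V; Cod V e = one\<rbrakk> \<Longrightarrow> \<phi> (munit V one X) (x, x) \<cdot> (cmap (Tb_unit V one T X) (x, x) \<cdot> (cpi {()} () \<cdot> e)) = TA (smap (star_unit V one X)) \<cdot> (x \<cdot> e)"
proof -
  note [simp] = X
  let ?C = "T_cell T (star_unit V one X)"
  have C: "is_scell V ?C" by (rule is_scell_T_cell[OF is_scell_star_unit[OF X]])
  \<comment> \<open>\<open>T\<close> preserves identities, so the unit span on an object is carried
    to the unit span on its image and no comparison cell intervenes.\<close>
  have su: "T_span T (sunit V (cp X)) = sunit V (TO (cp X))"
    by (simp add: sunit_def T_span_def)
  note [simp] = su
  show m: "mcell (Tb_unit V one T X)" unfolding Tb_unit_def
    by (rule mcell_vcomp) (use mcell_pts_cell[OF C] in simp_all)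
  show d: ?A ?B
    "PROP ?D" "PROP ?E"
    by (simp_all add: Tb_unit_def)
  assume 1: "x \<in> Pts X" "e \<in> Arr V" "Cod V e = one"
  note c = pts_cell_cmap[OF C, of x x]
  let ?k = "cmap (pts_unit V one (TO (cp X))) (x, x) \<cdot> (cpi {()} () \<cdot> e)"
  note u = pts_unit_cmap[of "TO (cp X)" x x]
  have "fbi (scod ?C) (sleft ?C \<cdot> x, sright ?C \<cdot> x) \<cdot> (cmap (ptc ?C) (x, x) \<cdot> ?k) = (smap ?C \<cdot> fbi (sdom ?C) (x, x)) \<cdot> ?k"
    by (rule Cmp_extend1[OF c(4)]) (use c(1-3) u 1 in simp_all)
  then show "\<phi> (munit V one X) (x, x) \<cdot> (cmap (Tb_unit V one T X) (x, x) \<cdot> (cpi {()} () \<cdot> e)) = TA (smap (star_unit V one X)) \<cdot> (x \<cdot> e)"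
    using 1 c u pts_unit_cmap_same(2)[of "TO (cp X)" x e] by (simp add: Tb_unit_def)
qed

text \<open>The lax comparison is composed of those of \<open>V(1, -)\<close>, of \<open>T\<close>
  and of \<open>- * 1\<close>. A pair of elements passes through them as a pairing into the pullback
  of the images, then as a pairing into the image of the pullback, and last as its value under
  \<open>T\<close> of the inverse comparison of spans.\<close>

lemma Tb_comp_simps [simp]:
  assumes m: "is_mat small V p" "is_mat small V q" "msrc q = mtgt p"
  shows "mcell (Tb_comp V one T q p)" "cdom (Tb_comp V one T q p) = mcomp V (Tm q) (Tm p)" (is ?A) "ccod (Tb_comp V one T q p) = Tm (mcomp V q p)" (is ?B)
    "x \<in> Pts (msrc p) \<Longrightarrow> cleft (Tb_comp V one T q p) x = x" (is "PROP ?E") "z \<in> Pts (mtgt q) \<Longrightarrow> cright (Tb_comp V one T q p) z = z" (is "PROP ?G")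
    "\<lbrakk>x \<in> Pts (msrc p); y \<in> Pts (mtgt p); z \<in> Pts (mtgt q); g \<in> Arr V; h \<in> Arr V; Dom V g = Dom V h; Cod V g = fib V (T_span T (sm q)) (y, z); Cod V h = fib V (T_span T (sm p)) (x, y)\<rbrakk> \<Longrightarrow>
      \<phi> (mcomp V q p) (x, z) \<cdot> (cmap (Tb_comp V one T q p) (x, z) \<cdot> (mci (Tm q) (Tm p) x y z \<cdot> pair V g h)) =
      TA (smap (star_comp V one q p)) \<cdot> T_pair (sl (sm q)) (sr (sm p)) (\<phi> q (y, z) \<cdot> g) (\<phi> p (x, y) \<cdot> h)"
proof -
  note [simp] = m
  let ?C = "T_cell T (star_comp V one q p)" and ?D = "T_comp V T (sm q) (sm p)"
  have C: "is_scell V ?C" by (rule is_scell_T_cell[OF is_scell_star_comp[OF m]])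
  have D: "is_scell V ?D" by (rule is_scell_T_comp) simp_all
  have P: "mcell (pts_comp V one (T_span T (sm q)) (T_span T (sm p)))" by (rule mcell_pts_comp) simp_all
  have [simp]: "sleft (star_comp V one q p) = Ident V (cp (msrc p))" "sright (star_comp V one q p) = Ident V (cp (mtgt q))"
    by (simp_all add: star_comp_def globular_scell_def)
  show "mcell (Tb_comp V one T q p)" unfolding Tb_comp_def
    by (rule mcell_vcomp[OF mcell_vcomp[OF P mcell_pts_cell[OF D]] mcell_pts_cell[OF C]]) simp_all
  show ?A ?B
    "PROP ?E" "PROP ?G"
    by (simp_all add: Tb_comp_def)
  assume 1: "x \<in> Pts (msrc p)" "y \<in> Pts (mtgt p)" "z \<in> Pts (mtgt q)" "g \<in> Arr V" "h \<in> Arr V" "Dom V g = Dom V h"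
      "Cod V g = fib V (T_span T (sm q)) (y, z)" "Cod V h = fib V (T_span T (sm p)) (x, y)"
  let ?e = "mci (Tm q) (Tm p) x y z \<cdot> pair V g h"
  let ?p = "cmap (pts_comp V one (T_span T (sm q)) (T_span T (sm p))) (x, z)"
  note c = pts_cell_cmap[OF C, of x z] and d = pts_cell_cmap[OF D, of x z]
  note p = pts_comp_cmap[of "T_span T (sm p)" "T_span T (sm q)" x z]
  have e: "?e \<in> Arr V" "Dom V ?e = Dom V h" "Cod V ?e = ment (mcomp V (Tm q) (Tm p)) (x, z)" using 1 by simp_all
  have pt: "?p \<in> Arr V" "Dom V ?p = ment (mcomp V (Tm q) (Tm p)) (x, z)" "Cod V ?p = fib V (scomp V (T_span T (sm q)) (T_span T (sm p))) (x, z)"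
    using p(1-3) 1 by simp_all
  have dt: "cmap (ptc ?D) (x, z) \<in> Arr V" "Dom V (cmap (ptc ?D) (x, z)) = fib V (scomp V (T_span T (sm q)) (T_span T (sm p))) (x, z)"
    "Cod V (cmap (ptc ?D) (x, z)) = fib V (T_span T (scomp V (sm q) (sm p))) (x, z)"
    using d(1-3) 1 by simp_all
  have ct: "cmap (ptc ?C) (x, z) \<in> Arr V" "Dom V (cmap (ptc ?C) (x, z)) = fib V (T_span T (scomp V (sm q) (sm p))) (x, z)"
    "Cod V (cmap (ptc ?C) (x, z)) = fib V (T_span T (sm (mcomp V q p))) (x, z)"
    using c(1-3) 1 by simp_all
  have "cmap (Tb_comp V one T q p) (x, z) = cmap (ptc ?C) (x, z) \<cdot> (cmap (ptc ?D) (x, z) \<cdot> ?p)"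
    using 1 by (simp add: Tb_comp_def)
  then have 2: "cmap (Tb_comp V one T q p) (x, z) \<cdot> ?e = cmap (ptc ?C) (x, z) \<cdot> (cmap (ptc ?D) (x, z) \<cdot> (?p \<cdot> ?e))"
    using ct dt pt e by (simp del: pair_Cmp)
  have c4: "\<phi> (mcomp V q p) (x, z) \<cdot> cmap (ptc ?C) (x, z) = TA (smap (star_comp V one q p)) \<cdot> fbi (T_span T (scomp V (sm q) (sm p))) (x, z)"
    using c(4) 1 by simp
  have d4: "fbi (T_span T (scomp V (sm q) (sm p))) (x, z) \<cdot> cmap (ptc ?D) (x, z) = smap ?D \<cdot> fbi (scomp V (T_span T (sm q)) (T_span T (sm p))) (x, z)"
    using d(4) 1 by simp
  have "\<phi> (mcomp V q p) (x, z) \<cdot> (cmap (ptc ?C) (x, z) \<cdot> (cmap (ptc ?D) (x, z) \<cdot> (?p \<cdot> ?e))) =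
     TA (smap (star_comp V one q p)) \<cdot> (fbi (T_span T (scomp V (sm q) (sm p))) (x, z) \<cdot> (cmap (ptc ?D) (x, z) \<cdot> (?p \<cdot> ?e)))"
    by (rule Cmp_extend[OF c4]) (use ct dt pt e 1 in simp_all)
  also have "fbi (T_span T (scomp V (sm q) (sm p))) (x, z) \<cdot> (cmap (ptc ?D) (x, z) \<cdot> (?p \<cdot> ?e)) =
     smap ?D \<cdot> (fbi (scomp V (T_span T (sm q)) (T_span T (sm p))) (x, z) \<cdot> (?p \<cdot> ?e))"
    by (rule Cmp_extend[OF d4]) (use ct dt pt e 1 is_scellD(9-11)[OF D] in simp_all)
  also have "fbi (scomp V (T_span T (sm q)) (T_span T (sm p))) (x, z) \<cdot> (?p \<cdot> ?e) = pb_pair V (TA (sl (sm q))) (TA (sr (sm p))) (\<phi> q (y, z) \<cdot> g) (\<phi> p (x, y) \<cdot> h)"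
    using p(4)[of y g h] 1 by simp
  also have "smap ?D \<cdot> \<dots> = T_pair (sl (sm q)) (sr (sm p)) (\<phi> q (y, z) \<cdot> g) (\<phi> p (x, y) \<cdot> h)"
    by (rule T_pair_pb_pair) (use 1 in simp_all)
  finally show "\<phi> (mcomp V q p) (x, z) \<cdot> (cmap (Tb_comp V one T q p) (x, z) \<cdot> ?e) =
      TA (smap (star_comp V one q p)) \<cdot> T_pair (sl (sm q)) (sr (sm p)) (\<phi> q (y, z) \<cdot> g) (\<phi> p (x, y) \<cdot> h)" using 2 by simp
qed

section \<open>The monad laws on boundary functions\<close>

abbreviation "Mb X x \<equiv> mult T (cp X) \<cdot> (TA (eps (TO (cp X))) \<cdot> x)"
abbreviation "Eb X x \<equiv> unit T (cp X) \<cdot> cpi X x"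
abbreviation "Tf a \<equiv> fib V (T_span T (sm a))"

lemma eb_set_PiE [simp]: "small X \<Longrightarrow> eb_set V one T X \<in> X \<rightarrow>\<^sub>E Pts X"
proof (rule PiE_I)
  fix x assume "small X" "x \<notin> X"
  then show "eb_set V one T X x = undefined" by (simp add: eb_set_def compose_def)
qed simp

lemma mb_set_PiE [simp]: "small X \<Longrightarrow> mb_set V one T X \<in> Pts (Pts X) \<rightarrow>\<^sub>E Pts X"
proof (rule PiE_I)
  fix x assume "small X" "x \<notin> Pts (Pts X)"
  then show "mb_set V one T X x = undefined" by (auto simp: mb_set_def pts_map_def)
qed simp

lemma copow_map_id [simp]: "small X \<Longrightarrow> cpm X X (\<lambda>x\<in>X. x) = Ident V (cp X)"
  by (rule copow_eqI[of X]) auto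

lemma eps_copow_eb [simp]:
  "small X \<Longrightarrow> eps (TO (cp X)) \<cdot> cpm X (Pts X) (eb_set V one T X) = unit T (cp X)"
  by (rule copow_eqI[of X]) auto

text \<open>An instance of naturality of the counit: the function \<open>mb_set\<close> is
  composition with an arrow, and the counit turns the function on points back into that
  arrow.\<close>

lemma eps_copow_mb:
  "small X \<Longrightarrow> eps (TO (cp X)) \<cdot> cpm (Pts (Pts X)) (Pts X) (mb_set V one T X) =
    mult T (cp X) \<cdot> (TA (eps (TO (cp X))) \<cdot> eps (TO (cp (Pts X))))"
  by (rule copow_eqI[of "Pts (Pts X)"]) auto

lemma Mb_Eb: "small X \<Longrightarrow> x \<in> Pts X \<Longrightarrow> Mb X (Eb (Pts X) x) = x"
  by simp

lemma Mb_TEb: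
  assumes "small X" "x \<in> Pts X"
  shows "Mb X (TA (cpm X (Pts X) (eb_set V one T X)) \<cdot> x) = x"
proof -
  have "TA (eps (TO (cp X))) \<cdot> TA (cpm X (Pts X) (eb_set V one T X)) = TA (unit T (cp X))"
    by (rule T_commute1) (use assms in auto)
  then have "TA (eps (TO (cp X))) \<cdot> (TA (cpm X (Pts X) (eb_set V one T X)) \<cdot> x) = TA (unit T (cp X)) \<cdot> x"
    by (rule Cmp_extend1) (use assms in auto)
  then show ?thesis using assms by simp
qed

text \<open>The associativity law of the monad on points, obtained from \<open>eps_copow_mb\<close>
  under \<open>T\<close> and from associativity of \<open>m\<close>. It makes the left boundaries of
  the two sides of the associativity axiom agree.\<close>

lemma Mb_TMb:
  assumes "small X" "x \<in> Pts (Pts (Pts X))"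
  shows "Mb X (TA (cpm (Pts (Pts X)) (Pts X) (mb_set V one T X)) \<cdot> x) = Mb X (Mb (Pts X) x)"
proof -
  let ?e = "eps (TO (cp X))" and ?e' = "eps (TO (cp (Pts X)))"
  have "TA ?e \<cdot> TA (cpm (Pts (Pts X)) (Pts X) (mb_set V one T X)) = TA (mult T (cp X) \<cdot> (TA ?e \<cdot> ?e'))"
    by (rule T_commute1[OF eps_copow_mb]) (use assms in auto)
  then have "TA ?e \<cdot> (TA (cpm (Pts (Pts X)) (Pts X) (mb_set V one T X)) \<cdot> x) = TA (mult T (cp X) \<cdot> (TA ?e \<cdot> ?e')) \<cdot> x"
    by (rule Cmp_extend1) (use assms in auto)
  then show ?thesis using assms by simp
qed

end

section \<open>Data of an enriched category and its span\<close>

text \<open>The boundaries of all data are fixed, but none of the equations is assumed. In this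
  generality the axioms can be shown equivalent to conditions on elements, and the matrix of points
  of an internal category can be treated before its axioms are known.\<close>

locale pre_ecat = star_points small V one T
  for small :: "'a set \<Rightarrow> bool" and V :: "('o, 'a) cat" (structure) and one :: 'o and T :: "('o, 'a) monad_data" +
  fixes A :: "('o, 'a) ecat"
  assumes small_X [simp]: "small (eX A)" and mat [simp]: "is_mat small V (ea A)"
    and src [simp]: "msrc (ea A) = pts V one (omap (endo T) (cp (eX A)))" and tgt [simp]: "mtgt (ea A) = eX A"
    and un_cell [simp]: "is_mcell small V (eun A)" "cdom (eun A) = munit V one (eX A)" "ccod (eun A) = ea A"
      "cleft (eun A) = eb_set V one T (eX A)" "cright (eun A) = idf (eX A)"
    and mu_cell [simp]: "is_mcell small V (emu A)" "cdom (emu A) = mcomp V (ea A) (Tb_mat V one T (ea A))" "ccod (emu A) = ea A"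
      "cleft (emu A) = mb_set V one T (eX A)" "cright (emu A) = idf (eX A)"
begin

abbreviation "X \<equiv> eX A"
abbreviation "a \<equiv> ea A"
abbreviation "L \<equiv> star_ecat_l V one T A"
abbreviation "R \<equiv> sr (sm (ea A))"

lemma L_simps [simp]:
  "L \<in> Arr V" "Dom V L = mtot V a" "Cod V L = TO (cp X)"
  "\<lbrakk>x \<in> Arr V; Dom V x = one; Cod V x = TO (cp X); y \<in> X\<rbrakk> \<Longrightarrow> L \<cdot> mti a (x, y) = x \<cdot> bng (ment a (x, y))"
  "\<lbrakk>x \<in> Arr V; Dom V x = one; Cod V x = TO (cp X); y \<in> X; g \<in> Arr V; Cod V g = ment a (x, y)\<rbrakk> \<Longrightarrow> L \<cdot> (mti a (x, y) \<cdot> g) = x \<cdot> bng (Dom V g)"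
  by (simp_all add: star_ecat_l_def)

text \<open>A pasting argument. The leg \<open>L\<close> is the counit after the left leg of
  \<open>a * 1\<close>, so \<open>X\<^sub>2\<close> is obtained by pulling back first along the
  counit and then along that left leg. The first of these pullbacks is \<open>Tb a * 1\<close> by
  the strong conjoint hypothesis, and the second is the composite of spans.\<close>

lemma star_X2:
  shows "is_iso V (star_X2_map V one T A)" "Dom V (star_X2_map V one T A) = pb V (sl (sm a)) (sr (sm (Tm a)))" (is ?A)
    "Cod V (star_X2_map V one T A) = pb V L (TA R)" (is ?B)
    "pb1 V L (TA R) \<cdot> star_X2_map V one T A = pb1 V (sl (sm a)) (sr (sm (Tm a)))" (is ?C)
    "pb2 V L (TA R) \<cdot> star_X2_map V one T A = epsT a \<cdot> pb2 V (sl (sm a)) (sr (sm (Tm a)))" (is ?D)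
proof -
  let ?l = "sl (sm a)" and ?r = "sr (sm (Tm a))" and ?e = "eps (TO (cp X))"
  define s where "s = star_X2_map V one T A"
  have com: "?l \<cdot> pb1 V ?l ?r = ?r \<cdot> pb2 V ?l ?r" by (rule pb_commute) simp_all
  have "TA R \<cdot> (epsT a \<cdot> pb2 V ?l ?r) = ?e \<cdot> (?r \<cdot> pb2 V ?l ?r)"
    using Cmp_extend[OF conjoint_commute[OF mat], of "pb2 V ?l ?r"] by simp
  also have "\<dots> = L \<cdot> pb1 V ?l ?r" using com by (simp add: star_ecat_l_def)
  finally have com2: "L \<cdot> pb1 V ?l ?r = TA R \<cdot> (epsT a \<cdot> pb2 V ?l ?r)" by simp
  have s: "s \<in> Arr V" "Dom V s = pb V ?l ?r" "Cod V s = pb V L (TA R)" "pb1 V L (TA R) \<cdot> s = pb1 V ?l ?r" "pb2 V L (TA R) \<cdot> s = epsT a \<cdot> pb2 V ?l ?r"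
    unfolding s_def star_X2_map_def Let_def Tb_mat_def using com2 by simp_all
  have "is_iso V s"
  proof (rule is_isoI_mono_lift[OF s(1)])
    fix u v assume uv: "u \<in> Arr V" "v \<in> Arr V" "Dom V u = Dom V v" "Cod V u = Dom V s" "Cod V v = Dom V s" "s \<cdot> u = s \<cdot> v"
    have 1: "pb1 V ?l ?r \<cdot> u = pb1 V ?l ?r \<cdot> v"
      using Cmp_extend1[OF s(4), of u] Cmp_extend1[OF s(4), of v] uv s(1-3) by simp
    have "pb2 V L (TA R) \<cdot> (s \<cdot> u) = (epsT a \<cdot> pb2 V ?l ?r) \<cdot> u" "pb2 V L (TA R) \<cdot> (s \<cdot> v) = (epsT a \<cdot> pb2 V ?l ?r) \<cdot> v"
      by (rule Cmp_extend1[OF s(5)]; use uv(1-5) s(1-3) in simp)+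
    then have 2: "epsT a \<cdot> (pb2 V ?l ?r \<cdot> u) = epsT a \<cdot> (pb2 V ?l ?r \<cdot> v)" using uv s(1-3) by simp
    have "?l \<cdot> (pb1 V ?l ?r \<cdot> u) = ?r \<cdot> (pb2 V ?l ?r \<cdot> u)" "?l \<cdot> (pb1 V ?l ?r \<cdot> v) = ?r \<cdot> (pb2 V ?l ?r \<cdot> v)"
      by (rule Cmp_extend[OF com]; use uv(1-5) s(1-3) in simp)+
    then have 3: "?r \<cdot> (pb2 V ?l ?r \<cdot> u) = ?r \<cdot> (pb2 V ?l ?r \<cdot> v)" using 1 by simp
    have 4: "pb2 V ?l ?r \<cdot> u = pb2 V ?l ?r \<cdot> v"
      by (rule conjoint_mono[OF mat _ _ _ _ _ 2 3]) (use uv(1-5) s(1-3) in simp_all)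
    show "u = v" by (rule pb_eqI[of ?l ?r, OF _ _ _ _ _ _ _ _ 1 4]) (use uv(1-5) s(1-3) in simp_all)
  next
    let ?p1 = "pb1 V L (TA R)" and ?p2 = "pb2 V L (TA R)"
    have "L \<cdot> ?p1 = TA R \<cdot> ?p2" by (rule pb_commute) simp_all
    then have c: "TA R \<cdot> ?p2 = eps (TO (cp (mtgt a))) \<cdot> (?l \<cdot> ?p1)" by (simp add: star_ecat_l_def)
    \<comment> \<open>The second projection of \<open>X\<^sub>2\<close> lifts to the apex of
      \<open>Tb a * 1\<close>: its image under \<open>T r\<close> is the counit applied to the left
      leg of the first projection. Paired with the first projection, this lift gives the
      section.\<close>
    obtain u where u: "u \<in> Arr V" "Dom V u = pb V L (TA R)" "Cod V u = mtot V (Tm a)" "epsT a \<cdot> u = ?p2" "?r \<cdot> u = ?l \<cdot> ?p1"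
      by (rule conjoint_lift[OF mat _ _ _ _ _ c]) simp_all
    define w where "w = pb_pair V ?l ?r ?p1 u"
    have w: "w \<in> Arr V" "Dom V w = pb V L (TA R)" "Cod V w = pb V ?l ?r" "pb1 V ?l ?r \<cdot> w = ?p1" "pb2 V ?l ?r \<cdot> w = u"
      unfolding w_def using u by simp_all
    have "s \<cdot> w = Ident V (pb V L (TA R))"
    proof (rule pb_eqI[of L "TA R"])
      have "?p1 \<cdot> (s \<cdot> w) = pb1 V ?l ?r \<cdot> w" by (rule Cmp_extend1[OF s(4)]) (use s(1-3) w(1-3) in simp_all)
      then show "?p1 \<cdot> (s \<cdot> w) = ?p1 \<cdot> Ident V (pb V L (TA R))" using w(4) by simp
      have "?p2 \<cdot> (s \<cdot> w) = (epsT a \<cdot> pb2 V ?l ?r) \<cdot> w" by (rule Cmp_extend1[OF s(5)]) (use s(1-3) w(1-3) in simp_all)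
      then show "?p2 \<cdot> (s \<cdot> w) = ?p2 \<cdot> Ident V (pb V L (TA R))" using w u by simp
    qed (use s(1-3) w(1-3) in simp_all)
    then show "\<exists>w\<in>Arr V. Dom V w = Cod V s \<and> Cod V w = Dom V s \<and> s \<cdot> w = Ident V (Cod V s)" using w(1-3) s(1-3) by auto
  qed
  then show "is_iso V (star_X2_map V one T A)" ?A
    ?B
    ?C
    ?D
    using s by (simp_all add: s_def)
qed

lemma star_X2_inv [simp]:
  "inv_arr V (star_X2_map V one T A) \<in> Arr V" "Dom V (inv_arr V (star_X2_map V one T A)) = pb V L (TA R)"
  "Cod V (inv_arr V (star_X2_map V one T A)) = pb V (sl (sm a)) (sr (sm (Tm a)))"
  using star_X2 by simp_all

lemma star_X2_inv_pb:
  "pb1 V (sl (sm a)) (sr (sm (Tm a))) \<cdot> inv_arr V (star_X2_map V one T A) = pb1 V L (TA R)"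
  "epsT a \<cdot> (pb2 V (sl (sm a)) (sr (sm (Tm a))) \<cdot> inv_arr V (star_X2_map V one T A)) = pb2 V L (TA R)"
proof -
  let ?s = "star_X2_map V one T A"
  note s = star_X2 is_iso_Arr[OF star_X2(1)]
  have "pb1 V L (TA R) \<cdot> (?s \<cdot> inv_arr V ?s) = pb1 V (sl (sm a)) (sr (sm (Tm a))) \<cdot> inv_arr V ?s"
    by (rule Cmp_extend1[OF s(4)]) (use s(1-3,6) in simp_all)
  then show "pb1 V (sl (sm a)) (sr (sm (Tm a))) \<cdot> inv_arr V ?s = pb1 V L (TA R)" using s(1-3) by simp
  have "pb2 V L (TA R) \<cdot> (?s \<cdot> inv_arr V ?s) = (epsT a \<cdot> pb2 V (sl (sm a)) (sr (sm (Tm a)))) \<cdot> inv_arr V ?s"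
    by (rule Cmp_extend1[OF s(5)]) (use s(1-3,6) in simp_all)
  then show "epsT a \<cdot> (pb2 V (sl (sm a)) (sr (sm (Tm a))) \<cdot> inv_arr V ?s) = pb2 V L (TA R)" using s(1-3) by simp
qed

lemma star_X2_inv_pair:
  assumes 1: "x \<in> Pts (Pts X)" "y \<in> Pts X" "z \<in> X" "g \<in> Arr V" "h \<in> Arr V" "Dom V g = Dom V h" "Cod V g = ment a (y, z)" "Cod V h = Tf a (x, y)"
  shows "inv_arr V (star_X2_map V one T A) \<cdot> pb_pair V L (TA R) (mti a (y, z) \<cdot> g) (\<phi> a (x, y) \<cdot> h) =
    pb_pair V (sl (sm a)) (sr (sm (Tm a))) (mti a (y, z) \<cdot> g) (mti (Tm a) (x, y) \<cdot> h)" (is "_ \<cdot> ?p = ?q")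
proof -
  let ?s = "star_X2_map V one T A" and ?l = "sl (sm a)" and ?r = "sr (sm (Tm a))"
  note s = star_X2 is_iso_Arr[OF star_X2(1)]
  have p: "?p \<in> Arr V" "Dom V ?p = Dom V h" "Cod V ?p = pb V L (TA R)" "pb1 V L (TA R) \<cdot> ?p = mti a (y, z) \<cdot> g" "pb2 V L (TA R) \<cdot> ?p = \<phi> a (x, y) \<cdot> h"
    using 1 by simp_all
  have q: "?q \<in> Arr V" "Dom V ?q = Dom V h" "Cod V ?q = pb V ?l ?r" "pb1 V ?l ?r \<cdot> ?q = mti a (y, z) \<cdot> g" "pb2 V ?l ?r \<cdot> ?q = mti (Tm a) (x, y) \<cdot> h"
    using 1 by simp_all
  have e: "epsT a \<cdot> (mti (Tm a) (x, y) \<cdot> h) = \<phi> a (x, y) \<cdot> h" using 1 by simp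
  have "?p = ?s \<cdot> ?q"
  proof (rule pb_eqI[of L "TA R"])
    have "pb1 V L (TA R) \<cdot> (?s \<cdot> ?q) = pb1 V ?l ?r \<cdot> ?q" by (rule Cmp_extend1[OF s(4)]) (use s(2,3,6) q(1-3) in simp_all)
    then show "pb1 V L (TA R) \<cdot> ?p = pb1 V L (TA R) \<cdot> (?s \<cdot> ?q)" unfolding p(4) q(4) by simp
    have "pb2 V L (TA R) \<cdot> (?s \<cdot> ?q) = (epsT a \<cdot> pb2 V ?l ?r) \<cdot> ?q" by (rule Cmp_extend1[OF s(5)]) (use s(2,3,6) q(1-3) in simp_all)
    also have "\<dots> = epsT a \<cdot> (pb2 V ?l ?r \<cdot> ?q)" by (rule assoc_right) (use q(1-3) in simp_all)
    also have "\<dots> = \<phi> a (x, y) \<cdot> h" unfolding q(5) by (rule e)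
    finally show "pb2 V L (TA R) \<cdot> ?p = pb2 V L (TA R) \<cdot> (?s \<cdot> ?q)" unfolding p(5) by simp
  qed (use s(2,3,6) p(1-3) q(1-3) in simp_all)
  then have "inv_arr V ?s \<cdot> ?p = inv_arr V ?s \<cdot> (?s \<cdot> ?q)" by simp
  also have "\<dots> = ?q" by (rule inv_arr_cancel(1)[OF s(1)]) (use s(2) q(1,3) in simp_all)
  finally show ?thesis .
qed

text \<open>Elements of \<open>X\<^sub>2\<close> are moved by the isomorphism into the composite of
  \<open>a * 1\<close> with \<open>Tb a * 1\<close>, where they split over summands. On such a piece
  the first component lies in an entry of \<open>a\<close> and the second in a fibre of
  \<open>T (a * 1)\<close>.\<close>

lemma star_X2_local_eqI:
  assumes f: "f \<in> Arr V" "Cod V f = pb V L (TA R)"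
    and uv: "u \<in> Arr V" "v \<in> Arr V" "Dom V u = Dom V f" "Dom V v = Dom V f" "Cod V u = Cod V v"
    and loc: "\<And>x y z k g h. \<lbrakk>x \<in> Pts (Pts X); y \<in> Pts X; z \<in> X; k \<in> Arr V; g \<in> Arr V; h \<in> Arr V; Cod V k = Dom V f; Dom V k = Dom V h; Dom V g = Dom V h; Cod V g = ment a (y, z); Cod V h = Tf a (x, y); f \<cdot> k = pb_pair V L (TA R) (mti a (y, z) \<cdot> g) (\<phi> a (x, y) \<cdot> h)\<rbrakk> \<Longrightarrow> u \<cdot> k = v \<cdot> k"
  shows "u = v"
proof -
  let ?s = "star_X2_map V one T A"
  note s = star_X2(1-3) is_iso_Arr[OF star_X2(1)]
  let ?f = "inv_arr V ?s \<cdot> f"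
  have f': "?f \<in> Arr V" "Dom V ?f = Dom V f" "Cod V ?f = pb V (sl (sm a)) (sr (sm (Tm a)))" using f s by simp_all
  show ?thesis
  proof (rule star_comp_local_eqI[of "Tm a" a ?f])
    fix x y z k g h assume "x \<in> msrc (Tm a)" "y \<in> mtgt (Tm a)" "z \<in> mtgt a" and 1: "k \<in> Arr V" "g \<in> Arr V" "h \<in> Arr V"
      "Cod V k = Dom V ?f" "Dom V k = Dom V h" "Dom V g = Dom V h" "Cod V g = ment a (y, z)" "Cod V h = ment (Tm a) (x, y)"
      and e: "?f \<cdot> k = pb_pair V (sl (sm a)) (sr (sm (Tm a))) (mti a (y, z) \<cdot> g) (mti (Tm a) (x, y) \<cdot> h)"
    then have xyz: "x \<in> Pts (Pts X)" "y \<in> Pts X" "z \<in> X" by simp_all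
    have h: "Cod V h = Tf a (x, y)" using 1(8) xyz by simp
    have k: "Cod V k = Dom V f" using 1(4) f'(2) by simp
    let ?p = "pb_pair V L (TA R) (mti a (y, z) \<cdot> g) (\<phi> a (x, y) \<cdot> h)"
    have p: "?p \<in> Arr V" "Dom V ?p = Dom V h" "Cod V ?p = pb V L (TA R)" using 1(1-7) xyz h by simp_all
    have "inv_arr V ?s \<cdot> (f \<cdot> k) = inv_arr V ?s \<cdot> ?p"
      unfolding star_X2_inv_pair[OF xyz 1(2,3,6,7) h] e[symmetric] using f s 1(1) k by simp
    then have "?s \<cdot> (inv_arr V ?s \<cdot> (f \<cdot> k)) = ?s \<cdot> (inv_arr V ?s \<cdot> ?p)" by simp
    then have "f \<cdot> k = ?p" using inv_arr_cancel(2)[OF s(1), of "f \<cdot> k"] inv_arr_cancel(2)[OF s(1), of ?p] f s(3) 1(1) k p by simp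
    then show "u \<cdot> k = v \<cdot> k" by (rule loc[OF xyz 1(1-3) k 1(5-7) h])
  qed (use f' uv in simp_all)
qed

subsection \<open>Multiplication on generalized elements\<close>

text \<open>The diagonal entry of the unit matrix is the copower of the one-element set
  \<open>{()}\<close>. Restricting the unit cell to its only summand yields a point of an entry of
  the matrix.\<close>

definition un :: "'a \<Rightarrow> 'a" where
  "un x = cmap (eun A) (x, x) \<cdot> cpi {()} ()"

definition mul :: "'a \<Rightarrow> 'a \<Rightarrow> 'a \<Rightarrow> 'a \<Rightarrow> 'a \<Rightarrow> 'a" where
  "mul x y z g h = cmap (emu A) (x, z) \<cdot> (mci a (Tm a) x y z \<cdot> pair V g h)"

text \<open>The multiplication of \<open>A * 1\<close> on the composite of spans, before it is
  transported to \<open>X\<^sub>2\<close> along the inverse of \<open>star_X2_map\<close>.\<close>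

definition nu :: 'a where
  "nu = smap (stc (emu A)) \<cdot> smap (star_comp V one a (Tm a))"

definition ups :: 'a where
  "ups = smap (stc (eun A)) \<cdot> smap (star_unit V one X)"

lemma un_simps [simp]:
  "x \<in> X \<Longrightarrow> un x \<in> Arr V" "x \<in> X \<Longrightarrow> Dom V (un x) = one" "x \<in> X \<Longrightarrow> Cod V (un x) = ment a (Eb X x, x)"
  by (simp_all add: un_def)

lemma mul_simps [simp]:
  assumes "x \<in> Pts (Pts X)" "y \<in> Pts X" "z \<in> X" "g \<in> Arr V" "h \<in> Arr V" "Dom V g = Dom V h" "Cod V g = ment a (y, z)" "Cod V h = Tf a (x, y)"
  shows "mul x y z g h \<in> Arr V" "Dom V (mul x y z g h) = Dom V h" "Cod V (mul x y z g h) = ment a (Mb X x, z)"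
    "e \<in> Arr V \<Longrightarrow> Cod V e = Dom V h \<Longrightarrow> mul x y z g h \<cdot> e = mul x y z (g \<cdot> e) (h \<cdot> e)"
  unfolding mul_def using assms by simp_all

lemma nu_simps [simp]:
  "nu \<in> Arr V" "Dom V nu = pb V (sl (sm a)) (sr (sm (Tm a)))" "Cod V nu = mtot V a"
  by (simp_all add: nu_def)

lemma nu_pair:
  assumes "x \<in> Pts (Pts X)" "y \<in> Pts X" "z \<in> X" "g \<in> Arr V" "h \<in> Arr V" "Dom V g = Dom V h" "Cod V g = ment a (y, z)" "Cod V h = Tf a (x, y)"
  shows "nu \<cdot> pb_pair V (sl (sm a)) (sr (sm (Tm a))) (mti a (y, z) \<cdot> g) (mti (Tm a) (x, y) \<cdot> h) = mti a (Mb X x, z) \<cdot> mul x y z g h"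
  unfolding nu_def mul_def using assms by simp

lemma ups_simps [simp]:
  "ups \<in> Arr V" "Dom V ups = cp X" "Cod V ups = mtot V a" "x \<in> X \<Longrightarrow> ups \<cdot> cpi X x = mti a (Eb X x, x) \<cdot> un x" (is "PROP ?A")
  "\<lbrakk>x \<in> X; e \<in> Arr V; Cod V e = one\<rbrakk> \<Longrightarrow> ups \<cdot> (cpi X x \<cdot> e) = mti a (Eb X x, x) \<cdot> (un x \<cdot> e)"
proof -
  show *: "ups \<in> Arr V" "Dom V ups = cp X" "Cod V ups = mtot V a" "PROP ?A"
    by (simp_all add: ups_def un_def)
  assume 1: "x \<in> X" "e \<in> Arr V" "Cod V e = one"
  have "ups \<cdot> (cpi X x \<cdot> e) = (mti a (Eb X x, x) \<cdot> un x) \<cdot> e"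
    by (rule Cmp_extend1[OF *(4)[OF 1(1)]]) (use 1 * in simp_all)
  then show "ups \<cdot> (cpi X x \<cdot> e) = mti a (Eb X x, x) \<cdot> (un x \<cdot> e)" using 1 by simp
qed

lemma star_ecat_simps [simp]:
  "iX0 (star_ecat V one T A) = cp X" "iX1 (star_ecat V one T A) = mtot V a" "il (star_ecat V one T A) = L" "ir (star_ecat V one T A) = R"
  "iun (star_ecat V one T A) = ups" "imu (star_ecat V one T A) = nu \<cdot> inv_arr V (star_X2_map V one T A)"
  by (simp_all add: star_ecat_def ups_def nu_def)

lemma imu_pair:
  assumes 1: "x \<in> Pts (Pts X)" "y \<in> Pts X" "z \<in> X" "g \<in> Arr V" "h \<in> Arr V" "Dom V g = Dom V h" "Cod V g = ment a (y, z)" "Cod V h = Tf a (x, y)"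
  shows "nu \<cdot> (inv_arr V (star_X2_map V one T A) \<cdot> pb_pair V L (TA R) (mti a (y, z) \<cdot> g) (\<phi> a (x, y) \<cdot> h)) = mti a (Mb X x, z) \<cdot> mul x y z g h"
  unfolding star_X2_inv_pair[OF 1] by (rule nu_pair[OF 1])

text \<open>
  The axioms of an enriched category in terms of generalized elements of the entries of the matrix.
  The inner 2-cells \<open>Tb \<upsilon>\<close>, \<open>Tb \<mu>\<close>, \<open>eb\<close>, \<open>mb\<close> only enter through the composites of
  their values with the inclusions of the fibres, which determine them.
\<close>

definition unit_left :: bool where
  "unit_left \<longleftrightarrow> (\<forall>x \<in> Pts X. \<forall>y \<in> X. \<forall>g h. g \<in> Arr V \<longrightarrow> h \<in> Arr V \<longrightarrow> Dom V g = Dom V h \<longrightarrow> Cod V g = ment a (x, y) \<longrightarrow>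
     Cod V h = Tf a (Eb (Pts X) x, Eb X y) \<longrightarrow> \<phi> a (Eb (Pts X) x, Eb X y) \<cdot> h = unit T (mtot V a) \<cdot> (mti a (x, y) \<cdot> g) \<longrightarrow>
     mul (Eb (Pts X) x) (Eb X y) y (un y \<cdot> bng (Dom V h)) h = g)"

definition unit_right :: bool where
  "unit_right \<longleftrightarrow> (\<forall>x \<in> Pts X. \<forall>y \<in> X. \<forall>g h. g \<in> Arr V \<longrightarrow> h \<in> Arr V \<longrightarrow> Dom V g = Dom V h \<longrightarrow> Cod V g = ment a (x, y) \<longrightarrow>
     Cod V h = Tf a (TA (cpm X (Pts X) (eb_set V one T X)) \<cdot> x, x) \<longrightarrow>
     \<phi> a (TA (cpm X (Pts X) (eb_set V one T X)) \<cdot> x, x) \<cdot> h = TA ups \<cdot> (x \<cdot> bng (Dom V h)) \<longrightarrow>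
     mul (TA (cpm X (Pts X) (eb_set V one T X)) \<cdot> x) x y g h = g)"

abbreviation "Tmb \<equiv> TA (cpm (Pts (Pts X)) (Pts X) (mb_set V one T X))"

definition assoc :: bool where
  "assoc \<longleftrightarrow> (\<forall>x \<in> Pts (Pts (Pts X)). \<forall>y \<in> Pts (Pts X). \<forall>z \<in> Pts X. \<forall>w \<in> X. \<forall>g h k t s.
     g \<in> Arr V \<longrightarrow> h \<in> Arr V \<longrightarrow> k \<in> Arr V \<longrightarrow> t \<in> Arr V \<longrightarrow> s \<in> Arr V \<longrightarrow>
     Dom V g = Dom V k \<longrightarrow> Dom V h = Dom V k \<longrightarrow> Dom V t = Dom V k \<longrightarrow> Dom V s = Dom V k \<longrightarrow>
     Cod V g = ment a (z, w) \<longrightarrow> Cod V h = Tf a (y, z) \<longrightarrow> Cod V k = Tf (Tm a) (x, y) \<longrightarrow>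
     Cod V t = Tf a (Tmb \<cdot> x, z) \<longrightarrow> Cod V s = Tf a (Mb (Pts X) x, Mb X y) \<longrightarrow>
     \<phi> a (Tmb \<cdot> x, z) \<cdot> t = TA nu \<cdot> T_pair (sl (sm a)) (sr (sm (Tm a))) (\<phi> a (y, z) \<cdot> h) (\<phi> (Tm a) (x, y) \<cdot> k) \<longrightarrow>
     \<phi> a (Mb (Pts X) x, Mb X y) \<cdot> s = mult T (mtot V a) \<cdot> (TA (epsT a) \<cdot> (\<phi> (Tm a) (x, y) \<cdot> k)) \<longrightarrow>
     mul (Tmb \<cdot> x) z w g t = mul (Mb (Pts X) x) (Mb X y) w (mul y z w g h) s)"

declare Mb_TEb [simp]

lemma eb_mat_a [simp]:
  "\<lbrakk>x \<in> Arr V; Dom V x = one; Cod V x = TO (cp X); y \<in> X; g \<in> Arr V; Cod V g = ment a (x, y)\<rbrakk> \<Longrightarrow>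
   \<phi> a (Eb (Pts X) x, Eb X y) \<cdot> (cmap (eb_mat V one T a) (x, y) \<cdot> g) = unit T (mtot V a) \<cdot> (mti a (x, y) \<cdot> g)"
  using eb_mat_simps(6)[OF mat, of x y g] by simp

lemma mb_mat_a [simp]:
  "\<lbrakk>x \<in> Arr V; Dom V x = one; Cod V x = TO (cp (Pts (Pts X))); y \<in> Arr V; Dom V y = one; Cod V y = TO (cp (Pts X)); g \<in> Arr V; Cod V g = Tf (Tm a) (x, y)\<rbrakk> \<Longrightarrow>
   \<phi> a (Mb (Pts X) x, Mb X y) \<cdot> (cmap (mb_mat V one T a) (x, y) \<cdot> g) = mult T (mtot V a) \<cdot> (TA (epsT a) \<cdot> (\<phi> (Tm a) (x, y) \<cdot> g))"
  using mb_mat_simps(6)[OF mat, of x y g] by simp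

lemma un_munit:
  "\<lbrakk>x \<in> X; e \<in> Arr V; Cod V e = one\<rbrakk> \<Longrightarrow> cmap (eun A) (x, x) \<cdot> (cpi {()} () \<cdot> e) = un x \<cdot> e"
  by (simp add: un_def)

lemma unit_left_cell:
  defines "\<Phi> \<equiv> hcomp V (eun A) (eb_mat V one T a)"
  shows "mcell \<Phi>" "\<lbrakk>x \<in> Pts X; y \<in> X; y' \<in> X; e \<in> Arr V; g \<in> Arr V; Dom V e = Dom V g; Cod V e = cp (eqv y' y); Cod V g = ment a (x, y')\<rbrakk> \<Longrightarrow>
    cmap \<Phi> (x, y) \<cdot> (mci (munit V one X) a x y' y \<cdot> pair V e g) =
    mci a (Tm a) (Eb (Pts X) x) (Eb X y') y \<cdot> pair V (cmap (eun A) (y', y) \<cdot> e) (cmap (eb_mat V one T a) (x, y') \<cdot> g)" (is "PROP ?A")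
proof -
  have *: "y \<in> mtgt (cdom (eb_mat V one T a)) \<Longrightarrow> cleft (eun A) y = cright (eb_mat V one T a) y" for y by simp
  show "mcell \<Phi>" unfolding \<Phi>_def by (rule mcell_hcomp[OF _ _ _ _ *]) simp_all
  note hc = hcomp_cmap(4)[of "eb_mat V one T a" "eun A" x y y' e g, OF _ _ _ _ *]
  show "PROP ?A"
    unfolding \<Phi>_def using hc by simp
qed

text \<open>The equation between cells is evaluated on elements of the summands. Off-diagonal
  summands have initial domains by \<open>to_munit_cases\<close>; on the diagonal, both sides become
  those of \<open>unit_left\<close>.\<close>

lemma unit_left_iff:
  "vcomp V (emu A) (hcomp V (eun A) (eb_mat V one T a)) = lunitor V one a \<longleftrightarrow> unit_left"
proof -
  define \<Phi> where "\<Phi> = hcomp V (eun A) (eb_mat V one T a)"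
  note \<Phi> = unit_left_cell[folded \<Phi>_def]
  have d [simp]: "cdom \<Phi> = mcomp V (munit V one X) a" "ccod \<Phi> = mcomp V a (Tm a)" "x \<in> Pts X \<Longrightarrow> cleft \<Phi> x = Eb (Pts X) x" "y \<in> X \<Longrightarrow> cright \<Phi> y = y" for x y
    by (simp_all add: \<Phi>_def)
  have m: "mcell (vcomp V (emu A) \<Phi>)" by (rule mcell_vcomp) (use \<Phi>(1) in simp_all)
  have key: "cmap (vcomp V (emu A) \<Phi>) (x, y) \<cdot> (mci (munit V one X) a x y y \<cdot> pair V (cpi {()} () \<cdot> bng (Dom V g)) g) =
      mul (Eb (Pts X) x) (Eb X y) y (un y \<cdot> bng (Dom V h)) h"
    if 1: "x \<in> Pts X" "y \<in> X" "g \<in> Arr V" "h \<in> Arr V" "Dom V g = Dom V h" "Cod V g = ment a (x, y)"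
     "Cod V h = Tf a (Eb (Pts X) x, Eb X y)" and eq: "\<phi> a (Eb (Pts X) x, Eb X y) \<cdot> h = unit T (mtot V a) \<cdot> (mti a (x, y) \<cdot> g)" for x y g h
  proof -
    \<comment> \<open>The constraint on \<open>h\<close> determines it, as the fibre inclusion is
      monic: it is the value of the unit of \<open>Tb\<close> at \<open>g\<close>.\<close>
    have "h = cmap (eb_mat V one T a) (x, y) \<cdot> g"
      by (rule fib_mono[of "T_span T (sm a)" "Eb (Pts X) x" "Eb X y"]) (use 1 eq in simp_all)
    note h = this[symmetric]
    let ?e = "mci (munit V one X) a x y y \<cdot> pair V (cpi {()} () \<cdot> bng (Dom V g)) g"
    have "cmap (vcomp V (emu A) \<Phi>) (x, y) \<cdot> ?e = (cmap (emu A) (Eb (Pts X) x, y) \<cdot> cmap \<Phi> (x, y)) \<cdot> ?e" using 1 by simp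
    also have "\<dots> = cmap (emu A) (Eb (Pts X) x, y) \<cdot> (cmap \<Phi> (x, y) \<cdot> ?e)"
      by (rule assoc_right) (use 1 \<Phi>(1) in simp_all)
    also have "cmap \<Phi> (x, y) \<cdot> ?e = mci a (Tm a) (Eb (Pts X) x) (Eb X y) y \<cdot> pair V (cmap (eun A) (y, y) \<cdot> (cpi {()} () \<cdot> bng (Dom V g))) (cmap (eb_mat V one T a) (x, y) \<cdot> g)"
      by (rule \<Phi>(2)) (use 1 in simp_all)
    also have "\<dots> = mci a (Tm a) (Eb (Pts X) x) (Eb X y) y \<cdot> pair V (un y \<cdot> bng (Dom V h)) h"
      using un_munit[of y "bng (Dom V g)"] 1(1-6) h by simp
    finally show ?thesis by (simp add: mul_def)
  qed
  show ?thesis unfolding \<Phi>_def[symmetric]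
  proof
    assume eq: "vcomp V (emu A) \<Phi> = lunitor V one a"
    show unit_left unfolding unit_left_def
    proof (intro ballI allI impI)
      fix x y g h assume 1: "x \<in> Pts X" "y \<in> X" "g \<in> Arr V" "h \<in> Arr V" "Dom V g = Dom V h" "Cod V g = ment a (x, y)"
       "Cod V h = Tf a (Eb (Pts X) x, Eb X y)" and e: "\<phi> a (Eb (Pts X) x, Eb X y) \<cdot> h = unit T (mtot V a) \<cdot> (mti a (x, y) \<cdot> g)"
      show "mul (Eb (Pts X) x) (Eb X y) y (un y \<cdot> bng (Dom V h)) h = g"
        unfolding key[OF 1 e, symmetric] eq using lunitor_cmap(4)[of a x y "cpi {()} () \<cdot> bng (Dom V g)" g] 1 by simp
    qed
  next
    assume ul: unit_left
    show "vcomp V (emu A) \<Phi> = lunitor V one a"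
    proof (rule mcell_eqI[OF m])
      fix x y assume xy: "x \<in> msrc (cdom (lunitor V one a))" "y \<in> mtgt (cdom (lunitor V one a))"
      then have xy': "x \<in> Pts X" "y \<in> X" by simp_all
      note lc = lunitor_cmap[OF mat, of x y, simplified]
      show "cmap (vcomp V (emu A) \<Phi>) (x, y) = cmap (lunitor V one a) (x, y)"
      proof (rule mcomp_eqI[of a "munit V one X" x y])
        fix y' g h assume 1: "y' \<in> mtgt a" "g \<in> Arr V" "h \<in> Arr V" "Dom V g = Dom V h" "Cod V g = ment (munit V one X) (y', y)" "Cod V h = ment a (x, y')"
        show "cmap (vcomp V (emu A) \<Phi>) (x, y) \<cdot> (mci (munit V one X) a x y' y \<cdot> pair V g h) = cmap (lunitor V one a) (x, y) \<cdot> (mci (munit V one X) a x y' y \<cdot> pair V g h)"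
        proof (rule to_munit_cases[of y' X y g])
          assume e: "y' = y" "g = cpi {()} () \<cdot> bng (Dom V g)"
          \<comment> \<open>The value of the unit of \<open>Tb\<close> satisfies the constraint, so
            the condition on elements can be applied to it.\<close>
          let ?k = "cmap (eb_mat V one T a) (x, y) \<cdot> h"
          have k: "?k \<in> Arr V" "Dom V ?k = Dom V h" "Cod V ?k = Tf a (Eb (Pts X) x, Eb X y)"
             "\<phi> a (Eb (Pts X) x, Eb X y) \<cdot> ?k = unit T (mtot V a) \<cdot> (mti a (x, y) \<cdot> h)" using 1 e(1) xy' by simp_all
          have "cmap (vcomp V (emu A) \<Phi>) (x, y) \<cdot> (mci (munit V one X) a x y y \<cdot> pair V (cpi {()} () \<cdot> bng (Dom V h)) h) = h"
            unfolding key[OF xy' 1(3) k(1) k(2)[symmetric] 1(6)[unfolded e(1)] k(3,4)]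
            using ul[unfolded unit_left_def, rule_format, OF xy' 1(3) k(1) k(2)[symmetric] 1(6)[unfolded e(1)] k(3,4)] .
          moreover have "g = cpi {()} () \<cdot> bng (Dom V h)" using e(2) 1(4) by simp
          moreover have "cmap (lunitor V one a) (x, y) \<cdot> (mci (munit V one X) a x y y \<cdot> pair V (cpi {()} () \<cdot> bng (Dom V h)) h) = h"
            by (rule lunitor_cmap(4)[OF mat, simplified]) (use xy' 1 e(1) in simp_all)
          ultimately show ?thesis using e(1) by simp
        next
          assume "is_initial V (Dom V g)"
          then show ?thesis by (rule is_initial_unique) (use 1 xy' \<Phi>(1) m lc in simp_all)
        qed (use 1 xy' in simp_all)
      qed (use xy' lc m \<Phi>(1) in simp_all)
    qed simp_all
  qed
qed

text \<open>The argument of \<open>unit_left_iff\<close> with the factors exchanged. The inner cell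
  is now \<open>Tb \<upsilon>\<close> after the lax unit; composed with the fibre inclusion, its
  value at a point \<open>x\<close> is \<open>T ups\<close> applied to \<open>x\<close>, which is
  the constraint that \<open>unit_right\<close> places on \<open>h\<close>.\<close>

lemma unit_right_iff:
  "vcomp V (emu A) (hcomp V (mcid V a) (vcomp V (Tb_cell V one T (eun A)) (Tb_unit V one T X))) = runitor V one a \<longleftrightarrow> unit_right"
proof -
  define \<Psi> where "\<Psi> = vcomp V (Tb_cell V one T (eun A)) (Tb_unit V one T X)"
  define \<Phi> where "\<Phi> = hcomp V (mcid V a) \<Psi>"
  let ?x = "\<lambda>x. TA (cpm X (Pts X) (eb_set V one T X)) \<cdot> x"
  have mP: "mcell \<Psi>" unfolding \<Psi>_def by (rule mcell_vcomp) simp_all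
  have Pd [simp]: "cdom \<Psi> = munit V one (Pts X)" "ccod \<Psi> = Tm a" "x \<in> Pts X \<Longrightarrow> cleft \<Psi> x = ?x x" "x \<in> Pts X \<Longrightarrow> cright \<Psi> x = x" for x
    by (simp_all add: \<Psi>_def)
  have Pc: "\<phi> a (?x x, x) \<cdot> (cmap \<Psi> (x, x) \<cdot> (cpi {()} () \<cdot> e)) = TA ups \<cdot> (x \<cdot> e)"
    if 1: "x \<in> Pts X" "e \<in> Arr V" "Cod V e = one" for x e
  proof -
    let ?u = "cmap (Tb_unit V one T X) (x, x) \<cdot> (cpi {()} () \<cdot> e)"
    have "\<phi> a (?x x, x) \<cdot> (cmap (Tb_cell V one T (eun A)) (x, x) \<cdot> ?u) = TA (smap (stc (eun A))) \<cdot> (\<phi> (munit V one X) (x, x) \<cdot> ?u)"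
      using Tb_cell_cmap[of "eun A" x x ?u] 1 by simp
    also have "\<phi> (munit V one X) (x, x) \<cdot> ?u = TA (smap (star_unit V one X)) \<cdot> (x \<cdot> e)" using 1 by simp
    finally show ?thesis using 1 by (simp add: \<Psi>_def ups_def)
  qed
  have *: "y \<in> mtgt (cdom \<Psi>) \<Longrightarrow> cleft (mcid V a) y = cright \<Psi> y" for y by simp
  have m\<Phi>: "mcell \<Phi>" unfolding \<Phi>_def by (rule mcell_hcomp[OF _ _ _ _ *]) (use mP in simp_all)
  have \<Phi>2: "cmap \<Phi> (x, y) \<cdot> (mci a (munit V one (Pts X)) x x' y \<cdot> pair V g e) = mci a (Tm a) (?x x) x' y \<cdot> pair V g (cmap \<Psi> (x, x') \<cdot> e)"
    if 1: "x \<in> Pts X" "y \<in> X" "x' \<in> Pts X" "e \<in> Arr V" "g \<in> Arr V" "Dom V g = Dom V e" "Cod V e = cp (eqv x x')" "Cod V g = ment a (x', y)" for x y x' e g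
    unfolding \<Phi>_def using hcomp_cmap(4)[OF mP _ _ _ *, of x y x' g e] 1 by simp
  have d [simp]: "cdom \<Phi> = mcomp V a (munit V one (Pts X))" "ccod \<Phi> = mcomp V a (Tm a)" "x \<in> Pts X \<Longrightarrow> cleft \<Phi> x = ?x x" "y \<in> X \<Longrightarrow> cright \<Phi> y = y" for x y
    by (simp_all add: \<Phi>_def)
  have m: "mcell (vcomp V (emu A) \<Phi>)" by (rule mcell_vcomp) (use m\<Phi> in simp_all)
  have key: "cmap (vcomp V (emu A) \<Phi>) (x, y) \<cdot> (mci a (munit V one (Pts X)) x x y \<cdot> pair V g (cpi {()} () \<cdot> bng (Dom V g))) =
      mul (?x x) x y g h"
    if 1: "x \<in> Pts X" "y \<in> X" "g \<in> Arr V" "h \<in> Arr V" "Dom V g = Dom V h" "Cod V g = ment a (x, y)"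
     "Cod V h = Tf a (?x x, x)" and eq: "\<phi> a (?x x, x) \<cdot> h = TA ups \<cdot> (x \<cdot> bng (Dom V h))" for x y g h
  proof -
    have "h = cmap \<Psi> (x, x) \<cdot> (cpi {()} () \<cdot> bng (Dom V g))"
      by (rule fib_mono[of "T_span T (sm a)" "?x x" x]) (use 1 eq Pc[of x "bng (Dom V g)"] mP in simp_all)
    note h = this[symmetric]
    let ?e = "mci a (munit V one (Pts X)) x x y \<cdot> pair V g (cpi {()} () \<cdot> bng (Dom V g))"
    have "cmap (vcomp V (emu A) \<Phi>) (x, y) \<cdot> ?e = (cmap (emu A) (?x x, y) \<cdot> cmap \<Phi> (x, y)) \<cdot> ?e" using 1 by simp
    also have "\<dots> = cmap (emu A) (?x x, y) \<cdot> (cmap \<Phi> (x, y) \<cdot> ?e)"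
      by (rule assoc_right) (use 1 m\<Phi> in simp_all)
    also have "cmap \<Phi> (x, y) \<cdot> ?e = mci a (Tm a) (?x x) x y \<cdot> pair V g (cmap \<Psi> (x, x) \<cdot> (cpi {()} () \<cdot> bng (Dom V g)))"
      by (rule \<Phi>2) (use 1 in simp_all)
    finally show ?thesis unfolding h by (simp add: mul_def)
  qed
  show ?thesis unfolding \<Psi>_def[symmetric] \<Phi>_def[symmetric]
  proof
    assume eq: "vcomp V (emu A) \<Phi> = runitor V one a"
    show unit_right unfolding unit_right_def
    proof (intro ballI allI impI)
      fix x y g h assume 1: "x \<in> Pts X" "y \<in> X" "g \<in> Arr V" "h \<in> Arr V" "Dom V g = Dom V h" "Cod V g = ment a (x, y)"
       "Cod V h = Tf a (?x x, x)" and e: "\<phi> a (?x x, x) \<cdot> h = TA ups \<cdot> (x \<cdot> bng (Dom V h))"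
      show "mul (?x x) x y g h = g"
        unfolding key[OF 1 e, symmetric] eq using runitor_cmap(4)[of a x y g "cpi {()} () \<cdot> bng (Dom V g)"] 1 by simp
    qed
  next
    assume ul: unit_right
    show "vcomp V (emu A) \<Phi> = runitor V one a"
    proof (rule mcell_eqI[OF m])
      fix x y assume xy: "x \<in> msrc (cdom (runitor V one a))" "y \<in> mtgt (cdom (runitor V one a))"
      then have xy': "x \<in> Pts X" "y \<in> X" by simp_all
      note lc = runitor_cmap[OF mat, of x y, simplified]
      show "cmap (vcomp V (emu A) \<Phi>) (x, y) = cmap (runitor V one a) (x, y)"
      proof (rule mcomp_eqI[of "munit V one (Pts X)" a x y])
        fix x' g h assume 1: "x' \<in> mtgt (munit V one (Pts X))" "g \<in> Arr V" "h \<in> Arr V" "Dom V g = Dom V h" "Cod V g = ment a (x', y)" "Cod V h = ment (munit V one (Pts X)) (x, x')"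
        then have x': "x' \<in> Pts X" by simp
        show "cmap (vcomp V (emu A) \<Phi>) (x, y) \<cdot> (mci a (munit V one (Pts X)) x x' y \<cdot> pair V g h) = cmap (runitor V one a) (x, y) \<cdot> (mci a (munit V one (Pts X)) x x' y \<cdot> pair V g h)"
        proof (rule to_munit_cases[OF xy'(1) x' 1(3,6)])
          assume e: "x = x'" "h = cpi {()} () \<cdot> bng (Dom V h)"
          let ?c = "cpi {()} () \<cdot> bng (Dom V g)"
          let ?k = "cmap \<Psi> (x, x) \<cdot> ?c"
          have k: "?k \<in> Arr V" "Dom V ?k = Dom V g" "Cod V ?k = Tf a (?x x, x)"
             "\<phi> a (?x x, x) \<cdot> ?k = TA ups \<cdot> (x \<cdot> bng (Dom V ?k))" using 1 xy' mP Pc[of x "bng (Dom V g)"] by simp_all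
          have "cmap (vcomp V (emu A) \<Phi>) (x, y) \<cdot> (mci a (munit V one (Pts X)) x x y \<cdot> pair V g ?c) = g"
            unfolding key[OF xy' 1(2) k(1) k(2)[symmetric] 1(5)[folded e(1)] k(3,4)]
            using ul[unfolded unit_right_def, rule_format, OF xy' 1(2) k(1) k(2)[symmetric] 1(5)[folded e(1)] k(3,4)] .
          moreover have "h = ?c" using e(2) 1(4) by simp
          moreover have "cmap (runitor V one a) (x, y) \<cdot> (mci a (munit V one (Pts X)) x x y \<cdot> pair V g ?c) = g"
            by (rule runitor_cmap(4)[OF mat, simplified]) (use xy' 1 e(1) in simp_all)
          ultimately show ?thesis using e(1) by simp
        next
          assume "is_initial V (Dom V h)"
          then show ?thesis by (rule is_initial_unique) (use 1 xy' x' m\<Phi> m lc in simp_all)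
        qed
      qed (use xy' lc m m\<Phi> in simp_all)
    qed simp_all
  qed
qed

text \<open>Both sides are evaluated on triples in the bracketing to the right, where the inverse
  associator acts by \<open>associator_cmap\<close>. The constraints on \<open>t\<close> and
  \<open>s\<close> determine them as the values of \<open>Tb \<mu>\<close> after the lax comparison
  and of the multiplication of \<open>Tb\<close>. The two sides then are multiplications of
  \<open>g\<close> with \<open>t\<close>, and of the product of \<open>g\<close> and
  \<open>h\<close> with \<open>s\<close>.\<close>

lemma assoc_iff:
  "vcomp V (emu A) (hcomp V (mcid V a) (vcomp V (Tb_cell V one T (emu A)) (Tb_comp V one T a (Tm a))))
     = vcomp V (vcomp V (emu A) (hcomp V (emu A) (mb_mat V one T a))) (globular_inv V (associator V a (Tm a) (Tm (Tm a)))) \<longleftrightarrow> assoc"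
proof -
  define \<Psi> where "\<Psi> = vcomp V (Tb_cell V one T (emu A)) (Tb_comp V one T a (Tm a))"
  define \<Phi> where "\<Phi> = hcomp V (mcid V a) \<Psi>"
  define \<Theta> where "\<Theta> = hcomp V (emu A) (mb_mat V one T a)"
  define \<alpha> where "\<alpha> = globular_inv V (associator V a (Tm a) (Tm (Tm a)))"
  have mP: "mcell \<Psi>" unfolding \<Psi>_def by (rule mcell_vcomp) simp_all
  have Pd [simp]: "cdom \<Psi> = mcomp V (Tm a) (Tm (Tm a))" "ccod \<Psi> = Tm a" "x \<in> Pts (Pts (Pts X)) \<Longrightarrow> cleft \<Psi> x = Tmb \<cdot> x" "z \<in> Pts X \<Longrightarrow> cright \<Psi> z = z" for x z
    by (simp_all add: \<Psi>_def)
  \<comment> \<open>The lax comparison turns the pair into a pairing into \<open>T\<close> of the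
    pullback, and \<open>Tb \<mu>\<close> then acts by \<open>T\<close> of the induced map of
    totals. The composite of the two is \<open>T nu\<close>.\<close>
  have Pc: "\<phi> a (Tmb \<cdot> x, z) \<cdot> (cmap \<Psi> (x, z) \<cdot> (mci (Tm a) (Tm (Tm a)) x y z \<cdot> pair V h k)) =
     TA nu \<cdot> T_pair (sl (sm a)) (sr (sm (Tm a))) (\<phi> a (y, z) \<cdot> h) (\<phi> (Tm a) (x, y) \<cdot> k)"
    if 1: "x \<in> Pts (Pts (Pts X))" "y \<in> Pts (Pts X)" "z \<in> Pts X" "h \<in> Arr V" "k \<in> Arr V" "Dom V h = Dom V k" "Cod V h = Tf a (y, z)" "Cod V k = Tf (Tm a) (x, y)" for x y z h k
  proof -
    let ?e = "mci (Tm a) (Tm (Tm a)) x y z \<cdot> pair V h k"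
    let ?c = "cmap (Tb_comp V one T a (Tm a)) (x, z)"
    have e: "?e \<in> Arr V" "Dom V ?e = Dom V k" "Cod V ?e = ment (mcomp V (Tm a) (Tm (Tm a))) (x, z)" using 1 by simp_all
    have c: "?c \<in> Arr V" "Dom V ?c = ment (mcomp V (Tm a) (Tm (Tm a))) (x, z)" "Cod V ?c = Tf (mcomp V a (Tm a)) (x, z)"
      using 1 mcellD(7-9)[of "Tb_comp V one T a (Tm a)" x z] by simp_all
    have "\<phi> a (Tmb \<cdot> x, z) \<cdot> (cmap (Tb_cell V one T (emu A)) (x, z) \<cdot> (?c \<cdot> ?e)) = TA (smap (stc (emu A))) \<cdot> (\<phi> (mcomp V a (Tm a)) (x, z) \<cdot> (?c \<cdot> ?e))"
      using Tb_cell_cmap[of "emu A" x z "?c \<cdot> ?e"] 1 c e by (simp del: pair_Cmp)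
    also have "\<phi> (mcomp V a (Tm a)) (x, z) \<cdot> (?c \<cdot> ?e) = TA (smap (star_comp V one a (Tm a))) \<cdot> T_pair (sl (sm a)) (sr (sm (Tm a))) (\<phi> a (y, z) \<cdot> h) (\<phi> (Tm a) (x, y) \<cdot> k)"
      using 1 by simp
    also have "TA (smap (stc (emu A))) \<cdot> \<dots> = TA nu \<cdot> T_pair (sl (sm a)) (sr (sm (Tm a))) (\<phi> a (y, z) \<cdot> h) (\<phi> (Tm a) (x, y) \<cdot> k)"
      unfolding nu_def using 1 by simp
    finally have 2: "\<phi> a (Tmb \<cdot> x, z) \<cdot> (cmap (Tb_cell V one T (emu A)) (x, z) \<cdot> (?c \<cdot> ?e)) = TA nu \<cdot> T_pair (sl (sm a)) (sr (sm (Tm a))) (\<phi> a (y, z) \<cdot> h) (\<phi> (Tm a) (x, y) \<cdot> k)" .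
    have t: "cmap (Tb_cell V one T (emu A)) (x, z) \<in> Arr V" "Dom V (cmap (Tb_cell V one T (emu A)) (x, z)) = Tf (mcomp V a (Tm a)) (x, z)"
      using 1 mcellD(7-9)[of "Tb_cell V one T (emu A)" x z] by simp_all
    have "cmap \<Psi> (x, z) \<cdot> ?e = (cmap (Tb_cell V one T (emu A)) (x, z) \<cdot> ?c) \<cdot> ?e" using 1 by (simp add: \<Psi>_def)
    also have "\<dots> = cmap (Tb_cell V one T (emu A)) (x, z) \<cdot> (?c \<cdot> ?e)" by (rule assoc_right) (use e c t in simp_all)
    finally show ?thesis using 2 by simp
  qed
  have *: "y \<in> mtgt (cdom \<Psi>) \<Longrightarrow> cleft (mcid V a) y = cright \<Psi> y" for y by simp
  have m\<Phi>: "mcell \<Phi>" unfolding \<Phi>_def by (rule mcell_hcomp[OF _ _ _ _ *]) (use mP in simp_all)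
  have \<Phi>2: "cmap \<Phi> (x, w) \<cdot> (mci a (mcomp V (Tm a) (Tm (Tm a))) x z w \<cdot> pair V g e) = mci a (Tm a) (Tmb \<cdot> x) z w \<cdot> pair V g (cmap \<Psi> (x, z) \<cdot> e)"
    if 1: "x \<in> Pts (Pts (Pts X))" "z \<in> Pts X" "w \<in> X" "e \<in> Arr V" "g \<in> Arr V" "Dom V g = Dom V e" "Cod V e = ment (mcomp V (Tm a) (Tm (Tm a))) (x, z)" "Cod V g = ment a (z, w)" for x z w e g
    unfolding \<Phi>_def using hcomp_cmap(4)[OF mP _ _ _ *, of x w z g e] 1 by simp
  have d [simp]: "cdom \<Phi> = mcomp V a (mcomp V (Tm a) (Tm (Tm a)))" "ccod \<Phi> = mcomp V a (Tm a)" "x \<in> Pts (Pts (Pts X)) \<Longrightarrow> cleft \<Phi> x = Tmb \<cdot> x" "y \<in> X \<Longrightarrow> cright \<Phi> y = y" for x y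
    by (simp_all add: \<Phi>_def)
  have m1: "mcell (vcomp V (emu A) \<Phi>)" by (rule mcell_vcomp) (use m\<Phi> in simp_all)
  have **: "y \<in> mtgt (cdom (mb_mat V one T a)) \<Longrightarrow> cleft (emu A) y = cright (mb_mat V one T a) y" for y by simp
  have m\<Theta>: "mcell \<Theta>" unfolding \<Theta>_def by (rule mcell_hcomp[OF _ _ _ _ **]) simp_all
  have \<Theta>2: "cmap \<Theta> (x, w) \<cdot> (mci (mcomp V a (Tm a)) (Tm (Tm a)) x y w \<cdot> pair V g e) = mci a (Tm a) (Mb (Pts X) x) (Mb X y) w \<cdot> pair V (cmap (emu A) (y, w) \<cdot> g) (cmap (mb_mat V one T a) (x, y) \<cdot> e)"
    if 1: "x \<in> Pts (Pts (Pts X))" "y \<in> Pts (Pts X)" "w \<in> X" "e \<in> Arr V" "g \<in> Arr V" "Dom V g = Dom V e" "Cod V g = ment (mcomp V a (Tm a)) (y, w)" "Cod V e = Tf (Tm a) (x, y)" for x y w e g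
    unfolding \<Theta>_def using hcomp_cmap(4)[of "mb_mat V one T a" "emu A" x w y g e, OF _ _ _ _ **] 1 by simp
  have d2 [simp]: "cdom \<Theta> = mcomp V (mcomp V a (Tm a)) (Tm (Tm a))" "ccod \<Theta> = mcomp V a (Tm a)" "x \<in> Pts (Pts (Pts X)) \<Longrightarrow> cleft \<Theta> x = Mb (Pts X) x" "y \<in> X \<Longrightarrow> cright \<Theta> y = y" for x y
    by (simp_all add: \<Theta>_def)
  have m\<alpha>: "mcell \<alpha>" unfolding \<alpha>_def by (rule mcell_assoc_inv) simp_all
  have d3 [simp]: "cdom \<alpha> = mcomp V a (mcomp V (Tm a) (Tm (Tm a)))" "ccod \<alpha> = mcomp V (mcomp V a (Tm a)) (Tm (Tm a))" "x \<in> Pts (Pts (Pts X)) \<Longrightarrow> cleft \<alpha> x = x" "y \<in> X \<Longrightarrow> cright \<alpha> y = y" for x y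
    by (simp_all add: \<alpha>_def)
  have m2: "mcell (vcomp V (vcomp V (emu A) \<Theta>) \<alpha>)"
    by (rule mcell_vcomp[OF m\<alpha> mcell_vcomp[OF m\<Theta>]]) simp_all
  have key: "cmap (vcomp V (emu A) \<Phi>) (x, w) \<cdot> (mci a (mcomp V (Tm a) (Tm (Tm a))) x z w \<cdot> pair V g (mci (Tm a) (Tm (Tm a)) x y z \<cdot> pair V h k)) =
      mul (Tmb \<cdot> x) z w g (cmap \<Psi> (x, z) \<cdot> (mci (Tm a) (Tm (Tm a)) x y z \<cdot> pair V h k))"
    and key2: "cmap (vcomp V (vcomp V (emu A) \<Theta>) \<alpha>) (x, w) \<cdot> (mci a (mcomp V (Tm a) (Tm (Tm a))) x z w \<cdot> pair V g (mci (Tm a) (Tm (Tm a)) x y z \<cdot> pair V h k)) =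
      mul (Mb (Pts X) x) (Mb X y) w (mul y z w g h) (cmap (mb_mat V one T a) (x, y) \<cdot> k)"
    if 1: "x \<in> Pts (Pts (Pts X))" "y \<in> Pts (Pts X)" "z \<in> Pts X" "w \<in> X" "g \<in> Arr V" "h \<in> Arr V" "k \<in> Arr V" "Dom V g = Dom V k" "Dom V h = Dom V k" "Cod V g = ment a (z, w)"
     "Cod V h = Tf a (y, z)" "Cod V k = Tf (Tm a) (x, y)" for x y z w g h k
  proof -
    let ?f = "mci (Tm a) (Tm (Tm a)) x y z \<cdot> pair V h k"
    let ?e = "mci a (mcomp V (Tm a) (Tm (Tm a))) x z w \<cdot> pair V g ?f"
    have f: "?f \<in> Arr V" "Dom V ?f = Dom V k" "Cod V ?f = ment (mcomp V (Tm a) (Tm (Tm a))) (x, z)" using 1 by simp_all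
    have e: "?e \<in> Arr V" "Dom V ?e = Dom V k" "Cod V ?e = ment (mcomp V a (mcomp V (Tm a) (Tm (Tm a)))) (x, w)" using 1 f by simp_all
    have "cmap (vcomp V (emu A) \<Phi>) (x, w) \<cdot> ?e = (cmap (emu A) (Tmb \<cdot> x, w) \<cdot> cmap \<Phi> (x, w)) \<cdot> ?e" using 1 by simp
    also have "\<dots> = cmap (emu A) (Tmb \<cdot> x, w) \<cdot> (cmap \<Phi> (x, w) \<cdot> ?e)"
      by (rule assoc_right) (use 1 e m\<Phi> in simp_all)
    also have "cmap \<Phi> (x, w) \<cdot> ?e = mci a (Tm a) (Tmb \<cdot> x) z w \<cdot> pair V g (cmap \<Psi> (x, z) \<cdot> ?f)"
      by (rule \<Phi>2) (use 1 f in simp_all)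
    finally show "cmap (vcomp V (emu A) \<Phi>) (x, w) \<cdot> ?e = mul (Tmb \<cdot> x) z w g (cmap \<Psi> (x, z) \<cdot> ?f)" by (simp add: mul_def)
    let ?k = "mci a (Tm a) y z w \<cdot> pair V g h"
    let ?e' = "mci (mcomp V a (Tm a)) (Tm (Tm a)) x y w \<cdot> pair V ?k k"
    have k: "?k \<in> Arr V" "Dom V ?k = Dom V k" "Cod V ?k = ment (mcomp V a (Tm a)) (y, w)" using 1 by simp_all
    have e': "?e' \<in> Arr V" "Dom V ?e' = Dom V k" "Cod V ?e' = ment (mcomp V (mcomp V a (Tm a)) (Tm (Tm a))) (x, w)" using 1 k by simp_all
    have \<alpha>e: "cmap \<alpha> (x, w) \<cdot> ?e = ?e'"
      unfolding \<alpha>_def using associator_cmap(4)[of "Tm (Tm a)" "Tm a" a x w y z g h k] 1 by simp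
    have mm: "cmap \<alpha> (x, w) \<in> Arr V" "Dom V (cmap \<alpha> (x, w)) = ment (mcomp V a (mcomp V (Tm a) (Tm (Tm a)))) (x, w)"
      "Cod V (cmap \<alpha> (x, w)) = ment (mcomp V (mcomp V a (Tm a)) (Tm (Tm a))) (x, w)"
      "cmap \<Theta> (x, w) \<in> Arr V" "Dom V (cmap \<Theta> (x, w)) = ment (mcomp V (mcomp V a (Tm a)) (Tm (Tm a))) (x, w)" "Cod V (cmap \<Theta> (x, w)) = ment (mcomp V a (Tm a)) (Mb (Pts X) x, w)"
      using 1 mcellD(7-9)[OF m\<alpha>, of x w] mcellD(7-9)[OF m\<Theta>, of x w] by simp_all
    have "cmap (vcomp V (vcomp V (emu A) \<Theta>) \<alpha>) (x, w) = (cmap (emu A) (Mb (Pts X) x, w) \<cdot> cmap \<Theta> (x, w)) \<cdot> cmap \<alpha> (x, w)" using 1 by simp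
    then have "cmap (vcomp V (vcomp V (emu A) \<Theta>) \<alpha>) (x, w) \<cdot> ?e = cmap (emu A) (Mb (Pts X) x, w) \<cdot> (cmap \<Theta> (x, w) \<cdot> (cmap \<alpha> (x, w) \<cdot> ?e))"
      using mm e 1 by (simp del: pair_Cmp)
    also have "\<dots> = cmap (emu A) (Mb (Pts X) x, w) \<cdot> (mci a (Tm a) (Mb (Pts X) x) (Mb X y) w \<cdot> pair V (cmap (emu A) (y, w) \<cdot> ?k) (cmap (mb_mat V one T a) (x, y) \<cdot> k))"
      unfolding \<alpha>e by (subst \<Theta>2) (use 1 k in simp_all)
    finally show "cmap (vcomp V (vcomp V (emu A) \<Theta>) \<alpha>) (x, w) \<cdot> ?e = mul (Mb (Pts X) x) (Mb X y) w (mul y z w g h) (cmap (mb_mat V one T a) (x, y) \<cdot> k)"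
      by (simp add: mul_def)
  qed
  have tP: "cmap \<Psi> (x, z) \<cdot> (mci (Tm a) (Tm (Tm a)) x y z \<cdot> pair V h k) \<in> Arr V"
    "Dom V (cmap \<Psi> (x, z) \<cdot> (mci (Tm a) (Tm (Tm a)) x y z \<cdot> pair V h k)) = Dom V k"
    "Cod V (cmap \<Psi> (x, z) \<cdot> (mci (Tm a) (Tm (Tm a)) x y z \<cdot> pair V h k)) = Tf a (Tmb \<cdot> x, z)"
    if 1: "x \<in> Pts (Pts (Pts X))" "y \<in> Pts (Pts X)" "z \<in> Pts X" "h \<in> Arr V" "k \<in> Arr V" "Dom V h = Dom V k" "Cod V h = Tf a (y, z)" "Cod V k = Tf (Tm a) (x, y)" for x y z h k
    using 1 mcellD(7-9)[OF mP, of x z] by simp_all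
  have tM: "cmap (mb_mat V one T a) (x, y) \<cdot> k \<in> Arr V" "Dom V (cmap (mb_mat V one T a) (x, y) \<cdot> k) = Dom V k" "Cod V (cmap (mb_mat V one T a) (x, y) \<cdot> k) = Tf a (Mb (Pts X) x, Mb X y)"
    "\<phi> a (Mb (Pts X) x, Mb X y) \<cdot> (cmap (mb_mat V one T a) (x, y) \<cdot> k) = mult T (mtot V a) \<cdot> (TA (epsT a) \<cdot> (\<phi> (Tm a) (x, y) \<cdot> k))"
    if 1: "x \<in> Pts (Pts (Pts X))" "y \<in> Pts (Pts X)" "k \<in> Arr V" "Cod V k = Tf (Tm a) (x, y)" for x y k
    using 1 mcellD(7-9)[of "mb_mat V one T a" x y] by simp_all
  show ?thesis unfolding \<Psi>_def[symmetric] \<Phi>_def[symmetric] \<Theta>_def[symmetric] \<alpha>_def[symmetric]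
  proof
    assume eq: "vcomp V (emu A) \<Phi> = vcomp V (vcomp V (emu A) \<Theta>) \<alpha>"
    show assoc unfolding assoc_def
    proof (intro ballI allI impI)
      fix x y z w g h k t s assume 1: "x \<in> Pts (Pts (Pts X))" "y \<in> Pts (Pts X)" "z \<in> Pts X" "w \<in> X" "g \<in> Arr V" "h \<in> Arr V" "k \<in> Arr V" "t \<in> Arr V" "s \<in> Arr V"
       "Dom V g = Dom V k" "Dom V h = Dom V k" "Dom V t = Dom V k" "Dom V s = Dom V k" "Cod V g = ment a (z, w)" "Cod V h = Tf a (y, z)" "Cod V k = Tf (Tm a) (x, y)"
       "Cod V t = Tf a (Tmb \<cdot> x, z)" "Cod V s = Tf a (Mb (Pts X) x, Mb X y)"
       and e: "\<phi> a (Tmb \<cdot> x, z) \<cdot> t = TA nu \<cdot> T_pair (sl (sm a)) (sr (sm (Tm a))) (\<phi> a (y, z) \<cdot> h) (\<phi> (Tm a) (x, y) \<cdot> k)"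
       "\<phi> a (Mb (Pts X) x, Mb X y) \<cdot> s = mult T (mtot V a) \<cdot> (TA (epsT a) \<cdot> (\<phi> (Tm a) (x, y) \<cdot> k))"
      have t: "t = cmap \<Psi> (x, z) \<cdot> (mci (Tm a) (Tm (Tm a)) x y z \<cdot> pair V h k)"
        by (rule fib_mono[of "T_span T (sm a)" "Tmb \<cdot> x" z]) (use 1 e(1) Pc[of x y z h k] tP[of x y z h k] in simp_all)
      have s: "s = cmap (mb_mat V one T a) (x, y) \<cdot> k"
        by (rule fib_mono[of "T_span T (sm a)" "Mb (Pts X) x" "Mb X y"]) (use 1 e(2) tM[of x y k] in simp_all)
      show "mul (Tmb \<cdot> x) z w g t = mul (Mb (Pts X) x) (Mb X y) w (mul y z w g h) s"
        unfolding t s key[OF 1(1-7,10,11,14-16), symmetric] key2[OF 1(1-7,10,11,14-16), symmetric] eq ..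
    qed
  next
    assume as: assoc
    show "vcomp V (emu A) \<Phi> = vcomp V (vcomp V (emu A) \<Theta>) \<alpha>"
    proof (rule mcell_eqI[OF m1 m2])
      fix x assume "x \<in> msrc (cdom (vcomp V (vcomp V (emu A) \<Theta>) \<alpha>))"
      then have x: "x \<in> Pts (Pts (Pts X))" by simp
      \<comment> \<open>The left boundaries are the two ways of multiplying down three layers of the
        monad on points.\<close>
      show "cleft (vcomp V (emu A) \<Phi>) x = cleft (vcomp V (vcomp V (emu A) \<Theta>) \<alpha>) x" using Mb_TMb[OF small_X x] x by simp
    next
      fix x w assume xw: "x \<in> msrc (cdom (vcomp V (vcomp V (emu A) \<Theta>) \<alpha>))" "w \<in> mtgt (cdom (vcomp V (vcomp V (emu A) \<Theta>) \<alpha>))"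
      then have xw': "x \<in> Pts (Pts (Pts X))" "w \<in> X" by simp_all
      note c1 = mcellD(7-9)[OF m1, of x w] and c2 = mcellD(7-9)[OF m2, of x w]
      show "cmap (vcomp V (emu A) \<Phi>) (x, w) = cmap (vcomp V (vcomp V (emu A) \<Theta>) \<alpha>) (x, w)"
      proof (rule mcomp3_eqI_right[of "Tm (Tm a)" "Tm a" a x w])
        fix y z g h k assume 1: "y \<in> mtgt (Tm (Tm a))" "z \<in> mtgt (Tm a)" "g \<in> Arr V" "h \<in> Arr V" "k \<in> Arr V" "Dom V g = Dom V k" "Dom V h = Dom V k"
           "Cod V g = ment a (z, w)" "Cod V h = ment (Tm a) (y, z)" "Cod V k = ment (Tm (Tm a)) (x, y)"
        then have yz: "y \<in> Pts (Pts X)" "z \<in> Pts X" by simp_all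
        have hk: "Cod V h = Tf a (y, z)" "Cod V k = Tf (Tm a) (x, y)" using 1 yz xw' by simp_all
        note p = tP[OF xw'(1) yz 1(4,5,7) hk] and q = tM[OF xw'(1) yz(1) 1(5) hk(2)]
        show "cmap (vcomp V (emu A) \<Phi>) (x, w) \<cdot> (mci a (mcomp V (Tm a) (Tm (Tm a))) x z w \<cdot> pair V g (mci (Tm a) (Tm (Tm a)) x y z \<cdot> pair V h k)) =
          cmap (vcomp V (vcomp V (emu A) \<Theta>) \<alpha>) (x, w) \<cdot> (mci a (mcomp V (Tm a) (Tm (Tm a))) x z w \<cdot> pair V g (mci (Tm a) (Tm (Tm a)) x y z \<cdot> pair V h k))"
          unfolding key[OF xw'(1) yz xw'(2) 1(3-8) hk] key2[OF xw'(1) yz xw'(2) 1(3-8) hk]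
          by (rule as[unfolded assoc_def, rule_format, OF xw'(1) yz xw'(2) 1(3-5) p(1) q(1) 1(6,7) p(2) q(2) 1(8) hk p(3) q(3) Pc[OF xw'(1) yz 1(4,5,7) hk] q(4)])
      next
        show "Cod V (cmap (vcomp V (emu A) \<Phi>) (x, w)) = Cod V (cmap (vcomp V (vcomp V (emu A) \<Theta>) \<alpha>) (x, w))"
          using c1(3) c2(3) Mb_TMb[OF small_X xw'(1)] xw' by simp
      qed (use xw' c1 c2 in simp_all)
    qed simp_all
  qed
qed

lemma is_ecat_iff: "is_ecat small V one T A \<longleftrightarrow> unit_left \<and> unit_right \<and> assoc"
  unfolding is_ecat_def unit_left_iff[symmetric] unit_right_iff[symmetric] assoc_iff[symmetric] by simp

end

lemma (in star_points) pre_ecat_if_is_ecat: "is_ecat small V one T A \<Longrightarrow> pre_ecat small V one T A"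
  by unfold_locales (simp_all add: is_ecat_def)

section \<open>From the axioms on elements to the internal category\<close>

context pre_ecat
begin

declare imu_pair [simp]

lemma TL_phi [simp]:
  assumes "x \<in> Arr V" "Dom V x = one" "Cod V x = TO (cp (Pts X))" "y \<in> Arr V" "Dom V y = one" "Cod V y = TO (cp X)" "g \<in> Arr V" "Cod V g = Tf a (x, y)"
  shows "TA L \<cdot> (\<phi> a (x, y) \<cdot> g) = TA (eps (TO (cp X))) \<cdot> (x \<cdot> bng (Dom V g))"
  using assms by (simp add: star_ecat_l_def)

lemma sl_ups: "sl (sm a) \<cdot> ups = cpm X (Pts X) (eb_set V one T X)"
  by (rule copow_eqI[of X]) auto

lemma sr_ups: "R \<cdot> ups = Ident V (cp X)"
  by (rule copow_eqI[of X]) auto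

text \<open>The left leg is considered before the counit is applied to it. The image of this
  equation under \<open>T\<close> locates the value of \<open>T nu\<close> in a fibre over
  \<open>Tmb \<cdot> x\<close>, as the associativity law requires.\<close>

lemma sl_nu: "sl (sm a) \<cdot> nu = cpm (Pts (Pts X)) (Pts X) (mb_set V one T X) \<cdot> (sl (sm (Tm a)) \<cdot> pb2 V (sl (sm a)) (sr (sm (Tm a))))"
proof (rule star_comp_local_eqI[of "Tm a" a "Ident V (pb V (sl (sm a)) (sr (sm (Tm a))))"])
  let ?P = "pb V (sl (sm a)) (sr (sm (Tm a)))"
  fix x y z k g h assume "x \<in> msrc (Tm a)" "y \<in> mtgt (Tm a)" "z \<in> mtgt a" and 1: "k \<in> Arr V" "g \<in> Arr V" "h \<in> Arr V" "Cod V k = Dom V (Ident V ?P)"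
    "Dom V k = Dom V h" "Dom V g = Dom V h" "Cod V g = ment a (y, z)" "Cod V h = ment (Tm a) (x, y)"
    and e: "Ident V ?P \<cdot> k = pb_pair V (sl (sm a)) (sr (sm (Tm a))) (mti a (y, z) \<cdot> g) (mti (Tm a) (x, y) \<cdot> h)"
  then have xyz: "x \<in> Pts (Pts X)" "y \<in> Pts X" "z \<in> X" by simp_all
  have k: "k = pb_pair V (sl (sm a)) (sr (sm (Tm a))) (mti a (y, z) \<cdot> g) (mti (Tm a) (x, y) \<cdot> h)" using e 1 by simp
  have h: "Cod V h = Tf a (x, y)" using 1(8) xyz by simp
  have "(sl (sm a) \<cdot> nu) \<cdot> k = sl (sm a) \<cdot> (nu \<cdot> k)" by (rule assoc_right) (use 1 in simp_all)
  also have "nu \<cdot> k = mti a (Mb X x, z) \<cdot> mul x y z g h" unfolding k by (rule nu_pair[OF xyz 1(2,3,6,7) h])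
  finally show "(sl (sm a) \<cdot> nu) \<cdot> k = (cpm (Pts (Pts X)) (Pts X) (mb_set V one T X) \<cdot> (sl (sm (Tm a)) \<cdot> pb2 V (sl (sm a)) (sr (sm (Tm a))))) \<cdot> k"
    using xyz 1(1-7) h k by simp
qed simp_all

lemma sr_nu: "R \<cdot> nu = R \<cdot> pb1 V (sl (sm a)) (sr (sm (Tm a)))"
proof (rule star_comp_local_eqI[of "Tm a" a "Ident V (pb V (sl (sm a)) (sr (sm (Tm a))))"])
  let ?P = "pb V (sl (sm a)) (sr (sm (Tm a)))"
  fix x y z k g h assume "x \<in> msrc (Tm a)" "y \<in> mtgt (Tm a)" "z \<in> mtgt a" and 1: "k \<in> Arr V" "g \<in> Arr V" "h \<in> Arr V" "Cod V k = Dom V (Ident V ?P)"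
    "Dom V k = Dom V h" "Dom V g = Dom V h" "Cod V g = ment a (y, z)" "Cod V h = ment (Tm a) (x, y)"
    and e: "Ident V ?P \<cdot> k = pb_pair V (sl (sm a)) (sr (sm (Tm a))) (mti a (y, z) \<cdot> g) (mti (Tm a) (x, y) \<cdot> h)"
  then have xyz: "x \<in> Pts (Pts X)" "y \<in> Pts X" "z \<in> X" by simp_all
  have k: "k = pb_pair V (sl (sm a)) (sr (sm (Tm a))) (mti a (y, z) \<cdot> g) (mti (Tm a) (x, y) \<cdot> h)" using e 1 by simp
  have h: "Cod V h = Tf a (x, y)" using 1(8) xyz by simp
  have "(R \<cdot> nu) \<cdot> k = R \<cdot> (nu \<cdot> k)" by (rule assoc_right) (use 1 in simp_all)
  also have "nu \<cdot> k = mti a (Mb X x, z) \<cdot> mul x y z g h" unfolding k by (rule nu_pair[OF xyz 1(2,3,6,7) h])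
  finally show "(R \<cdot> nu) \<cdot> k = (R \<cdot> pb1 V (sl (sm a)) (sr (sm (Tm a)))) \<cdot> k"
    using xyz 1(1-7) h k by simp
qed simp_all

lemma L_ups: "L \<cdot> ups = unit T (cp X)"
  by (rule copow_eqI[of X]) auto

lemma star_X2_eqI:
  assumes uv: "u \<in> Arr V" "v \<in> Arr V" "Dom V u = pb V L (TA R)" "Dom V v = pb V L (TA R)" "Cod V u = Cod V v"
    and loc: "\<And>x y z g h. \<lbrakk>x \<in> Pts (Pts X); y \<in> Pts X; z \<in> X; g \<in> Arr V; h \<in> Arr V; Dom V g = Dom V h; Cod V g = ment a (y, z); Cod V h = Tf a (x, y)\<rbrakk> \<Longrightarrow>
      u \<cdot> pb_pair V L (TA R) (mti a (y, z) \<cdot> g) (\<phi> a (x, y) \<cdot> h) = v \<cdot> pb_pair V L (TA R) (mti a (y, z) \<cdot> g) (\<phi> a (x, y) \<cdot> h)"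
  shows "u = v"
proof (rule star_X2_local_eqI[of "Ident V (pb V L (TA R))"])
  fix x y z k g h assume 1: "x \<in> Pts (Pts X)" "y \<in> Pts X" "z \<in> X" and 2: "k \<in> Arr V" and 3: "g \<in> Arr V" "h \<in> Arr V"
    and 4: "Cod V k = Dom V (Ident V (pb V L (TA R)))" "Dom V k = Dom V h" and 5: "Dom V g = Dom V h" "Cod V g = ment a (y, z)" "Cod V h = Tf a (x, y)"
    and e: "Ident V (pb V L (TA R)) \<cdot> k = pb_pair V L (TA R) (mti a (y, z) \<cdot> g) (\<phi> a (x, y) \<cdot> h)"
  have "k = pb_pair V L (TA R) (mti a (y, z) \<cdot> g) (\<phi> a (x, y) \<cdot> h)" using e 2 4(1) by simp
  then show "u \<cdot> k = v \<cdot> k" using loc[OF 1 3 5] by simp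
qed (use uv in simp_all)

abbreviation "M \<equiv> nu \<cdot> inv_arr V (star_X2_map V one T A)"

lemma L_M: "L \<cdot> M = mult T (cp X) \<cdot> (TA L \<cdot> pb2 V L (TA R))"
  by (rule star_X2_eqI) simp_all

lemma R_M: "R \<cdot> M = R \<cdot> pb1 V L (TA R)"
  by (rule star_X2_eqI) simp_all

text \<open>On the summand \<open>a (x, y)\<close> the pairing has as components the unit point at
  \<open>y\<close> and the value of the unit of \<open>Tb\<close> at the identity of the entry. The
  law becomes \<open>unit_left\<close> for that generic element.\<close>

lemma M_unit_left:
  assumes unit_left
  shows "M \<cdot> pb_pair V L (TA R) (ups \<cdot> R) (unit T (mtot V a)) = Ident V (mtot V a)"
proof (rule mtot_eqI[OF mat])
  have LR: "L \<cdot> (ups \<cdot> R) = TA R \<cdot> unit T (mtot V a)"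
    using Cmp_extend1[OF L_ups, of R] by simp
  then show "M \<cdot> pb_pair V L (TA R) (ups \<cdot> R) (unit T (mtot V a)) \<in> Arr V" "Dom V (M \<cdot> pb_pair V L (TA R) (ups \<cdot> R) (unit T (mtot V a))) = mtot V a"
    "Cod V (M \<cdot> pb_pair V L (TA R) (ups \<cdot> R) (unit T (mtot V a))) = Cod V (Ident V (mtot V a))" by simp_all
  fix x y assume "x \<in> msrc a" "y \<in> mtgt a"
  then have xy: "x \<in> Pts X" "y \<in> X" by simp_all
  let ?D = "ment a (x, y)"
  let ?h = "cmap (eb_mat V one T a) (x, y) \<cdot> Ident V ?D"
  have h: "?h \<in> Arr V" "Dom V ?h = ?D" "Cod V ?h = Tf a (Eb (Pts X) x, Eb X y)"
    "\<phi> a (Eb (Pts X) x, Eb X y) \<cdot> ?h = unit T (mtot V a) \<cdot> (mti a (x, y) \<cdot> Ident V ?D)"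
    using xy eb_mat_a[of x y "Ident V ?D"] by (simp_all del: eb_mat_a)
  have "pb_pair V L (TA R) (ups \<cdot> R) (unit T (mtot V a)) \<cdot> mti a (x, y) = pb_pair V L (TA R) ((ups \<cdot> R) \<cdot> mti a (x, y)) (unit T (mtot V a) \<cdot> mti a (x, y))"
    by (rule pb_pair_Cmp) (use LR xy in simp_all)
  also have "\<dots> = pb_pair V L (TA R) (mti a (Eb X y, y) \<cdot> (un y \<cdot> bng (Dom V ?h))) (\<phi> a (Eb (Pts X) x, Eb X y) \<cdot> ?h)"
    unfolding h(4) h(2) using xy by simp
  finally have e: "pb_pair V L (TA R) (ups \<cdot> R) (unit T (mtot V a)) \<cdot> mti a (x, y) = \<dots>" .
  have "(M \<cdot> pb_pair V L (TA R) (ups \<cdot> R) (unit T (mtot V a))) \<cdot> mti a (x, y) = nu \<cdot> (inv_arr V (star_X2_map V one T A) \<cdot> (pb_pair V L (TA R) (ups \<cdot> R) (unit T (mtot V a)) \<cdot> mti a (x, y)))"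
    using LR xy by simp
  also have "\<dots> = mti a (Mb X (Eb (Pts X) x), y) \<cdot> mul (Eb (Pts X) x) (Eb X y) y (un y \<cdot> bng (Dom V ?h)) ?h"
    unfolding e by (rule imu_pair) (use xy h in simp_all)
  also have "mul (Eb (Pts X) x) (Eb X y) y (un y \<cdot> bng (Dom V ?h)) ?h = Ident V ?D"
    by (rule assms[unfolded unit_left_def, rule_format, OF xy _ h(1) _ _ h(3,4)]) (use xy h(2) in simp_all)
  finally show "(M \<cdot> pb_pair V L (TA R) (ups \<cdot> R) (unit T (mtot V a))) \<cdot> mti a (x, y) = Ident V (mtot V a) \<cdot> mti a (x, y)"
    using xy by simp
qed simp_all

text \<open>As for the left law, the generic element of \<open>a (x, y)\<close> is used. Its partner
  is no longer the value of a given cell but has to be produced as an element of a fibre.\<close>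

lemma M_unit_right:
  assumes unit_right
  shows "M \<cdot> pb_pair V L (TA R) (Ident V (mtot V a)) (TA ups \<cdot> L) = Ident V (mtot V a)"
proof (rule mtot_eqI[OF mat])
  have TR: "TA R \<cdot> TA ups = Ident V (TO (cp X))" using T_commute1[OF sr_ups] by simp
  have Tl: "TA (sl (sm a)) \<cdot> TA ups = TA (cpm X (Pts X) (eb_set V one T X))" using T_commute1[OF sl_ups] by simp
  have LR: "L \<cdot> Ident V (mtot V a) = TA R \<cdot> (TA ups \<cdot> L)"
    using Cmp_extend1[OF TR, of L] by simp
  then show "M \<cdot> pb_pair V L (TA R) (Ident V (mtot V a)) (TA ups \<cdot> L) \<in> Arr V" "Dom V (M \<cdot> pb_pair V L (TA R) (Ident V (mtot V a)) (TA ups \<cdot> L)) = mtot V a"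
    "Cod V (M \<cdot> pb_pair V L (TA R) (Ident V (mtot V a)) (TA ups \<cdot> L)) = Cod V (Ident V (mtot V a))" by simp_all
  fix x y assume "x \<in> msrc a" "y \<in> mtgt a"
  then have xy: "x \<in> Pts X" "y \<in> X" by simp_all
  let ?D = "ment a (x, y)"
  let ?x = "TA (cpm X (Pts X) (eb_set V one T X)) \<cdot> x"
  let ?k = "TA ups \<cdot> (x \<cdot> bng ?D)"
  \<comment> \<open>The lift exists because \<open>T ups\<close> carries the point \<open>x\<close>
    into the fibre over \<open>?x\<close> and \<open>x\<close>: its two legs are given by
    \<open>Tl\<close> and \<open>TR\<close>, the images under \<open>T\<close> of
    \<open>sl_ups\<close> and \<open>sr_ups\<close>.\<close>
  let ?h = "fib_lift V one (T_span T (sm a)) (?x, x) ?k"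
  have k: "TA R \<cdot> ?k = x \<cdot> bng ?D" using Cmp_extend1[OF TR, of "x \<cdot> bng ?D"] xy by simp
  have k2: "TA (sl (sm a)) \<cdot> ?k = ?x \<cdot> bng ?D" using Cmp_extend1[OF Tl, of "x \<cdot> bng ?D"] xy by simp
  have h: "?h \<in> Arr V" "Dom V ?h = ?D" "Cod V ?h = Tf a (?x, x)" "\<phi> a (?x, x) \<cdot> ?h = TA ups \<cdot> (x \<cdot> bng ?D)"
    using xy k k2 by simp_all
  have h4: "\<phi> a (?x, x) \<cdot> ?h = TA ups \<cdot> (x \<cdot> bng (Dom V ?h))" using h(2,4) by simp
  have "pb_pair V L (TA R) (Ident V (mtot V a)) (TA ups \<cdot> L) \<cdot> mti a (x, y) = pb_pair V L (TA R) (Ident V (mtot V a) \<cdot> mti a (x, y)) ((TA ups \<cdot> L) \<cdot> mti a (x, y))"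
    by (rule pb_pair_Cmp) (use LR xy in simp_all)
  also have "\<dots> = pb_pair V L (TA R) (mti a (x, y) \<cdot> Ident V ?D) (\<phi> a (?x, x) \<cdot> ?h)"
    unfolding h(4) using xy by simp
  finally have e: "pb_pair V L (TA R) (Ident V (mtot V a)) (TA ups \<cdot> L) \<cdot> mti a (x, y) = \<dots>" .
  have "(M \<cdot> pb_pair V L (TA R) (Ident V (mtot V a)) (TA ups \<cdot> L)) \<cdot> mti a (x, y) = nu \<cdot> (inv_arr V (star_X2_map V one T A) \<cdot> (pb_pair V L (TA R) (Ident V (mtot V a)) (TA ups \<cdot> L) \<cdot> mti a (x, y)))"
    using LR xy by simp
  also have "\<dots> = mti a (Mb X ?x, y) \<cdot> mul ?x x y (Ident V ?D) ?h"
    unfolding e by (rule imu_pair) (use xy h in simp_all)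
  also have "mul ?x x y (Ident V ?D) ?h = Ident V ?D"
    by (rule assms[unfolded unit_right_def, rule_format, OF xy _ h(1) _ _ h(3) h4]) (use xy h(2) in simp_all)
  finally show "(M \<cdot> pb_pair V L (TA R) (Ident V (mtot V a)) (TA ups \<cdot> L)) \<cdot> mti a (x, y) = Ident V (mtot V a) \<cdot> mti a (x, y)"
    using xy by simp
qed simp_all

text \<open>The common domain is the object of composable triples. Its first projection is a
  composable pair and splits into elements \<open>g\<close> and \<open>h\<close> over summands. The
  remaining factor sits under two layers of \<open>T\<close>; its target is then constant, so that
  \<open>conjoint_local_eqI\<close> for \<open>Tb a\<close> places it in a fibre. On the resulting
  triples the equation is the condition \<open>assoc\<close>.\<close>

lemma M_assoc:
  assumes assoc
  defines "p1 \<equiv> pb1 V L (TA R)" and "p2 \<equiv> pb2 V L (TA R)"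
  defines "\<pi>\<^sub>1 \<equiv> pb1 V p2 (TA p1)" and "\<pi>\<^sub>2 \<equiv> pb2 V p2 (TA p1)"
  shows "M \<cdot> pb_pair V L (TA R) (M \<cdot> \<pi>\<^sub>1) (mult T (mtot V a) \<cdot> (TA p2 \<cdot> \<pi>\<^sub>2)) = M \<cdot> pb_pair V L (TA R) (p1 \<cdot> \<pi>\<^sub>1) (TA M \<cdot> \<pi>\<^sub>2)"
proof -
  let ?s = "inv_arr V (star_X2_map V one T A)" and ?P = "pb V L (TA R)" and ?q1 = "pb1 V (sl (sm a)) (sr (sm (Tm a)))" and ?q2 = "pb2 V (sl (sm a)) (sr (sm (Tm a)))"
  let ?Q = "pb V p2 (TA p1)"
  have p: "p1 \<in> Arr V" "Dom V p1 = ?P" "Cod V p1 = mtot V a" "p2 \<in> Arr V" "Dom V p2 = ?P" "Cod V p2 = TO (mtot V a)"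
    by (simp_all add: p1_def p2_def)
  have pc: "L \<cdot> p1 = TA R \<cdot> p2" unfolding p1_def p2_def by (rule pb_commute) simp_all
  have pi: "\<pi>\<^sub>1 \<in> Arr V" "Dom V \<pi>\<^sub>1 = ?Q" "Cod V \<pi>\<^sub>1 = ?P" "\<pi>\<^sub>2 \<in> Arr V" "Dom V \<pi>\<^sub>2 = ?Q" "Cod V \<pi>\<^sub>2 = TO ?P"
    using p by (simp_all add: \<pi>\<^sub>1_def \<pi>\<^sub>2_def)
  have pic: "p2 \<cdot> \<pi>\<^sub>1 = TA p1 \<cdot> \<pi>\<^sub>2" unfolding \<pi>\<^sub>1_def \<pi>\<^sub>2_def by (rule pb_commute) (use p in simp_all)
  have M: "M \<in> Arr V" "Dom V M = ?P" "Cod V M = mtot V a" by simp_all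
  have LM: "L \<cdot> M = mult T (cp X) \<cdot> (TA L \<cdot> p2)" and RM: "R \<cdot> M = R \<cdot> p1" using L_M R_M by (simp_all add: p1_def p2_def)
  have TRM: "TA R \<cdot> TA M = TA R \<cdot> TA p1" by (rule T_commute[OF RM]) (use p M in simp_all)
  have TLp: "TA L \<cdot> TA p1 = TA (TA R) \<cdot> TA p2" by (rule T_commute[OF pc]) (use p in simp_all)
  have c1: "L \<cdot> (M \<cdot> \<pi>\<^sub>1) = TA R \<cdot> (mult T (mtot V a) \<cdot> (TA p2 \<cdot> \<pi>\<^sub>2))"
  proof -
    have "L \<cdot> (M \<cdot> \<pi>\<^sub>1) = (mult T (cp X) \<cdot> (TA L \<cdot> p2)) \<cdot> \<pi>\<^sub>1" by (rule Cmp_extend1[OF LM]) (use p pi M in simp_all)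
    also have "\<dots> = mult T (cp X) \<cdot> (TA L \<cdot> (TA p1 \<cdot> \<pi>\<^sub>2))" using p pi pic by simp
    also have "TA L \<cdot> (TA p1 \<cdot> \<pi>\<^sub>2) = TA (TA R) \<cdot> (TA p2 \<cdot> \<pi>\<^sub>2)" by (rule Cmp_extend[OF TLp]) (use p pi in simp_all)
    finally show ?thesis using p pi by simp
  qed
  have c2: "L \<cdot> (p1 \<cdot> \<pi>\<^sub>1) = TA R \<cdot> (TA M \<cdot> \<pi>\<^sub>2)"
  proof -
    have "L \<cdot> (p1 \<cdot> \<pi>\<^sub>1) = TA R \<cdot> (p2 \<cdot> \<pi>\<^sub>1)" by (rule Cmp_extend[OF pc]) (use p pi in simp_all)
    also have "\<dots> = TA R \<cdot> (TA p1 \<cdot> \<pi>\<^sub>2)" using pic by simp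
    also have "\<dots> = TA R \<cdot> (TA M \<cdot> \<pi>\<^sub>2)" by (rule Cmp_extend[OF TRM[symmetric]]) (use p pi M in simp_all)
    finally show ?thesis .
  qed
  define l where "l = pb_pair V L (TA R) (M \<cdot> \<pi>\<^sub>1) (mult T (mtot V a) \<cdot> (TA p2 \<cdot> \<pi>\<^sub>2))"
  define r where "r = pb_pair V L (TA R) (p1 \<cdot> \<pi>\<^sub>1) (TA M \<cdot> \<pi>\<^sub>2)"
  have l: "l \<in> Arr V" "Dom V l = ?Q" "Cod V l = ?P" unfolding l_def using c1 p pi by (simp_all del: assoc_right)
  have r: "r \<in> Arr V" "Dom V r = ?Q" "Cod V r = ?P" unfolding r_def using c2 p pi by (simp_all del: T_simps(6))
  have lk: "l \<cdot> k = pb_pair V L (TA R) ((M \<cdot> \<pi>\<^sub>1) \<cdot> k) ((mult T (mtot V a) \<cdot> (TA p2 \<cdot> \<pi>\<^sub>2)) \<cdot> k)" if "k \<in> Arr V" "Cod V k = ?Q" for k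
    unfolding l_def by (rule pb_pair_Cmp[OF _ _ _ _ _ _ _ _ c1]) (use that p pi in simp_all)
  have rk: "r \<cdot> k = pb_pair V L (TA R) ((p1 \<cdot> \<pi>\<^sub>1) \<cdot> k) ((TA M \<cdot> \<pi>\<^sub>2) \<cdot> k)" if "k \<in> Arr V" "Cod V k = ?Q" for k
    unfolding r_def by (rule pb_pair_Cmp[OF _ _ _ _ _ _ _ _ c2]) (use that p pi in simp_all)
  have s1: "?q1 \<cdot> ?s = p1" and s2: "epsT a \<cdot> (?q2 \<cdot> ?s) = p2" using star_X2_inv_pb by (simp_all add: p1_def p2_def)
  have Ts1: "TA ?q1 \<cdot> TA ?s = TA p1" by (rule T_commute1[OF s1]) simp_all
  have Ts2: "TA (epsT a) \<cdot> (TA ?q2 \<cdot> TA ?s) = TA p2" using T_commute1[OF s2] by simp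
  have qc: "sl (sm a) \<cdot> ?q1 = sr (sm (Tm a)) \<cdot> ?q2" by (rule pb_commute) simp_all
  have Tqc: "TA (sl (sm a)) \<cdot> TA ?q1 = TA (sr (sm (Tm a))) \<cdot> TA ?q2" by (rule T_commute[OF qc]) simp_all
  have Tslnu: "TA (sl (sm a)) \<cdot> TA nu = Tmb' \<cdot> (TA (sl (sm (Tm a))) \<cdot> TA ?q2)" if "Tmb' = Tmb" for Tmb'
    using T_commute1[OF sl_nu] that by simp
  have Tsrnu: "TA R \<cdot> TA nu = TA R \<cdot> TA ?q1" by (rule T_commute[OF sr_nu]) simp_all
  have main: "M \<cdot> l = M \<cdot> r"
  \<comment> \<open>The composable pair is localized, which fixes the indices \<open>y\<close>,
    \<open>z\<close>, \<open>w\<close> and the elements \<open>g\<close>, \<open>h\<close>.\<close>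
  proof (rule star_X2_local_eqI[of \<pi>\<^sub>1])
    fix y z w k g h assume 1: "y \<in> Pts (Pts X)" "z \<in> Pts X" "w \<in> X" "k \<in> Arr V" "g \<in> Arr V" "h \<in> Arr V" "Cod V k = Dom V \<pi>\<^sub>1"
      "Dom V k = Dom V h" "Dom V g = Dom V h" "Cod V g = ment a (z, w)" "Cod V h = Tf a (y, z)"
      and e: "\<pi>\<^sub>1 \<cdot> k = pb_pair V L (TA R) (mti a (z, w) \<cdot> g) (\<phi> a (y, z) \<cdot> h)"
    have ck: "Cod V k = ?Q" using 1(7) pi by simp
    have \<pi>k: "\<pi>\<^sub>2 \<cdot> k \<in> Arr V" "Dom V (\<pi>\<^sub>2 \<cdot> k) = Dom V h" "Cod V (\<pi>\<^sub>2 \<cdot> k) = TO ?P" using pi 1(4,8) ck by simp_all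
    let ?n = "TA ?s \<cdot> (\<pi>\<^sub>2 \<cdot> k)"
    have n: "?n \<in> Arr V" "Dom V ?n = Dom V h" "Cod V ?n = TO (pb V (sl (sm a)) (sr (sm (Tm a))))" using \<pi>k by simp_all
    have n1: "TA ?q1 \<cdot> ?n = \<phi> a (y, z) \<cdot> h"
    proof -
      have "TA ?q1 \<cdot> ?n = TA p1 \<cdot> (\<pi>\<^sub>2 \<cdot> k)" by (rule Cmp_extend1[OF Ts1]) (use \<pi>k in simp_all)
      also have "\<dots> = p2 \<cdot> (\<pi>\<^sub>1 \<cdot> k)" by (rule Cmp_extend[OF pic[symmetric]]) (use p pi 1 ck in simp_all)
      also have "\<dots> = \<phi> a (y, z) \<cdot> h" unfolding e p2_def using 1(1-6,8-11) by simp
      finally show ?thesis .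
    qed
    have n2: "TA (epsT a) \<cdot> (TA ?q2 \<cdot> ?n) = TA p2 \<cdot> (\<pi>\<^sub>2 \<cdot> k)"
      using Cmp_extend1[of "TA (epsT a)" "TA ?q2 \<cdot> TA ?s" "TA p2" "\<pi>\<^sub>2 \<cdot> k", OF Ts2] \<pi>k by simp
    let ?f = "TA ?q2 \<cdot> ?n"
    have f: "?f \<in> Arr V" "Dom V ?f = Dom V h" "Cod V ?f = TO (mtot V (Tm a))" using n by simp_all
    have "TA (sr (sm (Tm a))) \<cdot> ?f = TA (sl (sm a)) \<cdot> (TA ?q1 \<cdot> ?n)" by (rule Cmp_extend[OF Tqc[symmetric]]) (use n in simp_all)
    \<comment> \<open>The second coordinate of the composable pair under \<open>T\<close> has as its
      target the source of \<open>h\<close>, which is the point \<open>y\<close>. This is the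
      hypothesis under which the strong conjoint property localizes.\<close>
    then have fy: "TA (sr (sm (Tm a))) \<cdot> ?f = y \<cdot> bng (Dom V ?f)" unfolding n1 f(2) using 1 by simp
    show "(M \<cdot> l) \<cdot> k = (M \<cdot> r) \<cdot> k"
    proof (rule conjoint_local_eqI[of "Tm a" ?f y])
      fix x k' g3 assume 2: "x \<in> Arr V" "Dom V x = one" "Cod V x = TO (cp (msrc (Tm a)))" "k' \<in> Arr V" "g3 \<in> Arr V" "Dom V k' = Dom V g3"
         "Cod V k' = Dom V ?f" "Cod V g3 = Tf (Tm a) (x, y)" and e2: "?f \<cdot> k' = \<phi> (Tm a) (x, y) \<cdot> g3"
      have x: "x \<in> Pts (Pts (Pts X))" using 2 by simp
      have ck': "Cod V k' = Dom V h" using 2(7) f by simp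
      define g' where "g' = g \<cdot> k'"
      define h' where "h' = h \<cdot> k'"
      define K where "K = k \<cdot> k'"
      have g': "g' \<in> Arr V" "Dom V g' = Dom V g3" "Cod V g' = ment a (z, w)" using 1 2 ck' by (simp_all add: g'_def)
      have h': "h' \<in> Arr V" "Dom V h' = Dom V g3" "Cod V h' = Tf a (y, z)" using 1 2 ck' by (simp_all add: h'_def)
      have K: "K \<in> Arr V" "Dom V K = Dom V g3" "Cod V K = ?Q" using 1 2 ck ck' by (simp_all add: K_def)
      have P1: "\<pi>\<^sub>1 \<cdot> K = pb_pair V L (TA R) (mti a (z, w) \<cdot> g') (\<phi> a (y, z) \<cdot> h')"
      proof -
        have "\<pi>\<^sub>1 \<cdot> K = pb_pair V L (TA R) (mti a (z, w) \<cdot> g) (\<phi> a (y, z) \<cdot> h) \<cdot> k'"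
          unfolding K_def by (rule Cmp_extend1[OF e]) (use 1(4,8) 2(4) ck' ck pi in simp_all)
        also have "\<dots> = pb_pair V L (TA R) ((mti a (z, w) \<cdot> g) \<cdot> k') ((\<phi> a (y, z) \<cdot> h) \<cdot> k')"
          by (rule pb_pair_Cmp) (use 1(1-6,8-11) 2(4) ck' in simp_all)
        finally show ?thesis using 1(1-6,8-11) 2(4) ck' by (simp add: g'_def h'_def)
      qed
      have n1': "TA ?q1 \<cdot> (?n \<cdot> k') = \<phi> a (y, z) \<cdot> h'"
        using Cmp_extend1[of "TA ?q1" ?n "\<phi> a (y, z) \<cdot> h" k', OF n1] n 1(1-6,8-11) 2(4) ck' by (simp add: h'_def)
      have n2': "TA ?q2 \<cdot> (?n \<cdot> k') = \<phi> (Tm a) (x, y) \<cdot> g3"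
        using e2 n 2(4) ck' assoc_right[of k' ?n "TA ?q2"] by simp
      have sq: "TA (sl (sm a)) \<cdot> (\<phi> a (y, z) \<cdot> h') = TA (sr (sm (Tm a))) \<cdot> (\<phi> (Tm a) (x, y) \<cdot> g3)"
        using 1(1-3) h' 2(1-6,8) by simp
      let ?tp = "T_pair (sl (sm a)) (sr (sm (Tm a))) (\<phi> a (y, z) \<cdot> h') (\<phi> (Tm a) (x, y) \<cdot> g3)"
      have tp: "?tp \<in> Arr V" "Dom V ?tp = Dom V g3" "Cod V ?tp = TO (pb V (sl (sm a)) (sr (sm (Tm a))))" "TA ?q1 \<cdot> ?tp = \<phi> a (y, z) \<cdot> h'" "TA ?q2 \<cdot> ?tp = \<phi> (Tm a) (x, y) \<cdot> g3"
        using sq 1(1-3) h' 2(1-6,8) by simp_all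
      \<comment> \<open>\<open>T\<close> of the composite of spans is still a pullback, so this
        element is determined by its two components.\<close>
      have nk: "?n \<cdot> k' = ?tp"
        by (rule T_pb_eqI[of "sl (sm a)" "sr (sm (Tm a))"]) (use n tp n1' n2' 2(4,6) ck' in simp_all)
      have nK: "TA ?s \<cdot> (\<pi>\<^sub>2 \<cdot> K) = ?tp" using nk \<pi>k pi ck 1(4) 2(4) ck' 1(8) by (simp add: K_def)
      \<comment> \<open>Through the isomorphism between the composite of spans and
        \<open>X\<^sub>2\<close>, the second projection becomes the counit after the second
        projection of spans. The counit appears here under \<open>T\<close>, as it does in the
        multiplication of \<open>Tb\<close>.\<close>
      have p2K: "TA p2 \<cdot> (\<pi>\<^sub>2 \<cdot> K) = TA (epsT a) \<cdot> (\<phi> (Tm a) (x, y) \<cdot> g3)"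
      proof -
        have "TA p2 \<cdot> (\<pi>\<^sub>2 \<cdot> K) = TA (epsT a) \<cdot> ((TA ?q2 \<cdot> TA ?s) \<cdot> (\<pi>\<^sub>2 \<cdot> K))"
          by (rule Cmp_extend1[OF Ts2, symmetric]) (use K pi in simp_all)
        also have "(TA ?q2 \<cdot> TA ?s) \<cdot> (\<pi>\<^sub>2 \<cdot> K) = TA ?q2 \<cdot> (TA ?s \<cdot> (\<pi>\<^sub>2 \<cdot> K))"
          by (rule assoc_right) (use K pi in simp_all)
        finally show ?thesis unfolding nK tp(5) .
      qed
      define s where "s = cmap (mb_mat V one T a) (x, y) \<cdot> g3"
      have s: "s \<in> Arr V" "Dom V s = Dom V g3" "Cod V s = Tf a (Mb (Pts X) x, Mb X y)" "\<phi> a (Mb (Pts X) x, Mb X y) \<cdot> s = mult T (mtot V a) \<cdot> (TA (epsT a) \<cdot> (\<phi> (Tm a) (x, y) \<cdot> g3))"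
        unfolding s_def using x 1(1) 2(5,8) mcellD(7-9)[of "mb_mat V one T a" x y] by simp_all
      let ?k = "TA nu \<cdot> ?tp"
      \<comment> \<open>An element of \<open>Tb a\<close> whose image is the product of the second
        and third entries of the triple. The equations \<open>kl\<close> and \<open>kr\<close>,
        established next from \<open>sl_nu\<close> and \<open>sr_nu\<close> under \<open>T\<close>,
        place that product in the fibre.\<close>
      define t where "t = fib_lift V one (T_span T (sm a)) (Tmb \<cdot> x, z) ?k"
      have "TA (sl (sm a)) \<cdot> ?k = (Tmb \<cdot> (TA (sl (sm (Tm a))) \<cdot> TA ?q2)) \<cdot> ?tp"
        by (rule Cmp_extend1[OF Tslnu[OF refl]]) (use tp in simp_all)
      also have "\<dots> = Tmb \<cdot> (TA (sl (sm (Tm a))) \<cdot> (TA ?q2 \<cdot> ?tp))" using tp(1-3) by simp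
      also have "\<dots> = (Tmb \<cdot> x) \<cdot> bng (Dom V g3)" unfolding tp(5) using x 1(1) 2(5,8) by simp
      finally have kl: "TA (sl (sm a)) \<cdot> ?k = (Tmb \<cdot> x) \<cdot> bng (Dom V g3)" .
      have "TA R \<cdot> ?k = TA R \<cdot> (TA ?q1 \<cdot> ?tp)" by (rule Cmp_extend[OF Tsrnu]) (use tp in simp_all)
      also have "\<dots> = z \<cdot> bng (Dom V g3)" unfolding tp(4) using 1(1,2) h' by simp
      finally have kr: "TA R \<cdot> ?k = z \<cdot> bng (Dom V g3)" .
      have t: "t \<in> Arr V" "Dom V t = Dom V g3" "Cod V t = Tf a (Tmb \<cdot> x, z)" "\<phi> a (Tmb \<cdot> x, z) \<cdot> t = ?k"
        unfolding t_def using fib_lift_simps[of "T_span T (sm a)" "Tmb \<cdot> x" z ?k] x 1(2) tp(1-3) kl kr by simp_all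
      have L1: "l \<cdot> K = pb_pair V L (TA R) (mti a (Mb X y, w) \<cdot> mul y z w g' h') (\<phi> a (Mb (Pts X) x, Mb X y) \<cdot> s)"
      proof -
        have "(M \<cdot> \<pi>\<^sub>1) \<cdot> K = nu \<cdot> (?s \<cdot> (\<pi>\<^sub>1 \<cdot> K))" using pi K by simp
        also have "\<dots> = mti a (Mb X y, w) \<cdot> mul y z w g' h'" unfolding P1 by (rule imu_pair) (use 1(1-3) g' h' in simp_all)
        finally have a1: "(M \<cdot> \<pi>\<^sub>1) \<cdot> K = mti a (Mb X y, w) \<cdot> mul y z w g' h'" .
        have "(mult T (mtot V a) \<cdot> (TA p2 \<cdot> \<pi>\<^sub>2)) \<cdot> K = mult T (mtot V a) \<cdot> (TA p2 \<cdot> (\<pi>\<^sub>2 \<cdot> K))" using p pi K by simp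
        then show ?thesis unfolding lk[OF K(1,3)] a1 p2K s(4) by simp
      qed
      have R1: "r \<cdot> K = pb_pair V L (TA R) (mti a (z, w) \<cdot> g') (\<phi> a (Tmb \<cdot> x, z) \<cdot> t)"
      proof -
        have "(p1 \<cdot> \<pi>\<^sub>1) \<cdot> K = p1 \<cdot> (\<pi>\<^sub>1 \<cdot> K)" using p pi K by simp
        also have "\<dots> = mti a (z, w) \<cdot> g'" unfolding P1 p1_def using 1(1-3) g' h' by simp
        finally have a1: "(p1 \<cdot> \<pi>\<^sub>1) \<cdot> K = mti a (z, w) \<cdot> g'" .
        have "(TA M \<cdot> \<pi>\<^sub>2) \<cdot> K = TA nu \<cdot> (TA ?s \<cdot> (\<pi>\<^sub>2 \<cdot> K))" using pi K by simp
        then show ?thesis unfolding rk[OF K(1,3)] a1 nK t(4) by simp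
      qed
      have "M \<cdot> (l \<cdot> K) = mti a (Mb X (Mb (Pts X) x), w) \<cdot> mul (Mb (Pts X) x) (Mb X y) w (mul y z w g' h') s"
        unfolding L1 using imu_pair[of "Mb (Pts X) x" "Mb X y" w "mul y z w g' h'" s] x 1(1-3) g' h' s(1-3) by simp
      moreover have "M \<cdot> (r \<cdot> K) = mti a (Mb X (Tmb \<cdot> x), w) \<cdot> mul (Tmb \<cdot> x) z w g' t"
        unfolding R1 using imu_pair[of "Tmb \<cdot> x" z w g' t] x 1(1-3) g' h' t(1-3) by simp
      moreover have "mul (Tmb \<cdot> x) z w g' t = mul (Mb (Pts X) x) (Mb X y) w (mul y z w g' h') s"
        by (rule assms(1)[unfolded assoc_def, rule_format, OF x 1(1-3) g'(1) h'(1) 2(5) t(1) s(1) g'(2) h'(2) t(2) s(2) g'(3) h'(3) 2(8) t(3) s(3) t(4) s(4)])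
      ultimately have "M \<cdot> (l \<cdot> K) = M \<cdot> (r \<cdot> K)" unfolding Mb_TMb[OF small_X x] by simp
      then show "((M \<cdot> l) \<cdot> k) \<cdot> k' = ((M \<cdot> r) \<cdot> k) \<cdot> k'" using l r 1(4,8) 2(4) ck ck' by (simp add: K_def)
    qed (use f fy 1 l r ck in simp_all)
  qed (use l r pi in simp_all)
  then show ?thesis unfolding l_def r_def .
qed

lemma is_icat_star:
  assumes unit_left unit_right assoc
  shows "is_icat V T (star_ecat V one T A)"
  unfolding is_icat_def star_ecat_simps Let_def
  using L_ups sr_ups L_M R_M M_unit_left[OF assms(1)] M_unit_right[OF assms(2)] M_assoc[OF assms(3)]
  by (simp del: assoc_right T_simps(6))

end

section \<open>Morphisms of enriched categories on elements\<close>

locale pre_ecat_mor = A: pre_ecat small V one T A + B: pre_ecat small V one T B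
  for small :: "'a set \<Rightarrow> bool" and V :: "('o, 'a) cat" (structure) and one :: 'o and T :: "('o, 'a) monad_data"
    and A B :: "('o, 'a) ecat" +
  fixes f :: "'a \<Rightarrow> 'a" and \<zeta> :: "('o, 'a) mcell"
  assumes f [simp]: "f \<in> eX A \<rightarrow>\<^sub>E eX B" and cell [simp]: "is_mcell small V \<zeta>" "cdom \<zeta> = ea A" "ccod \<zeta> = ea B"
    "cleft \<zeta> = Tb_fun V one T (eX A) (eX B) f" "cright \<zeta> = f"
begin

abbreviation "f1 \<equiv> copow_map V one (eX A) (eX B) f"
abbreviation "F \<equiv> amap (endo T) (copow_map V one (eX A) (eX B) f)"
abbreviation "FF \<equiv> amap (endo T) (copow_map V one (A.Pts (eX A)) (A.Pts (eX B)) (Tb_fun V one T (eX A) (eX B) f))"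
abbreviation "Z \<equiv> smap (star_cell V one \<zeta>)"

lemma f_mem [simp]: "x \<in> eX A \<Longrightarrow> f x \<in> eX B"
  using PiE_mem[OF f] .

lemma Tb_fun_PiE [simp]: "Tb_fun V one T (eX A) (eX B) f \<in> A.Pts (eX A) \<rightarrow>\<^sub>E A.Pts (eX B)"
  using A.mcellD(5)[OF cell(1)] by simp

lemma eps_Tb_fun: "eps_obj V one (A.TO (copow V one B.X)) \<cdot> copow_map V one (A.Pts A.X) (A.Pts B.X) (Tb_fun V one T A.X B.X f) = F \<cdot> eps_obj V one (A.TO (copow V one A.X))"
  by (rule A.copow_eqI[of "A.Pts A.X"]) auto

text \<open>Naturality of the multiplication of \<open>Tb\<close> on points, from naturality of the
  counit and of \<open>m\<close>. It matches the boundaries in the compatibility of a morphism with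
  multiplication.\<close>

lemma Mb_FF:
  assumes "x \<in> A.Pts (A.Pts A.X)"
  shows "A.Mb B.X (FF \<cdot> x) = F \<cdot> A.Mb A.X x"
proof -
  have "A.TA (eps_obj V one (A.TO (copow V one B.X))) \<cdot> FF = A.TA (F \<cdot> eps_obj V one (A.TO (copow V one A.X)))"
    by (rule A.T_commute1[OF eps_Tb_fun]) simp_all
  then have "A.TA (eps_obj V one (A.TO (copow V one B.X))) \<cdot> (FF \<cdot> x) = A.TA (F \<cdot> eps_obj V one (A.TO (copow V one A.X))) \<cdot> x"
    by (rule A.Cmp_extend1) (use assms in simp_all)
  then show ?thesis using assms by simp
qed

definition mor_unit :: bool where
  "mor_unit \<longleftrightarrow> (\<forall>x \<in> A.X. cmap \<zeta> (A.Eb A.X x, x) \<cdot> A.un x = B.un (f x))"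

text \<open>The variable \<open>h'\<close> stands for the value of \<open>Tb \<zeta>\<close> at
  \<open>h\<close>, which is determined by its image under the fibre inclusion. The action of
  \<open>Tb\<close> on 2-cells thereby enters through \<open>T Z\<close> alone.\<close>

definition mor_mul :: bool where
  "mor_mul \<longleftrightarrow> (\<forall>x \<in> A.Pts (A.Pts A.X). \<forall>y \<in> A.Pts A.X. \<forall>z \<in> A.X. \<forall>g h h'. g \<in> Arr V \<longrightarrow> h \<in> Arr V \<longrightarrow> h' \<in> Arr V \<longrightarrow>
     Dom V g = Dom V h \<longrightarrow> Dom V h' = Dom V h \<longrightarrow> Cod V g = ment A.a (y, z) \<longrightarrow> Cod V h = A.Tf A.a (x, y) \<longrightarrow> Cod V h' = A.Tf B.a (FF \<cdot> x, F \<cdot> y) \<longrightarrow>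
     A.\<phi> B.a (FF \<cdot> x, F \<cdot> y) \<cdot> h' = A.TA Z \<cdot> (A.\<phi> A.a (x, y) \<cdot> h) \<longrightarrow>
     cmap \<zeta> (A.Mb A.X x, z) \<cdot> A.mul x y z g h = B.mul (FF \<cdot> x) (F \<cdot> y) (f z) (cmap \<zeta> (y, z) \<cdot> g) h')"

lemma munit_cell_simps [simp]:
  "cdom (munit_cell V one A.X B.X f) = munit V one A.X" "ccod (munit_cell V one A.X B.X f) = munit V one B.X"
  "x \<in> A.X \<Longrightarrow> cleft (munit_cell V one A.X B.X f) x = f x" "x \<in> A.X \<Longrightarrow> cright (munit_cell V one A.X B.X f) x = f x"
  by (simp_all add: munit_cell_def)

lemma munit_cell_cmap:
  assumes "x \<in> A.X" "x' \<in> A.X"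
  shows "cmap (munit_cell V one A.X B.X f) (x, x') \<in> Arr V" (is ?A) "Dom V (cmap (munit_cell V one A.X B.X f) (x, x')) = copow V one (eqv x x')" (is ?B)
    "Cod V (cmap (munit_cell V one A.X B.X f) (x, x')) = copow V one (eqv (f x) (f x'))" (is ?C)
    "x = x' \<Longrightarrow> cmap (munit_cell V one A.X B.X f) (x, x') \<cdot> copow_incl V one {()} () = copow_incl V one {()} ()" (is "PROP ?D")
proof -
  have "id \<in> eqv x x' \<rightarrow> eqv (f x) (f x')" by (auto simp: eqv_def split: if_splits)
  then show ?A ?B
    ?C
    "PROP ?D"
    using assms by (simp_all add: munit_cell_def)
qed

lemma mcell_munit_cell: "A.mcell (munit_cell V one A.X B.X f)"
proof (rule A.mcellI)
  show "cleft (munit_cell V one A.X B.X f) \<in> extensional (msrc (cdom (munit_cell V one A.X B.X f)))"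
    "cright (munit_cell V one A.X B.X f) \<in> extensional (mtgt (cdom (munit_cell V one A.X B.X f)))"
    "cmap (munit_cell V one A.X B.X f) \<in> extensional (msrc (cdom (munit_cell V one A.X B.X f)) \<times> mtgt (cdom (munit_cell V one A.X B.X f)))"
    by (simp_all add: munit_cell_def)
qed (use munit_cell_cmap in simp_all)

lemma mor_unit_iff: "vcomp V \<zeta> (eun A) = vcomp V (eun B) (munit_cell V one A.X B.X f) \<longleftrightarrow> mor_unit"
proof -
  let ?u = "munit_cell V one A.X B.X f"
  have m1: "A.mcell (vcomp V \<zeta> (eun A))" by (rule A.mcell_vcomp) simp_all
  have m2: "A.mcell (vcomp V (eun B) ?u)" by (rule A.mcell_vcomp[OF mcell_munit_cell]) simp_all
  have k1: "cmap (vcomp V \<zeta> (eun A)) (x, x) \<cdot> copow_incl V one {()} () = cmap \<zeta> (A.Eb A.X x, x) \<cdot> A.un x" if "x \<in> A.X" for x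
    using that by (simp add: A.un_def)
  have k2: "cmap (vcomp V (eun B) ?u) (x, x) \<cdot> copow_incl V one {()} () = B.un (f x)" if "x \<in> A.X" for x
    using that munit_cell_cmap[of x x] by (simp add: B.un_def)
  show ?thesis
  proof
    assume "vcomp V \<zeta> (eun A) = vcomp V (eun B) ?u"
    then show mor_unit unfolding mor_unit_def using k1 k2 by metis
  next
    assume mu: mor_unit
    show "vcomp V \<zeta> (eun A) = vcomp V (eun B) ?u"
    proof (rule A.mcell_eqI[OF m1 m2])
      fix x x' assume "x \<in> msrc (cdom (vcomp V (eun B) ?u))" "x' \<in> mtgt (cdom (vcomp V (eun B) ?u))"
      then have x: "x \<in> A.X" "x' \<in> A.X" by simp_all
      note c1 = A.mcellD(7-9)[OF m1, of x x'] and c2 = A.mcellD(7-9)[OF m2, of x x']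
      show "cmap (vcomp V \<zeta> (eun A)) (x, x') = cmap (vcomp V (eun B) ?u) (x, x')"
      proof (rule A.copow_eqI[of "eqv x x'"])
        fix i assume "i \<in> eqv x x'"
        then have "x' = x" by (simp add: eqv_def split: if_splits)
        then show "cmap (vcomp V \<zeta> (eun A)) (x, x') \<cdot> copow_incl V one (eqv x x') i = cmap (vcomp V (eun B) ?u) (x, x') \<cdot> copow_incl V one (eqv x x') i"
          using k1[OF x(1)] k2[OF x(1)] mu x unfolding mor_unit_def by (simp del: A.vcomp_simps)
      next
        show "Cod V (cmap (vcomp V \<zeta> (eun A)) (x, x')) = Cod V (cmap (vcomp V (eun B) ?u) (x, x'))"
          using c1(3) c2(3) x by simp
      qed (use c1 c2 x in simp_all)
    qed (simp_all)
  qed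
qed

text \<open>Evaluation on pairs of elements: the left side multiplies in \<open>A\<close> and then
  applies \<zeta>, while the right side applies \<zeta> and \<open>Tb \<zeta>\<close> to the factors
  first. Monicity of fibres identifies \<open>h'\<close> with the value of
  \<open>Tb \<zeta>\<close>.\<close>

lemma mor_mul_iff: "vcomp V \<zeta> (emu A) = vcomp V (emu B) (hcomp V \<zeta> (Tb_cell V one T \<zeta>)) \<longleftrightarrow> mor_mul"
proof -
  let ?T = "Tb_cell V one T \<zeta>"
  define \<Phi> where "\<Phi> = hcomp V \<zeta> ?T"
  have mT: "A.mcell ?T" by simp
  have Tc: "A.\<phi> B.a (FF \<cdot> x, F \<cdot> y) \<cdot> (cmap ?T (x, y) \<cdot> g) = A.TA Z \<cdot> (A.\<phi> A.a (x, y) \<cdot> g)"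
    if "x \<in> A.Pts (A.Pts A.X)" "y \<in> A.Pts A.X" "g \<in> Arr V" "Cod V g = A.Tf A.a (x, y)" for x y g
    using A.Tb_cell_cmap[of \<zeta> x y g] that by simp
  have Tt: "cmap ?T (x, y) \<in> Arr V" "Dom V (cmap ?T (x, y)) = A.Tf A.a (x, y)" "Cod V (cmap ?T (x, y)) = A.Tf B.a (FF \<cdot> x, F \<cdot> y)"
    if "x \<in> A.Pts (A.Pts A.X)" "y \<in> A.Pts A.X" for x y
    using A.mcellD(7-9)[OF mT, of x y] that by simp_all
  have *: "y \<in> mtgt (cdom ?T) \<Longrightarrow> cleft \<zeta> y = cright ?T y" for y by simp
  have m\<Phi>: "A.mcell \<Phi>" unfolding \<Phi>_def by (rule A.mcell_hcomp[OF _ _ _ _ *]) simp_all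
  have d [simp]: "cdom \<Phi> = mcomp V A.a (A.Tm A.a)" "ccod \<Phi> = mcomp V B.a (A.Tm B.a)" "x \<in> A.Pts (A.Pts A.X) \<Longrightarrow> cleft \<Phi> x = FF \<cdot> x" "y \<in> A.X \<Longrightarrow> cright \<Phi> y = f y" for x y
    by (simp_all add: \<Phi>_def)
  have \<Phi>2: "cmap \<Phi> (x, z) \<cdot> (mincl V A.a (A.Tm A.a) x y z \<cdot> pair V g e) = mincl V B.a (A.Tm B.a) (FF \<cdot> x) (F \<cdot> y) (f z) \<cdot> pair V (cmap \<zeta> (y, z) \<cdot> g) (cmap ?T (x, y) \<cdot> e)"
    if 1: "x \<in> A.Pts (A.Pts A.X)" "y \<in> A.Pts A.X" "z \<in> A.X" "e \<in> Arr V" "g \<in> Arr V" "Dom V g = Dom V e" "Cod V g = ment A.a (y, z)" "Cod V e = A.Tf A.a (x, y)" for x y z e g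
    unfolding \<Phi>_def using A.hcomp_cmap(4)[OF mT _ _ _ *, of x z y g e] 1 by simp
  have m1: "A.mcell (vcomp V \<zeta> (emu A))" by (rule A.mcell_vcomp) simp_all
  have m2: "A.mcell (vcomp V (emu B) \<Phi>)" by (rule A.mcell_vcomp[OF m\<Phi>]) simp_all
  have key1: "cmap (vcomp V \<zeta> (emu A)) (x, z) \<cdot> (mincl V A.a (A.Tm A.a) x y z \<cdot> pair V g h) = cmap \<zeta> (A.Mb A.X x, z) \<cdot> A.mul x y z g h"
    and key2: "cmap (vcomp V (emu B) \<Phi>) (x, z) \<cdot> (mincl V A.a (A.Tm A.a) x y z \<cdot> pair V g h) = B.mul (FF \<cdot> x) (F \<cdot> y) (f z) (cmap \<zeta> (y, z) \<cdot> g) (cmap ?T (x, y) \<cdot> h)"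
    if 1: "x \<in> A.Pts (A.Pts A.X)" "y \<in> A.Pts A.X" "z \<in> A.X" "g \<in> Arr V" "h \<in> Arr V" "Dom V g = Dom V h" "Cod V g = ment A.a (y, z)" "Cod V h = A.Tf A.a (x, y)" for x y z g h
  proof -
    show "cmap (vcomp V \<zeta> (emu A)) (x, z) \<cdot> (mincl V A.a (A.Tm A.a) x y z \<cdot> pair V g h) = cmap \<zeta> (A.Mb A.X x, z) \<cdot> A.mul x y z g h"
      using 1 by (simp add: A.mul_def)
    let ?e = "mincl V A.a (A.Tm A.a) x y z \<cdot> pair V g h"
    have e: "?e \<in> Arr V" "Dom V ?e = Dom V h" "Cod V ?e = ment (mcomp V A.a (A.Tm A.a)) (x, z)" using 1 by simp_all
    have t: "cmap \<Phi> (x, z) \<in> Arr V" "Dom V (cmap \<Phi> (x, z)) = ment (mcomp V A.a (A.Tm A.a)) (x, z)" "Cod V (cmap \<Phi> (x, z)) = ment (mcomp V B.a (A.Tm B.a)) (FF \<cdot> x, f z)"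
      using 1 A.mcellD(7-9)[OF m\<Phi>, of x z] by simp_all
    have "cmap (vcomp V (emu B) \<Phi>) (x, z) \<cdot> ?e = (cmap (emu B) (FF \<cdot> x, f z) \<cdot> cmap \<Phi> (x, z)) \<cdot> ?e" using 1 by simp
    also have "\<dots> = cmap (emu B) (FF \<cdot> x, f z) \<cdot> (cmap \<Phi> (x, z) \<cdot> ?e)" by (rule A.assoc_right) (use 1 e t in simp_all)
    also have "cmap \<Phi> (x, z) \<cdot> ?e = mincl V B.a (A.Tm B.a) (FF \<cdot> x) (F \<cdot> y) (f z) \<cdot> pair V (cmap \<zeta> (y, z) \<cdot> g) (cmap ?T (x, y) \<cdot> h)"
      by (rule \<Phi>2) (use 1 in simp_all)
    finally show "cmap (vcomp V (emu B) \<Phi>) (x, z) \<cdot> ?e = B.mul (FF \<cdot> x) (F \<cdot> y) (f z) (cmap \<zeta> (y, z) \<cdot> g) (cmap ?T (x, y) \<cdot> h)" by (simp add: B.mul_def)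
  qed
  show ?thesis unfolding \<Phi>_def[symmetric]
  proof
    assume eq: "vcomp V \<zeta> (emu A) = vcomp V (emu B) \<Phi>"
    show mor_mul unfolding mor_mul_def
    proof (intro ballI allI impI)
      fix x y z g h h' assume 1: "x \<in> A.Pts (A.Pts A.X)" "y \<in> A.Pts A.X" "z \<in> A.X" "g \<in> Arr V" "h \<in> Arr V" "h' \<in> Arr V" "Dom V g = Dom V h" "Dom V h' = Dom V h"
        "Cod V g = ment A.a (y, z)" "Cod V h = A.Tf A.a (x, y)" "Cod V h' = A.Tf B.a (FF \<cdot> x, F \<cdot> y)" and e: "A.\<phi> B.a (FF \<cdot> x, F \<cdot> y) \<cdot> h' = A.TA Z \<cdot> (A.\<phi> A.a (x, y) \<cdot> h)"
      have h': "h' = cmap ?T (x, y) \<cdot> h"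
        by (rule A.fib_mono[of "T_span T (A.sm B.a)" "FF \<cdot> x" "F \<cdot> y"]) (use 1 e Tc[of x y h] Tt[of x y] in simp_all)
      show "cmap \<zeta> (A.Mb A.X x, z) \<cdot> A.mul x y z g h = B.mul (FF \<cdot> x) (F \<cdot> y) (f z) (cmap \<zeta> (y, z) \<cdot> g) h'"
        unfolding h' key1[OF 1(1-5,7,9,10), symmetric] key2[OF 1(1-5,7,9,10), symmetric] eq ..
    qed
  next
    assume mm: mor_mul
    show "vcomp V \<zeta> (emu A) = vcomp V (emu B) \<Phi>"
    proof (rule A.mcell_eqI[OF m1 m2])
      fix x assume "x \<in> msrc (cdom (vcomp V (emu B) \<Phi>))"
      then have x: "x \<in> A.Pts (A.Pts A.X)" by simp
      show "cleft (vcomp V \<zeta> (emu A)) x = cleft (vcomp V (emu B) \<Phi>) x" using x Mb_FF[OF x] by simp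
    next
      fix x z assume "x \<in> msrc (cdom (vcomp V (emu B) \<Phi>))" "z \<in> mtgt (cdom (vcomp V (emu B) \<Phi>))"
      then have x: "x \<in> A.Pts (A.Pts A.X)" "z \<in> A.X" by simp_all
      note c1 = A.mcellD(7-9)[OF m1, of x z] and c2 = A.mcellD(7-9)[OF m2, of x z]
      show "cmap (vcomp V \<zeta> (emu A)) (x, z) = cmap (vcomp V (emu B) \<Phi>) (x, z)"
      proof (rule A.mcomp_eqI[of "A.Tm A.a" A.a x z])
        fix y h g assume 1: "y \<in> mtgt (A.Tm A.a)" "g \<in> Arr V" "h \<in> Arr V" "Dom V g = Dom V h" "Cod V g = ment A.a (y, z)" "Cod V h = ment (A.Tm A.a) (x, y)"
        then have y: "y \<in> A.Pts A.X" by simp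
        have h: "Cod V h = A.Tf A.a (x, y)" using 1(6) x y by simp
        have h': "cmap ?T (x, y) \<cdot> h \<in> Arr V" "Dom V (cmap ?T (x, y) \<cdot> h) = Dom V h" "Cod V (cmap ?T (x, y) \<cdot> h) = A.Tf B.a (FF \<cdot> x, F \<cdot> y)"
          using Tt[OF x(1) y] 1(3) h by simp_all
        show "cmap (vcomp V \<zeta> (emu A)) (x, z) \<cdot> (mincl V A.a (A.Tm A.a) x y z \<cdot> pair V g h) = cmap (vcomp V (emu B) \<Phi>) (x, z) \<cdot> (mincl V A.a (A.Tm A.a) x y z \<cdot> pair V g h)"
          unfolding key1[OF x(1) y x(2) 1(2-5) h] key2[OF x(1) y x(2) 1(2-5) h]
          by (rule mm[unfolded mor_mul_def, rule_format, OF x(1) y x(2) 1(2,3) h'(1) 1(4) h'(2) 1(5) h h'(3) Tc[OF x(1) y 1(3) h]])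
      next
        show "Cod V (cmap (vcomp V \<zeta> (emu A)) (x, z)) = Cod V (cmap (vcomp V (emu B) \<Phi>) (x, z))"
          using c1(3) c2(3) x Mb_FF[OF x(1)] by simp
      qed (use c1 c2 x in simp_all)
    qed simp_all
  qed
qed

lemma is_ecat_mor_iff: "is_ecat_mor small V one T A B f \<zeta> \<longleftrightarrow> mor_unit \<and> mor_mul"
  unfolding is_ecat_mor_def mor_unit_iff[symmetric] mor_mul_iff[symmetric] by simp

text \<open>Existence of the element over which \<open>mor_mul\<close> quantifies, so that the
  condition can be applied to any given pair of elements.\<close>

lemma Tb_cell_phi:
  assumes "x \<in> A.Pts (A.Pts A.X)" "y \<in> A.Pts A.X" "h \<in> Arr V" "Cod V h = A.Tf A.a (x, y)"
  obtains h' where "h' \<in> Arr V" "Dom V h' = Dom V h" "Cod V h' = A.Tf B.a (FF \<cdot> x, F \<cdot> y)" "A.\<phi> B.a (FF \<cdot> x, F \<cdot> y) \<cdot> h' = A.TA Z \<cdot> (A.\<phi> A.a (x, y) \<cdot> h)"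
proof (rule that[of "cmap (Tb_cell V one T \<zeta>) (x, y) \<cdot> h"])
  have mT: "A.mcell (Tb_cell V one T \<zeta>)" by simp
  show "cmap (Tb_cell V one T \<zeta>) (x, y) \<cdot> h \<in> Arr V" "Dom V (cmap (Tb_cell V one T \<zeta>) (x, y) \<cdot> h) = Dom V h" "Cod V (cmap (Tb_cell V one T \<zeta>) (x, y) \<cdot> h) = A.Tf B.a (FF \<cdot> x, F \<cdot> y)"
    using A.mcellD(7-9)[OF mT, of x y] assms by simp_all
  show "A.\<phi> B.a (FF \<cdot> x, F \<cdot> y) \<cdot> (cmap (Tb_cell V one T \<zeta>) (x, y) \<cdot> h) = A.TA Z \<cdot> (A.\<phi> A.a (x, y) \<cdot> h)"
    using A.Tb_cell_cmap[of \<zeta> x y h] assms by simp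
qed

lemma L_Z: "B.L \<cdot> Z = F \<cdot> A.L"
  by (rule A.mtot_eqI[of A.a]) simp_all

lemma R_Z: "B.R \<cdot> Z = f1 \<cdot> A.R"
  by (rule A.mtot_eqI[of A.a]) simp_all

text \<open>Compatibility with the legs holds summand by summand for any 2-cell with these
  boundaries. The unit is tested on points of the copower, and the multiplication on the pieces of
  composable pairs, where it is the condition \<open>mor_mul\<close>.\<close>

lemma is_icat_mor_star:
  assumes mor_unit mor_mul
  shows "is_icat_mor V T (star_ecat V one T A) (star_ecat V one T B) f1 Z"
proof -
  have un: "Z \<cdot> A.ups = B.ups \<cdot> f1"
  proof (rule A.copow_eqI[of A.X])
    fix x assume x: "x \<in> A.X"
    then show "(Z \<cdot> A.ups) \<cdot> copow_incl V one A.X x = (B.ups \<cdot> f1) \<cdot> copow_incl V one A.X x"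
      using assms(1) unfolding mor_unit_def by simp
  qed simp_all
  let ?p1 = "pb1 V A.L (A.TA A.R)" and ?p2 = "pb2 V A.L (A.TA A.R)"
  have pc: "A.L \<cdot> ?p1 = A.TA A.R \<cdot> ?p2" by (rule A.pb_commute) simp_all
  have TRZ: "A.TA B.R \<cdot> A.TA Z = F \<cdot> A.TA A.R" by (rule A.T_commute[OF R_Z]) simp_all
  have "B.L \<cdot> (Z \<cdot> ?p1) = F \<cdot> (A.L \<cdot> ?p1)" by (rule A.Cmp_extend[OF L_Z]) simp_all
  also have "\<dots> = F \<cdot> (A.TA A.R \<cdot> ?p2)" unfolding pc ..
  also have "\<dots> = A.TA B.R \<cdot> (A.TA Z \<cdot> ?p2)" by (rule A.Cmp_extend[OF TRZ[symmetric]]) simp_all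
  finally have com: "B.L \<cdot> (Z \<cdot> ?p1) = A.TA B.R \<cdot> (A.TA Z \<cdot> ?p2)" .
  let ?Q = "pb_pair V B.L (A.TA B.R) (Z \<cdot> ?p1) (A.TA Z \<cdot> ?p2)"
  have Q: "?Q \<in> Arr V" "Dom V ?Q = pb V A.L (A.TA A.R)" "Cod V ?Q = pb V B.L (A.TA B.R)" using com by simp_all
  have mu: "Z \<cdot> A.M = B.M \<cdot> ?Q"
  proof (rule A.star_X2_eqI)
    fix x y z g h assume 1: "x \<in> A.Pts (A.Pts A.X)" "y \<in> A.Pts A.X" "z \<in> A.X" "g \<in> Arr V" "h \<in> Arr V" "Dom V g = Dom V h" "Cod V g = ment A.a (y, z)" "Cod V h = A.Tf A.a (x, y)"
    let ?P = "pb_pair V A.L (A.TA A.R) (mtot_incl V A.a (y, z) \<cdot> g) (A.\<phi> A.a (x, y) \<cdot> h)"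
    have P: "?P \<in> Arr V" "Dom V ?P = Dom V h" "Cod V ?P = pb V A.L (A.TA A.R)" using 1 by simp_all
    obtain h' where h': "h' \<in> Arr V" "Dom V h' = Dom V h" "Cod V h' = A.Tf B.a (FF \<cdot> x, F \<cdot> y)" "A.\<phi> B.a (FF \<cdot> x, F \<cdot> y) \<cdot> h' = A.TA Z \<cdot> (A.\<phi> A.a (x, y) \<cdot> h)"
      using Tb_cell_phi[OF 1(1,2,5,8)] .
    have "(Z \<cdot> A.M) \<cdot> ?P = Z \<cdot> (A.nu \<cdot> (inv_arr V (star_X2_map V one T A) \<cdot> ?P))" using P by simp
    also have "\<dots> = Z \<cdot> (mtot_incl V A.a (A.Mb A.X x, z) \<cdot> A.mul x y z g h)" unfolding A.imu_pair[OF 1] ..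
    also have "\<dots> = mtot_incl V B.a (F \<cdot> A.Mb A.X x, f z) \<cdot> (cmap \<zeta> (A.Mb A.X x, z) \<cdot> A.mul x y z g h)" using 1 by simp
    also have "cmap \<zeta> (A.Mb A.X x, z) \<cdot> A.mul x y z g h = B.mul (FF \<cdot> x) (F \<cdot> y) (f z) (cmap \<zeta> (y, z) \<cdot> g) h'"
      by (rule assms(2)[unfolded mor_mul_def, rule_format]) (use 1 h' in simp_all)
    finally have l: "(Z \<cdot> A.M) \<cdot> ?P = mtot_incl V B.a (A.Mb B.X (FF \<cdot> x), f z) \<cdot> B.mul (FF \<cdot> x) (F \<cdot> y) (f z) (cmap \<zeta> (y, z) \<cdot> g) h'" unfolding Mb_FF[OF 1(1)] .
    have "?Q \<cdot> ?P = pb_pair V B.L (A.TA B.R) ((Z \<cdot> ?p1) \<cdot> ?P) ((A.TA Z \<cdot> ?p2) \<cdot> ?P)"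
      by (rule A.pb_pair_Cmp[OF _ _ _ _ _ _ _ _ com]) (use P in simp_all)
    also have "(Z \<cdot> ?p1) \<cdot> ?P = mtot_incl V B.a (F \<cdot> y, f z) \<cdot> (cmap \<zeta> (y, z) \<cdot> g)" using 1 by simp
    also have "(A.TA Z \<cdot> ?p2) \<cdot> ?P = A.\<phi> B.a (FF \<cdot> x, F \<cdot> y) \<cdot> h'" unfolding h'(4) using 1 by simp
    finally have q: "?Q \<cdot> ?P = pb_pair V B.L (A.TA B.R) (mtot_incl V B.a (F \<cdot> y, f z) \<cdot> (cmap \<zeta> (y, z) \<cdot> g)) (A.\<phi> B.a (FF \<cdot> x, F \<cdot> y) \<cdot> h')" .
    have "(B.M \<cdot> ?Q) \<cdot> ?P = B.nu \<cdot> (inv_arr V (star_X2_map V one T B) \<cdot> (?Q \<cdot> ?P))" using P Q by simp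
    also have "\<dots> = mtot_incl V B.a (A.Mb B.X (FF \<cdot> x), f z) \<cdot> B.mul (FF \<cdot> x) (F \<cdot> y) (f z) (cmap \<zeta> (y, z) \<cdot> g) h'"
      unfolding q by (rule B.imu_pair) (use 1 h'(1-3) in simp_all)
    finally show "(Z \<cdot> A.M) \<cdot> ?P = (B.M \<cdot> ?Q) \<cdot> ?P" using l by simp
  qed (use Q in simp_all)
  show ?thesis unfolding is_icat_mor_def A.star_ecat_simps B.star_ecat_simps using L_Z R_Z un mu by (simp del: A.assoc_right)
qed

end

section \<open>Identities and composites of enriched morphisms\<close>

context star_points
begin

lemma pre_ecat_mor_if_is_ecat_mor:
  "\<lbrakk>is_ecat small V one T A; is_ecat small V one T B; is_ecat_mor small V one T A B f \<zeta>\<rbrakk> \<Longrightarrow> pre_ecat_mor small V one T A B f \<zeta>"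
  using pre_ecat_if_is_ecat[of A] pre_ecat_if_is_ecat[of B]
  by (simp add: pre_ecat_mor_def pre_ecat_mor_axioms_def is_ecat_mor_def)

lemma star_cell_mcid: "is_mat small V p \<Longrightarrow> smap (star_cell V one (mcid V p)) = Ident V (mtot V p)"
  by (rule mtot_eqI[of p]) simp_all

lemma star_cell_vcomp: "\<lbrakk>mcell \<Phi>; mcell \<Psi>; ccod \<Phi> = cdom \<Psi>\<rbrakk> \<Longrightarrow> smap (star_cell V one (vcomp V \<Psi> \<Phi>)) = smap (star_cell V one \<Psi>) \<cdot> smap (star_cell V one \<Phi>)"
  by (rule mtot_eqI[of "cdom \<Phi>"]) simp_all

lemma copow_map_compose:
  assumes "small X" "small Y" "small W" "f \<in> X \<rightarrow>\<^sub>E Y" "g \<in> Y \<rightarrow>\<^sub>E W"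
  shows "copow_map V one X W (compose X g f) = copow_map V one Y W g \<cdot> copow_map V one X Y f"
proof (rule copow_eqI[of X])
  have "compose X g f \<in> X \<rightarrow>\<^sub>E W" using assms by (auto simp: compose_def)
  note [simp] = this assms
  show "copow_map V one X W (compose X g f) \<in> Arr V" "copow_map V one Y W g \<cdot> copow_map V one X Y f \<in> Arr V" "Dom V (copow_map V one X W (compose X g f)) = copow V one X"
   "Dom V (copow_map V one Y W g \<cdot> copow_map V one X Y f) = copow V one X" "Cod V (copow_map V one X W (compose X g f)) = Cod V (copow_map V one Y W g \<cdot> copow_map V one X Y f)"
    by simp_all
  fix x assume x: "x \<in> X"
  then have "f x \<in> Y" using PiE_mem[OF assms(4)] by simp
  then show "copow_map V one X W (compose X g f) \<cdot> copow_incl V one X x = (copow_map V one Y W g \<cdot> copow_map V one X Y f) \<cdot> copow_incl V one X x"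
    using x by (simp add: compose_eq)
qed (use assms in simp)

lemma Tb_fun_id: "small X \<Longrightarrow> Tb_fun V one T X X (\<lambda>x\<in>X. x) = (\<lambda>x\<in>Pts X. x)"
  by (rule ext) (simp add: Tb_fun_def pts_map_def)

lemma Tb_fun_compose:
  assumes "small X" "small Y" "small W" "f \<in> X \<rightarrow>\<^sub>E Y" "g \<in> Y \<rightarrow>\<^sub>E W"
  shows "Tb_fun V one T X W (compose X g f) = compose (Pts X) (Tb_fun V one T Y W g) (Tb_fun V one T X Y f)"
proof (rule ext)
  have c: "compose X g f \<in> X \<rightarrow>\<^sub>E W" using assms by (auto simp: compose_def)
  fix x
  show "Tb_fun V one T X W (compose X g f) x = compose (Pts X) (Tb_fun V one T Y W g) (Tb_fun V one T X Y f) x"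
  proof (cases "x \<in> Pts X")
    case True
    then show ?thesis using assms c by (simp add: compose_eq copow_map_compose[OF assms])
  next
    case False
    then show ?thesis using assms c by (auto simp: Tb_fun_def pts_map_def compose_def)
  qed
qed

lemma vcomp_assoc:
  assumes "mcell \<Phi>" "mcell \<Psi>" "mcell \<Theta>" "ccod \<Phi> = cdom \<Psi>" "ccod \<Psi> = cdom \<Theta>"
  shows "vcomp V \<Theta> (vcomp V \<Psi> \<Phi>) = vcomp V (vcomp V \<Theta> \<Psi>) \<Phi>"
  by (rule mcell_eqI) (use assms in simp_all)

lemma vcomp_mcid_right: "mcell \<Phi> \<Longrightarrow> vcomp V \<Phi> (mcid V (cdom \<Phi>)) = \<Phi>"
  by (rule mcell_eqI) simp_all

lemma vcomp_mcid_left: "mcell \<Phi> \<Longrightarrow> vcomp V (mcid V (ccod \<Phi>)) \<Phi> = \<Phi>"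
  by (rule mcell_eqI) simp_all

lemma mcid_fields: "cleft (mcid V p) = (\<lambda>x\<in>msrc p. x)" "cright (mcid V p) = (\<lambda>y\<in>mtgt p. y)"
  by (simp_all add: mcid_def)

lemma vcomp_fields: "cleft (vcomp V \<Psi> \<Phi>) = compose (msrc (cdom \<Phi>)) (cleft \<Psi>) (cleft \<Phi>)" "cright (vcomp V \<Psi> \<Phi>) = compose (mtgt (cdom \<Phi>)) (cright \<Psi>) (cright \<Phi>)"
  by (simp_all add: vcomp_def)

lemma is_ecat_mor_id:
  assumes "is_ecat small V one T A"
  shows "is_ecat_mor small V one T A A (idf (eX A)) (mcid V (ea A))"
proof -
  interpret A: pre_ecat small V one T A by (rule pre_ecat_if_is_ecat[OF assms])
  interpret m: pre_ecat_mor small V one T A A "idf (eX A)" "mcid V (ea A)"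
    by unfold_locales (simp_all add: Tb_fun_id mcid_fields)
  have Z: "m.Z = Ident V (mtot V A.a)" by (simp add: star_cell_mcid)
  have F: "m.F = Ident V (TO (copow V one A.X))" by simp
  have FF: "m.FF = Ident V (TO (copow V one (Pts A.X)))" by (simp add: Tb_fun_id)
  have m.mor_unit unfolding m.mor_unit_def by simp
  moreover have m.mor_mul unfolding m.mor_mul_def Z F FF
  proof (intro ballI allI impI)
    fix x y z g h h' assume 1: "x \<in> Pts (Pts A.X)" "y \<in> Pts A.X" "z \<in> A.X" "g \<in> Arr V" "h \<in> Arr V" "h' \<in> Arr V" "Dom V g = Dom V h" "Dom V h' = Dom V h"
        "Cod V g = ment A.a (y, z)" "Cod V h = Tf A.a (x, y)" "Cod V h' = Tf A.a (Ident V (TO (copow V one (Pts A.X))) \<cdot> x, Ident V (TO (copow V one A.X)) \<cdot> y)"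
      and e: "\<phi> A.a (Ident V (TO (copow V one (Pts A.X))) \<cdot> x, Ident V (TO (copow V one A.X)) \<cdot> y) \<cdot> h' = TA (Ident V (mtot V A.a)) \<cdot> (\<phi> A.a (x, y) \<cdot> h)"
    have "h' = h" by (rule fib_mono[of "T_span T (sm A.a)" x y]) (use 1 e in simp_all)
    then show "cmap (mcid V A.a) (Mb A.X x, z) \<cdot> A.mul x y z g h = A.mul (Ident V (TO (copow V one (Pts A.X))) \<cdot> x) (Ident V (TO (copow V one A.X)) \<cdot> y) ((\<lambda>x\<in>A.X. x) z) (cmap (mcid V A.a) (y, z) \<cdot> g) h'"
      using 1 by simp
  qed
  ultimately show ?thesis by (simp add: m.is_ecat_mor_iff)
qed

text \<open>The elementwise condition is applied once for each factor. The intermediate element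
  \<open>h1\<close> is the value at \<open>h\<close> of \<open>Tb\<close> of the inner 2-cell, and
  that \<open>h'\<close> is the value of \<open>Tb\<close> of the outer 2-cell at \<open>h1\<close>
  follows from functoriality of \<open>T\<close> on apexes.\<close>

lemma is_ecat_mor_comp:
  assumes A: "is_ecat small V one T A" and B: "is_ecat small V one T B" and C: "is_ecat small V one T C"
    and f: "is_ecat_mor small V one T A B f \<zeta>" and g: "is_ecat_mor small V one T B C g \<xi>"
  shows "is_ecat_mor small V one T A C (compose (eX A) g f) (vcomp V \<xi> \<zeta>)"
proof -
  interpret f: pre_ecat_mor small V one T A B f \<zeta> by (rule pre_ecat_mor_if_is_ecat_mor[OF A B f])
  interpret g: pre_ecat_mor small V one T B C g \<xi> by (rule pre_ecat_mor_if_is_ecat_mor[OF B C g])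
  have c: "compose (eX A) g f \<in> eX A \<rightarrow>\<^sub>E eX C" using f.f g.f by (auto simp: compose_def)
  have cl: "cleft (vcomp V \<xi> \<zeta>) = Tb_fun V one T (eX A) (eX C) (compose (eX A) g f)"
    by (simp add: vcomp_fields Tb_fun_compose[of "eX A" "eX B" "eX C"])
  interpret m: pre_ecat_mor small V one T A C "compose (eX A) g f" "vcomp V \<xi> \<zeta>"
    by unfold_locales (use c cl in \<open>simp_all add: vcomp_fields\<close>)
  have Z: "m.Z = g.Z \<cdot> f.Z" by (rule star_cell_vcomp) simp_all
  have F: "m.F = g.F \<cdot> f.F" by (simp add: copow_map_compose[of "eX A" "eX B" "eX C"])
  have FF: "m.FF = g.FF \<cdot> f.FF" by (simp add: Tb_fun_compose[of "eX A" "eX B" "eX C"] copow_map_compose[of "Pts (eX A)" "Pts (eX B)" "Pts (eX C)"])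
  have fg: "f.mor_unit" "f.mor_mul" "g.mor_unit" "g.mor_mul" using f g f.is_ecat_mor_iff g.is_ecat_mor_iff by auto
  have m.mor_unit unfolding m.mor_unit_def
  proof
    fix x assume x: "x \<in> eX A"
    then show "cmap (vcomp V \<xi> \<zeta>) (Eb (eX A) x, x) \<cdot> f.A.un x = g.B.un (compose (eX A) g f x)"
      using fg(1)[unfolded f.mor_unit_def] fg(3)[unfolded g.mor_unit_def] by (simp add: compose_eq)
  qed
  moreover have m.mor_mul unfolding m.mor_mul_def Z F FF
  proof (intro ballI allI impI)
    fix x y z k h h' assume 1: "x \<in> Pts (Pts (eX A))" "y \<in> Pts (eX A)" "z \<in> eX A" "k \<in> Arr V" "h \<in> Arr V" "h' \<in> Arr V" "Dom V k = Dom V h" "Dom V h' = Dom V h"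
        "Cod V k = ment (ea A) (y, z)" "Cod V h = Tf (ea A) (x, y)" "Cod V h' = Tf (ea C) ((g.FF \<cdot> f.FF) \<cdot> x, (g.F \<cdot> f.F) \<cdot> y)"
      and e: "\<phi> (ea C) ((g.FF \<cdot> f.FF) \<cdot> x, (g.F \<cdot> f.F) \<cdot> y) \<cdot> h' = TA (g.Z \<cdot> f.Z) \<cdot> (\<phi> (ea A) (x, y) \<cdot> h)"
    obtain h1 where h1: "h1 \<in> Arr V" "Dom V h1 = Dom V h" "Cod V h1 = Tf (ea B) (f.FF \<cdot> x, f.F \<cdot> y)" "\<phi> (ea B) (f.FF \<cdot> x, f.F \<cdot> y) \<cdot> h1 = TA f.Z \<cdot> (\<phi> (ea A) (x, y) \<cdot> h)"
      using f.Tb_cell_phi[OF 1(1,2,5,10)] .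
    have xy: "f.FF \<cdot> x \<in> Pts (Pts (eX B))" "f.F \<cdot> y \<in> Pts (eX B)" "f z \<in> eX B" "cmap \<zeta> (y, z) \<cdot> k \<in> Arr V" "Dom V (cmap \<zeta> (y, z) \<cdot> k) = Dom V h1"
      "Cod V (cmap \<zeta> (y, z) \<cdot> k) = ment (ea B) (f.F \<cdot> y, f z)" using 1 h1(2) by simp_all
    have e1: "cmap \<zeta> (Mb (eX A) x, z) \<cdot> f.A.mul x y z k h = f.B.mul (f.FF \<cdot> x) (f.F \<cdot> y) (f z) (cmap \<zeta> (y, z) \<cdot> k) h1"
      by (rule fg(2)[unfolded f.mor_mul_def, rule_format]) (use 1 h1 in simp_all)
    have e2: "cmap \<xi> (Mb (eX B) (f.FF \<cdot> x), f z) \<cdot> f.B.mul (f.FF \<cdot> x) (f.F \<cdot> y) (f z) (cmap \<zeta> (y, z) \<cdot> k) h1 = g.B.mul (g.FF \<cdot> (f.FF \<cdot> x)) (g.F \<cdot> (f.F \<cdot> y)) (g (f z)) (cmap \<xi> (f.F \<cdot> y, f z) \<cdot> (cmap \<zeta> (y, z) \<cdot> k)) h'"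
    proof (rule fg(4)[unfolded g.mor_mul_def, rule_format, OF xy(1-4) h1(1) 1(6) xy(5) _ xy(6) h1(3)])
      show "\<phi> (ea C) (g.FF \<cdot> (f.FF \<cdot> x), g.F \<cdot> (f.F \<cdot> y)) \<cdot> h' = TA g.Z \<cdot> (\<phi> (ea B) (f.FF \<cdot> x, f.F \<cdot> y) \<cdot> h1)"
        unfolding h1(4) using e 1 by simp
    qed (use 1 h1(2) in simp_all)
    have "cmap (vcomp V \<xi> \<zeta>) (Mb (eX A) x, z) \<cdot> f.A.mul x y z k h = cmap \<xi> (f.F \<cdot> Mb (eX A) x, f z) \<cdot> (cmap \<zeta> (Mb (eX A) x, z) \<cdot> f.A.mul x y z k h)"
      using 1 by simp
    also have "\<dots> = g.B.mul (g.FF \<cdot> (f.FF \<cdot> x)) (g.F \<cdot> (f.F \<cdot> y)) (g (f z)) (cmap \<xi> (f.F \<cdot> y, f z) \<cdot> (cmap \<zeta> (y, z) \<cdot> k)) h'"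
      unfolding e1 e2[unfolded f.Mb_FF[OF 1(1)]] ..
    finally show "cmap (vcomp V \<xi> \<zeta>) (Mb (eX A) x, z) \<cdot> f.A.mul x y z k h = g.B.mul ((g.FF \<cdot> f.FF) \<cdot> x) ((g.F \<cdot> f.F) \<cdot> y) (compose (eX A) g f z) (cmap (vcomp V \<xi> \<zeta>) (y, z) \<cdot> k) h'"
      using 1 by (simp add: compose_eq)
  qed
  ultimately show ?thesis by (simp add: m.is_ecat_mor_iff)
qed

end

section \<open>Internal categories on elements\<close>

locale icat = star_points small V one T
  for small :: "'a set \<Rightarrow> bool" and V :: "('o, 'a) cat" (structure) and one :: 'o and T :: "('o, 'a) monad_data" +
  fixes S :: "('o, 'a) icat"
  assumes icat: "is_icat V T S"
begin

abbreviation "Y \<equiv> iX0 S"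
abbreviation "Y1 \<equiv> iX1 S"
abbreviation "ipr1 \<equiv> pb1 V (il S) (amap (endo T) (ir S))"
abbreviation "ipr2 \<equiv> pb2 V (il S) (amap (endo T) (ir S))"
abbreviation "ipair \<equiv> pb_pair V (il S) (amap (endo T) (ir S))"

lemma icat_simps [simp]:
  "Y \<in> Obj V" "Y1 \<in> Obj V" "il S \<in> Arr V" "Dom V (il S) = Y1" "Cod V (il S) = TO Y" "ir S \<in> Arr V" "Dom V (ir S) = Y1" "Cod V (ir S) = Y"
  "iun S \<in> Arr V" "Dom V (iun S) = Y" "Cod V (iun S) = Y1" "imu S \<in> Arr V" "Dom V (imu S) = pb V (il S) (TA (ir S))" "Cod V (imu S) = Y1"
  using icat by (simp_all add: is_icat_def)

lemma icat_laws:
  "il S \<cdot> iun S = unit T Y" "ir S \<cdot> iun S = Ident V Y"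
  "il S \<cdot> imu S = mult T Y \<cdot> (TA (il S) \<cdot> ipr2)" "ir S \<cdot> imu S = ir S \<cdot> ipr1"
  "imu S \<cdot> ipair (iun S \<cdot> ir S) (unit T Y1) = Ident V Y1"
  "imu S \<cdot> ipair (Ident V Y1) (TA (iun S) \<cdot> il S) = Ident V Y1"
  "imu S \<cdot> ipair (imu S \<cdot> pb1 V ipr2 (TA ipr1)) (mult T Y1 \<cdot> (TA ipr2 \<cdot> pb2 V ipr2 (TA ipr1))) = imu S \<cdot> ipair (ipr1 \<cdot> pb1 V ipr2 (TA ipr1)) (TA (imu S) \<cdot> pb2 V ipr2 (TA ipr1))"
  using icat unfolding is_icat_def Let_def by blast+

lemma icat_laws_extend [simp]:
  "il S \<cdot> iun S = unit T Y" "ir S \<cdot> iun S = Ident V Y"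
  "k \<in> Arr V \<Longrightarrow> Cod V k = Y \<Longrightarrow> il S \<cdot> (iun S \<cdot> k) = unit T Y \<cdot> k" (is "PROP ?A") "k \<in> Arr V \<Longrightarrow> Cod V k = Y \<Longrightarrow> ir S \<cdot> (iun S \<cdot> k) = k" (is "PROP ?B")
  "il S \<cdot> imu S = mult T Y \<cdot> (TA (il S) \<cdot> ipr2)" (is ?C) "ir S \<cdot> imu S = ir S \<cdot> ipr1" (is ?D)
  "k \<in> Arr V \<Longrightarrow> Cod V k = pb V (il S) (TA (ir S)) \<Longrightarrow> il S \<cdot> (imu S \<cdot> k) = mult T Y \<cdot> (TA (il S) \<cdot> (ipr2 \<cdot> k))" (is "PROP ?E")
  "k \<in> Arr V \<Longrightarrow> Cod V k = pb V (il S) (TA (ir S)) \<Longrightarrow> ir S \<cdot> (imu S \<cdot> k) = ir S \<cdot> (ipr1 \<cdot> k)" (is "PROP ?G")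
  "TA (ir S) \<cdot> TA (iun S) = Ident V (TO Y)" (is ?H) "k \<in> Arr V \<Longrightarrow> Cod V k = TO Y \<Longrightarrow> TA (ir S) \<cdot> (TA (iun S) \<cdot> k) = k" (is "PROP ?I")
  "TA (ir S) \<cdot> TA (imu S) = TA (ir S) \<cdot> TA ipr1" (is ?J)
  "k \<in> Arr V \<Longrightarrow> Cod V k = TO (pb V (il S) (TA (ir S))) \<Longrightarrow> TA (ir S) \<cdot> (TA (imu S) \<cdot> k) = TA (ir S) \<cdot> (TA ipr1 \<cdot> k)" (is "PROP ?K")
proof -
  show "il S \<cdot> iun S = unit T Y" "ir S \<cdot> iun S = Ident V Y" ?C ?D by (rule icat_laws)+
  show "PROP ?A" by (rule Cmp_extend1[OF icat_laws(1)]) simp_all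
  show "PROP ?B" using Cmp_extend1[OF icat_laws(2), of k] by simp
  show "PROP ?E"
    using Cmp_extend1[OF icat_laws(3), of k] by simp
  show "PROP ?G" by (rule Cmp_extend[OF icat_laws(4)]) simp_all
  have 1: ?H using T_commute1[OF icat_laws(2)] by simp
  then show ?H .
  show "PROP ?I" using Cmp_extend1[OF 1, of k] by simp
  have 2: ?J by (rule T_commute[OF icat_laws(4)]) simp_all
  then show ?J .
  show "PROP ?K"
    by (rule Cmp_extend[OF 2]) simp_all
qed

lemma imu_unit_left:
  assumes "h \<in> Arr V" "Cod V h = Y1"
  shows "imu S \<cdot> ipair (iun S \<cdot> (ir S \<cdot> h)) (unit T Y1 \<cdot> h) = h"
proof -
  have "imu S \<cdot> (ipair (iun S \<cdot> ir S) (unit T Y1) \<cdot> h) = Ident V Y1 \<cdot> h"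
    by (rule Cmp_extend1[OF icat_laws(5)]) (use assms in simp_all)
  moreover have "ipair (iun S \<cdot> ir S) (unit T Y1) \<cdot> h = ipair ((iun S \<cdot> ir S) \<cdot> h) (unit T Y1 \<cdot> h)"
    by (rule pb_pair_Cmp) (use assms in simp_all)
  ultimately show ?thesis using assms by simp
qed

lemma imu_unit_right:
  assumes "h \<in> Arr V" "Cod V h = Y1"
  shows "imu S \<cdot> ipair h (TA (iun S) \<cdot> (il S \<cdot> h)) = h"
proof -
  have "imu S \<cdot> (ipair (Ident V Y1) (TA (iun S) \<cdot> il S) \<cdot> h) = Ident V Y1 \<cdot> h"
    by (rule Cmp_extend1[OF icat_laws(6)]) (use assms in simp_all)
  moreover have "ipair (Ident V Y1) (TA (iun S) \<cdot> il S) \<cdot> h = ipair (Ident V Y1 \<cdot> h) ((TA (iun S) \<cdot> il S) \<cdot> h)"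
    by (rule pb_pair_Cmp) (use assms in simp_all)
  ultimately show ?thesis using assms by simp
qed

lemma ipr_commute [simp]:
  "TA (ir S) \<cdot> ipr2 = il S \<cdot> ipr1" (is ?A) "k \<in> Arr V \<Longrightarrow> Cod V k = pb V (il S) (TA (ir S)) \<Longrightarrow> TA (ir S) \<cdot> (ipr2 \<cdot> k) = il S \<cdot> (ipr1 \<cdot> k)" (is "PROP ?B")
  "TA (TA (ir S)) \<cdot> TA ipr2 = TA (il S) \<cdot> TA ipr1" (is ?C) "k \<in> Arr V \<Longrightarrow> Cod V k = TO (pb V (il S) (TA (ir S))) \<Longrightarrow> TA (TA (ir S)) \<cdot> (TA ipr2 \<cdot> k) = TA (il S) \<cdot> (TA ipr1 \<cdot> k)" (is "PROP ?D")
proof -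
  have c: "il S \<cdot> ipr1 = TA (ir S) \<cdot> ipr2" by (rule pb_commute) simp_all
  then show ?A by simp
  show "PROP ?B"
    by (rule Cmp_extend[OF c[symmetric]]) simp_all
  have c2: ?C by (rule T_commute[OF c[symmetric]]) simp_all
  then show ?C .
  show "PROP ?D"
    by (rule Cmp_extend[OF c2]) simp_all
qed

text \<open>The associativity axiom is precomposed with the element of the object of composable
  triples that is given by \<open>h\<close> and \<open>k\<close>.\<close>

lemma imu_assoc:
  assumes hk: "h \<in> Arr V" "Cod V h = pb V (il S) (TA (ir S))" "k \<in> Arr V" "Cod V k = TO (pb V (il S) (TA (ir S)))" "Dom V h = Dom V k"
    and e: "ipr2 \<cdot> h = TA ipr1 \<cdot> k"
  shows "imu S \<cdot> ipair (imu S \<cdot> h) (mult T Y1 \<cdot> (TA ipr2 \<cdot> k)) = imu S \<cdot> ipair (ipr1 \<cdot> h) (TA (imu S) \<cdot> k)"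
proof -
  let ?p = "pb1 V ipr2 (TA ipr1)" and ?q = "pb2 V ipr2 (TA ipr1)"
  let ?u = "pb_pair V ipr2 (TA ipr1) h k"
  have u: "?u \<in> Arr V" "Dom V ?u = Dom V k" "Cod V ?u = pb V ipr2 (TA ipr1)" "?p \<cdot> ?u = h" "?q \<cdot> ?u = k" using hk e by simp_all
  have pq: "ipr2 \<cdot> ?p = TA ipr1 \<cdot> ?q" by (rule pb_commute) simp_all
  have c1: "il S \<cdot> (imu S \<cdot> ?p) = TA (ir S) \<cdot> (mult T Y1 \<cdot> (TA ipr2 \<cdot> ?q))" using pq by simp
  have c2: "il S \<cdot> (ipr1 \<cdot> ?p) = TA (ir S) \<cdot> (TA (imu S) \<cdot> ?q)" using pq ipr_commute(2)[of ?p] by simp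
  have "imu S \<cdot> (ipair (imu S \<cdot> ?p) (mult T Y1 \<cdot> (TA ipr2 \<cdot> ?q)) \<cdot> ?u) = (imu S \<cdot> ipair (ipr1 \<cdot> ?p) (TA (imu S) \<cdot> ?q)) \<cdot> ?u"
    by (rule Cmp_extend1[OF icat_laws(7)]) (use c1 u in simp_all)
  also have "\<dots> = imu S \<cdot> (ipair (ipr1 \<cdot> ?p) (TA (imu S) \<cdot> ?q) \<cdot> ?u)" by (rule assoc_right) (use c2 u in simp_all)
  also have "ipair (ipr1 \<cdot> ?p) (TA (imu S) \<cdot> ?q) \<cdot> ?u = ipair ((ipr1 \<cdot> ?p) \<cdot> ?u) ((TA (imu S) \<cdot> ?q) \<cdot> ?u)"
    by (rule pb_pair_Cmp[OF _ _ _ _ _ _ _ _ c2]) (use u in simp_all)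
  also have "(ipr1 \<cdot> ?p) \<cdot> ?u = ipr1 \<cdot> (?p \<cdot> ?u)" by (rule assoc_right) (use u(1-3) in simp_all)
  also have "(TA (imu S) \<cdot> ?q) \<cdot> ?u = TA (imu S) \<cdot> (?q \<cdot> ?u)" by (rule assoc_right) (use u(1-3) in simp_all)
  also have "ipair (imu S \<cdot> ?p) (mult T Y1 \<cdot> (TA ipr2 \<cdot> ?q)) \<cdot> ?u = ipair ((imu S \<cdot> ?p) \<cdot> ?u) ((mult T Y1 \<cdot> (TA ipr2 \<cdot> ?q)) \<cdot> ?u)"
    by (rule pb_pair_Cmp[OF _ _ _ _ _ _ _ _ c1]) (use u in simp_all)
  also have "(imu S \<cdot> ?p) \<cdot> ?u = imu S \<cdot> (?p \<cdot> ?u)" by (rule assoc_right) (use u(1-3) in simp_all)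
  also have "(mult T Y1 \<cdot> (TA ipr2 \<cdot> ?q)) \<cdot> ?u = mult T Y1 \<cdot> (TA ipr2 \<cdot> (?q \<cdot> ?u))"
    using u(1-3) by (simp del: pb_pair_cancel)
  finally show ?thesis unfolding u(4,5) .
qed

subsection \<open>The matrix of points\<close>

abbreviation "E \<equiv> TA (eps (iX0 S))"
abbreviation "b \<equiv> icat_span S"
abbreviation "inc x y \<equiv> fbi (icat_span S) (TA (eps (iX0 S)) \<cdot> x, y)"
abbreviation "pX \<equiv> pts V one (iX0 S)"
abbreviation "pm \<equiv> pts_icat_mat V one T S"

lemma icat_span_simps [simp]: "sl b = il S" "sr b = ir S" "is_span V b"
proof -
  show 1: "sl b = il S" "sr b = ir S" by (simp_all add: icat_span_def)
  show "is_span V b" by (subst is_span_def) (simp add: 1)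
qed

lemma left_apply [simp]: "\<lbrakk>x \<in> Arr V; Dom V x = one; Cod V x = TO (cp pX)\<rbrakk> \<Longrightarrow> pts_icat_left V one T S x = E \<cdot> x"
  by (simp add: pts_icat_left_def)

lemma left_PiE: "pts_icat_left V one T S \<in> Pts pX \<rightarrow>\<^sub>E pts V one (TO Y)"
proof (rule PiE_I)
  fix x assume "x \<notin> Pts pX"
  then show "pts_icat_left V one T S x = undefined" by (auto simp: pts_icat_left_def pts_map_def)
qed simp

lemma pm_simps [simp]:
  "msrc pm = Pts pX" "mtgt pm = pX" "\<lbrakk>x \<in> Arr V; Dom V x = one; Cod V x = TO (cp pX); y \<in> Arr V; Dom V y = one; Cod V y = Y\<rbrakk> \<Longrightarrow>
     ment pm (x, y) = fib V b (E \<cdot> x, y)"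
  by (simp_all add: pts_icat_mat_def)

lemma is_mat_pm [simp]: "is_mat small V pm"
  unfolding is_mat_def pm_simps
proof (intro conjI PiE_I)
  fix z assume "z \<in> Pts pX \<times> pX"
  then show "ment pm z \<in> Obj V" by (cases z) simp
next
  fix z assume "z \<notin> Pts pX \<times> pX"
  then show "ment pm z = undefined" by (cases z) (auto simp: pts_icat_mat_def)
qed simp_all

lemma inc_simps [simp]:
  assumes "x \<in> Arr V" "Dom V x = one" "Cod V x = TO (cp pX)" "y \<in> Arr V" "Dom V y = one" "Cod V y = Y"
  shows "il S \<cdot> inc x y = (E \<cdot> x) \<cdot> bng (fib V b (E \<cdot> x, y))" "ir S \<cdot> inc x y = y \<cdot> bng (fib V b (E \<cdot> x, y))"
    "g \<in> Arr V \<Longrightarrow> Cod V g = fib V b (E \<cdot> x, y) \<Longrightarrow> il S \<cdot> (inc x y \<cdot> g) = E \<cdot> (x \<cdot> bng (Dom V g))"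
    "g \<in> Arr V \<Longrightarrow> Cod V g = fib V b (E \<cdot> x, y) \<Longrightarrow> ir S \<cdot> (inc x y \<cdot> g) = y \<cdot> bng (Dom V g)"
  using fib_simps(5,6)[of b "E \<cdot> x" y] fib_simps'[of b "E \<cdot> x" y g] assms by simp_all

abbreviation "restr \<equiv> pts_icat_restr V one T S"

lemma restr_simps [simp]:
  "cdom restr = pm" "ccod restr = psp b" "cleft restr = pts_icat_left V one T S"
  "\<lbrakk>x \<in> Arr V; Dom V x = one; Cod V x = Y\<rbrakk> \<Longrightarrow> cright restr x = x" "cright restr = (\<lambda>y\<in>pX. y)"
  "\<lbrakk>x \<in> Arr V; Dom V x = one; Cod V x = TO (cp pX); y \<in> Arr V; Dom V y = one; Cod V y = Y\<rbrakk> \<Longrightarrow>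
     cmap restr (x, y) = Ident V (fib V b (E \<cdot> x, y))"
  by (simp_all add: pts_icat_restr_def)

lemma mcell_restr [simp]: "mcell restr"
proof (rule mcellI)
  show "cleft restr \<in> extensional (msrc (cdom restr))" using left_PiE by (simp add: PiE_def)
  show "cright restr \<in> extensional (mtgt (cdom restr))" by simp
  show "cmap restr \<in> extensional (msrc (cdom restr) \<times> mtgt (cdom restr))" by (simp add: pts_icat_restr_def)
qed simp_all

text \<open>The component on arrows of the counit at \<open>S\<close>; its component on objects is
  \<open>eps (iX0 S)\<close>.\<close>

definition eps1 :: 'a where
  "eps1 = smap (svcomp V (eps_span V one b) (stc restr))"

lemma eps1_simps [simp]:
  "eps1 \<in> Arr V" "Dom V eps1 = mtot V pm" "Cod V eps1 = Y1"
  "\<lbrakk>x \<in> Arr V; Dom V x = one; Cod V x = TO (cp pX); y \<in> Arr V; Dom V y = one; Cod V y = Y\<rbrakk> \<Longrightarrow>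
     eps1 \<cdot> mti pm (x, y) = inc x y"
  "\<lbrakk>x \<in> Arr V; Dom V x = one; Cod V x = TO (cp pX); y \<in> Arr V; Dom V y = one; Cod V y = Y; g \<in> Arr V; Cod V g = fib V b (E \<cdot> x, y)\<rbrakk> \<Longrightarrow> eps1 \<cdot> (mti pm (x, y) \<cdot> g) = inc x y \<cdot> g"
  by (simp_all add: eps1_def)

text \<open>The left boundary of the counit on arrows, computed in two ways. The second form shows
  it as \<open>T\<close> of the counit on objects after the counit of spans, as in the left leg of
  the associated internal category.\<close>

lemma sleft_eps1: "eps (TO Y) \<cdot> cpm (Pts pX) (pts V one (TO Y)) (pts_icat_left V one T S) = E \<cdot> eps (TO (cp pX))"
  by (rule copow_eqI[of "Pts pX"]) (use left_PiE in auto)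

lemma is_scell_eps1: "is_scell V (svcomp V (eps_span V one b) (stc restr))"
  by (rule is_scell_svcomp[OF is_scell_star_cell[OF mcell_restr] is_scell_eps_span]) simp_all

lemma il_eps1: "il S \<cdot> eps1 = E \<cdot> (eps (TO (cp pX)) \<cdot> sl (sm pm))"
  by (rule mtot_eqI[of pm]) simp_all

lemma ir_eps1: "ir S \<cdot> eps1 = eps Y \<cdot> sr (sm pm)"
  by (rule mtot_eqI[of pm]) simp_all

subsection \<open>Unit and multiplication of the category of points\<close>

abbreviation "P \<equiv> pts_icat V one T S"

lemma factor_simps [simp]:
  "cdom (pts_icat_factor V one T S f \<Phi>) = cdom \<Phi>" "ccod (pts_icat_factor V one T S f \<Phi>) = pm" "cleft (pts_icat_factor V one T S f \<Phi>) = f"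
  "cright (pts_icat_factor V one T S f \<Phi>) = cright \<Phi>" "cmap (pts_icat_factor V one T S f \<Phi>) = cmap \<Phi>"
  by (simp_all add: pts_icat_factor_def)

lemma mcell_factor:
  assumes \<Phi>: "mcell \<Phi>" "ccod \<Phi> = psp b" and f: "f \<in> msrc (cdom \<Phi>) \<rightarrow>\<^sub>E Pts pX"
    and l: "\<And>x. x \<in> msrc (cdom \<Phi>) \<Longrightarrow> cleft \<Phi> x = E \<cdot> f x"
  shows "mcell (pts_icat_factor V one T S f \<Phi>)"
proof (rule mcellI)
  have fm: "f x \<in> Pts pX" if "x \<in> msrc (cdom \<Phi>)" for x using PiE_mem[OF f that] .
  have rm: "cright \<Phi> y \<in> pX" if "y \<in> mtgt (cdom \<Phi>)" for y using mcellD(4)[OF \<Phi>(1) that] \<Phi>(2) by simp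
  show "cleft (pts_icat_factor V one T S f \<Phi>) \<in> extensional (msrc (cdom (pts_icat_factor V one T S f \<Phi>)))" using f by (simp add: PiE_def)
  show "cright (pts_icat_factor V one T S f \<Phi>) \<in> extensional (mtgt (cdom (pts_icat_factor V one T S f \<Phi>)))" using mcellD(6)[OF \<Phi>(1)] by (simp add: PiE_def)
  show "cmap (pts_icat_factor V one T S f \<Phi>) \<in> extensional (msrc (cdom (pts_icat_factor V one T S f \<Phi>)) \<times> mtgt (cdom (pts_icat_factor V one T S f \<Phi>)))"
    using mcell_extensional[OF \<Phi>(1)] by simp
  show "x \<in> msrc (cdom (pts_icat_factor V one T S f \<Phi>)) \<Longrightarrow> cleft (pts_icat_factor V one T S f \<Phi>) x \<in> msrc (ccod (pts_icat_factor V one T S f \<Phi>))" for x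
    using fm by simp
  show "y \<in> mtgt (cdom (pts_icat_factor V one T S f \<Phi>)) \<Longrightarrow> cright (pts_icat_factor V one T S f \<Phi>) y \<in> mtgt (ccod (pts_icat_factor V one T S f \<Phi>))" for y
    using rm by simp
  fix x y assume "x \<in> msrc (cdom (pts_icat_factor V one T S f \<Phi>))" "y \<in> mtgt (cdom (pts_icat_factor V one T S f \<Phi>))"
  then have xy: "x \<in> msrc (cdom \<Phi>)" "y \<in> mtgt (cdom \<Phi>)" by simp_all
  show "cmap (pts_icat_factor V one T S f \<Phi>) (x, y) \<in> Arr V \<and> Dom V (cmap (pts_icat_factor V one T S f \<Phi>) (x, y)) = ment (cdom (pts_icat_factor V one T S f \<Phi>)) (x, y) \<and>
    Cod V (cmap (pts_icat_factor V one T S f \<Phi>) (x, y)) = ment (ccod (pts_icat_factor V one T S f \<Phi>)) (cleft (pts_icat_factor V one T S f \<Phi>) x, cright (pts_icat_factor V one T S f \<Phi>) y)"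
    using mcellD(7-9)[OF \<Phi>(1) xy] l[OF xy(1)] fm[OF xy(1)] rm[OF xy(2)] \<Phi>(2) by simp
qed (use \<Phi> in simp_all)

lemma is_scell_un_cell: "is_scell V (icat_un_cell V T S)"
  unfolding is_scell_def by (simp add: icat_un_cell_def)

lemma is_scell_mu_cell: "is_scell V (icat_mu_cell V T S)"
  unfolding is_scell_def by (simp add: icat_mu_cell_def)

lemma un_cell_simps [simp]:
  "sdom (icat_un_cell V T S) = sunit V Y" "scod (icat_un_cell V T S) = b" "sleft (icat_un_cell V T S) = unit T Y" "sright (icat_un_cell V T S) = Ident V Y" "smap (icat_un_cell V T S) = iun S"
  by (simp_all add: icat_un_cell_def)

lemma mu_cell_simps [simp]:
  "sdom (icat_mu_cell V T S) = scomp V b (T_span T b)" "scod (icat_mu_cell V T S) = b" "sleft (icat_mu_cell V T S) = mult T Y" "sright (icat_mu_cell V T S) = Ident V Y" "smap (icat_mu_cell V T S) = imu S"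
  by (simp_all add: icat_mu_cell_def)

text \<open>The unit cell of the category of points as a cell into \<open>V(1, b)\<close>. Factoring
  it through the restricted matrix changes its codomain and left boundary and keeps the components;
  the same holds for the multiplication \<open>muc\<close>.\<close>

definition unc :: "('o, 'a) mcell" where
  "unc = vcomp V (ptc (icat_un_cell V T S)) (pts_unit V one Y)"

lemma unc_simps [simp]: "mcell unc" "cdom unc = munit V one pX" "ccod unc = psp b" "cright unc = (\<lambda>y\<in>pX. y)"
  "\<lbrakk>x \<in> Arr V; Dom V x = one; Cod V x = Y\<rbrakk> \<Longrightarrow> cleft unc x = unit T Y \<cdot> x"
proof -
  show 1: "mcell unc" unfolding unc_def by (rule mcell_vcomp) (use mcell_pts_cell[OF is_scell_un_cell] in simp_all)
  show 2: "cdom unc = munit V one pX" "ccod unc = psp b" "\<lbrakk>x \<in> Arr V; Dom V x = one; Cod V x = Y\<rbrakk> \<Longrightarrow> cleft unc x = unit T Y \<cdot> x" for x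
    by (simp_all add: unc_def)
  show "cright unc = (\<lambda>y\<in>pX. y)"
  proof (rule extensionalityI[of _ pX])
    show "cright unc \<in> extensional pX" using mcellD(6)[OF 1] 2 by (simp add: PiE_def)
  qed (simp_all add: unc_def)
qed

lemma unc_cmap:
  assumes x: "x \<in> Arr V" "Dom V x = one" "Cod V x = Y"
  shows "fbi b (unit T Y \<cdot> x, x) \<cdot> (cmap unc (x, x) \<cdot> cpi {()} ()) = iun S \<cdot> x"
proof -
  note c = pts_cell_cmap[OF is_scell_un_cell, of x x]
  let ?k = "cmap (pts_unit V one Y) (x, x) \<cdot> cpi {()} ()"
  note u = pts_unit_cmap[of Y x x]
  have "fbi b (unit T Y \<cdot> x, Ident V Y \<cdot> x) \<cdot> (cmap (ptc (icat_un_cell V T S)) (x, x) \<cdot> ?k) = (iun S \<cdot> fbi (sunit V Y) (x, x)) \<cdot> ?k"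
    by (rule Cmp_extend1) (use c u x in simp_all)
  then show ?thesis using x c u pts_unit_cmap_same(1)[of Y x] by (simp add: unc_def)
qed

definition muc :: "('o, 'a) mcell" where
  "muc = vcomp V (ptc (icat_mu_cell V T S)) (vcomp V (pts_comp V one b (T_span T b)) (hcomp V restr (pts_icat_T_restr V one T S)))"

abbreviation "TX \<equiv> pts_icat_T_restr V one T S"

lemma TX_simps:
  shows "mcell TX" "cdom TX = Tm pm" "ccod TX = psp (T_span T b)"
    "x \<in> Pts (Pts pX) \<Longrightarrow> cleft TX x = TA E \<cdot> (TA (eps (TO (cp pX))) \<cdot> x)" (is "PROP ?A") "y \<in> Pts pX \<Longrightarrow> cright TX y = E \<cdot> y" (is "PROP ?B")
    "\<lbrakk>x \<in> Pts (Pts pX); y \<in> Pts pX; g \<in> Arr V; Cod V g = Tf pm (x, y)\<rbrakk> \<Longrightarrow>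
      fbi (T_span T b) (TA E \<cdot> (TA (eps (TO (cp pX))) \<cdot> x), E \<cdot> y) \<cdot> (cmap TX (x, y) \<cdot> g) = TA eps1 \<cdot> (\<phi> pm (x, y) \<cdot> g)"
proof -
  let ?X = "svcomp V (eps_span V one b) (stc restr)"
  let ?C = "T_cell T ?X"
  have C: "is_scell V ?C" by (rule is_scell_T_cell[OF is_scell_eps1])
  show m: "mcell TX" unfolding pts_icat_T_restr_def by (rule mcell_pts_cell[OF C])
  show "cdom TX = Tm pm" "ccod TX = psp (T_span T b)" by (simp_all add: pts_icat_T_restr_def)
  have sl: "sleft ?X = E \<cdot> eps (TO (cp pX))" and sr: "sright ?X = eps Y" and smp: "smap ?X = eps1"
    using sleft_eps1 by (simp_all add: eps1_def)
  have lr: "sleft ?C = TA E \<cdot> TA (eps (TO (cp pX)))" "sright ?C = E" "smap ?C = TA eps1"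
    unfolding T_cell_simps sl sr smp by simp_all
  have dd: "sdom ?C = T_span T (sm pm)" "scod ?C = T_span T b" by simp_all
  show "PROP ?A" "PROP ?B"
    unfolding pts_icat_T_restr_def pts_cell_simps lr by simp_all
  assume 1: "x \<in> Pts (Pts pX)" "y \<in> Pts pX" "g \<in> Arr V" "Cod V g = Tf pm (x, y)"
  note c = pts_cell_cmap[OF C, of x y, unfolded lr dd]
  have "fbi (T_span T b) ((TA E \<cdot> TA (eps (TO (cp pX)))) \<cdot> x, E \<cdot> y) \<cdot> (cmap TX (x, y) \<cdot> g) = (TA eps1 \<cdot> \<phi> pm (x, y)) \<cdot> g"
    unfolding pts_icat_T_restr_def by (rule Cmp_extend1[OF c(4)]) (use c(1-3) 1 in simp_all)
  then show "fbi (T_span T b) (TA E \<cdot> (TA (eps (TO (cp pX))) \<cdot> x), E \<cdot> y) \<cdot> (cmap TX (x, y) \<cdot> g) = TA eps1 \<cdot> (\<phi> pm (x, y) \<cdot> g)"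
    using 1 by simp
qed

text \<open>The last clause follows a pair of elements through the restriction, the lax comparison
  of \<open>V(1, -)\<close> and the multiplication of \<open>S\<close>. After the fibre inclusion,
  only the multiplication of \<open>S\<close> on the images of the two elements under the counit
  remains.\<close>

lemma muc_simps:
  shows "mcell muc" "cdom muc = mcomp V pm (Tm pm)" "ccod muc = psp b" "cright muc = (\<lambda>y\<in>pX. y)"
    "x \<in> Pts (Pts pX) \<Longrightarrow> cleft muc x = E \<cdot> Mb pX x"
    "\<lbrakk>x \<in> Pts (Pts pX); y \<in> Pts pX; z \<in> pX; g \<in> Arr V; h \<in> Arr V; Dom V g = Dom V h; Cod V g = fib V b (E \<cdot> y, z); Cod V h = Tf pm (x, y)\<rbrakk> \<Longrightarrow>
      inc (Mb pX x) z \<cdot> (cmap muc (x, z) \<cdot> (mci pm (Tm pm) x y z \<cdot> pair V g h)) = imu S \<cdot> ipair (inc y z \<cdot> g) (TA eps1 \<cdot> (\<phi> pm (x, y) \<cdot> h))"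
proof -
  let ?H = "hcomp V restr TX" and ?Q = "pts_comp V one b (T_span T b)" and ?N = "ptc (icat_mu_cell V T S)"
  have *: "y \<in> mtgt (cdom TX) \<Longrightarrow> cleft restr y = cright TX y" for y using TX_simps by simp
  have mH: "mcell ?H" by (rule mcell_hcomp[OF _ _ _ _ *]) (use TX_simps in simp_all)
  have mQ: "mcell ?Q" by (rule mcell_pts_comp) simp_all
  have mN: "mcell ?N" by (rule mcell_pts_cell[OF is_scell_mu_cell])
  have mQH: "mcell (vcomp V ?Q ?H)" by (rule mcell_vcomp[OF mH mQ]) (use TX_simps in simp_all)
  show m: "mcell muc" unfolding muc_def by (rule mcell_vcomp[OF mQH mN]) simp_all
  show d: "cdom muc = mcomp V pm (Tm pm)" "ccod muc = psp b" by (simp_all add: muc_def TX_simps)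
  show l: "x \<in> Pts (Pts pX) \<Longrightarrow> cleft muc x = E \<cdot> Mb pX x" for x
    by (simp add: muc_def TX_simps)
  show "cright muc = (\<lambda>y\<in>pX. y)"
  proof (rule extensionalityI[of _ pX])
    show "cright muc \<in> extensional pX" using mcellD(6)[OF m] d by (simp add: PiE_def)
  qed (simp_all add: muc_def)
  assume 1: "x \<in> Pts (Pts pX)" "y \<in> Pts pX" "z \<in> pX" "g \<in> Arr V" "h \<in> Arr V" "Dom V g = Dom V h" "Cod V g = fib V b (E \<cdot> y, z)" "Cod V h = Tf pm (x, y)"
  let ?x = "TA E \<cdot> (TA (eps (TO (cp pX))) \<cdot> x)"
  let ?e = "mci pm (Tm pm) x y z \<cdot> pair V g h"
  have e: "?e \<in> Arr V" "Dom V ?e = Dom V h" "Cod V ?e = ment (mcomp V pm (Tm pm)) (x, z)" using 1 by simp_all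
  have H: "cmap ?H (x, z) \<in> Arr V" "Dom V (cmap ?H (x, z)) = ment (mcomp V pm (Tm pm)) (x, z)" "Cod V (cmap ?H (x, z)) = ment (mcomp V (psp b) (psp (T_span T b))) (?x, z)"
    using mcellD(7-9)[OF mH, of x z] 1 TX_simps by simp_all
  have xt: "?x \<in> Arr V" "Dom V ?x = one" "Cod V ?x = TO (TO Y)" using 1 by simp_all
  note q = pts_comp_cmap[of "T_span T b" b ?x z, simplified]
  have Q: "cmap ?Q (?x, z) \<in> Arr V" "Dom V (cmap ?Q (?x, z)) = ment (mcomp V (psp b) (psp (T_span T b))) (?x, z)" "Cod V (cmap ?Q (?x, z)) = fib V (scomp V b (T_span T b)) (?x, z)"
    using q(1-3) 1 by simp_all
  note n = pts_cell_cmap[OF is_scell_mu_cell, of ?x z]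
  have N: "cmap ?N (?x, z) \<in> Arr V" "Dom V (cmap ?N (?x, z)) = fib V (scomp V b (T_span T b)) (?x, z)" "Cod V (cmap ?N (?x, z)) = fib V b (mult T Y \<cdot> ?x, z)"
    "fbi b (mult T Y \<cdot> ?x, z) \<cdot> cmap ?N (?x, z) = imu S \<cdot> fbi (scomp V b (T_span T b)) (?x, z)"
    using n 1 by simp_all
  have "cmap muc (x, z) = cmap ?N (?x, z) \<cdot> (cmap ?Q (?x, z) \<cdot> cmap ?H (x, z))"
    using 1 by (simp add: muc_def TX_simps)
  then have "cmap muc (x, z) \<cdot> ?e = cmap ?N (?x, z) \<cdot> (cmap ?Q (?x, z) \<cdot> (cmap ?H (x, z) \<cdot> ?e))"
    using N Q H e by (simp del: pair_Cmp)
  also have "cmap ?H (x, z) \<cdot> ?e = mci (psp b) (psp (T_span T b)) ?x (E \<cdot> y) z \<cdot> pair V g (cmap TX (x, y) \<cdot> h)"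
    using hcomp_cmap(4)[OF TX_simps(1) mcell_restr _ _ *, of x z y g h] 1 TX_simps by simp
  finally have 2: "cmap muc (x, z) \<cdot> ?e = cmap ?N (?x, z) \<cdot> (cmap ?Q (?x, z) \<cdot> (mci (psp b) (psp (T_span T b)) ?x (E \<cdot> y) z \<cdot> pair V g (cmap TX (x, y) \<cdot> h)))" (is "_ = cmap ?N (?x, z) \<cdot> (cmap ?Q (?x, z) \<cdot> ?e2)") .
  have t: "cmap TX (x, y) \<cdot> h \<in> Arr V" "Dom V (cmap TX (x, y) \<cdot> h) = Dom V h" "Cod V (cmap TX (x, y) \<cdot> h) = fib V (T_span T b) (?x, E \<cdot> y)"
    using mcellD(7-9)[OF TX_simps(1), of x y] 1 TX_simps by simp_all
  have e2: "?e2 \<in> Arr V" "Dom V ?e2 = Dom V h" "Cod V ?e2 = ment (mcomp V (psp b) (psp (T_span T b))) (?x, z)"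
    using 1 t by (simp_all del: Cmp_simps add: Cmp_simps[of _ "mci (psp b) (psp (T_span T b)) ?x (E \<cdot> y) z"] Cmp_simps[of _ E] Cmp_simps[of _ "TA E"] Cmp_simps[of _ "TA (eps (TO (cp pX)))"])
  \<comment> \<open>Naturality of \<open>m\<close> moves \<open>T\<close> of the counit to the
    outside. This is why the left boundary factors through the restriction and the cell can be
    regarded as one into the restricted matrix.\<close>
  have mx: "mult T Y \<cdot> ?x = E \<cdot> Mb pX x" using 1 by simp
  have "fbi b (mult T Y \<cdot> ?x, z) \<cdot> (cmap ?N (?x, z) \<cdot> (cmap ?Q (?x, z) \<cdot> ?e2)) = (imu S \<cdot> fbi (scomp V b (T_span T b)) (?x, z)) \<cdot> (cmap ?Q (?x, z) \<cdot> ?e2)"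
    by (rule Cmp_extend1[OF N(4)]) (use N Q e2 1 in simp_all)
  also have "\<dots> = imu S \<cdot> (fbi (scomp V b (T_span T b)) (?x, z) \<cdot> (cmap ?Q (?x, z) \<cdot> ?e2))"
    by (rule assoc_right) (use Q e2 1 in simp_all)
  also have "fbi (scomp V b (T_span T b)) (?x, z) \<cdot> (cmap ?Q (?x, z) \<cdot> ?e2) = pb_pair V (il S) (TA (ir S)) (inc y z \<cdot> g) (fbi (T_span T b) (?x, E \<cdot> y) \<cdot> (cmap TX (x, y) \<cdot> h))"
    using q(4)[of "E \<cdot> y" g "cmap TX (x, y) \<cdot> h"] 1 t by simp
  also have "fbi (T_span T b) (?x, E \<cdot> y) \<cdot> (cmap TX (x, y) \<cdot> h) = TA eps1 \<cdot> (\<phi> pm (x, y) \<cdot> h)" by (rule TX_simps(6)[OF 1(1,2,5,8)])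
  finally show "inc (Mb pX x) z \<cdot> (cmap muc (x, z) \<cdot> ?e) = imu S \<cdot> ipair (inc y z \<cdot> g) (TA eps1 \<cdot> (\<phi> pm (x, y) \<cdot> h))"
    unfolding 2 mx .
qed

lemma P_simps [simp]: "eX P = pX" "ea P = pm"
  by (simp_all add: pts_icat_def)

lemma eun_P: "eun P = pts_icat_factor V one T S (eb_set V one T pX) unc" and emu_P: "emu P = pts_icat_factor V one T S (mb_set V one T pX) muc"
  by (simp_all add: pts_icat_def unc_def muc_def)

end

text \<open>The boundaries of the data of \<open>V(1, S)\<close> are correct, so its axioms may be
  verified in elementwise form.\<close>

sublocale icat \<subseteq> P: pre_ecat small V one T "pts_icat V one T S"
proof unfold_locales
  show "is_mcell small V (eun P)" unfolding eun_P by (rule mcell_factor) simp_all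
  show "is_mcell small V (emu P)" unfolding emu_P by (rule mcell_factor) (use muc_simps in simp_all)
qed (simp_all add: eun_P emu_P muc_simps)

section \<open>The axioms for the category of points and the counit\<close>

context icat
begin

lemma P_un_inc:
  assumes "x \<in> pX"
  shows "inc (Eb pX x) x \<cdot> P.un x = iun S \<cdot> x"
  using unc_cmap[of x] assms by (simp add: P.un_def eun_P)

lemma P_un_simps:
  assumes "x \<in> pX"
  shows "P.un x \<in> Arr V" "Dom V (P.un x) = one" "Cod V (P.un x) = fib V b (E \<cdot> Eb pX x, x)"
  using P.un_simps[of x] assms by simp_all

lemma P_mul_inc:
  assumes "x \<in> Pts (Pts pX)" "y \<in> Pts pX" "z \<in> pX" "g \<in> Arr V" "h \<in> Arr V" "Dom V g = Dom V h" "Cod V g = fib V b (E \<cdot> y, z)" "Cod V h = Tf pm (x, y)"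
  shows "inc (Mb pX x) z \<cdot> P.mul x y z g h = imu S \<cdot> ipair (inc y z \<cdot> g) (TA eps1 \<cdot> (\<phi> pm (x, y) \<cdot> h))"
  using muc_simps(6)[OF assms] by (simp add: P.mul_def emu_P)

lemma P_mul_simps:
  assumes "x \<in> Pts (Pts pX)" "y \<in> Pts pX" "z \<in> pX" "g \<in> Arr V" "h \<in> Arr V" "Dom V g = Dom V h" "Cod V g = fib V b (E \<cdot> y, z)" "Cod V h = Tf pm (x, y)"
  shows "P.mul x y z g h \<in> Arr V" "Dom V (P.mul x y z g h) = Dom V h" "Cod V (P.mul x y z g h) = fib V b (E \<cdot> Mb pX x, z)" (is ?A)
proof -
  have m: "Mb pX x \<in> Pts pX" using assms by simp
  show "P.mul x y z g h \<in> Arr V" "Dom V (P.mul x y z g h) = Dom V h" ?A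
    using P.mul_simps(1-3)[of x y z g h] assms pm_simps(3)[of "Mb pX x" z] m by simp_all
qed

lemma P_ups: "eps1 \<cdot> P.ups = iun S \<cdot> eps Y"
proof (rule copow_eqI[of pX])
  fix x assume x: "x \<in> pX"
  have e: "Eb pX x \<in> Pts pX" using x by simp
  have "(eps1 \<cdot> P.ups) \<cdot> cpi pX x = eps1 \<cdot> (mti pm (Eb pX x, x) \<cdot> P.un x)"
    using P.ups_simps(4)[of x] P.ups_simps(1-3) x by simp
  also have "\<dots> = inc (Eb pX x) x \<cdot> P.un x" by (rule eps1_simps(5)) (use x e P_un_simps[OF x] in simp_all)
  finally show "(eps1 \<cdot> P.ups) \<cdot> cpi pX x = (iun S \<cdot> eps Y) \<cdot> cpi pX x"
    unfolding P_un_inc[OF x] using x by simp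
qed (use P.ups_simps(1-3) in simp_all)

lemma T_ir_eps1: "TA (ir S) \<cdot> TA eps1 = E \<cdot> TA (sr (sm pm))"
  by (rule T_commute[OF ir_eps1]) simp_all

lemma TA_ir_eps1_phi:
  assumes "x \<in> Pts (Pts pX)" "y \<in> Pts pX" "h \<in> Arr V" "Cod V h = Tf pm (x, y)"
  shows "TA (ir S) \<cdot> (TA eps1 \<cdot> (\<phi> pm (x, y) \<cdot> h)) = E \<cdot> (y \<cdot> bng (Dom V h))"
  using Cmp_extend[OF T_ir_eps1, of "\<phi> pm (x, y) \<cdot> h"] assms by simp

text \<open>Both sides are composed with the fibre inclusion. The claim then is the left unit law of
  \<open>S\<close> at the image of \<open>g\<close> in the object of arrows; the constraint on
  \<open>h\<close> becomes the unit of the monad at that image.\<close>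

lemma unit_left_P: "P.unit_left"
  unfolding P.unit_left_def P_simps
proof (intro ballI allI impI)
  fix x y g h assume 1: "x \<in> Pts pX" "y \<in> pX" "g \<in> Arr V" "h \<in> Arr V" "Dom V g = Dom V h" "Cod V g = ment pm (x, y)"
    "Cod V h = Tf pm (Eb (Pts pX) x, Eb pX y)" and e: "\<phi> pm (Eb (Pts pX) x, Eb pX y) \<cdot> h = unit T (mtot V pm) \<cdot> (mti pm (x, y) \<cdot> g)"
  have g: "Cod V g = fib V b (E \<cdot> x, y)" using 1 by simp
  have ex: "Eb (Pts pX) x \<in> Pts (Pts pX)" "Eb pX y \<in> Pts pX" using 1(1,2) by simp_all
  have eq: "Mb pX (Eb (Pts pX) x) = x" by (rule Mb_Eb) (use 1 in simp_all)
  let ?u = "P.un y \<cdot> bng (Dom V h)" and ?h0 = "inc x y \<cdot> g"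
  note un = P_un_simps[OF 1(2)]
  have u: "?u \<in> Arr V" "Dom V ?u = Dom V h" "Cod V ?u = fib V b (E \<cdot> Eb pX y, y)" using un 1(4) by simp_all
  note ms = P_mul_simps[OF ex 1(2) u(1) 1(4) u(2,3) 1(7), unfolded eq] and mi = P_mul_inc[OF ex 1(2) u(1) 1(4) u(2,3) 1(7), unfolded eq]
  have h0: "?h0 \<in> Arr V" "Cod V ?h0 = Y1" "ir S \<cdot> ?h0 = y \<cdot> bng (Dom V h)" using 1(1-5) g by simp_all
  have "inc (Eb pX y) y \<cdot> ?u = (iun S \<cdot> y) \<cdot> bng (Dom V h)"
    by (rule Cmp_extend1[OF P_un_inc[OF 1(2)]]) (use un ex 1(2,4) in simp_all)
  also have "\<dots> = iun S \<cdot> (ir S \<cdot> ?h0)" unfolding h0(3) using 1(2,4) by simp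
  finally have a: "inc (Eb pX y) y \<cdot> ?u = iun S \<cdot> (ir S \<cdot> ?h0)" .
  have c: "TA eps1 \<cdot> (\<phi> pm (Eb (Pts pX) x, Eb pX y) \<cdot> h) = unit T Y1 \<cdot> ?h0"
    unfolding e using 1(1-5) g by simp
  show "P.mul (Eb (Pts pX) x) (Eb pX y) y ?u h = g"
  proof (rule fib_mono[of b "E \<cdot> x" y])
    show "inc x y \<cdot> P.mul (Eb (Pts pX) x) (Eb pX y) y ?u h = inc x y \<cdot> g"
      unfolding mi a c by (rule imu_unit_left[OF h0(1,2)])
  qed (use 1(1-5) g ms in simp_all)
qed

text \<open>The right unit law of \<open>S\<close> at the image of \<open>g\<close>. The constraint
  on \<open>h\<close> is rewritten with the image under \<open>T\<close> of \<open>P_ups\<close>,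
  the compatibility of the counit with units.\<close>

lemma unit_right_P: "P.unit_right"
  unfolding P.unit_right_def P_simps
proof (intro ballI allI impI)
  let ?t = "\<lambda>x. TA (cpm pX (Pts pX) (eb_set V one T pX)) \<cdot> x"
  fix x y g h assume 1: "x \<in> Pts pX" "y \<in> pX" "g \<in> Arr V" "h \<in> Arr V" "Dom V g = Dom V h" "Cod V g = ment pm (x, y)"
    "Cod V h = Tf pm (?t x, x)" and e: "\<phi> pm (?t x, x) \<cdot> h = TA P.ups \<cdot> (x \<cdot> bng (Dom V h))"
  have g: "Cod V g = fib V b (E \<cdot> x, y)" using 1 by simp
  have ex: "?t x \<in> Pts (Pts pX)" using 1(1,2) by simp
  have eq: "Mb pX (?t x) = x" by (rule Mb_TEb) (use 1 in simp_all)
  let ?h0 = "inc x y \<cdot> g"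
  note ms = P_mul_simps[OF ex 1(1,2,3,4,5) g 1(7), unfolded eq] and mi = P_mul_inc[OF ex 1(1,2,3,4,5) g 1(7), unfolded eq]
  have h0: "?h0 \<in> Arr V" "Cod V ?h0 = Y1" "il S \<cdot> ?h0 = E \<cdot> (x \<cdot> bng (Dom V h))" using 1(1-5) g by simp_all
  have "TA eps1 \<cdot> TA P.ups = TA (iun S) \<cdot> E" by (rule T_commute[OF P_ups]) (use P.ups_simps(1-3) in simp_all)
  then have "TA eps1 \<cdot> (TA P.ups \<cdot> (x \<cdot> bng (Dom V h))) = TA (iun S) \<cdot> (E \<cdot> (x \<cdot> bng (Dom V h)))"
    by (rule Cmp_extend) (use P.ups_simps(1-3) 1(1,4) in simp_all)
  then have c: "TA eps1 \<cdot> (\<phi> pm (?t x, x) \<cdot> h) = TA (iun S) \<cdot> (il S \<cdot> ?h0)" unfolding e h0(3) .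
  show "P.mul (?t x) x y g h = g"
  proof (rule fib_mono[of b "E \<cdot> x" y])
    show "inc x y \<cdot> P.mul (?t x) x y g h = inc x y \<cdot> g"
      unfolding mi c by (rule imu_unit_right[OF h0(1,2)])
  qed (use 1(1-5) g ms in simp_all)
qed

lemma P_nu_simps: "P.nu \<in> Arr V" "Dom V P.nu = pb V (sl (sm pm)) (sr (sm (Tm pm)))" "Cod V P.nu = mtot V pm"
  using P.nu_simps by simp_all

text \<open>The square needed to map composable pairs of the matrix of points to composable pairs of
  \<open>S\<close>. It combines the leg equations of the counit, one of them under \<open>T\<close>,
  with the square of the strong conjoint.\<close>

lemma eps1_com:
  "il S \<cdot> (eps1 \<cdot> pb1 V (sl (sm pm)) (sr (sm (Tm pm)))) = TA (ir S) \<cdot> ((TA eps1 \<cdot> epsT pm) \<cdot> pb2 V (sl (sm pm)) (sr (sm (Tm pm))))"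
proof -
  let ?q1 = "pb1 V (sl (sm pm)) (sr (sm (Tm pm)))" and ?q2 = "pb2 V (sl (sm pm)) (sr (sm (Tm pm)))"
  let ?e = "eps (TO (cp pX))"
  have q: "sl (sm pm) \<cdot> ?q1 = sr (sm (Tm pm)) \<cdot> ?q2" by (rule pb_commute) simp_all
  have "il S \<cdot> (eps1 \<cdot> ?q1) = (E \<cdot> (?e \<cdot> sl (sm pm))) \<cdot> ?q1" by (rule Cmp_extend1[OF il_eps1]) simp_all
  also have "\<dots> = E \<cdot> (?e \<cdot> (sr (sm (Tm pm)) \<cdot> ?q2))" using q by simp
  also have "?e \<cdot> (sr (sm (Tm pm)) \<cdot> ?q2) = TA (sr (sm pm)) \<cdot> (epsT pm \<cdot> ?q2)"
    using Cmp_extend[OF conjoint_commute[OF is_mat_pm], of ?q2] by simp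
  also have "E \<cdot> (TA (sr (sm pm)) \<cdot> (epsT pm \<cdot> ?q2)) = TA (ir S) \<cdot> (TA eps1 \<cdot> (epsT pm \<cdot> ?q2))"
    by (rule Cmp_extend[OF T_ir_eps1[symmetric]]) simp_all
  finally show ?thesis by simp
qed

text \<open>The counit on composable pairs, from the composite of spans of the category of points to
  the object of composable pairs of \<open>S\<close>.\<close>

definition eps2 :: 'a where
  "eps2 = ipair (eps1 \<cdot> pb1 V (sl (sm pm)) (sr (sm (Tm pm)))) ((TA eps1 \<cdot> epsT pm) \<cdot> pb2 V (sl (sm pm)) (sr (sm (Tm pm))))"

lemma eps2_simps [simp]: "eps2 \<in> Arr V" "Dom V eps2 = pb V (sl (sm pm)) (sr (sm (Tm pm)))" (is ?A) "Cod V eps2 = pb V (il S) (TA (ir S))" (is ?B)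
proof -
  show "eps2 \<in> Arr V" unfolding eps2_def by (rule pb_pair_simps(1)[OF _ _ _ _ _ _ _ _ eps1_com]; simp)
  show ?A unfolding eps2_def by (subst pb_pair_simps(2)[OF _ _ _ _ _ _ _ _ eps1_com]; simp)
  show ?B unfolding eps2_def by (rule pb_pair_simps(3)[OF _ _ _ _ _ _ _ _ eps1_com]; simp)
qed

text \<open>Compatibility of the counit with multiplication. After splitting the composite of spans
  over summands it is the description \<open>P_mul_inc\<close> of the multiplication of
  points.\<close>

lemma eps1_nu:
  "eps1 \<cdot> P.nu = imu S \<cdot> eps2"
proof (rule star_comp_local_eqI[of "Tm pm" pm "Ident V (pb V (sl (sm pm)) (sr (sm (Tm pm))))"])
  let ?q1 = "pb1 V (sl (sm pm)) (sr (sm (Tm pm)))" and ?q2 = "pb2 V (sl (sm pm)) (sr (sm (Tm pm)))" and ?I = "Ident V (pb V (sl (sm pm)) (sr (sm (Tm pm))))"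
  show "imu S \<cdot> eps2 \<in> Arr V" "Dom V (imu S \<cdot> eps2) = Dom V ?I" "Cod V (eps1 \<cdot> P.nu) = Cod V (imu S \<cdot> eps2)"
    "eps1 \<cdot> P.nu \<in> Arr V" "Dom V (eps1 \<cdot> P.nu) = Dom V ?I" using P_nu_simps by simp_all
  fix x y z k g h assume "x \<in> msrc (Tm pm)" "y \<in> mtgt (Tm pm)" "z \<in> mtgt pm" and 1: "k \<in> Arr V" "g \<in> Arr V" "h \<in> Arr V" "Cod V k = Dom V ?I"
    "Dom V k = Dom V h" "Dom V g = Dom V h" "Cod V g = ment pm (y, z)" "Cod V h = ment (Tm pm) (x, y)"
    and e: "?I \<cdot> k = pb_pair V (sl (sm pm)) (sr (sm (Tm pm))) (mti pm (y, z) \<cdot> g) (mti (Tm pm) (x, y) \<cdot> h)"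
  then have xyz: "x \<in> Pts (Pts pX)" "y \<in> Pts pX" "z \<in> pX" by simp_all
  have k: "k = pb_pair V (sl (sm pm)) (sr (sm (Tm pm))) (mti pm (y, z) \<cdot> g) (mti (Tm pm) (x, y) \<cdot> h)" using e 1 by simp
  have ck: "Cod V k = pb V (sl (sm pm)) (sr (sm (Tm pm)))" using 1(4) by simp
  have h: "Cod V h = Tf pm (x, y)" and g: "Cod V g = fib V b (E \<cdot> y, z)" using 1(7,8) xyz by simp_all
  have q1: "?q1 \<cdot> k = mti pm (y, z) \<cdot> g" and q2: "?q2 \<cdot> k = mti (Tm pm) (x, y) \<cdot> h" unfolding k using xyz 1(2,3,6) g h by simp_all
  have mx: "Mb pX x \<in> Pts pX" using xyz by simp
  note ms = P_mul_simps[OF xyz 1(2,3,6) g h]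
  have "(eps1 \<cdot> P.nu) \<cdot> k = eps1 \<cdot> (P.nu \<cdot> k)" by (rule assoc_right) (use 1(1) ck P_nu_simps in simp_all)
  also have "P.nu \<cdot> k = mti pm (Mb pX x, z) \<cdot> P.mul x y z g h"
    unfolding k using P.nu_pair[unfolded P_simps, OF xyz 1(2,3,6,7) h] .
  also have "eps1 \<cdot> (mti pm (Mb pX x, z) \<cdot> P.mul x y z g h) = inc (Mb pX x) z \<cdot> P.mul x y z g h"
    by (rule eps1_simps(5)) (use mx xyz ms in simp_all)
  also have "\<dots> = imu S \<cdot> ipair (inc y z \<cdot> g) (TA eps1 \<cdot> (\<phi> pm (x, y) \<cdot> h))" by (rule P_mul_inc[OF xyz 1(2,3,6) g h])
  finally have l: "(eps1 \<cdot> P.nu) \<cdot> k = \<dots>" .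
  have "(imu S \<cdot> eps2) \<cdot> k = imu S \<cdot> (eps2 \<cdot> k)" by (rule assoc_right) (use 1(1) ck in simp_all)
  also have "eps2 \<cdot> k = ipair ((eps1 \<cdot> ?q1) \<cdot> k) (((TA eps1 \<cdot> epsT pm) \<cdot> ?q2) \<cdot> k)"
    unfolding eps2_def by (rule pb_pair_Cmp[OF _ _ _ _ _ _ _ _ eps1_com]) (use 1(1) ck in simp_all)
  also have "(eps1 \<cdot> ?q1) \<cdot> k = eps1 \<cdot> (?q1 \<cdot> k)" by (rule assoc_right) (use 1(1) ck in simp_all)
  also have "\<dots> = inc y z \<cdot> g" unfolding q1 using xyz 1(2) g by simp
  also have "((TA eps1 \<cdot> epsT pm) \<cdot> ?q2) \<cdot> k = TA eps1 \<cdot> (epsT pm \<cdot> (?q2 \<cdot> k))" using 1(1) ck by simp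
  also have "\<dots> = TA eps1 \<cdot> (\<phi> pm (x, y) \<cdot> h)" unfolding q2 using xyz 1(3) h by simp
  finally show "(eps1 \<cdot> P.nu) \<cdot> k = (imu S \<cdot> eps2) \<cdot> k" unfolding l by simp
qed simp_all

text \<open>Associativity for three separate elements, lying under zero, one and two layers of
  \<open>T\<close>. The two square conditions say that consecutive elements are composable.\<close>

lemma imu_assoc_pair:
  assumes ghk: "g \<in> Arr V" "h \<in> Arr V" "k \<in> Arr V" "Dom V g = Dom V k" "Dom V h = Dom V k" "Cod V g = Y1" "Cod V h = TO Y1" "Cod V k = TO (TO Y1)"
    and gh: "il S \<cdot> g = TA (ir S) \<cdot> h" and hk: "TA (il S) \<cdot> h = TA (TA (ir S)) \<cdot> k"
  shows "imu S \<cdot> ipair (imu S \<cdot> ipair g h) (mult T Y1 \<cdot> k) = imu S \<cdot> ipair g (TA (imu S) \<cdot> T_pair (il S) (TA (ir S)) h k)"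
proof -
  let ?H = "ipair g h" and ?K = "T_pair (il S) (TA (ir S)) h k"
  have H: "?H \<in> Arr V" "Dom V ?H = Dom V k" "Cod V ?H = pb V (il S) (TA (ir S))" "ipr1 \<cdot> ?H = g" "ipr2 \<cdot> ?H = h"
    using ghk gh by simp_all
  have K: "?K \<in> Arr V" "Dom V ?K = Dom V k" "Cod V ?K = TO (pb V (il S) (TA (ir S)))" "TA ipr1 \<cdot> ?K = h" "TA ipr2 \<cdot> ?K = k"
    by (rule T_pair_simps[OF _ _ _ _ _ _ _ _ hk]; use ghk in simp)+
  have "imu S \<cdot> ipair (imu S \<cdot> ?H) (mult T Y1 \<cdot> (TA ipr2 \<cdot> ?K)) = imu S \<cdot> ipair (ipr1 \<cdot> ?H) (TA (imu S) \<cdot> ?K)"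
  proof (rule imu_assoc[OF H(1,3) K(1,3)])
    show "Dom V ?H = Dom V ?K" unfolding H(2) K(2) ..
    show "ipr2 \<cdot> ?H = TA ipr1 \<cdot> ?K" unfolding H(5) K(4) ..
  qed
  then show ?thesis unfolding H(4) K(5) .
qed

text \<open>After the fibre inclusion both sides are products in \<open>S\<close> of the images
  \<open>?gz\<close>, \<open>?hz\<close>, \<open>?kz\<close> of the three elements under the counit,
  and \<open>imu_assoc_pair\<close> applies. The element \<open>t\<close> is treated with
  \<open>eps1_nu\<close> under \<open>T\<close>, the element \<open>s\<close> with naturality of
  \<open>m\<close>.\<close>

lemma assoc_P: "P.assoc"
  unfolding P.assoc_def P_simps
proof (intro ballI allI impI)
  let ?t = "TA (cpm (Pts (Pts pX)) (Pts pX) (mb_set V one T pX))"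
  let ?sl = "sl (sm pm)" and ?sr = "sr (sm (Tm pm))"
  fix x y z w g h k t s assume x: "x \<in> Pts (Pts (Pts pX))" and 1: "y \<in> Pts (Pts pX)" "z \<in> Pts pX" "w \<in> pX" "g \<in> Arr V" "h \<in> Arr V" "k \<in> Arr V" "t \<in> Arr V" "s \<in> Arr V"
    "Dom V g = Dom V k" "Dom V h = Dom V k" "Dom V t = Dom V k" "Dom V s = Dom V k" "Cod V g = ment pm (z, w)" "Cod V h = Tf pm (y, z)" "Cod V k = Tf (Tm pm) (x, y)"
    "Cod V t = Tf pm (?t \<cdot> x, z)" "Cod V s = Tf pm (Mb (Pts pX) x, Mb pX y)"
    and e: "\<phi> pm (?t \<cdot> x, z) \<cdot> t = TA P.nu \<cdot> T_pair ?sl ?sr (\<phi> pm (y, z) \<cdot> h) (\<phi> (Tm pm) (x, y) \<cdot> k)"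
       "\<phi> pm (Mb (Pts pX) x, Mb pX y) \<cdot> s = mult T (mtot V pm) \<cdot> (TA (epsT pm) \<cdot> (\<phi> (Tm pm) (x, y) \<cdot> k))"
  have g: "Cod V g = fib V b (E \<cdot> z, w)" using 1 by simp
  have tx: "?t \<cdot> x \<in> Pts (Pts pX)" "Mb (Pts pX) x \<in> Pts (Pts pX)" "Mb pX y \<in> Pts pX" using x 1(1) by simp_all
  have gt: "Dom V g = Dom V t" "Dom V g = Dom V h" using 1(9-11) by simp_all
  note mt = P_mul_simps[OF tx(1) 1(2,3,4,7) gt(1) g 1(16)] and it = P_mul_inc[OF tx(1) 1(2,3,4,7) gt(1) g 1(16)]
  note m1 = P_mul_simps[OF 1(1-5) gt(2) g 1(14)] and i1 = P_mul_inc[OF 1(1-5) gt(2) g 1(14)]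
  have ds: "Dom V (P.mul y z w g h) = Dom V s" using m1 1(10,12) by simp
  note ms = P_mul_simps[OF tx(2,3) 1(3) m1(1) 1(8) ds m1(3) 1(17)] and i2 = P_mul_inc[OF tx(2,3) 1(3) m1(1) 1(8) ds m1(3) 1(17)]
  have eqm: "Mb pX (?t \<cdot> x) = Mb pX (Mb (Pts pX) x)" by (rule Mb_TMb[OF _ x]) simp
  let ?h = "\<phi> pm (y, z) \<cdot> h" and ?k = "\<phi> (Tm pm) (x, y) \<cdot> k"
  let ?gz = "inc z w \<cdot> g" and ?hz = "TA eps1 \<cdot> (\<phi> pm (y, z) \<cdot> h)" and ?kz = "TA (TA eps1 \<cdot> epsT pm) \<cdot> (\<phi> (Tm pm) (x, y) \<cdot> k)"
  have hk: "?h \<in> Arr V" "?k \<in> Arr V" "Dom V ?h = Dom V k" "Dom V ?k = Dom V k" "Cod V ?h = TO (mtot V pm)" "Cod V ?k = TO (mtot V (Tm pm))" "TA ?sl \<cdot> ?h = TA ?sr \<cdot> ?k"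
    using x 1(1-6) 1(10,14,15) by simp_all
  have g0: "?gz \<in> Arr V" "Dom V ?gz = Dom V k" "Cod V ?gz = Y1" using 1(2-4,9) g by simp_all
  have h0: "?hz \<in> Arr V" "Dom V ?hz = Dom V k" "Cod V ?hz = TO Y1" using hk by simp_all
  have k0: "?kz \<in> Arr V" "Dom V ?kz = Dom V k" "Cod V ?kz = TO (TO Y1)" using hk by simp_all
  have cgh: "il S \<cdot> ?gz = TA (ir S) \<cdot> ?hz" unfolding TA_ir_eps1_phi[OF 1(1,2,5,14)] using 1(2-4,9,10) g by simp
  \<comment> \<open>The chain ending in \<open>chk\<close> shows that \<open>?hz\<close> and
    \<open>?kz\<close> are composable. It replaces the left leg of the counit by its description,
    passes to \<open>?k\<close> through the pullback square \<open>hk(7)\<close>, crosses the strong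
    conjoint square and returns by the right leg, all under \<open>T\<close>.\<close>
  have Tc: "TA (il S) \<cdot> TA eps1 = TA E \<cdot> (TA (eps (TO (cp pX))) \<cdot> TA ?sl)"
    using T_commute1[OF il_eps1] by simp
  have "TA (il S) \<cdot> ?hz = (TA E \<cdot> (TA (eps (TO (cp pX))) \<cdot> TA ?sl)) \<cdot> ?h" by (rule Cmp_extend1[OF Tc]) (use hk in simp_all)
  also have "\<dots> = TA E \<cdot> (TA (eps (TO (cp pX))) \<cdot> (TA ?sr \<cdot> ?k))" using hk(1,2,5,6) unfolding hk(7)[symmetric] by simp
  also have "TA (eps (TO (cp pX))) \<cdot> (TA ?sr \<cdot> ?k) = TA (TA (sr (sm pm))) \<cdot> (TA (epsT pm) \<cdot> ?k)"
    by (rule Cmp_extend[OF T_commute[OF conjoint_commute[OF is_mat_pm, symmetric, unfolded pm_simps(2)]]]) (use hk in simp_all)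
  also have "TA E \<cdot> (TA (TA (sr (sm pm))) \<cdot> (TA (epsT pm) \<cdot> ?k)) = TA (TA (ir S)) \<cdot> (TA (TA eps1) \<cdot> (TA (epsT pm) \<cdot> ?k))"
    by (rule Cmp_extend[OF T_commute[OF T_ir_eps1[symmetric]]]) (use hk in simp_all)
  also have "TA (TA eps1) \<cdot> (TA (epsT pm) \<cdot> ?k) = ?kz" by (rule Cmp_extend1[OF T_commute1[OF refl]]) (use hk(2,6) in simp_all)
  finally have chk: "TA (il S) \<cdot> ?hz = TA (TA (ir S)) \<cdot> ?kz" .
  let ?K = "T_pair (il S) (TA (ir S)) ?hz ?kz"
  \<comment> \<open>\<open>T\<close> of the counit on composable pairs carries the pairing of the
    given elements to the pairing of their images. This converts the constraint on \<open>t\<close>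
    into the form that \<open>imu_assoc_pair\<close> expects.\<close>
  have QK: "TA eps2 \<cdot> T_pair ?sl ?sr ?h ?k = ?K"
    unfolding eps2_def by (rule T_pair_map[OF _ _ _ _ _ _ _ _ _ _ _ hk(7) _ _ _ _ _ _ eps1_com chk]) (use hk(1-6) in simp_all)
  have tp: "T_pair ?sl ?sr ?h ?k \<in> Arr V" "Dom V (T_pair ?sl ?sr ?h ?k) = Dom V ?k" "Cod V (T_pair ?sl ?sr ?h ?k) = TO (pb V ?sl ?sr)"
    by (rule T_pair_simps[OF _ _ _ _ _ _ _ _ hk(7)]; use hk(1-6) in simp)+
  have Tn: "TA eps1 \<cdot> TA P.nu = TA (imu S) \<cdot> TA eps2" by (rule T_commute[OF eps1_nu]) (use P_nu_simps in simp_all)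
  have "TA eps1 \<cdot> (TA P.nu \<cdot> T_pair ?sl ?sr ?h ?k) = TA (imu S) \<cdot> (TA eps2 \<cdot> T_pair ?sl ?sr ?h ?k)"
    by (rule Cmp_extend[OF Tn]) (use P_nu_simps tp in simp_all)
  then have T1: "TA eps1 \<cdot> (\<phi> pm (?t \<cdot> x, z) \<cdot> t) = TA (imu S) \<cdot> ?K" unfolding e(1) QK .
  have T2: "TA eps1 \<cdot> (\<phi> pm (Mb (Pts pX) x, Mb pX y) \<cdot> s) = mult T Y1 \<cdot> ?kz"
    unfolding e(2) using hk(2,6) by simp
  have gh: "Dom V ?gz = Dom V ?kz" "Dom V ?hz = Dom V ?kz" unfolding g0(2) h0(2) k0(2) by (rule refl)+
  note as = imu_assoc_pair[OF g0(1) h0(1) k0(1) gh g0(3) h0(3) k0(3) cgh chk]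
  show "P.mul (?t \<cdot> x) z w g t = P.mul (Mb (Pts pX) x) (Mb pX y) w (P.mul y z w g h) s"
  proof (rule fib_mono[of b "E \<cdot> Mb pX (Mb (Pts pX) x)" w])
    show "inc (Mb pX (Mb (Pts pX) x)) w \<cdot> P.mul (?t \<cdot> x) z w g t = inc (Mb pX (Mb (Pts pX) x)) w \<cdot> P.mul (Mb (Pts pX) x) (Mb pX y) w (P.mul y z w g h) s"
      unfolding i2 i1 it[unfolded eqm] T1 T2 as ..
    show "Dom V (P.mul (?t \<cdot> x) z w g t) = Dom V (P.mul (Mb (Pts pX) x) (Mb pX y) w (P.mul y z w g h) s)" unfolding mt(2) ms(2) using 1(11,12) by simp
  qed (simp_all only: mt(1) ms(1) mt(3)[unfolded eqm] ms(3), use x 1(3) in simp_all)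
qed

lemma is_ecat_P: "is_ecat small V one T P"
  using P.is_ecat_iff unit_left_P unit_right_P assoc_P by simp

text \<open>Compatibility with multiplication is \<open>eps1_nu\<close> transported along the
  inverse of the isomorphism to \<open>X\<^sub>2\<close>; the projections of
  \<open>X\<^sub>2\<close> turn into those of the composite of spans by
  \<open>star_X2_inv_pb\<close>.\<close>

lemma counit_mor: "is_icat_mor V T (star_ecat V one T P) S (eps Y) eps1"
proof -
  let ?L = "star_ecat_l V one T P" and ?R = "sr (sm pm)"
  let ?s = "inv_arr V (star_X2_map V one T P)" and ?q1 = "pb1 V (sl (sm pm)) (sr (sm (Tm pm)))" and ?q2 = "pb2 V (sl (sm pm)) (sr (sm (Tm pm)))"
  have s: "?s \<in> Arr V" "Dom V ?s = pb V ?L (TA ?R)" "Cod V ?s = pb V (sl (sm pm)) (sr (sm (Tm pm)))"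
    using P.star_X2_inv[unfolded P_simps] by simp_all
  have sp: "?q1 \<cdot> ?s = pb1 V ?L (TA ?R)" "epsT pm \<cdot> (?q2 \<cdot> ?s) = pb2 V ?L (TA ?R)"
    using P.star_X2_inv_pb[unfolded P_simps] by simp_all
  have "eps1 \<cdot> (P.nu \<cdot> ?s) = (imu S \<cdot> eps2) \<cdot> ?s" by (rule Cmp_extend1[OF eps1_nu]) (use s P_nu_simps in simp_all)
  also have "\<dots> = imu S \<cdot> (eps2 \<cdot> ?s)" by (rule assoc_right) (use s in simp_all)
  also have "eps2 \<cdot> ?s = ipair ((eps1 \<cdot> ?q1) \<cdot> ?s) (((TA eps1 \<cdot> epsT pm) \<cdot> ?q2) \<cdot> ?s)"
    unfolding eps2_def by (rule pb_pair_Cmp[OF _ _ _ _ _ _ _ _ eps1_com]) (use s in simp_all)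
  also have "(eps1 \<cdot> ?q1) \<cdot> ?s = eps1 \<cdot> pb1 V ?L (TA ?R)" unfolding sp(1)[symmetric] by (rule assoc_right) (use s in simp_all)
  also have "((TA eps1 \<cdot> epsT pm) \<cdot> ?q2) \<cdot> ?s = TA eps1 \<cdot> pb2 V ?L (TA ?R)" unfolding sp(2)[symmetric] using s by simp
  finally have mu: "eps1 \<cdot> (P.nu \<cdot> ?s) = imu S \<cdot> ipair (eps1 \<cdot> pb1 V ?L (TA ?R)) (TA eps1 \<cdot> pb2 V ?L (TA ?R))" .
  have L: "il S \<cdot> eps1 = E \<cdot> ?L" using il_eps1 by (simp add: star_ecat_l_def)
  show ?thesis unfolding is_icat_mor_def P.star_ecat_simps P_simps
    using mu L ir_eps1 P_ups by simp
qed

end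

section \<open>Adjunctions from universal counits\<close>

text \<open>On arrows, \<open>G\<close> is only required to satisfy the naturality square of the
  counit. The equations to be derived for \<open>G\<close> and for the unit are equations between
  arrows into some \<open>omap G S\<close>, and \<open>uniq\<close> reduces them to equations in
  \<open>D\<close> after applying \<open>F\<close> and composing with the counit.\<close>

lemma adjunction_if_universal:
  assumes F: "is_functor C D F"
    and G: "\<And>S. S \<in> Obj D \<Longrightarrow> omap G S \<in> Obj C"
    and eps: "\<And>S. S \<in> Obj D \<Longrightarrow> \<epsilon> S \<in> Hom D (omap F (omap G S)) S"
    and ex: "\<And>A S g. \<lbrakk>A \<in> Obj C; S \<in> Obj D; g \<in> Hom D (omap F A) S\<rbrakk> \<Longrightarrow>
      \<exists>h. h \<in> Hom C A (omap G S) \<and> \<epsilon> S \<cdot>\<^bsub>D\<^esub> amap F h = g"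
    and uniq: "\<And>A S h k. \<lbrakk>A \<in> Obj C; S \<in> Obj D; h \<in> Hom C A (omap G S); k \<in> Hom C A (omap G S); \<epsilon> S \<cdot>\<^bsub>D\<^esub> amap F h = \<epsilon> S \<cdot>\<^bsub>D\<^esub> amap F k\<rbrakk> \<Longrightarrow> h = k"
    and amap_G: "\<And>S R g. \<lbrakk>S \<in> Obj D; R \<in> Obj D; g \<in> Hom D S R\<rbrakk> \<Longrightarrow>
      amap G g \<in> Hom C (omap G S) (omap G R) \<and> \<epsilon> R \<cdot>\<^bsub>D\<^esub> amap F (amap G g) = g \<cdot>\<^bsub>D\<^esub> \<epsilon> S"
  shows "\<exists>\<eta>. is_adjunction C D F G \<eta> \<epsilon>"
proof -
  interpret C: category C using F by (simp add: is_functor_def)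
  interpret D: category D using F by (simp add: is_functor_def)
  have Fs: "\<And>X. X \<in> Obj C \<Longrightarrow> omap F X \<in> Obj D" "\<And>A B f. f \<in> Hom C A B \<Longrightarrow> amap F f \<in> Hom D (omap F A) (omap F B)"
    "\<And>X. X \<in> Obj C \<Longrightarrow> amap F (Ident C X) = Ident D (omap F X)"
    "\<And>A B E f g. f \<in> Hom C A B \<Longrightarrow> g \<in> Hom C B E \<Longrightarrow> amap F (g \<cdot>\<^bsub>C\<^esub> f) = amap F g \<cdot>\<^bsub>D\<^esub> amap F f"
    using F by (auto simp: is_functor_def)
  have amap_G': "amap G g \<in> Hom C (omap G S) (omap G R)" "\<epsilon> R \<cdot>\<^bsub>D\<^esub> amap F (amap G g) = g \<cdot>\<^bsub>D\<^esub> \<epsilon> S"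
    if "g \<in> Hom D S R" for S R g
    using amap_G[of S R g] that D.Dom_Obj[of g] D.Cod_Obj[of g] by auto
  have objD: "S \<in> Obj D" "R \<in> Obj D" if "g \<in> Hom D S R" for S R g using that D.Dom_Obj[of g] D.Cod_Obj[of g] by auto
  have objC: "S \<in> Obj C" "R \<in> Obj C" if "g \<in> Hom C S R" for S R g using that C.Dom_Obj[of g] C.Cod_Obj[of g] by auto
  have eF: "\<epsilon> R \<cdot>\<^bsub>D\<^esub> amap F (g \<cdot>\<^bsub>C\<^esub> f) = (\<epsilon> R \<cdot>\<^bsub>D\<^esub> amap F g) \<cdot>\<^bsub>D\<^esub> amap F f"
    if "f \<in> Hom C A B" "g \<in> Hom C B (omap G R)" "R \<in> Obj D" for A B R f g
    unfolding Fs(4)[OF that(1,2)] by (rule D.Cmp_assoc[OF Fs(2)[OF that(1)] Fs(2)[OF that(2)] eps[OF that(3)]])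
  \<comment> \<open>The unit is the transpose of an identity, so one triangle identity holds by
    construction and only the other is left for \<open>tri\<close>.\<close>
  define \<eta> where "\<eta> A = (SOME h. h \<in> Hom C A (omap G (omap F A)) \<and> \<epsilon> (omap F A) \<cdot>\<^bsub>D\<^esub> amap F h = Ident D (omap F A))" for A
  have eta: "\<eta> A \<in> Hom C A (omap G (omap F A))" "\<epsilon> (omap F A) \<cdot>\<^bsub>D\<^esub> amap F (\<eta> A) = Ident D (omap F A)" if "A \<in> Obj C" for A
    using someI_ex[OF ex[OF that Fs(1)[OF that] D.Ident_Hom[OF Fs(1)[OF that]]]] unfolding \<eta>_def by auto
  have GI: "amap G (Ident D S) = Ident C (omap G S)" if S: "S \<in> Obj D" for S
  proof (rule uniq[OF G[OF S] S])
    show "\<epsilon> S \<cdot>\<^bsub>D\<^esub> amap F (amap G (Ident D S)) = \<epsilon> S \<cdot>\<^bsub>D\<^esub> amap F (Ident C (omap G S))"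
      unfolding amap_G'(2)[OF D.Ident_Hom[OF S]] Fs(3)[OF G[OF S]] D.Ident_Cmp[OF eps[OF S]] D.Cmp_Ident[OF eps[OF S]] ..
  qed (use amap_G'(1)[OF D.Ident_Hom[OF S]] C.Ident_Hom[OF G[OF S]] in auto)
  have GC: "amap G (g \<cdot>\<^bsub>D\<^esub> f) = amap G g \<cdot>\<^bsub>C\<^esub> amap G f" if f: "f \<in> Hom D S R" and g: "g \<in> Hom D R Q" for S R Q f g
  proof (rule uniq[OF G[OF objD(1)[OF f]] objD(2)[OF g]])
    have gf: "g \<cdot>\<^bsub>D\<^esub> f \<in> Hom D S Q" by (rule D.Cmp_Hom[OF f g])
    show "amap G (g \<cdot>\<^bsub>D\<^esub> f) \<in> Hom C (omap G S) (omap G Q)" by (rule amap_G'(1)[OF gf])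
    show "amap G g \<cdot>\<^bsub>C\<^esub> amap G f \<in> Hom C (omap G S) (omap G Q)" by (rule C.Cmp_Hom[OF amap_G'(1)[OF f] amap_G'(1)[OF g]])
    have "\<epsilon> Q \<cdot>\<^bsub>D\<^esub> amap F (amap G g \<cdot>\<^bsub>C\<^esub> amap G f) = (g \<cdot>\<^bsub>D\<^esub> \<epsilon> R) \<cdot>\<^bsub>D\<^esub> amap F (amap G f)"
      unfolding eF[OF amap_G'(1)[OF f] amap_G'(1)[OF g] objD(2)[OF g]] amap_G'(2)[OF g] ..
    also have "\<dots> = g \<cdot>\<^bsub>D\<^esub> (f \<cdot>\<^bsub>D\<^esub> \<epsilon> S)"
      unfolding D.Cmp_assoc[OF Fs(2)[OF amap_G'(1)[OF f]] eps[OF objD(2)[OF f]] g, symmetric] amap_G'(2)[OF f] ..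
    also have "\<dots> = (g \<cdot>\<^bsub>D\<^esub> f) \<cdot>\<^bsub>D\<^esub> \<epsilon> S" by (rule D.Cmp_assoc[OF eps[OF objD(1)[OF f]] f g])
    finally show "\<epsilon> Q \<cdot>\<^bsub>D\<^esub> amap F (amap G (g \<cdot>\<^bsub>D\<^esub> f)) = \<epsilon> Q \<cdot>\<^bsub>D\<^esub> amap F (amap G g \<cdot>\<^bsub>C\<^esub> amap G f)"
      unfolding amap_G'(2)[OF gf] by simp
  qed
  have Gf: "is_functor D C G"
    unfolding is_functor_def using G amap_G'(1) GI GC C.category_axioms D.category_axioms by auto
  have nat: "\<eta> B \<cdot>\<^bsub>C\<^esub> f = amap G (amap F f) \<cdot>\<^bsub>C\<^esub> \<eta> A" if f: "f \<in> Hom C A B" for A B f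
  proof (rule uniq[OF objC(1)[OF f] Fs(1)[OF objC(2)[OF f]]])
    note A = objC(1)[OF f] and B = objC(2)[OF f]
    note Ff = Fs(2)[OF f]
    show "\<eta> B \<cdot>\<^bsub>C\<^esub> f \<in> Hom C A (omap G (omap F B))" by (rule C.Cmp_Hom[OF f eta(1)[OF B]])
    show "amap G (amap F f) \<cdot>\<^bsub>C\<^esub> \<eta> A \<in> Hom C A (omap G (omap F B))" by (rule C.Cmp_Hom[OF eta(1)[OF A] amap_G'(1)[OF Ff]])
    have "\<epsilon> (omap F B) \<cdot>\<^bsub>D\<^esub> amap F (amap G (amap F f) \<cdot>\<^bsub>C\<^esub> \<eta> A) = (amap F f \<cdot>\<^bsub>D\<^esub> \<epsilon> (omap F A)) \<cdot>\<^bsub>D\<^esub> amap F (\<eta> A)"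
      unfolding eF[OF eta(1)[OF A] amap_G'(1)[OF Ff] Fs(1)[OF B]] amap_G'(2)[OF Ff] ..
    also have "\<dots> = amap F f"
      unfolding D.Cmp_assoc[OF Fs(2)[OF eta(1)[OF A]] eps[OF Fs(1)[OF A]] Ff, symmetric] eta(2)[OF A] by (rule D.Cmp_Ident[OF Ff])
    finally show "\<epsilon> (omap F B) \<cdot>\<^bsub>D\<^esub> amap F (\<eta> B \<cdot>\<^bsub>C\<^esub> f) = \<epsilon> (omap F B) \<cdot>\<^bsub>D\<^esub> amap F (amap G (amap F f) \<cdot>\<^bsub>C\<^esub> \<eta> A)"
      unfolding eF[OF f eta(1)[OF B] Fs(1)[OF B]] eta(2)[OF B] D.Ident_Cmp[OF Ff] by simp
  qed
  have tri: "amap G (\<epsilon> S) \<cdot>\<^bsub>C\<^esub> \<eta> (omap G S) = Ident C (omap G S)" if S: "S \<in> Obj D" for S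
  proof (rule uniq[OF G[OF S] S])
    note GS = G[OF S] and e = amap_G'[OF eps[OF S]]
    show "amap G (\<epsilon> S) \<cdot>\<^bsub>C\<^esub> \<eta> (omap G S) \<in> Hom C (omap G S) (omap G S)" by (rule C.Cmp_Hom[OF eta(1)[OF GS] e(1)])
    show "Ident C (omap G S) \<in> Hom C (omap G S) (omap G S)" by (rule C.Ident_Hom[OF GS])
    show "\<epsilon> S \<cdot>\<^bsub>D\<^esub> amap F (amap G (\<epsilon> S) \<cdot>\<^bsub>C\<^esub> \<eta> (omap G S)) = \<epsilon> S \<cdot>\<^bsub>D\<^esub> amap F (Ident C (omap G S))"
      unfolding eF[OF eta(1)[OF GS] e(1) S] e(2) D.Cmp_assoc[OF Fs(2)[OF eta(1)[OF GS]] eps[OF Fs(1)[OF GS]] eps[OF S], symmetric] eta(2)[OF GS] Fs(3)[OF GS] ..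
  qed
  have comp: "is_functor C C (comp_functor G F)" "is_functor D D (comp_functor F G)"
    using F Gf unfolding is_functor_def comp_functor_def by auto
  have ids: "is_functor C C id_functor" "is_functor D D id_functor"
    using F unfolding is_functor_def id_functor_def by (auto intro: C.Dom_Obj C.Cod_Obj D.Dom_Obj D.Cod_Obj)
  have "is_nat_trans C C id_functor (comp_functor G F) \<eta>"
    unfolding is_nat_trans_def using comp ids eta(1) nat by (auto simp: id_functor_def comp_functor_def)
  moreover have "is_nat_trans D D (comp_functor F G) id_functor \<epsilon>"
    unfolding is_nat_trans_def using comp ids eps amap_G'(2) by (auto simp: id_functor_def comp_functor_def)
  ultimately show ?thesis
    unfolding is_adjunction_def using F Gf eta(2) tri by auto
qed

section \<open>The two categories and the functor to internal categories\<close>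

context star_points
begin

lemma is_icat_mor_id:
  assumes "is_icat V T S"
  shows "is_icat_mor V T S S (Ident V (iX0 S)) (Ident V (iX1 S))"
proof -
  interpret icat small V one T S by unfold_locales (rule assms)
  have "ipair ipr1 ipr2 = Ident V (pb V (il S) (TA (ir S)))"
    by (rule pb_eqI[of "il S" "TA (ir S)"]) simp_all
  then show ?thesis by (simp add: is_icat_mor_def)
qed

lemma is_icat_mor_comp:
  assumes S: "is_icat V T S" and R: "is_icat V T R" and Q: "is_icat V T Q"
    and f: "is_icat_mor V T S R f\<^sub>0 f\<^sub>1" and g: "is_icat_mor V T R Q g\<^sub>0 g\<^sub>1"
  shows "is_icat_mor V T S Q (g\<^sub>0 \<cdot> f\<^sub>0) (g\<^sub>1 \<cdot> f\<^sub>1)"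
proof -
  interpret S: icat small V one T S by unfold_locales (rule S)
  interpret R: icat small V one T R by unfold_locales (rule R)
  interpret Q: icat small V one T Q by unfold_locales (rule Q)
  have fs: "f\<^sub>0 \<in> Arr V" "Dom V f\<^sub>0 = S.Y" "Cod V f\<^sub>0 = R.Y" "f\<^sub>1 \<in> Arr V" "Dom V f\<^sub>1 = S.Y1" "Cod V f\<^sub>1 = R.Y1"
    and fl: "il R \<cdot> f\<^sub>1 = TA f\<^sub>0 \<cdot> il S" and fr: "ir R \<cdot> f\<^sub>1 = f\<^sub>0 \<cdot> ir S" and fu: "f\<^sub>1 \<cdot> iun S = iun R \<cdot> f\<^sub>0"
    and fm: "f\<^sub>1 \<cdot> imu S = imu R \<cdot> R.ipair (f\<^sub>1 \<cdot> S.ipr1) (TA f\<^sub>1 \<cdot> S.ipr2)"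
    using f by (simp_all add: is_icat_mor_def)
  have gs: "g\<^sub>0 \<in> Arr V" "Dom V g\<^sub>0 = R.Y" "Cod V g\<^sub>0 = Q.Y" "g\<^sub>1 \<in> Arr V" "Dom V g\<^sub>1 = R.Y1" "Cod V g\<^sub>1 = Q.Y1"
    and gl: "il Q \<cdot> g\<^sub>1 = TA g\<^sub>0 \<cdot> il R" and gr: "ir Q \<cdot> g\<^sub>1 = g\<^sub>0 \<cdot> ir R" and gu: "g\<^sub>1 \<cdot> iun R = iun Q \<cdot> g\<^sub>0"
    and gm: "g\<^sub>1 \<cdot> imu R = imu Q \<cdot> Q.ipair (g\<^sub>1 \<cdot> R.ipr1) (TA g\<^sub>1 \<cdot> R.ipr2)"
    using g by (simp_all add: is_icat_mor_def)
  note [simp] = fs gs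
  have l: "il Q \<cdot> (g\<^sub>1 \<cdot> f\<^sub>1) = TA (g\<^sub>0 \<cdot> f\<^sub>0) \<cdot> il S"
    using Cmp_extend[OF gl, of f\<^sub>1] fl by simp
  have r: "ir Q \<cdot> (g\<^sub>1 \<cdot> f\<^sub>1) = (g\<^sub>0 \<cdot> f\<^sub>0) \<cdot> ir S"
    using Cmp_extend[OF gr, of f\<^sub>1] fr by simp
  have u: "(g\<^sub>1 \<cdot> f\<^sub>1) \<cdot> iun S = iun Q \<cdot> (g\<^sub>0 \<cdot> f\<^sub>0)"
    using Cmp_extend[OF gu, of f\<^sub>0] fu by simp
  \<comment> \<open>Compatibility with the legs suffices to induce an arrow between objects of
    composable pairs. It is stated for arbitrary internal categories in order to serve both factors
    of the composite.\<close>
  have com: "il P \<cdot> (h\<^sub>1 \<cdot> pb1 V (il K) (TA (ir K))) = TA (ir P) \<cdot> (TA h\<^sub>1 \<cdot> pb2 V (il K) (TA (ir K)))"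
    if K: "is_icat V T K" and P: "is_icat V T P" and h: "h\<^sub>0 \<in> Arr V" "Dom V h\<^sub>0 = iX0 K" "Cod V h\<^sub>0 = iX0 P" "h\<^sub>1 \<in> Arr V" "Dom V h\<^sub>1 = iX1 K" "Cod V h\<^sub>1 = iX1 P"
      "il P \<cdot> h\<^sub>1 = TA h\<^sub>0 \<cdot> il K" "ir P \<cdot> h\<^sub>1 = h\<^sub>0 \<cdot> ir K" for K P h\<^sub>0 h\<^sub>1
  proof -
    interpret K: icat small V one T K by unfold_locales (rule K)
    interpret P: icat small V one T P by unfold_locales (rule P)
    have Tr: "TA h\<^sub>0 \<cdot> TA (ir K) = TA (ir P) \<cdot> TA h\<^sub>1" by (rule T_commute[OF h(8)[symmetric]]) (use h(1-6) in simp_all)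
    have "il P \<cdot> (h\<^sub>1 \<cdot> K.ipr1) = TA h\<^sub>0 \<cdot> (il K \<cdot> K.ipr1)" by (rule Cmp_extend[OF h(7)]) (use h(1-6) in simp_all)
    also have "il K \<cdot> K.ipr1 = TA (ir K) \<cdot> K.ipr2" by simp
    also have "TA h\<^sub>0 \<cdot> (TA (ir K) \<cdot> K.ipr2) = TA (ir P) \<cdot> (TA h\<^sub>1 \<cdot> K.ipr2)" by (rule Cmp_extend[OF Tr]) (use h(1-6) in simp_all)
    finally show ?thesis .
  qed
  note cf = com[OF S R fs fl fr] and cg = com[OF R Q gs gl gr]
  let ?H = "R.ipair (f\<^sub>1 \<cdot> S.ipr1) (TA f\<^sub>1 \<cdot> S.ipr2)"
  have H: "?H \<in> Arr V" "Dom V ?H = pb V (il S) (TA (ir S))" "Cod V ?H = pb V (il R) (TA (ir R))" "R.ipr1 \<cdot> ?H = f\<^sub>1 \<cdot> S.ipr1" "R.ipr2 \<cdot> ?H = TA f\<^sub>1 \<cdot> S.ipr2"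
    using cf by simp_all
  let ?K = "Q.ipair (g\<^sub>1 \<cdot> R.ipr1) (TA g\<^sub>1 \<cdot> R.ipr2)"
  have K: "?K \<in> Arr V" "Dom V ?K = pb V (il R) (TA (ir R))" "Cod V ?K = pb V (il Q) (TA (ir Q))"
    using cg by simp_all
  have "(g\<^sub>1 \<cdot> f\<^sub>1) \<cdot> imu S = g\<^sub>1 \<cdot> (imu R \<cdot> ?H)" using fm by simp
  also have "\<dots> = (imu Q \<cdot> ?K) \<cdot> ?H" by (rule Cmp_extend1[OF gm]) (use H(1-3) K in simp_all)
  also have "\<dots> = imu Q \<cdot> (?K \<cdot> ?H)" by (rule assoc_right) (use H(1-3) K in simp_all)
  also have "?K \<cdot> ?H = Q.ipair ((g\<^sub>1 \<cdot> R.ipr1) \<cdot> ?H) ((TA g\<^sub>1 \<cdot> R.ipr2) \<cdot> ?H)"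
    by (rule pb_pair_Cmp[OF _ _ _ _ _ _ _ _ cg]) (use H(1-3) in simp_all)
  also have "(g\<^sub>1 \<cdot> R.ipr1) \<cdot> ?H = g\<^sub>1 \<cdot> (R.ipr1 \<cdot> ?H)" by (rule assoc_right) (use H(1-3) in simp_all)
  also have "(TA g\<^sub>1 \<cdot> R.ipr2) \<cdot> ?H = TA g\<^sub>1 \<cdot> (R.ipr2 \<cdot> ?H)" by (rule assoc_right) (use H(1-3) in simp_all)
  also have "g\<^sub>1 \<cdot> (R.ipr1 \<cdot> ?H) = (g\<^sub>1 \<cdot> f\<^sub>1) \<cdot> S.ipr1" unfolding H(4) by simp
  also have "TA g\<^sub>1 \<cdot> (R.ipr2 \<cdot> ?H) = TA (g\<^sub>1 \<cdot> f\<^sub>1) \<cdot> S.ipr2" unfolding H(5) by simp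
  finally have m: "(g\<^sub>1 \<cdot> f\<^sub>1) \<cdot> imu S = imu Q \<cdot> Q.ipair ((g\<^sub>1 \<cdot> f\<^sub>1) \<cdot> S.ipr1) (TA (g\<^sub>1 \<cdot> f\<^sub>1) \<cdot> S.ipr2)" .
  have t: "g\<^sub>0 \<cdot> f\<^sub>0 \<in> Hom V S.Y Q.Y" "g\<^sub>1 \<cdot> f\<^sub>1 \<in> Hom V S.Y1 Q.Y1" by simp_all
  show ?thesis unfolding is_icat_mor_def using t l r u m by blast
qed

lemma is_icat_morD:
  assumes "is_icat_mor V T S R f\<^sub>0 f\<^sub>1"
  shows "f\<^sub>0 \<in> Arr V" "Dom V f\<^sub>0 = iX0 S" "Cod V f\<^sub>0 = iX0 R" "f\<^sub>1 \<in> Arr V" "Dom V f\<^sub>1 = iX1 S" "Cod V f\<^sub>1 = iX1 R"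
  using assms by (simp_all add: is_icat_mor_def)

lemma category_Int_Cat: "category (Int_Cat V T)"
proof
  fix f A B assume "f \<in> Hom (Int_Cat V T) A B"
  then show "Cmp (Int_Cat V T) f (Ident (Int_Cat V T) A) = f" "Cmp (Int_Cat V T) (Ident (Int_Cat V T) B) f = f"
    using is_icat_morD[of A B] by (auto simp: Int_Cat_def)
next
  fix f g A B D assume "f \<in> Hom (Int_Cat V T) A B" "g \<in> Hom (Int_Cat V T) B D"
  then show "Cmp (Int_Cat V T) g f \<in> Hom (Int_Cat V T) A D"
    using is_icat_mor_comp[of A B D] by (auto simp: Int_Cat_def)
  fix h E assume "f \<in> Hom (Int_Cat V T) A B" "g \<in> Hom (Int_Cat V T) B D" "h \<in> Hom (Int_Cat V T) D E"
  then show "Cmp (Int_Cat V T) h (Cmp (Int_Cat V T) g f) = Cmp (Int_Cat V T) (Cmp (Int_Cat V T) h g) f"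
    using is_icat_morD[of A B] is_icat_morD[of B D] is_icat_morD[of D E] by (auto simp: Int_Cat_def)
qed (auto simp: Int_Cat_def is_icat_mor_id)

lemma is_ecat_morD:
  assumes "is_ecat_mor small V one T A B f \<zeta>"
  shows "f \<in> eX A \<rightarrow>\<^sub>E eX B" "mcell \<zeta>" "cdom \<zeta> = ea A" "ccod \<zeta> = ea B"
  using assms by (simp_all add: is_ecat_mor_def)

lemma compose_idf: "f \<in> X \<rightarrow>\<^sub>E Y \<Longrightarrow> compose X f (idf X) = f" "f \<in> X \<rightarrow>\<^sub>E Y \<Longrightarrow> compose X (idf Y) f = f"
  by (rule extensionalityI[of _ X]; auto simp: compose_def PiE_def)+

lemma category_Enr_Cat: "category (Enr_Cat small V one T)"
proof
  fix f A B assume "f \<in> Hom (Enr_Cat small V one T) A B"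
  then show "Cmp (Enr_Cat small V one T) f (Ident (Enr_Cat small V one T) A) = f"
      "Cmp (Enr_Cat small V one T) (Ident (Enr_Cat small V one T) B) f = f"
    using is_ecat_morD[of A B] vcomp_mcid_right vcomp_mcid_left compose_idf by (fastforce simp: Enr_Cat_def)+
next
  fix f g A B D assume "f \<in> Hom (Enr_Cat small V one T) A B" "g \<in> Hom (Enr_Cat small V one T) B D"
  then show "Cmp (Enr_Cat small V one T) g f \<in> Hom (Enr_Cat small V one T) A D"
    using is_ecat_mor_comp[of A B D] by (auto simp: Enr_Cat_def)
  fix h E assume 1: "f \<in> Hom (Enr_Cat small V one T) A B" "g \<in> Hom (Enr_Cat small V one T) B D" "h \<in> Hom (Enr_Cat small V one T) D E"
  obtain f0 f1 g0 g1 h0 h1 where f: "f = (A, B, f0, f1)" "is_ecat_mor small V one T A B f0 f1" and g: "g = (B, D, g0, g1)" "is_ecat_mor small V one T B D g0 g1"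
    and h: "h = (D, E, h0, h1)" "is_ecat_mor small V one T D E h0 h1"
    using 1 by (cases f, cases g, cases h) (auto simp: Enr_Cat_def)
  have "vcomp V h1 (vcomp V g1 f1) = vcomp V (vcomp V h1 g1) f1"
    by (rule vcomp_assoc) (use is_ecat_morD[OF f(2)] is_ecat_morD[OF g(2)] is_ecat_morD[OF h(2)] in simp_all)
  moreover have "compose (eX A) h0 (compose (eX A) g0 f0) = compose (eX A) (compose (eX B) h0 g0) f0"
    by (rule compose_assoc) (use is_ecat_morD(1)[OF f(2)] in \<open>simp add: PiE_def\<close>)
  ultimately show "Cmp (Enr_Cat small V one T) h (Cmp (Enr_Cat small V one T) g f) = Cmp (Enr_Cat small V one T) (Cmp (Enr_Cat small V one T) h g) f"
    unfolding f(1) g(1) h(1) by (simp add: Enr_Cat_def)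
qed (auto simp: Enr_Cat_def is_ecat_mor_id)

lemma is_icat_star_ecat: "is_ecat small V one T A \<Longrightarrow> is_icat V T (star_ecat V one T A)"
proof -
  assume A: "is_ecat small V one T A"
  interpret A: pre_ecat small V one T A by (rule pre_ecat_if_is_ecat[OF A])
  show ?thesis using A A.is_icat_star A.is_ecat_iff by blast
qed

lemma is_icat_mor_star_ecat:
  assumes "is_ecat small V one T A" "is_ecat small V one T B" "is_ecat_mor small V one T A B f \<zeta>"
  shows "is_icat_mor V T (star_ecat V one T A) (star_ecat V one T B) (copow_map V one (eX A) (eX B) f) (smap (star_cell V one \<zeta>))"
proof -
  interpret pre_ecat_mor small V one T A B f \<zeta> by (rule pre_ecat_mor_if_is_ecat_mor[OF assms])
  show ?thesis using is_icat_mor_star is_ecat_mor_iff assms(3) by blast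
qed

lemma is_functor_star: "is_functor (Enr_Cat small V one T) (Int_Cat V T) (star_functor V one T)"
  unfolding is_functor_def
proof (intro conjI ballI impI)
  fix A assume "A \<in> Obj (Enr_Cat small V one T)"
  then have A: "is_ecat small V one T A" by (simp add: Enr_Cat_def)
  interpret A: pre_ecat small V one T A by (rule pre_ecat_if_is_ecat[OF A])
  show "omap (star_functor V one T) A \<in> Obj (Int_Cat V T)" using is_icat_star_ecat[OF A] by (simp add: star_functor_def Int_Cat_def)
  have "smap (star_cell V one (mcid V A.a)) = Ident V (mtot V A.a)" by (rule star_cell_mcid) simp
  then show "amap (star_functor V one T) (Ident (Enr_Cat small V one T) A) = Ident (Int_Cat V T) (omap (star_functor V one T) A)"
    by (simp add: star_functor_def Int_Cat_def Enr_Cat_def A.star_ecat_simps)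
next
  fix f assume "f \<in> Arr (Enr_Cat small V one T)"
  then obtain A B f0 \<zeta> where f: "f = (A, B, f0, \<zeta>)" "is_ecat small V one T A" "is_ecat small V one T B" "is_ecat_mor small V one T A B f0 \<zeta>"
    by (auto simp: Enr_Cat_def)
  show "amap (star_functor V one T) f \<in> Hom (Int_Cat V T) (omap (star_functor V one T) (Dom (Enr_Cat small V one T) f)) (omap (star_functor V one T) (Cod (Enr_Cat small V one T) f))"
    using is_icat_mor_star_ecat[OF f(2-4)] is_icat_star_ecat[OF f(2)] is_icat_star_ecat[OF f(3)] unfolding f(1) by (simp add: star_functor_def Int_Cat_def Enr_Cat_def)
  fix g assume "g \<in> Arr (Enr_Cat small V one T)" "Dom (Enr_Cat small V one T) g = Cod (Enr_Cat small V one T) f"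
  then obtain E g0 \<xi> where g: "g = (B, E, g0, \<xi>)" "is_ecat small V one T E" "is_ecat_mor small V one T B E g0 \<xi>"
    unfolding f(1) by (auto simp: Enr_Cat_def)
  have sm: "small (eX A)" "small (eX B)" "small (eX E)" using f(2,3) g(2) by (simp_all add: is_ecat_def)
  show "amap (star_functor V one T) (Cmp (Enr_Cat small V one T) g f) = Cmp (Int_Cat V T) (amap (star_functor V one T) g) (amap (star_functor V one T) f)"
    unfolding f(1) g(1) using copow_map_compose[OF sm is_ecat_morD(1)[OF f(4)] is_ecat_morD(1)[OF g(3)]]
      star_cell_vcomp[OF is_ecat_morD(2)[OF f(4)] is_ecat_morD(2)[OF g(3)]] is_ecat_morD[OF f(4)] is_ecat_morD[OF g(3)]
    by (simp add: star_functor_def Int_Cat_def Enr_Cat_def)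
qed (rule category_Enr_Cat category_Int_Cat)+

end

lemma restrict_eqI: "(\<And>x. x \<in> X \<Longrightarrow> f x = g x) \<Longrightarrow> X = X' \<Longrightarrow> restrict f X = restrict g X'"
  by (auto simp: restrict_def)

section \<open>Transposing a morphism along the counit\<close>

locale transpose = A: pre_ecat small V one T A + S: icat small V one T S
  for small :: "'a set \<Rightarrow> bool" and V :: "('o, 'a) cat" (structure) and one :: 'o and T :: "('o, 'a) monad_data"
    and A :: "('o, 'a) ecat" and S :: "('o, 'a) icat" +
  fixes g0 g1 :: 'a
  assumes mor: "is_icat_mor V T (star_ecat V one T A) S g0 g1"
begin

lemma g_simps [simp]: "g0 \<in> Arr V" "Dom V g0 = copow V one A.X" "Cod V g0 = S.Y" "g1 \<in> Arr V" "Dom V g1 = mtot V A.a" "Cod V g1 = S.Y1"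
  using mor by (simp_all add: is_icat_mor_def A.star_ecat_simps)

lemma g_laws:
  "il S \<cdot> g1 = A.TA g0 \<cdot> A.L" "ir S \<cdot> g1 = g0 \<cdot> A.R" "g1 \<cdot> A.ups = iun S \<cdot> g0"
  "g1 \<cdot> A.M = imu S \<cdot> S.ipair (g1 \<cdot> pb1 V A.L (A.TA A.R)) (A.TA g1 \<cdot> pb2 V A.L (A.TA A.R))"
  using mor unfolding is_icat_mor_def A.star_ecat_simps by blast+

definition tfun :: "'a \<Rightarrow> 'a" where
  "tfun = (\<lambda>x \<in> A.X. g0 \<cdot> copow_incl V one A.X x)"

abbreviation "F \<equiv> amap (endo T) (copow_map V one (eX A) (pts V one (iX0 S)) tfun)"

lemma tfun_simps [simp]: "x \<in> A.X \<Longrightarrow> tfun x = g0 \<cdot> copow_incl V one A.X x" "tfun \<in> A.X \<rightarrow>\<^sub>E S.pX"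
  by (auto simp: tfun_def)

lemma tfun_mem: "x \<in> A.X \<Longrightarrow> tfun x \<in> S.pX"
  by (rule PiE_mem[OF tfun_simps(2)])

lemma eps_fun: "eps_obj V one S.Y \<cdot> copow_map V one A.X S.pX tfun = g0"
  by (rule A.copow_eqI[of A.X]) simp_all

text \<open>The restricted matrix has at \<open>F \<cdot> x\<close> the fibre of \<open>S\<close>
  over \<open>E \<cdot> (F \<cdot> x)\<close>. By this equation it is the fibre over
  \<open>T g0 \<cdot> x\<close>, into which \<open>g1\<close> carries the summands with source
  \<open>x\<close>.\<close>

lemma E_F: "x \<in> A.Pts A.X \<Longrightarrow> S.E \<cdot> (F \<cdot> x) = A.TA g0 \<cdot> x"
  by (rule A.Cmp_extend1[OF A.T_commute1[OF eps_fun]]) simp_all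

definition tcell :: "('o, 'a) mcell" where
  "tcell = \<lparr>cdom = A.a, ccod = S.pm, cleft = Tb_fun V one T A.X S.pX tfun, cright = tfun,
     cmap = (\<lambda>(x, y) \<in> A.Pts A.X \<times> A.X. fib_lift V one S.b (S.E \<cdot> (F \<cdot> x), g0 \<cdot> copow_incl V one A.X y) (g1 \<cdot> mtot_incl V A.a (x, y)))\<rparr>"

lemma tcell_simps [simp]: "cdom tcell = A.a" "ccod tcell = S.pm" "cleft tcell = Tb_fun V one T A.X S.pX tfun" "cright tcell = tfun"
  by (simp_all add: tcell_def)

lemma tcell_cmap:
  assumes "x \<in> A.Pts A.X" "y \<in> A.X"
  shows "cmap tcell (x, y) \<in> Arr V" "Dom V (cmap tcell (x, y)) = ment A.a (x, y)" (is ?A) "Cod V (cmap tcell (x, y)) = fib V S.b (S.E \<cdot> (F \<cdot> x), tfun y)" (is ?B)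
    "fib_incl V S.b (S.E \<cdot> (F \<cdot> x), tfun y) \<cdot> cmap tcell (x, y) = g1 \<cdot> mtot_incl V A.a (x, y)"
proof -
  let ?h = "g1 \<cdot> mtot_incl V A.a (x, y)"
  have "il S \<cdot> ?h = (A.TA g0 \<cdot> A.L) \<cdot> mtot_incl V A.a (x, y)" by (rule A.Cmp_extend1[OF g_laws(1)]) (use assms in simp_all)
  then have l: "il S \<cdot> ?h = (S.E \<cdot> (F \<cdot> x)) \<cdot> bang V one (Dom V ?h)" unfolding E_F[OF assms(1)] using assms by simp
  have "ir S \<cdot> ?h = (g0 \<cdot> A.R) \<cdot> mtot_incl V A.a (x, y)" by (rule A.Cmp_extend1[OF g_laws(2)]) (use assms in simp_all)
  then have r: "ir S \<cdot> ?h = (g0 \<cdot> copow_incl V one A.X y) \<cdot> bang V one (Dom V ?h)" using assms by simp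
  have c: "cmap tcell (x, y) = fib_lift V one S.b (S.E \<cdot> (F \<cdot> x), g0 \<cdot> copow_incl V one A.X y) ?h" using assms by (simp add: tcell_def)
  let ?v = "S.E \<cdot> (F \<cdot> x)" and ?w = "g0 \<cdot> copow_incl V one A.X y"
  have p: "?v \<in> Arr V" "?w \<in> Arr V" "Dom V ?v = one" "Dom V ?w = one" "Cod V ?v = Cod V (sl S.b)" "Cod V ?w = Cod V (sr S.b)"
    "?h \<in> Arr V" "Cod V ?h = Dom V (sl S.b)" using assms by simp_all
  have lr: "sl S.b \<cdot> ?h = ?v \<cdot> bang V one (Dom V ?h)" "sr S.b \<cdot> ?h = ?w \<cdot> bang V one (Dom V ?h)"
    unfolding S.icat_span_simps by (rule l r)+
  note f = A.fib_lift_simps[OF S.icat_span_simps(3) p lr]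
  show "cmap tcell (x, y) \<in> Arr V" ?B
    "fib_incl V S.b (S.E \<cdot> (F \<cdot> x), tfun y) \<cdot> cmap tcell (x, y) = ?h"
    unfolding c tfun_simps(1)[OF assms(2)] by (rule f)+
  show ?A unfolding c f(2) using assms by simp
qed

lemma mcell_cell: "A.mcell tcell"
proof (rule A.mcellI)
  show "cleft tcell \<in> extensional (msrc (cdom tcell))" by (simp add: Tb_fun_def pts_map_def)
  show "cright tcell \<in> extensional (mtgt (cdom tcell))" by (simp add: tfun_def)
  show "cmap tcell \<in> extensional (msrc (cdom tcell) \<times> mtgt (cdom tcell))" by (simp add: tcell_def)
  fix x y assume "x \<in> msrc (cdom tcell)" "y \<in> mtgt (cdom tcell)"
  then have xy: "x \<in> A.Pts A.X" "y \<in> A.X" by simp_all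
  show "cmap tcell (x, y) \<in> Arr V \<and> Dom V (cmap tcell (x, y)) = ment (cdom tcell) (x, y) \<and> Cod V (cmap tcell (x, y)) = ment (ccod tcell) (cleft tcell x, cright tcell y)"
    using tcell_cmap[OF xy] xy by simp
qed simp_all

end

sublocale transpose \<subseteq> m: pre_ecat_mor small V one T A "pts_icat V one T S" tfun tcell
  by unfold_locales (use mcell_cell in simp_all)

context transpose
begin

lemma inc_cell:
  assumes "x \<in> A.Pts A.X" "y \<in> A.X" "k \<in> Arr V" "Cod V k = ment A.a (x, y)"
  shows "fib_incl V S.b (S.E \<cdot> (F \<cdot> x), tfun y) \<cdot> (cmap tcell (x, y) \<cdot> k) = g1 \<cdot> (mtot_incl V A.a (x, y) \<cdot> k)"
proof -
  note c = tcell_cmap[OF assms(1,2)]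
  have "fib_incl V S.b (S.E \<cdot> (F \<cdot> x), tfun y) \<cdot> (cmap tcell (x, y) \<cdot> k) = (g1 \<cdot> mtot_incl V A.a (x, y)) \<cdot> k"
    by (rule A.Cmp_extend1[OF c(4)]) (use c(1-3) assms in simp_all)
  then show ?thesis using assms by simp
qed

text \<open>Existence in the universal property on arrows: on each summand, the counit is the fibre
  inclusion and so undoes the lifting by which \<open>tcell\<close> is defined.\<close>

lemma eps1_Z: "S.eps1 \<cdot> m.Z = g1"
proof (rule A.mtot_eqI[of A.a])
  fix x y assume "x \<in> msrc A.a" "y \<in> mtgt A.a"
  then have xy: "x \<in> A.Pts A.X" "y \<in> A.X" by simp_all
  note c = tcell_cmap[OF xy]
  have "(S.eps1 \<cdot> m.Z) \<cdot> mtot_incl V A.a (x, y) = S.eps1 \<cdot> (mtot_incl V S.pm (F \<cdot> x, tfun y) \<cdot> cmap tcell (x, y))"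
    using xy by (simp del: tfun_simps(1))
  also have "\<dots> = fib_incl V S.b (S.E \<cdot> (F \<cdot> x), tfun y) \<cdot> cmap tcell (x, y)"
    by (rule S.eps1_simps(5)) (use xy c in simp_all)
  finally show "(S.eps1 \<cdot> m.Z) \<cdot> mtot_incl V A.a (x, y) = g1 \<cdot> mtot_incl V A.a (x, y)" unfolding c(4) .
qed simp_all

text \<open>After the fibre inclusion both sides are the unit of \<open>S\<close> at the point
  \<open>tfun x\<close>: one by compatibility of \<open>g1\<close> with units, the other by the
  definition of the unit on points.\<close>

lemma mor_unit: m.mor_unit
  unfolding m.mor_unit_def
proof
  fix x assume x: "x \<in> A.X"
  have fx: "tfun x \<in> S.pX" using x by simp
  have e: "A.Eb A.X x \<in> A.Pts A.X" using x by simp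
  have Fe: "F \<cdot> A.Eb A.X x = A.Eb S.pX (tfun x)" using x tfun_mem[OF x] by (simp del: tfun_simps(1))
  note c = tcell_cmap[OF e x]
  have ug: "g1 \<cdot> (A.ups \<cdot> copow_incl V one A.X x) = (iun S \<cdot> g0) \<cdot> copow_incl V one A.X x"
    by (rule A.Cmp_extend1[OF g_laws(3)]) (use x in simp_all)
  have "fib_incl V S.b (S.E \<cdot> (F \<cdot> A.Eb A.X x), tfun x) \<cdot> (cmap tcell (A.Eb A.X x, x) \<cdot> A.un x) = g1 \<cdot> (mtot_incl V A.a (A.Eb A.X x, x) \<cdot> A.un x)"
    by (rule inc_cell[OF e x]) (use x in simp_all)
  also have "\<dots> = iun S \<cdot> tfun x" using ug x by simp
  finally have l: "fib_incl V S.b (S.E \<cdot> A.Eb S.pX (tfun x), tfun x) \<cdot> (cmap tcell (A.Eb A.X x, x) \<cdot> A.un x) = iun S \<cdot> tfun x"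
    unfolding Fe .
  show "cmap tcell (A.Eb A.X x, x) \<cdot> A.un x = S.P.un (tfun x)"
    by (rule A.fib_mono[of S.b "S.E \<cdot> A.Eb S.pX (tfun x)" "tfun x"])
      (use fx c[unfolded Fe] l S.P_un_inc[OF fx] S.P_un_simps[OF fx] x in \<open>simp_all del: tfun_simps(1)\<close>)
qed

text \<open>After the fibre inclusion both sides are the multiplication of \<open>S\<close> on the
  images of the two elements. For the first factor the image is formed by \<open>g1\<close>; for the
  second it is formed by \<open>T g1\<close>, which is \<open>T\<close> of the counit after
  \<open>T Z\<close> by \<open>eps1_Z\<close>.\<close>

lemma mor_mul: m.mor_mul
  unfolding m.mor_mul_def
proof (intro ballI allI impI)
  fix x y z g h h' assume 1: "x \<in> A.Pts (A.Pts A.X)" "y \<in> A.Pts A.X" "z \<in> A.X" "g \<in> Arr V" "h \<in> Arr V" "h' \<in> Arr V" "Dom V g = Dom V h" "Dom V h' = Dom V h"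
      "Cod V g = ment A.a (y, z)" "Cod V h = A.Tf A.a (x, y)" "Cod V h' = A.Tf (ea S.P) (m.FF \<cdot> x, m.F \<cdot> y)"
    and e: "A.\<phi> (ea S.P) (m.FF \<cdot> x, m.F \<cdot> y) \<cdot> h' = A.TA m.Z \<cdot> (A.\<phi> A.a (x, y) \<cdot> h)"
  have mx: "A.Mb A.X x \<in> A.Pts A.X" using 1(1) by simp
  have fz: "tfun z \<in> S.pX" by (rule tfun_mem[OF 1(3)])
  have Fx: "m.FF \<cdot> x \<in> A.Pts (A.Pts S.pX)" "m.F \<cdot> y \<in> A.Pts S.pX" using 1(1,2) by simp_all
  have MF: "F \<cdot> A.Mb A.X x = A.Mb S.pX (m.FF \<cdot> x)" using m.Mb_FF[OF 1(1)] by simp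
  note c = tcell_cmap[OF 1(2,3)] and cm = tcell_cmap[OF mx 1(3)]
  have cg: "cmap tcell (y, z) \<cdot> g \<in> Arr V" "Dom V (cmap tcell (y, z) \<cdot> g) = Dom V h'" "Cod V (cmap tcell (y, z) \<cdot> g) = fib V S.b (S.E \<cdot> (m.F \<cdot> y), tfun z)"
    using c 1 by simp_all
  have h': "Cod V h' = A.Tf S.pm (m.FF \<cdot> x, m.F \<cdot> y)" using 1(11) by simp
  note am = A.mul_simps(1-3)[OF 1(1-5,7,9,10)]
  let ?P = "pb_pair V A.L (A.TA A.R) (mtot_incl V A.a (y, z) \<cdot> g) (A.\<phi> A.a (x, y) \<cdot> h)"
  have P: "?P \<in> Arr V" "Dom V ?P = Dom V h" "Cod V ?P = pb V A.L (A.TA A.R)"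
    "pb1 V A.L (A.TA A.R) \<cdot> ?P = mtot_incl V A.a (y, z) \<cdot> g" "pb2 V A.L (A.TA A.R) \<cdot> ?P = A.\<phi> A.a (x, y) \<cdot> h" using 1 by simp_all
  let ?p1 = "pb1 V A.L (A.TA A.R)" and ?p2 = "pb2 V A.L (A.TA A.R)"
  have pc: "A.L \<cdot> ?p1 = A.TA A.R \<cdot> ?p2" by (rule A.pb_commute) simp_all
  have TR: "A.TA g0 \<cdot> A.TA A.R = A.TA (ir S) \<cdot> A.TA g1" by (rule A.T_commute[OF g_laws(2)[symmetric]]) simp_all
  have "il S \<cdot> (g1 \<cdot> ?p1) = A.TA g0 \<cdot> (A.L \<cdot> ?p1)" by (rule A.Cmp_extend[OF g_laws(1)]) simp_all
  also have "\<dots> = A.TA g0 \<cdot> (A.TA A.R \<cdot> ?p2)" unfolding pc ..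
  also have "\<dots> = A.TA (ir S) \<cdot> (A.TA g1 \<cdot> ?p2)" by (rule A.Cmp_extend[OF TR]) simp_all
  finally have com: "il S \<cdot> (g1 \<cdot> ?p1) = A.TA (ir S) \<cdot> (A.TA g1 \<cdot> ?p2)" .
  let ?Q = "S.ipair (g1 \<cdot> ?p1) (A.TA g1 \<cdot> ?p2)"
  have Q: "?Q \<in> Arr V" "Dom V ?Q = pb V A.L (A.TA A.R)" "Cod V ?Q = pb V (il S) (A.TA (ir S))" using com by simp_all
  have "fib_incl V S.b (S.E \<cdot> (F \<cdot> A.Mb A.X x), tfun z) \<cdot> (cmap tcell (A.Mb A.X x, z) \<cdot> A.mul x y z g h) = g1 \<cdot> (mtot_incl V A.a (A.Mb A.X x, z) \<cdot> A.mul x y z g h)"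
    by (rule inc_cell[OF mx 1(3) am(1,3)])
  \<comment> \<open>The elementwise multiplication of \<open>A\<close> is read as the multiplication
    of \<open>A * 1\<close> at a pairing, where multiplicativity of \<open>g1\<close> can be
    applied.\<close>
  also have "\<dots> = g1 \<cdot> (A.nu \<cdot> (inv_arr V (star_X2_map V one T A) \<cdot> ?P))" unfolding A.imu_pair[OF 1(1-5,7,9,10)] ..
  also have "\<dots> = g1 \<cdot> (A.M \<cdot> ?P)" using P(1-3) by simp
  also have "\<dots> = (imu S \<cdot> ?Q) \<cdot> ?P" by (rule A.Cmp_extend1[OF g_laws(4)]) (use P(1-3) in simp_all)
  also have "\<dots> = imu S \<cdot> (?Q \<cdot> ?P)" by (rule A.assoc_right) (use P(1-3) Q in simp_all)
  also have "?Q \<cdot> ?P = S.ipair ((g1 \<cdot> ?p1) \<cdot> ?P) ((A.TA g1 \<cdot> ?p2) \<cdot> ?P)"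
    by (rule A.pb_pair_Cmp[OF _ _ _ _ _ _ _ _ com]) (use P(1-3) in simp_all)
  also have "(g1 \<cdot> ?p1) \<cdot> ?P = g1 \<cdot> (?p1 \<cdot> ?P)" by (rule A.assoc_right) (use P(1-3) in simp_all)
  also have "(A.TA g1 \<cdot> ?p2) \<cdot> ?P = A.TA g1 \<cdot> (?p2 \<cdot> ?P)" by (rule A.assoc_right) (use P(1-3) in simp_all)
  also have "g1 \<cdot> (?p1 \<cdot> ?P) = fib_incl V S.b (S.E \<cdot> (m.F \<cdot> y), tfun z) \<cdot> (cmap tcell (y, z) \<cdot> g)"
    unfolding P(4) using inc_cell[OF 1(2,3,4,9)] by simp
  also have "A.TA g1 \<cdot> (?p2 \<cdot> ?P) = A.TA S.eps1 \<cdot> (A.TA m.Z \<cdot> (A.\<phi> A.a (x, y) \<cdot> h))"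
    unfolding P(5) by (rule A.Cmp_extend1[OF A.T_commute1[OF eps1_Z], symmetric]) (use 1 in simp_all)
  also have "A.TA m.Z \<cdot> (A.\<phi> A.a (x, y) \<cdot> h) = A.\<phi> S.pm (m.FF \<cdot> x, m.F \<cdot> y) \<cdot> h'" using e by simp
  finally have l: "fib_incl V S.b (S.E \<cdot> A.Mb S.pX (m.FF \<cdot> x), tfun z) \<cdot> (cmap tcell (A.Mb A.X x, z) \<cdot> A.mul x y z g h)
    = imu S \<cdot> S.ipair (fib_incl V S.b (S.E \<cdot> (m.F \<cdot> y), tfun z) \<cdot> (cmap tcell (y, z) \<cdot> g)) (A.TA S.eps1 \<cdot> (A.\<phi> S.pm (m.FF \<cdot> x, m.F \<cdot> y) \<cdot> h'))"
    unfolding MF .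
  note pi = S.P_mul_inc[OF Fx fz cg(1) 1(6) cg(2,3) h'] and ps = S.P_mul_simps[OF Fx fz cg(1) 1(6) cg(2,3) h']
  show "cmap tcell (A.Mb A.X x, z) \<cdot> A.mul x y z g h = S.P.mul (m.FF \<cdot> x) (m.F \<cdot> y) (tfun z) (cmap tcell (y, z) \<cdot> g) h'"
  proof (rule A.fib_mono[of S.b "S.E \<cdot> A.Mb S.pX (m.FF \<cdot> x)" "tfun z"])
    show "cmap tcell (A.Mb A.X x, z) \<cdot> A.mul x y z g h \<in> Arr V" using cm am by simp
    show "S.P.mul (m.FF \<cdot> x) (m.F \<cdot> y) (tfun z) (cmap tcell (y, z) \<cdot> g) h' \<in> Arr V" by (rule ps(1))
    show "Dom V (cmap tcell (A.Mb A.X x, z) \<cdot> A.mul x y z g h) = Dom V (S.P.mul (m.FF \<cdot> x) (m.F \<cdot> y) (tfun z) (cmap tcell (y, z) \<cdot> g) h')"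
      unfolding ps(2) using cm am 1(8) by simp
    show "Cod V (cmap tcell (A.Mb A.X x, z) \<cdot> A.mul x y z g h) = fib V S.b (S.E \<cdot> A.Mb S.pX (m.FF \<cdot> x), tfun z)"
      using cm(1-3) am unfolding MF by simp
    show "Cod V (S.P.mul (m.FF \<cdot> x) (m.F \<cdot> y) (tfun z) (cmap tcell (y, z) \<cdot> g) h') = fib V S.b (S.E \<cdot> A.Mb S.pX (m.FF \<cdot> x), tfun z)" by (rule ps(3))
    show "fib_incl V S.b (S.E \<cdot> A.Mb S.pX (m.FF \<cdot> x), tfun z) \<cdot> (cmap tcell (A.Mb A.X x, z) \<cdot> A.mul x y z g h) =
      fib_incl V S.b (S.E \<cdot> A.Mb S.pX (m.FF \<cdot> x), tfun z) \<cdot> S.P.mul (m.FF \<cdot> x) (m.F \<cdot> y) (tfun z) (cmap tcell (y, z) \<cdot> g) h'"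
      unfolding l pi ..
  qed (use Fx fz in simp_all)
qed

lemma is_ecat_mor_cell: "is_ecat_mor small V one T A S.P tfun tcell"
  using m.is_ecat_mor_iff mor_unit mor_mul by simp

text \<open>The equation on objects, evaluated at a summand of the copower, gives the value of
  \<open>f\<close>. The equation on arrows, restricted to a summand of \<open>a * 1\<close>, gives
  the composite of the component of \<zeta> with a fibre inclusion, which is monic.\<close>

lemma tcell_unique:
  assumes "pre_ecat_mor small V one T A S.P f \<zeta>" "eps_obj V one S.Y \<cdot> copow_map V one A.X S.pX f = g0" "S.eps1 \<cdot> smap (star_cell V one \<zeta>) = g1"
  shows "f = tfun" "\<zeta> = tcell"
proof -
  interpret n: pre_ecat_mor small V one T A S.P f \<zeta> by (rule assms(1))
  show f: "f = tfun"
  proof (rule PiE_ext)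
    show "f \<in> A.X \<rightarrow>\<^sub>E S.pX" using n.f by simp
    fix x assume x: "x \<in> A.X"
    have fx: "f x \<in> S.pX" using n.f_mem[OF x] by simp
    have "eps_obj V one S.Y \<cdot> (copow_map V one A.X S.pX f \<cdot> copow_incl V one A.X x) = g0 \<cdot> copow_incl V one A.X x"
      by (rule A.Cmp_extend1[OF assms(2)]) (use x n.f in simp_all)
    then show "f x = tfun x" using x fx n.f by simp
  qed simp
  show "\<zeta> = tcell"
  proof (rule A.mcell_eqI[OF n.cell(1) mcell_cell])
    fix x y assume "x \<in> msrc (cdom tcell)" "y \<in> mtgt (cdom tcell)"
    then have xy: "x \<in> A.Pts A.X" "y \<in> A.X" by simp_all
    have Fx: "F \<cdot> x \<in> A.Pts S.pX" and fy: "tfun y \<in> S.pX" using xy by simp_all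
    note c = tcell_cmap[OF xy]
    have z: "cmap \<zeta> (x, y) \<in> Arr V" "Dom V (cmap \<zeta> (x, y)) = ment A.a (x, y)" "Cod V (cmap \<zeta> (x, y)) = fib V S.b (S.E \<cdot> (F \<cdot> x), tfun y)"
      using A.mcellD(7-9)[OF n.cell(1), of x y] xy Fx fy by (simp_all add: f del: tfun_simps(1))
    have "S.eps1 \<cdot> (smap (star_cell V one \<zeta>) \<cdot> mtot_incl V A.a (x, y)) = g1 \<cdot> mtot_incl V A.a (x, y)"
      by (rule A.Cmp_extend1[OF assms(3)]) (use xy in simp_all)
    also have "smap (star_cell V one \<zeta>) \<cdot> mtot_incl V A.a (x, y) = mtot_incl V S.pm (F \<cdot> x, tfun y) \<cdot> cmap \<zeta> (x, y)"
      using xy by (simp add: f del: tfun_simps(1))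
    also have "S.eps1 \<cdot> (mtot_incl V S.pm (F \<cdot> x, tfun y) \<cdot> cmap \<zeta> (x, y)) = fib_incl V S.b (S.E \<cdot> (F \<cdot> x), tfun y) \<cdot> cmap \<zeta> (x, y)"
      by (rule S.eps1_simps(5)) (use xy z in simp_all)
    finally have e: "fib_incl V S.b (S.E \<cdot> (F \<cdot> x), tfun y) \<cdot> cmap \<zeta> (x, y) = g1 \<cdot> mtot_incl V A.a (x, y)" .
    show "cmap \<zeta> (x, y) = cmap tcell (x, y)"
      by (rule A.fib_mono[of S.b "S.E \<cdot> (F \<cdot> x)" "tfun y"]) (use Fx fy z c e in simp_all)
  qed (use f n.cell in simp_all)
qed

end

section \<open>Assembly of the adjunction\<close>

context star_points
begin

lemma icatI: "is_icat V T S \<Longrightarrow> icat small V one T S"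
  by unfold_locales

text \<open>The functor of points sends a morphism of internal categories to the transpose of its
  composite with the counit of its domain. This supplies the naturality square from which
  \<open>adjunction_if_universal\<close> derives functoriality of \<open>V(1, -)\<close>. The arrow
  \<open>e1\<close> is \<open>eps1\<close> at \<open>S\<close>, written out because \<open>S\<close>
  is not fixed here.\<close>

lemma transpose_pts_functor:
  assumes SR: "is_icat V T S" "is_icat V T R" and f: "is_icat_mor V T S R f\<^sub>0 f\<^sub>1"
  defines "e1 \<equiv> smap (svcomp V (eps_span V one (icat_span S)) (star_cell V one (pts_icat_restr V one T S)))"
  shows "transpose small V one T (pts_icat V one T S) R (f\<^sub>0 \<cdot> eps_obj V one (iX0 S)) (f\<^sub>1 \<cdot> e1)"
    "pts_map V one f\<^sub>0 = transpose.tfun V one (pts_icat V one T S) (f\<^sub>0 \<cdot> eps_obj V one (iX0 S))"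
    "pts_icat_factor V one T R (Tb_fun V one T (pts V one (iX0 S)) (pts V one (iX0 R)) (pts_map V one f\<^sub>0))
      (vcomp V (pts_cell V one (icat_mor_cell T S R f\<^sub>0 f\<^sub>1)) (pts_icat_restr V one T S))
      = transpose.tcell V one T (pts_icat V one T S) R (f\<^sub>0 \<cdot> eps_obj V one (iX0 S)) (f\<^sub>1 \<cdot> e1)"
proof -
  interpret S: icat small V one T S by (rule icatI[OF SR(1)])
  interpret R: icat small V one T R by (rule icatI[OF SR(2)])
  have e1: "e1 = S.eps1" unfolding e1_def S.eps1_def ..
  have fs: "f\<^sub>0 \<in> Arr V" "Dom V f\<^sub>0 = S.Y" "Cod V f\<^sub>0 = R.Y" "f\<^sub>1 \<in> Arr V" "Dom V f\<^sub>1 = S.Y1" "Cod V f\<^sub>1 = R.Y1"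
    and fl: "il R \<cdot> f\<^sub>1 = TA f\<^sub>0 \<cdot> il S" and fr: "ir R \<cdot> f\<^sub>1 = f\<^sub>0 \<cdot> ir S"
    using f by (simp_all add: is_icat_mor_def)
  note [simp] = fs
  \<comment> \<open>The composite to be transposed is a morphism because the category of points
    satisfies the enriched axioms and the counit is a morphism.\<close>
  interpret t: transpose small V one T S.P R "f\<^sub>0 \<cdot> eps_obj V one S.Y" "f\<^sub>1 \<cdot> S.eps1"
    by unfold_locales (rule is_icat_mor_comp[OF is_icat_star_ecat[OF S.is_ecat_P] SR S.counit_mor f])
  show "transpose small V one T S.P R (f\<^sub>0 \<cdot> eps_obj V one S.Y) (f\<^sub>1 \<cdot> e1)" unfolding e1 by (rule t.transpose_axioms)
  show tf: "pts_map V one f\<^sub>0 = t.tfun"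
    unfolding t.tfun_def pts_map_def by (rule restrict_eqI) simp_all
  let ?m = "icat_mor_cell T S R f\<^sub>0 f\<^sub>1"
  have m: "sdom ?m = S.b" "scod ?m = R.b" "sleft ?m = TA f\<^sub>0" "sright ?m = f\<^sub>0" "smap ?m = f\<^sub>1" by (simp_all add: icat_mor_cell_def)
  have sc: "is_scell V ?m" unfolding is_scell_def m using fl fr by simp
  let ?\<Phi> = "pts_icat_factor V one T R (Tb_fun V one T S.pX R.pX (pts_map V one f\<^sub>0)) (vcomp V (pts_cell V one ?m) S.restr)"
  have "?\<Phi> = t.tcell"
  proof (rule mcell.equality)
    show "cright ?\<Phi> = cright t.tcell" unfolding t.tcell_simps tf[symmetric] R.factor_simps vcomp_fields
      by (rule extensionalityI[of _ S.pX]) (simp_all add: m pts_map_def compose_def)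
    show "cmap ?\<Phi> = cmap t.tcell"
    proof (rule extensionalityI[of _ "Pts S.pX \<times> S.pX"])
      show "cmap ?\<Phi> \<in> extensional (Pts S.pX \<times> S.pX)" by (simp add: vcomp_def)
      show "cmap t.tcell \<in> extensional (Pts S.pX \<times> S.pX)" by (simp add: t.tcell_def)
      fix z assume "z \<in> Pts S.pX \<times> S.pX"
      then obtain x y where z: "z = (x, y)" "x \<in> Pts S.pX" "y \<in> S.pX" by (cases z) auto
      note c = pts_cell_cmap[OF sc, of "S.E \<cdot> x" y, unfolded m]
      have EF: "R.E \<cdot> (t.F \<cdot> x) = TA f\<^sub>0 \<cdot> (S.E \<cdot> x)" using t.E_F[of x] z(2) by simp
      have "cmap ?\<Phi> (x, y) = cmap (pts_cell V one ?m) (S.E \<cdot> x, y)"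
        using c(1-3) z(2,3) by simp
      \<comment> \<open>Both components are lifts into the same fibre: the action of
        \<open>V(1, -)\<close> on the 2-cell lifts the composite of its apex map with the fibre
        inclusion, and on each summand \<open>eps1\<close> is that fibre inclusion.\<close>
      also have "\<dots> = fib_lift V one R.b (TA f\<^sub>0 \<cdot> (S.E \<cdot> x), f\<^sub>0 \<cdot> y) (f\<^sub>1 \<cdot> fib_incl V S.b (S.E \<cdot> x, y))"
        using z(2,3) by (simp add: pts_cell_def m)
      also have "\<dots> = cmap t.tcell (x, y)" unfolding t.tcell_def using z(2,3) EF by simp
      finally show "cmap ?\<Phi> z = cmap t.tcell z" unfolding z(1) .
    qed
  qed (simp_all add: tf)
  then show "?\<Phi> = transpose.tcell V one T S.P R (f\<^sub>0 \<cdot> eps_obj V one S.Y) (f\<^sub>1 \<cdot> e1)" unfolding e1 .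
qed

theorem star_pts_adjunction:
  "\<exists>\<eta> \<epsilon>. is_adjunction (Enr_Cat small V one T) (Int_Cat V T) (star_functor V one T) (pts_functor V one T) \<eta> \<epsilon>"
proof -
  let ?C = "Enr_Cat small V one T" and ?D = "Int_Cat V T" and ?F = "star_functor V one T" and ?G = "pts_functor V one T"
  let ?e = "\<lambda>S. smap (svcomp V (eps_span V one (icat_span S)) (star_cell V one (pts_icat_restr V one T S)))"
  define \<epsilon> where "\<epsilon> S = (star_ecat V one T (pts_icat V one T S), S, eps_obj V one (iX0 S), ?e S)" for S
  have counit: "is_ecat small V one T (pts_icat V one T S)" "is_icat_mor V T (star_ecat V one T (pts_icat V one T S)) S (eps_obj V one (iX0 S)) (?e S)"
    if "is_icat V T S" for S
  proof -
    interpret icat small V one T S by (rule icatI[OF that])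
    show "is_ecat small V one T (pts_icat V one T S)" "is_icat_mor V T (star_ecat V one T (pts_icat V one T S)) S (eps_obj V one (iX0 S)) (?e S)"
      using is_ecat_P counit_mor unfolding eps1_def by simp_all
  qed
  have epsF: "Cmp ?D (\<epsilon> S) (amap ?F (A, pts_icat V one T S, f, \<zeta>)) =
      (star_ecat V one T A, S, eps_obj V one (iX0 S) \<cdot> copow_map V one (eX A) (eX (pts_icat V one T S)) f, ?e S \<cdot> smap (star_cell V one \<zeta>))" for A S f \<zeta>
    by (simp add: Int_Cat_def \<epsilon>_def star_functor_def)
  have "\<exists>\<eta>. is_adjunction ?C ?D ?F ?G \<eta> \<epsilon>"
  proof (rule adjunction_if_universal[OF is_functor_star])
    fix S assume "S \<in> Obj ?D"
    then have S: "is_icat V T S" by (simp add: Int_Cat_def)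
    show "omap ?G S \<in> Obj ?C" using counit[OF S] by (simp add: pts_functor_def Enr_Cat_def)
    show "\<epsilon> S \<in> Hom ?D (omap ?F (omap ?G S)) S"
      using counit[OF S] S is_icat_star_ecat by (simp add: pts_functor_def star_functor_def Int_Cat_def \<epsilon>_def)
  next
    fix A S g assume "A \<in> Obj ?C" "S \<in> Obj ?D" "g \<in> Hom ?D (omap ?F A) S"
    then obtain g0 g1 where A: "is_ecat small V one T A" and S: "is_icat V T S" and g: "g = (star_ecat V one T A, S, g0, g1)"
      "is_icat_mor V T (star_ecat V one T A) S g0 g1"
      by (auto simp: Int_Cat_def Enr_Cat_def star_functor_def)
    interpret A: pre_ecat small V one T A by (rule pre_ecat_if_is_ecat[OF A])
    interpret S: icat small V one T S by (rule icatI[OF S])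
    interpret t: transpose small V one T A S g0 g1 by unfold_locales (rule g(2))
    let ?h = "(A, S.P, t.tfun, t.tcell)"
    have "?h \<in> Hom ?C A (omap ?G S)" using A S.is_ecat_P t.is_ecat_mor_cell by (simp add: pts_functor_def Enr_Cat_def)
    moreover have "Cmp ?D (\<epsilon> S) (amap ?F ?h) = g"
      unfolding epsF g(1) S.eps1_def[symmetric] using t.eps_fun t.eps1_Z by simp
    ultimately show "\<exists>h. h \<in> Hom ?C A (omap ?G S) \<and> Cmp ?D (\<epsilon> S) (amap ?F h) = g" by blast
  next
    fix A S h k assume 1: "A \<in> Obj ?C" "S \<in> Obj ?D" "h \<in> Hom ?C A (omap ?G S)" "k \<in> Hom ?C A (omap ?G S)"
      and e: "Cmp ?D (\<epsilon> S) (amap ?F h) = Cmp ?D (\<epsilon> S) (amap ?F k)"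
    then have A: "is_ecat small V one T A" and S: "is_icat V T S" by (simp_all add: Enr_Cat_def Int_Cat_def)
    interpret A: pre_ecat small V one T A by (rule pre_ecat_if_is_ecat[OF A])
    interpret S: icat small V one T S by (rule icatI[OF S])
    obtain h0 h1 k0 k1 where h: "h = (A, S.P, h0, h1)" "is_ecat_mor small V one T A S.P h0 h1" and k: "k = (A, S.P, k0, k1)" "is_ecat_mor small V one T A S.P k0 k1"
      using 1(3,4) by (cases h, cases k) (auto simp: Enr_Cat_def pts_functor_def)
    \<comment> \<open>The common composite of both arrows with the counit. Each arrow is a transpose
      of it, so they coincide by \<open>tcell_unique\<close>.\<close>
    let ?g0 = "eps_obj V one S.Y \<cdot> copow_map V one (eX A) S.pX h0" and ?g1 = "S.eps1 \<cdot> smap (star_cell V one h1)"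
    have ek: "eps_obj V one S.Y \<cdot> copow_map V one (eX A) S.pX k0 = ?g0" "S.eps1 \<cdot> smap (star_cell V one k1) = ?g1"
      using e[unfolded h(1) k(1) epsF S.eps1_def[symmetric]] by simp_all
    interpret t: transpose small V one T A S ?g0 ?g1
      using is_icat_mor_comp[OF is_icat_star_ecat[OF A] is_icat_star_ecat[OF S.is_ecat_P] S is_icat_mor_star_ecat[OF A S.is_ecat_P h(2)] S.counit_mor]
      by unfold_locales simp
    have "h0 = t.tfun" "h1 = t.tcell" by (rule t.tcell_unique[OF pre_ecat_mor_if_is_ecat_mor[OF A S.is_ecat_P h(2)]]; rule refl)+
    moreover have "k0 = t.tfun" "k1 = t.tcell" by (rule t.tcell_unique[OF pre_ecat_mor_if_is_ecat_mor[OF A S.is_ecat_P k(2)] ek])+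
    ultimately show "h = k" unfolding h(1) k(1) by simp
  next
    fix S R g assume "S \<in> Obj ?D" "R \<in> Obj ?D" "g \<in> Hom ?D S R"
    then obtain f0 f1 where SR: "is_icat V T S" "is_icat V T R" and g: "g = (S, R, f0, f1)" and f: "is_icat_mor V T S R f0 f1"
      by (auto simp: Int_Cat_def)
    interpret S: icat small V one T S by (rule icatI[OF SR(1)])
    interpret R: icat small V one T R by (rule icatI[OF SR(2)])
    note tp = transpose_pts_functor[OF SR f]
    interpret t: transpose small V one T S.P R "f0 \<cdot> eps_obj V one S.Y" "f1 \<cdot> ?e S" by (rule tp(1))
    \<comment> \<open>With the value of \<open>V(1, -)\<close> on \<open>g\<close> identified as a
      transpose, naturality of the counit is the defining property of that transpose.\<close>
    have G: "amap ?G g = (S.P, R.P, t.tfun, t.tcell)"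
      unfolding g pts_functor_def using tp(3) by (simp add: tp(2))
    have "amap ?G g \<in> Hom ?C (omap ?G S) (omap ?G R)"
      unfolding G using S.is_ecat_P R.is_ecat_P t.is_ecat_mor_cell by (simp add: pts_functor_def Enr_Cat_def)
    moreover have "Cmp ?D (\<epsilon> R) (amap ?F (amap ?G g)) = Cmp ?D g (\<epsilon> S)"
      unfolding G epsF R.eps1_def[symmetric] using t.eps_fun t.eps1_Z by (simp add: g \<epsilon>_def Int_Cat_def)
    ultimately show "amap ?G g \<in> Hom ?C (omap ?G S) (omap ?G R) \<and> Cmp ?D (\<epsilon> R) (amap ?F (amap ?G g)) = Cmp ?D g (\<epsilon> S)" by simp
  qed
  then show ?thesis by blast
qed

end

theorem lemma9p1:
  fixes small :: "'a set \<Rightarrow> bool"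
    and V :: "('o, 'a) cat"
    and one :: 'o
    and T :: "('o, 'a) monad_data"
  assumes "smallness small"
    and "locally_small small V"
    and "lextensive small V"
    and "is_terminal V one"
    and "cartesian_monad V T"
    and "strong_conjoint small V one T"
  shows "\<exists>\<eta> \<epsilon>. is_adjunction (Enr_Cat small V one T) (Int_Cat V T)
           (star_functor V one T) (pts_functor V one T) \<eta> \<epsilon>"
proof -
  interpret star_points small V one T
    by unfold_locales (use assms in auto)
  show ?thesis by (rule star_pts_adjunction)
qed

end
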